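(* Let $G$ be a compact Hausdorff group with normalized Haar measure $m_G$, let $(\Phi,\Psi)$ be a pair of complementary Young functions both satisfying the $\Delta_2$-condition, and let $\mu\in M(G)$ with $\mu(G)\neq0$. The following are equivalent: (i) the integration operator $I_{\nu_{\Phi,\mu}}:L^1(\nu_{\Phi,\mu})\to L^\Phi(G)$ is compact; (ii) $\nu_{\Phi,\mu}$ has finite variation; (iii) there is a Bochner integrable $F_1:G\to L^\Phi(G)$ with $\nu_{\Phi,\mu}(A)=\int_AF_1\,dm_G$ for every Borel $A\subseteq G$; (iv) there is a Pettis integrable $F_2:G\to L^\Phi(G)$ with $\nu_{\Phi,\mu}(A)=\int_AF_2\,dm_G$ for every Borel $A\subseteq G$; (v) there is a Borel set $A\subseteq G$ with $0<|\nu_{\Phi,\mu}|(A)<\infty$; (vi) there is $f\in L^\Phi(G)$ with $d\mu=f\,dm_G$.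
   Context: $M(G)$: bounded complex Radon measures on $G$. Young function: convex $\Phi:[0,\infty]\to[0,\infty]$, $\Phi(0)=0$, $\lim_{x\to\infty}\Phi(x)=\infty$; complementary $\Psi(y)=\sup\{xy-\Phi(x):x\ge0\}$; $\Delta_2$: $\exists K,x_0>0$, $\Phi(2x)\le K\Phi(x)$ for $x\ge x_0$. $L^\Phi(G)$: Orlicz space with Luxemburg norm $\|f\|_\Phi=\inf\{k>0:\int_G\Phi(|f|/k)dm_G\le1\}$. $\mu*f(t)=\int_Gf(s^{-1}t)\,d\mu(s)$; $\nu_{\Phi,\mu}(A)=\mu*\chi_A\in L^\Phi(G)$. Variation $|\nu|(A)=\sup\sum_{E\in\rho}\|\nu(E)\|_\Phi$ over finite Borel partitions $\rho$ of $A$. A function $F:G\to X$ ($X$ Banach) is Pettis integrable if $\langle F,x'\rangle\in L^1(G)$ for all $x'\in X'$ and for each Borel $A$ there is a unique $x_A\in X$ with $\int_A\langle F,x'\rangle\,dm_G=\langle x_A,x'\rangle$ for all $x'$; then $\int_AF\,dm_G:=x_A$. For a vector measure $\nu$, $L^1(\nu)$ is the space (modulo $\nu$-a.e. equality) of measurable $f$ with $f\in L^1(|\langle\nu,x'\rangle|)$ for all $x'$ and such that for each Borel $A$ there is a unique $x_A$ with $\int_Af\,d\langle\nu,x'\rangle=\langle x_A,x'\rangle$ for all $x'$ (written $\int_Af\,d\nu$); norm $\|f\|_\nu=\sup_{\|x'\|\le1}\int_G|f|\,d|\langle\nu,x'\rangle|$; $I_\nu(f)=\int_Gf\,d\nu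$.
   Formalization: Both Young functions are required to be finite-valued on [0,∞); with values ∞ allowed, Δ2 can hold as ∞≤K∞ and the claim fails, e.g. Φ(x)=x, Ψ=∞ beyond 1, G the circle, μ a point mass: (ii) holds but (vi) fails. *)

theory Defs
  imports "HOL-Analysis.Analysis"
begin

definition young_function :: "(real \<Rightarrow> real) \<Rightarrow> bool" where
  "young_function Phi \<longleftrightarrow> convex_on {0..} Phi \<and> (\<forall>x\<ge>0. 0 \<le> Phi x) \<and> Phi 0 = 0
     \<and> filterlim Phi at_top at_top"

definition young_conj :: "(real \<Rightarrow> real) \<Rightarrow> real \<Rightarrow> ereal" where
  "young_conj Phi y = (SUP x\<in>{0..}. ereal (x * y - Phi x))"

definition complementary_young :: "(real \<Rightarrow> real) \<Rightarrow> (real \<Rightarrow> real) \<Rightarrow> bool" where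
  "complementary_young Phi Psi \<longleftrightarrow> (\<forall>y\<ge>0. young_conj Phi y = ereal (Psi y))"

definition delta2 :: "(real \<Rightarrow> real) \<Rightarrow> bool" where
  "delta2 Phi \<longleftrightarrow> (\<exists>K x0. K > 0 \<and> x0 > 0 \<and> (\<forall>x\<ge>x0. Phi (2 * x) \<le> K * Phi x))"

definition radon_measure :: "'a::topological_space measure \<Rightarrow> bool" where
  "radon_measure M \<longleftrightarrow> sets M = sets borel
     \<and> (\<forall>A\<in>sets borel. emeasure M A = (INF U\<in>{U. open U \<and> A \<subseteq> U}. emeasure M U))
     \<and> (\<forall>U. open U \<longrightarrow> emeasure M U = (SUP K\<in>{K. compact K \<and> K \<subseteq> U}. emeasure M K))"

definition normalized_haar :: "'g::{group_add,topological_space} measure \<Rightarrow> bool" where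
  "normalized_haar m \<longleftrightarrow> radon_measure m \<and> emeasure m UNIV = 1
     \<and> (\<forall>x. \<forall>A\<in>sets borel. emeasure m ((\<lambda>y. x + y) ` A) = emeasure m A)"

definition borel_partitions :: "'a::topological_space set \<Rightarrow> 'a set set set" where
  "borel_partitions A = {P. finite P \<and> disjoint P \<and> \<Union>P = A \<and> P \<subseteq> sets borel}"

definition cvar :: "('a::topological_space set \<Rightarrow> complex) \<Rightarrow> 'a set \<Rightarrow> ennreal" where
  "cvar la A = (SUP P\<in>borel_partitions A. \<Sum>E\<in>P. ennreal (cmod (la E)))"

definition var_measure :: "('a::topological_space set \<Rightarrow> complex) \<Rightarrow> 'a measure" where
  "var_measure la = measure_of UNIV (sets borel) (cvar la)"

definition countably_additive_c :: "('a::topological_space set \<Rightarrow> complex) \<Rightarrow> bool" where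
  "countably_additive_c la \<longleftrightarrow> (\<forall>A::nat \<Rightarrow> 'a set. range A \<subseteq> sets borel \<longrightarrow> disjoint_family A
      \<longrightarrow> (\<lambda>n. la (A n)) sums la (\<Union>n. A n))"

definition complex_radon_measure :: "('a::topological_space set \<Rightarrow> complex) \<Rightarrow> bool" where
  "complex_radon_measure la \<longleftrightarrow> countably_additive_c la \<and> radon_measure (var_measure la)"

definition jordan_pos :: "('a::topological_space set \<Rightarrow> real) \<Rightarrow> 'a measure" where
  "jordan_pos r = measure_of UNIV (sets borel) (\<lambda>A. SUP B\<in>{B\<in>sets borel. B \<subseteq> A}. ennreal (r B))"

definition cintegral :: "('a::topological_space set \<Rightarrow> complex) \<Rightarrow> ('a \<Rightarrow> complex) \<Rightarrow> 'a set \<Rightarrow> complex" where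
  "cintegral la f A =
     ((LINT x:A|jordan_pos (\<lambda>B. Re (la B)). f x) - (LINT x:A|jordan_pos (\<lambda>B. - Re (la B)). f x))
     + \<i> * ((LINT x:A|jordan_pos (\<lambda>B. Im (la B)). f x) - (LINT x:A|jordan_pos (\<lambda>B. - Im (la B)). f x))"

text \<open>The vector measure nu_{Phi,mu}(A) = mu * chi_A, (mu*f)(t) = int f(s^{-1} t) dmu(s).\<close>
definition conv_vm :: "('g::{group_add,topological_space} set \<Rightarrow> complex) \<Rightarrow> 'g set \<Rightarrow> 'g \<Rightarrow> complex" where
  "conv_vm mu A = (\<lambda>t. cintegral mu (\<lambda>s. indicator A (- s + t)) UNIV)"

section \<open>Orlicz spaces (elements are functions; equality is a.e. equality)\<close>

definition orlicz_space :: "(real \<Rightarrow> real) \<Rightarrow> 'a measure \<Rightarrow> ('a \<Rightarrow> complex) set" where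
  "orlicz_space Phi m = {f\<in>borel_measurable m. \<exists>k>0. (\<integral>\<^sup>+x. ennreal (Phi (cmod (f x) / k)) \<partial>m) \<le> 1}"

definition lux_norm :: "(real \<Rightarrow> real) \<Rightarrow> 'a measure \<Rightarrow> ('a \<Rightarrow> complex) \<Rightarrow> real" where
  "lux_norm Phi m f = Inf {k. k > 0 \<and> (\<integral>\<^sup>+x. ennreal (Phi (cmod (f x) / k)) \<partial>m) \<le> 1}"

definition orlicz_dual :: "(real \<Rightarrow> real) \<Rightarrow> 'a measure \<Rightarrow> (('a \<Rightarrow> complex) \<Rightarrow> complex) set" where
  "orlicz_dual Phi m = {ph. (\<forall>f\<in>orlicz_space Phi m. \<forall>g\<in>orlicz_space Phi m. ph (\<lambda>x. f x + g x) = ph f + ph g)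
      \<and> (\<forall>c. \<forall>f\<in>orlicz_space Phi m. ph (\<lambda>x. c * f x) = c * ph f)
      \<and> (\<exists>C. \<forall>f\<in>orlicz_space Phi m. cmod (ph f) \<le> C * lux_norm Phi m f)}"

definition orlicz_dual_ball :: "(real \<Rightarrow> real) \<Rightarrow> 'a measure \<Rightarrow> (('a \<Rightarrow> complex) \<Rightarrow> complex) set" where
  "orlicz_dual_ball Phi m = {ph\<in>orlicz_dual Phi m. \<forall>f\<in>orlicz_space Phi m. cmod (ph f) \<le> lux_norm Phi m f}"

definition vvar :: "(real \<Rightarrow> real) \<Rightarrow> 'a measure \<Rightarrow> ('a set \<Rightarrow> 'a \<Rightarrow> complex) \<Rightarrow> 'a::topological_space set \<Rightarrow> ennreal" where
  "vvar Phi m nu A = (SUP P\<in>borel_partitions A. \<Sum>E\<in>P. ennreal (lux_norm Phi m (nu E)))"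

definition vm_integral_is :: "(real \<Rightarrow> real) \<Rightarrow> 'a measure \<Rightarrow> ('a::topological_space set \<Rightarrow> 'a \<Rightarrow> complex)
    \<Rightarrow> ('a \<Rightarrow> complex) \<Rightarrow> 'a set \<Rightarrow> ('a \<Rightarrow> complex) \<Rightarrow> bool" where
  "vm_integral_is Phi m nu f A x \<longleftrightarrow> x \<in> orlicz_space Phi m
     \<and> (\<forall>ph\<in>orlicz_dual Phi m. cintegral (\<lambda>E. ph (nu E)) f A = ph x)"

definition L1_vm :: "(real \<Rightarrow> real) \<Rightarrow> 'a measure \<Rightarrow> ('a::topological_space set \<Rightarrow> 'a \<Rightarrow> complex) \<Rightarrow> ('a \<Rightarrow> complex) set" where
  "L1_vm Phi m nu = {f\<in>borel_measurable borel.
      (\<forall>ph\<in>orlicz_dual Phi m. integrable (var_measure (\<lambda>E. ph (nu E))) f)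
      \<and> (\<forall>A\<in>sets borel. \<exists>x. vm_integral_is Phi m nu f A x)}"

definition L1_vm_norm :: "(real \<Rightarrow> real) \<Rightarrow> 'a measure \<Rightarrow> ('a::topological_space set \<Rightarrow> 'a \<Rightarrow> complex) \<Rightarrow> ('a \<Rightarrow> complex) \<Rightarrow> ennreal" where
  "L1_vm_norm Phi m nu f = (SUP ph\<in>orlicz_dual_ball Phi m. \<integral>\<^sup>+s. ennreal (cmod (f s)) \<partial>(var_measure (\<lambda>E. ph (nu E))))"

definition integration_op_compact :: "(real \<Rightarrow> real) \<Rightarrow> 'a measure \<Rightarrow> ('a::topological_space set \<Rightarrow> 'a \<Rightarrow> complex) \<Rightarrow> bool" where
  "integration_op_compact Phi m nu \<longleftrightarrow>
     (\<forall>x::nat \<Rightarrow> 'a \<Rightarrow> complex.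
        (\<forall>n. \<exists>f\<in>L1_vm Phi m nu. L1_vm_norm Phi m nu f \<le> 1 \<and> vm_integral_is Phi m nu f UNIV (x n))
        \<longrightarrow> (\<exists>r y. strict_mono r \<and> y \<in> orlicz_space Phi m
               \<and> (\<lambda>n. lux_norm Phi m (\<lambda>t. x (r n) t - y t)) \<longlonglongrightarrow> 0))"

definition simple_LPhi :: "(real \<Rightarrow> real) \<Rightarrow> 'a measure \<Rightarrow> ('a::topological_space \<Rightarrow> 'a \<Rightarrow> complex) \<Rightarrow> bool" where
  "simple_LPhi Phi m G \<longleftrightarrow> finite (range G) \<and> (\<forall>v\<in>range G. G -` {v} \<in> sets borel \<and> v \<in> orlicz_space Phi m)"

definition simple_int :: "'a measure \<Rightarrow> ('a \<Rightarrow> 'a \<Rightarrow> complex) \<Rightarrow> 'a set \<Rightarrow> 'a \<Rightarrow> complex" where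
  "simple_int m G A = (\<lambda>t. \<Sum>v\<in>range G. complex_of_real (measure m (A \<inter> G -` {v})) * v t)"

definition bochner_approx :: "(real \<Rightarrow> real) \<Rightarrow> 'a measure \<Rightarrow> ('a::topological_space \<Rightarrow> 'a \<Rightarrow> complex)
    \<Rightarrow> (nat \<Rightarrow> 'a \<Rightarrow> 'a \<Rightarrow> complex) \<Rightarrow> bool" where
  "bochner_approx Phi m F Fn \<longleftrightarrow> (\<forall>n. simple_LPhi Phi m (Fn n))
     \<and> (AE s in m. (\<lambda>n. lux_norm Phi m (\<lambda>t. Fn n s t - F s t)) \<longlonglongrightarrow> 0)
     \<and> (\<lambda>n. \<integral>\<^sup>+s. ennreal (lux_norm Phi m (\<lambda>t. Fn n s t - F s t)) \<partial>m) \<longlonglongrightarrow> 0"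

definition bochner_integrable_LPhi :: "(real \<Rightarrow> real) \<Rightarrow> 'a measure \<Rightarrow> ('a::topological_space \<Rightarrow> 'a \<Rightarrow> complex) \<Rightarrow> bool" where
  "bochner_integrable_LPhi Phi m F \<longleftrightarrow> (\<forall>s. F s \<in> orlicz_space Phi m) \<and> (\<exists>Fn. bochner_approx Phi m F Fn)"

definition has_bochner_integral_LPhi :: "(real \<Rightarrow> real) \<Rightarrow> 'a measure \<Rightarrow> ('a::topological_space \<Rightarrow> 'a \<Rightarrow> complex)
    \<Rightarrow> 'a set \<Rightarrow> ('a \<Rightarrow> complex) \<Rightarrow> bool" where
  "has_bochner_integral_LPhi Phi m F A x \<longleftrightarrow> (\<exists>Fn. bochner_approx Phi m F Fn
     \<and> (\<lambda>n. lux_norm Phi m (\<lambda>t. simple_int m (Fn n) A t - x t)) \<longlonglongrightarrow> 0)"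

definition pettis_integral_is :: "(real \<Rightarrow> real) \<Rightarrow> 'a measure \<Rightarrow> ('a \<Rightarrow> 'a \<Rightarrow> complex)
    \<Rightarrow> 'a set \<Rightarrow> ('a \<Rightarrow> complex) \<Rightarrow> bool" where
  "pettis_integral_is Phi m F A x \<longleftrightarrow> x \<in> orlicz_space Phi m
     \<and> (\<forall>ph\<in>orlicz_dual Phi m. (LINT s:A|m. ph (F s)) = ph x)"

definition pettis_integrable_LPhi :: "(real \<Rightarrow> real) \<Rightarrow> 'a measure \<Rightarrow> ('a::topological_space \<Rightarrow> 'a \<Rightarrow> complex) \<Rightarrow> bool" where
  "pettis_integrable_LPhi Phi m F \<longleftrightarrow> (\<forall>s. F s \<in> orlicz_space Phi m)
     \<and> (\<forall>ph\<in>orlicz_dual Phi m. integrable m (\<lambda>s. ph (F s)))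
     \<and> (\<forall>A\<in>sets borel. \<exists>x. pettis_integral_is Phi m F A x)"

end

theory Submission
  imports Defs
begin

text \<open>Pairing \<open>\<nu>(A) = \<mu> * \<chi>\<^sub>A\<close> with a continuous function \<open>w\<close> gives the integral over \<open>A\<close> of the continuous
  function \<open>W w u = \<integral> w(s + u) d\<mu>(s)\<close>. Take as tests the continuous \<open>w\<close> with \<open>\<integral> \<Psi>(|w|) \<le> 1\<close>. A Bochner or
  Pettis density, or a set of finite positive variation, forces \<open>|\<integral> w d\<mu>|\<close> to be bounded over all
  tests: otherwise, by translation, the values \<open>W w u\<close> would be unbounded over the tests at every
  point \<open>u\<close>, and compactness of the group makes this quantitative. Boundedness on tests
  and density of continuous functions make \<open>\<mu>\<close> absolutely continuous, and duality puts its density \<open>f\<close>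
  in the Orlicz space. Conversely, if \<open>d\<mu> = f dm\<close>, then \<open>\<nu>(A)\<close> is the integral over \<open>A\<close> of the
  translates of \<open>f\<close>, which depend continuously on the translation because \<open>\<Phi>\<close> satisfies
  \<open>\<Delta>\<^sub>2\<close>. Compactness of the integration operator yields finite variation, since a finite net
  of the image of the unit ball is normed by finitely many functionals.\<close>

section \<open>Jordan decomposition of real set functions\<close>

text \<open>Three obstacles shape the proof. \<open>G\<close> need not be second countable, so the
  Borel sets of \<open>G \<times> G\<close> may exceed the product sigma-algebra, and
  \<open>(s, t) \<mapsto> indicator A (- s + t)\<close> is only known to be Borel; exchanging
  integrals therefore rests on inner regularity instead of product measurability. Next, the bound
  that a vector density gives for \<open>W w u\<close> holds outside a null set depending on
  \<open>w\<close>, and there are uncountably many tests; since \<open>W w\<close> is continuous and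
  defined everywhere, finitely many tests already exceed a given \<open>n\<close> at every point,
  and finitely many null sets can be discarded together. Finally, no representation of the dual of
  the Orlicz space is used: \<open>norming_lux\<close> recovers both membership and norm from
  pairings with bounded functions, at the price of the factor 2 in Hoelder's inequality. A Bochner
  density is treated through finite variation, because the definition allows a different
  approximating sequence for each Borel set.\<close>

lemma sums_ennreal_le:
  assumes "a sums (s::real)"
  shows "ennreal s \<le> (\<Sum>n. ennreal (a n))"
proof (rule LIMSEQ_le_const2)
  show "(\<lambda>n. ennreal (\<Sum>i<n. a i)) \<longlonglongrightarrow> ennreal s"
    using assms unfolding sums_def by (rule tendsto_ennrealI)
  have "ennreal (\<Sum>i\<in>I. a i) \<le> (\<Sum>i\<in>I. ennreal (a i))" if "finite I" for I
    using that
  proof induction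
    case (insert x F)
    have "ennreal (a x + sum a F) \<le> ennreal (a x) + ennreal (sum a F)"
      by (cases "a x \<ge> 0"; cases "sum a F \<ge> 0")
         (auto simp: ennreal_plus[symmetric] ennreal_neg simp del: ennreal_plus intro!: ennreal_leI)
    then show ?case using insert by (auto intro: order_trans add_left_mono)
  qed simp
  then show "\<exists>N. \<forall>n\<ge>N. ennreal (\<Sum>i<n. a i) \<le> (\<Sum>n. ennreal (a n))"
    by (meson finite_lessThan order_trans sum_le_suminf summableI zero_le)
qed

text \<open>Superadditivity bounds the partial sums by the value on the union, and the hypothesis on
  disjoint sequences gives the converse. Positive variation and variation over partitions are both
  suprema, for which exactly these two inequalities are easy.\<close>

lemma countably_additive_of_superadditive:
  fixes F :: "'a::topological_space set \<Rightarrow> ennreal"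
  assumes empty: "F {} = 0"
    and super: "\<And>A B. A \<in> sets borel \<Longrightarrow> B \<in> sets borel \<Longrightarrow> A \<inter> B = {} \<Longrightarrow> F A + F B \<le> F (A \<union> B)"
    and sub: "\<And>A::nat \<Rightarrow> 'a set. range A \<subseteq> sets borel \<Longrightarrow> disjoint_family A \<Longrightarrow> F (\<Union>n. A n) \<le> (\<Sum>n. F (A n))"
  shows "countably_additive (sets borel) F"
proof (rule countably_additiveI)
  fix A :: "nat \<Rightarrow> 'a set"
  assume A: "range A \<subseteq> sets borel" "disjoint_family A"
  have fin: "(\<Sum>i<n. F (A i)) \<le> F (\<Union>i<n. A i)" for n
  proof (induction n)
    case (Suc n)
    have d: "(\<Union>i<n. A i) \<inter> A n = {}"
    proof -
      have "A i \<inter> A n = {}" if "i < n" for i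
        using disjoint_family_onD[OF A(2), of i n] that by simp
      then show ?thesis by blast
    qed
    have "(\<Sum>i<Suc n. F (A i)) \<le> F (\<Union>i<n. A i) + F (A n)"
      using Suc by (simp add: add_right_mono)
    also have "\<dots> \<le> F ((\<Union>i<n. A i) \<union> A n)"
      using A(1) d by (intro super) auto
    also have "(\<Union>i<n. A i) \<union> A n = (\<Union>i<Suc n. A i)"
      by (simp add: lessThan_Suc Un_commute)
    finally show ?case .
  qed (simp add: empty)
  have mono: "F B \<le> F C" if "B \<in> sets borel" "C \<in> sets borel" "B \<subseteq> C" for B C
  proof -
    have "F B \<le> F B + F (C - B)" by simp
    also have "\<dots> \<le> F (B \<union> (C - B))" using that by (intro super) auto
    also have "B \<union> (C - B) = C" using that by auto
    finally show ?thesis .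
  qed
  have "(\<Sum>i<n. F (A i)) \<le> F (\<Union>i. A i)" for n
    by (rule order_trans[OF fin mono]) (use A in auto)
  then have "(\<Sum>i. F (A i)) \<le> F (\<Union>i. A i)"
    by (intro suminf_le_const) auto
  with sub[OF A] show "(\<Sum>i. F (A i)) = F (\<Union>i. A i)"
    by (rule antisym[rotated])
qed

definition countably_additive_real :: "('a::topological_space set \<Rightarrow> real) \<Rightarrow> bool" where
  "countably_additive_real r \<longleftrightarrow> (\<forall>A::nat \<Rightarrow> 'a set. range A \<subseteq> sets borel \<longrightarrow> disjoint_family A
      \<longrightarrow> (\<lambda>n. r (A n)) sums r (\<Union>n. A n))"

text \<open>The positive part in Jordan's decomposition. Negative \<open>r B\<close> become 0 under
  \<open>ennreal\<close>; for countably additive \<open>r\<close> this does not change the supremum,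
  since the empty set competes with value 0.\<close>

definition upper_var :: "('a::topological_space set \<Rightarrow> real) \<Rightarrow> 'a set \<Rightarrow> ennreal" where
  "upper_var r A = (SUP B\<in>{B\<in>sets borel. B \<subseteq> A}. ennreal (r B))"

context
  fixes r :: "'a::topological_space set \<Rightarrow> real"
  assumes r: "countably_additive_real r"
begin

lemma car_sums: "range A \<subseteq> sets borel \<Longrightarrow> disjoint_family A \<Longrightarrow> (\<lambda>n. r (A n)) sums r (\<Union>n. A n)"
  for A :: "nat \<Rightarrow> 'a set"
  using r by (auto simp: countably_additive_real_def)

lemma car_empty: "r {} = 0"
proof -
  have "(\<lambda>n::nat. r {}) sums r {}"
    using car_sums[of "\<lambda>_. {}"] by (simp add: disjoint_family_on_def)
  then have "(\<lambda>n::nat. r {}) \<longlonglongrightarrow> 0"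
    by (intro summable_LIMSEQ_zero) (auto simp: sums_iff)
  then show ?thesis by (simp add: LIMSEQ_const_iff)
qed

lemma car_union:
  assumes "A \<in> sets borel" "B \<in> sets borel" "A \<inter> B = {}"
  shows "r (A \<union> B) = r A + r B"
proof -
  have "(\<lambda>n. r (binaryset A B n)) sums r (\<Union>n. binaryset A B n)"
    using assms by (intro car_sums) (auto simp: range_binaryset_eq disjoint_family_on_def binaryset_def)
  moreover have "(\<lambda>n. r (binaryset A B n)) sums (r A + r B)"
    using binaryset_sums[of r A B] car_empty by simp
  ultimately show ?thesis
    by (simp add: UN_binaryset_eq sums_unique2)
qed

lemma car_diff:
  assumes "A \<in> sets borel" "B \<in> sets borel" "B \<subseteq> A"
  shows "r (A - B) = r A - r B"
  using car_union[of "A - B" B] assms by (simp add: Un_absorb2 Diff_disjoint Int_commute)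

lemma upper_var_ge: "B \<in> sets borel \<Longrightarrow> B \<subseteq> A \<Longrightarrow> ennreal (r B) \<le> upper_var r A"
  unfolding upper_var_def by (rule SUP_upper) auto

lemma upper_var_empty: "upper_var r {} = 0"
proof -
  have "{B \<in> sets borel. B \<subseteq> {}} = {{} :: 'a set}" by auto
  then show ?thesis by (simp add: upper_var_def car_empty)
qed

lemma upper_var_superadditive:
  assumes AB: "A \<in> sets borel" "B \<in> sets borel" "A \<inter> B = {}"
  shows "upper_var r A + upper_var r B \<le> upper_var r (A \<union> B)"
proof -
  let ?S = "\<lambda>A. {C \<in> sets borel. C \<subseteq> A}"
  have ne: "?S X \<noteq> {}" for X :: "'a set" by auto
  have le: "ennreal (r C) + ennreal (r D) \<le> upper_var r (A \<union> B)" if C: "C \<in> ?S A" and D: "D \<in> ?S B" for C D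
  proof -
    \<comment> \<open>A negative value counts as 0, and then the other set alone is a competitor;
      the union \<open>C \<union> D\<close> is needed only for two nonnegative values.\<close>
    consider "r C < 0" | "r D < 0" | "r C \<ge> 0" "r D \<ge> 0" by linarith
    then show ?thesis
    proof cases
      case 3
      then have "ennreal (r C) + ennreal (r D) = ennreal (r (C \<union> D))"
        using C D AB by (subst car_union) auto
      then show ?thesis using C D by (auto intro!: upper_var_ge)
    qed (use C D in \<open>auto simp: ennreal_neg intro!: upper_var_ge\<close>)
  qed
  have "upper_var r A + upper_var r B = (SUP C\<in>?S A. ennreal (r C) + upper_var r B)"
    unfolding upper_var_def[of r A] by (rule ennreal_SUP_add_left[OF ne, symmetric])
  also have "\<dots> = (SUP C\<in>?S A. SUP D\<in>?S B. ennreal (r C) + ennreal (r D))"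
    unfolding upper_var_def[of r B] by (simp add: ennreal_SUP_add_right[OF ne])
  also have "\<dots> \<le> upper_var r (A \<union> B)"
    using le by (intro SUP_least)
  finally show ?thesis .
qed

lemma countably_additive_upper_var: "countably_additive (sets borel) (upper_var r)"
proof (rule countably_additive_of_superadditive)
  fix A :: "nat \<Rightarrow> 'a set"
  assume A: "range A \<subseteq> sets borel" "disjoint_family A"
  show "upper_var r (\<Union>n. A n) \<le> (\<Sum>n. upper_var r (A n))"
    unfolding upper_var_def[of r "\<Union>n. A n"]
  proof (rule SUP_least)
    fix B assume B: "B \<in> {B \<in> sets borel. B \<subseteq> (\<Union>n. A n)}"
    have "(\<lambda>n. r (B \<inter> A n)) sums r (\<Union>n. B \<inter> A n)"
      using A B by (intro car_sums) (auto simp: disjoint_family_on_def)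
    moreover have "(\<Union>n. B \<inter> A n) = B" using B by auto
    ultimately have "ennreal (r B) \<le> (\<Sum>n. ennreal (r (B \<inter> A n)))"
      by (intro sums_ennreal_le) auto
    also have "\<dots> \<le> (\<Sum>n. upper_var r (A n))"
      using A B by (intro suminf_le upper_var_ge) auto
    finally show "ennreal (r B) \<le> (\<Sum>n. upper_var r (A n))" .
  qed
qed (auto simp: upper_var_empty upper_var_superadditive)

end

lemma countably_additive_real_uminus: "countably_additive_real r \<Longrightarrow> countably_additive_real (\<lambda>A. - r A)"
  by (auto simp: countably_additive_real_def intro!: sums_minus)

text \<open>Passing from \<open>B\<close> to \<open>A - B\<close> exchanges the competitors for
  \<open>r\<close> and for \<open>- r\<close>, because \<open>r B = r A - r (A - B)\<close>. The
  second half asks for \<open>r A \<ge> 0\<close> since \<open>ennreal (r A)\<close> forgets a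
  negative value; the case of negative \<open>r A\<close> is later obtained by applying the lemma to
  \<open>- r\<close>.\<close>

lemma upper_var_uminus_eq:
  assumes r: "countably_additive_real r" and A: "A \<in> sets borel"
  shows "upper_var r A \<le> ennreal (r A) + upper_var (\<lambda>B. - r B) A" and
        "r A \<ge> 0 \<Longrightarrow> ennreal (r A) + upper_var (\<lambda>B. - r B) A \<le> upper_var r A"
proof -
  note neg = countably_additive_real_uminus[OF r]
  show "upper_var r A \<le> ennreal (r A) + upper_var (\<lambda>B. - r B) A"
    unfolding upper_var_def[of r A]
  proof (rule SUP_least)
    fix B assume B: "B \<in> {B \<in> sets borel. B \<subseteq> A}"
    have "ennreal (r B) = ennreal (r A + - r (A - B))"
      using car_diff[OF r, of A B] A B by simp
    also have "\<dots> \<le> ennreal (r A) + ennreal (- r (A - B))"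
      by (cases "r A \<ge> 0"; cases "- r (A - B) \<ge> 0")
         (auto simp: ennreal_plus[symmetric] ennreal_neg simp del: ennreal_plus intro!: ennreal_leI)
    also have "\<dots> \<le> ennreal (r A) + upper_var (\<lambda>B. - r B) A"
      using A B by (intro add_left_mono upper_var_ge[OF neg]) auto
    finally show "ennreal (r B) \<le> ennreal (r A) + upper_var (\<lambda>B. - r B) A" .
  qed
  assume pos: "r A \<ge> 0"
  have "ennreal (r A) + upper_var (\<lambda>B. - r B) A
      = (SUP B\<in>{B \<in> sets borel. B \<subseteq> A}. ennreal (r A) + ennreal (- r B))"
    unfolding upper_var_def by (subst ennreal_SUP_add_right) auto
  also have "\<dots> \<le> upper_var r A"
  proof (rule SUP_least)
    fix B assume B: "B \<in> {B \<in> sets borel. B \<subseteq> A}"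
    show "ennreal (r A) + ennreal (- r B) \<le> upper_var r A"
    proof (cases "- r B \<ge> 0")
      case True
      have "ennreal (r A) + ennreal (- r B) = ennreal (r (A - B))"
        using car_diff[OF r, of A B] A B True pos by (simp add: ennreal_plus[symmetric] del: ennreal_plus)
      also have "\<dots> \<le> upper_var r A" using A B by (intro upper_var_ge[OF r]) auto
      finally show ?thesis .
    next
      case False
      then show ?thesis using A by (simp add: ennreal_neg upper_var_ge[OF r])
    qed
  qed
  finally show "ennreal (r A) + upper_var (\<lambda>B. - r B) A \<le> upper_var r A" .
qed

lemma jordan_pos_eq: "jordan_pos r = measure_of UNIV (sets borel) (upper_var r)"
  by (simp add: jordan_pos_def upper_var_def[abs_def])

lemma sets_jordan_pos [simp, measurable_cong]: "sets (jordan_pos r) = sets borel"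
  by (simp add: jordan_pos_eq sets.sigma_sets_eq[of borel, simplified])

lemma space_jordan_pos [simp]: "space (jordan_pos r) = UNIV"
  by (simp add: jordan_pos_eq)

lemma emeasure_jordan_pos:
  assumes "countably_additive_real r" "A \<in> sets borel"
  shows "emeasure (jordan_pos r) A = upper_var r A"
proof (rule emeasure_measure_of[OF jordan_pos_eq])
  show "positive (sets (jordan_pos r)) (upper_var r)"
    using assms by (auto simp: positive_def upper_var_empty)
  show "countably_additive (sets (jordan_pos r)) (upper_var r)"
    using assms by (auto simp: countably_additive_upper_var)
qed (use assms in auto)

text \<open>If the upper variation were infinite, one could peel off infinitely many disjoint sets
  on which \<open>r\<close> is at least 1 in absolute value.\<close>
lemma upper_var_finite:
  assumes r: "countably_additive_real r"
  shows "upper_var r UNIV < \<infinity>"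
proof (rule ccontr)
  assume inf: "\<not> upper_var r UNIV < \<infinity>"
  note neg = countably_additive_real_uminus[OF r]
  let ?T = "upper_var r"
  have split: "\<exists>B. (B \<in> sets borel \<and> ?T B = \<infinity>) \<and> B \<subseteq> E \<and> \<bar>r (E - B)\<bar> \<ge> 1"
    if E: "E \<in> sets borel \<and> ?T E = \<infinity>" for E
  proof -
    \<comment> \<open>The margin \<open>\<bar>r E\<bar>\<close> makes both \<open>r B\<close> and
      \<open>r (E - B) = r E - r B\<close> at least 1 in absolute value, so whichever piece has
      infinite variation can be kept and the other peeled off.\<close>
    have "ennreal (1 + \<bar>r E\<bar>) < ?T E" using E by auto
    then obtain B where B: "B \<in> sets borel" "B \<subseteq> E" "ennreal (1 + \<bar>r E\<bar>) < ennreal (r B)"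
      unfolding upper_var_def less_SUP_iff by auto
    then have rB: "r B > 1 + \<bar>r E\<bar>"
      by (subst (asm) ennreal_less_iff) auto
    have d: "r (E - B) = r E - r B" using car_diff[OF r] E B by auto
    have "B \<union> (E - B) = E" using B by auto
    moreover have "?T (B \<union> (E - B)) = ?T B + ?T (E - B)"
    proof -
      have "E - B \<in> sets borel" "B \<inter> (E - B) = {}" using E B by auto
      then show ?thesis
        using plus_emeasure[of B "jordan_pos r" "E - B"] B
        by (simp add: emeasure_jordan_pos[OF r] sets.Un del: Un_Diff_cancel)
    qed
    ultimately have "?T B = \<infinity> \<or> ?T (E - B) = \<infinity>" using E by (metis ennreal_add_eq_top infinity_ennreal_def)
    moreover have "\<bar>r (E - B)\<bar> \<ge> 1" "\<bar>r (E - (E - B))\<bar> \<ge> 1"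
      using rB d B by (auto simp: double_diff)
    moreover have "E - B \<in> sets borel" "E - B \<subseteq> E" using E B by auto
    ultimately show ?thesis using B by blast
  qed
  have "\<exists>E. \<forall>n. (E n \<in> sets borel \<and> ?T (E n) = \<infinity>) \<and> E (Suc n) \<subseteq> E n \<and> \<bar>r (E n - E (Suc n))\<bar> \<ge> 1"
  proof (rule dependent_nat_choice)
    show "\<exists>E. E \<in> sets borel \<and> ?T E = \<infinity>"
      using inf by (intro exI[of _ UNIV]) (simp add: less_top[symmetric])
  qed (rule split)
  then obtain E where E: "\<And>n. E n \<in> sets borel" "\<And>n. E (Suc n) \<subseteq> E n"
      "\<And>n. \<bar>r (E n - E (Suc n))\<bar> \<ge> 1" by blast
  have "decseq E" using E(2) by (rule decseq_SucI)
  have "(E i - E (Suc i)) \<inter> (E j - E (Suc j)) = {}" if "i < j" for i j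
    using decseqD[OF \<open>decseq E\<close>, of "Suc i" j] that by auto
  then have "disjoint_family (\<lambda>n. E n - E (Suc n))"
    unfolding disjoint_family_on_def by (metis inf_commute linorder_neqE_nat)
  then have "(\<lambda>n. r (E n - E (Suc n))) sums r (\<Union>n. E n - E (Suc n))"
    using E(1) by (intro car_sums[OF r]) auto
  then have "(\<lambda>n. r (E n - E (Suc n))) \<longlonglongrightarrow> 0"
    by (intro summable_LIMSEQ_zero) (auto simp: sums_iff)
  then have "\<forall>\<^sub>F n in sequentially. \<bar>r (E n - E (Suc n))\<bar> < 1"
    by (auto simp: tendsto_iff dist_real_def dest: spec[of _ 1])
  then show False using E(3) by (metis (no_types, lifting) eventually_sequentially leD order_refl)
qed

lemma finite_measure_jordan_pos:
  assumes "countably_additive_real r" shows "finite_measure (jordan_pos r)"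
  by (rule finite_measureI) (use upper_var_finite[OF assms] in \<open>auto simp: emeasure_jordan_pos[OF assms]\<close>)

lemma jordan_decomposition:
  assumes r: "countably_additive_real r" and A: "A \<in> sets borel"
  shows "r A = measure (jordan_pos r) A - measure (jordan_pos (\<lambda>B. - r B)) A"
proof -
  note neg = countably_additive_real_uminus[OF r]
  interpret P: finite_measure "jordan_pos r" by (rule finite_measure_jordan_pos[OF r])
  interpret N: finite_measure "jordan_pos (\<lambda>B. - r B)" by (rule finite_measure_jordan_pos[OF neg])
  have P: "upper_var r A = ennreal (measure (jordan_pos r) A)"
    using emeasure_jordan_pos[OF r A] P.emeasure_eq_measure by simp
  have N: "upper_var (\<lambda>B. - r B) A = ennreal (measure (jordan_pos (\<lambda>B. - r B)) A)"
    using emeasure_jordan_pos[OF neg A] N.emeasure_eq_measure by simp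
  show ?thesis
  proof (cases "r A \<ge> 0")
    case True
    have "upper_var r A = ennreal (r A) + upper_var (\<lambda>B. - r B) A"
      using upper_var_uminus_eq[OF r A] True by (intro antisym) auto
    then show ?thesis unfolding P N using True
      by (simp add: ennreal_plus[symmetric] del: ennreal_plus)
  next
    case False
    have "upper_var (\<lambda>B. - r B) A = ennreal (- r A) + upper_var r A"
      using upper_var_uminus_eq[OF neg A] False by (intro antisym) auto
    moreover have "measure (jordan_pos r) A - r A \<ge> 0"
      using False measure_nonneg[of "jordan_pos r" A] by linarith
    ultimately show ?thesis unfolding P N using False
      by (simp add: ennreal_plus[symmetric] del: ennreal_plus)
  qed
qed

section \<open>Variation of complex measures\<close>

text \<open>Common form of the scalar variation \<open>cvar\<close> and the vector variation
  \<open>vvar\<close>, so that additivity and monotonicity are proved once.\<close>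

definition partition_var :: "('a::topological_space set \<Rightarrow> ennreal) \<Rightarrow> 'a set \<Rightarrow> ennreal" where
  "partition_var q A = (SUP P\<in>borel_partitions A. \<Sum>E\<in>P. q E)"

lemma cvar_eq_partition_var: "cvar la = partition_var (\<lambda>E. ennreal (cmod (la E)))"
  by (simp add: cvar_def partition_var_def fun_eq_iff)

lemma vvar_eq_partition_var: "vvar Phi m nu = partition_var (\<lambda>E. ennreal (lux_norm Phi m (nu E)))"
  by (simp add: vvar_def partition_var_def fun_eq_iff)

lemma singleton_borel_partition: "A \<in> sets borel \<Longrightarrow> {A} \<in> borel_partitions A"
  by (simp add: borel_partitions_def)

lemma partition_var_ge: "A \<in> sets borel \<Longrightarrow> q A \<le> partition_var q A"
  unfolding partition_var_def by (rule SUP_upper2[OF singleton_borel_partition]) auto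

lemma partition_var_superadditive:
  assumes q: "q {} = 0" and AB: "A \<in> sets borel" "B \<in> sets borel" "A \<inter> B = {}"
  shows "partition_var q A + partition_var q B \<le> partition_var q (A \<union> B)"
proof -
  have ne: "borel_partitions A \<noteq> {}" "borel_partitions B \<noteq> {}"
    using AB singleton_borel_partition by auto
  have le: "sum q P + sum q Q \<le> partition_var q (A \<union> B)"
    if P: "P \<in> borel_partitions A" and Q: "Q \<in> borel_partitions B" for P Q
  proof -
    have fin: "finite P" "finite Q" using P Q by (auto simp: borel_partitions_def)
    \<comment> \<open>Both partitions may contain the empty set, and the union keeps only one copy
      of it; this is where \<open>q {} = 0\<close> enters.\<close>
    have "P \<inter> Q \<subseteq> {{}}"
      using P Q AB(3) by (auto simp: borel_partitions_def)
    then have "sum q (P \<inter> Q) = 0"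
      using q by (intro sum.neutral) auto
    then have "sum q P + sum q Q = sum q (P \<union> Q)"
      using sum.union_inter[OF fin, of q] by simp
    also have "P \<union> Q \<in> borel_partitions (A \<union> B)"
      using P Q AB(3) by (auto simp: borel_partitions_def intro!: disjoint_union)
    then have "sum q (P \<union> Q) \<le> partition_var q (A \<union> B)"
      unfolding partition_var_def by (rule SUP_upper)
    finally show ?thesis .
  qed
  have "partition_var q A + partition_var q B = (SUP P\<in>borel_partitions A. sum q P + partition_var q B)"
    unfolding partition_var_def[of q A] by (rule ennreal_SUP_add_left[OF ne(1), symmetric])
  also have "\<dots> = (SUP P\<in>borel_partitions A. SUP Q\<in>borel_partitions B. sum q P + sum q Q)"
    unfolding partition_var_def[of q B] by (simp add: ennreal_SUP_add_right[OF ne(2)])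
  also have "\<dots> \<le> partition_var q (A \<union> B)"
    using le by (intro SUP_least)
  finally show ?thesis .
qed

lemma partition_var_mono:
  assumes q: "q {} = 0" and AB: "A \<in> sets borel" "B \<in> sets borel" "A \<subseteq> B"
  shows "partition_var q A \<le> partition_var q B"
proof -
  have "partition_var q A \<le> partition_var q A + partition_var q (B - A)" by simp
  also have "\<dots> \<le> partition_var q (A \<union> (B - A))"
    using AB by (intro partition_var_superadditive q) auto
  also have "A \<union> (B - A) = B" using AB by auto
  finally show ?thesis .
qed

lemma partition_var_sum_le:
  assumes q: "q {} = 0" and fin: "finite I" and A: "\<And>i. i \<in> I \<Longrightarrow> A i \<in> sets borel"
    and disj: "disjoint_family_on A I"
  shows "(\<Sum>i\<in>I. partition_var q (A i)) \<le> partition_var q (\<Union>i\<in>I. A i)"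
  using fin A disj
proof (induction I)
  case (insert i I)
  have "A i \<inter> (\<Union>i\<in>I. A i) = {}"
    using insert.prems(2) insert.hyps(2) by (fastforce simp: disjoint_family_on_def)
  moreover have "disjoint_family_on A I"
    using insert.prems(2) by (rule disjoint_family_on_mono[rotated]) auto
  ultimately have "(\<Sum>i\<in>insert i I. partition_var q (A i)) \<le> partition_var q (A i) + partition_var q (\<Union>i\<in>I. A i)"
    using insert by (auto intro!: add_left_mono)
  also have "\<dots> \<le> partition_var q (A i \<union> (\<Union>i\<in>I. A i))"
    using insert \<open>A i \<inter> _ = {}\<close> by (intro partition_var_superadditive q sets.finite_UN) auto
  finally show ?case by simp
qed simp

lemma borel_partition_inter:
  assumes P: "P \<in> borel_partitions A" and B: "B \<in> sets borel" "B \<subseteq> A"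
  shows "(\<lambda>E. E \<inter> B) ` P \<in> borel_partitions B"
proof -
  have "disjoint ((\<lambda>E. E \<inter> B) ` P)"
    using P by (intro pairwise_imageI) (auto simp: borel_partitions_def pairwise_def disjnt_def)
  moreover have "\<Union>((\<lambda>E. E \<inter> B) ` P) = B"
    using P B by (auto simp: borel_partitions_def)
  ultimately show ?thesis
    using P B by (auto simp: borel_partitions_def)
qed

lemma partition_var_empty: "q {} = 0 \<Longrightarrow> partition_var q {} = 0"
proof -
  assume q: "q {} = 0"
  have "sum q P = 0" if "P \<in> borel_partitions {}" for P :: "'a set set"
    using that q by (intro sum.neutral) (auto simp: borel_partitions_def)
  then show ?thesis
    using singleton_borel_partition[of "{}::'a set"] by (auto simp: partition_var_def intro!: SUP_eq_const)
qed

lemma countably_additive_partition_var: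
  fixes q :: "'a::topological_space set \<Rightarrow> ennreal"
  assumes q: "q {} = 0"
    and sub: "\<And>A::nat \<Rightarrow> 'a set. range A \<subseteq> sets borel \<Longrightarrow> disjoint_family A \<Longrightarrow> q (\<Union>n. A n) \<le> (\<Sum>n. q (A n))"
  shows "countably_additive (sets borel) (partition_var q)"
proof (rule countably_additive_of_superadditive)
  show "partition_var q {} = 0" by (rule partition_var_empty[of q, OF q])
next
  fix A :: "nat \<Rightarrow> 'a set"
  assume A: "range A \<subseteq> sets borel" "disjoint_family A"
  show "partition_var q (\<Union>n. A n) \<le> (\<Sum>n. partition_var q (A n))"
    unfolding partition_var_def[of q "\<Union>n. A n"]
  proof (rule SUP_least)
    fix P assume P: "P \<in> borel_partitions (\<Union>n. A n)"
    have fin: "finite P" using P by (auto simp: borel_partitions_def)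
    have "sum q P \<le> (\<Sum>E\<in>P. \<Sum>n. q (E \<inter> A n))"
    proof (rule sum_mono)
      fix E assume E: "E \<in> P"
      then have E: "(\<Union>n. E \<inter> A n) = E" "E \<in> sets borel" using P by (auto simp: borel_partitions_def)
      have "q (\<Union>n. E \<inter> A n) \<le> (\<Sum>n. q (E \<inter> A n))"
        using A E(2) by (intro sub) (auto simp: disjoint_family_on_def)
      then show "q E \<le> (\<Sum>n. q (E \<inter> A n))" by (simp only: E(1))
    qed
    also have "\<dots> = (\<Sum>n. \<Sum>E\<in>P. q (E \<inter> A n))"
      by (simp add: suminf_sum)
    also have "\<dots> \<le> (\<Sum>n. partition_var q (A n))"
    proof (intro suminf_le)
      fix n
      \<comment> \<open>Distinct cells can have equal traces on \<open>A n\<close> only if the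
        traces are empty, so passing to the set of traces loses nothing.\<close>
      have "(\<Sum>E\<in>P. q (E \<inter> A n)) = sum q ((\<lambda>E. E \<inter> A n) ` P)"
      proof (rule sum.reindex_nontrivial[symmetric, unfolded o_def, OF fin])
        fix E F assume "E \<in> P" "F \<in> P" "E \<noteq> F" "E \<inter> A n = F \<inter> A n"
        then have "E \<inter> A n = {}" using P by (auto simp: borel_partitions_def pairwise_def disjnt_def)
        then show "q (E \<inter> A n) = 0" using q by simp
      qed
      also have "\<dots> \<le> partition_var q (A n)"
        unfolding partition_var_def using A by (intro SUP_upper borel_partition_inter[OF P]) auto
      finally show "(\<Sum>E\<in>P. q (E \<inter> A n)) \<le> partition_var q (A n)" .
    qed auto
    finally show "sum q P \<le> (\<Sum>n. partition_var q (A n))" .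
  qed
qed (use partition_var_superadditive[of q] q in auto)

lemma sets_var_measure [simp, measurable_cong]: "sets (var_measure la) = sets borel"
  by (simp add: var_measure_def sets.sigma_sets_eq[of borel, simplified])

lemma space_var_measure [simp]: "space (var_measure la) = UNIV"
  by (simp add: var_measure_def)

context
  fixes la :: "'a::topological_space set \<Rightarrow> complex"
  assumes la: "countably_additive_c la"
begin

lemma cac_sums: "range A \<subseteq> sets borel \<Longrightarrow> disjoint_family A \<Longrightarrow> (\<lambda>n. la (A n)) sums la (\<Union>n. A n)"
  for A :: "nat \<Rightarrow> 'a set"
  using la by (auto simp: countably_additive_c_def)

lemma cac_Re: "countably_additive_real (\<lambda>B. Re (la B))"
  and cac_Im: "countably_additive_real (\<lambda>B. Im (la B))"
  and cac_minus_Re: "countably_additive_real (\<lambda>B. - Re (la B))"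
  and cac_minus_Im: "countably_additive_real (\<lambda>B. - Im (la B))"
proof -
  show 1: "countably_additive_real (\<lambda>B. Re (la B))"
    unfolding countably_additive_real_def by (auto intro!: sums_Re cac_sums)
  show 2: "countably_additive_real (\<lambda>B. Im (la B))"
    unfolding countably_additive_real_def by (auto intro!: sums_Im cac_sums)
  show "countably_additive_real (\<lambda>B. - Re (la B))" "countably_additive_real (\<lambda>B. - Im (la B))"
    using 1 2 by (simp_all add: countably_additive_real_uminus)
qed

lemma cac_empty: "la {} = 0"
  using car_empty[OF cac_Re] car_empty[OF cac_Im] by (simp add: complex_eq_iff)

lemma cac_union:
  "A \<in> sets borel \<Longrightarrow> B \<in> sets borel \<Longrightarrow> A \<inter> B = {} \<Longrightarrow> la (A \<union> B) = la A + la B"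
  using car_union[OF cac_Re] car_union[OF cac_Im] by (simp add: complex_eq_iff)

lemma countably_additive_cvar: "countably_additive (sets borel) (cvar la)"
  unfolding cvar_eq_partition_var
proof (rule countably_additive_partition_var)
  fix A :: "nat \<Rightarrow> 'a set"
  assume A: "range A \<subseteq> sets borel" "disjoint_family A"
  show "ennreal (cmod (la (\<Union>n. A n))) \<le> (\<Sum>n. ennreal (cmod (la (A n))))"
  proof (rule LIMSEQ_le_const2)
    show "(\<lambda>n. ennreal (cmod (\<Sum>i<n. la (A i)))) \<longlonglongrightarrow> ennreal (cmod (la (\<Union>n. A n)))"
      using cac_sums[OF A] unfolding sums_def by (intro tendsto_ennrealI tendsto_norm)
    have "ennreal (cmod (\<Sum>i<n. la (A i))) \<le> (\<Sum>n. ennreal (cmod (la (A n))))" for n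
    proof -
      have "ennreal (cmod (\<Sum>i<n. la (A i))) \<le> ennreal (\<Sum>i<n. cmod (la (A i)))"
        by (intro ennreal_leI norm_sum)
      also have "\<dots> = (\<Sum>i<n. ennreal (cmod (la (A i))))" by (simp add: sum_ennreal)
      also have "\<dots> \<le> (\<Sum>n. ennreal (cmod (la (A n))))" by (intro sum_le_suminf) auto
      finally show ?thesis .
    qed
    then show "\<exists>N. \<forall>n\<ge>N. ennreal (cmod (\<Sum>i<n. la (A i))) \<le> (\<Sum>n. ennreal (cmod (la (A n))))"
      by blast
  qed
qed (simp add: cac_empty)

lemma cvar_empty: "cvar la {} = 0"
  unfolding cvar_eq_partition_var by (rule partition_var_empty) (simp add: cac_empty)

lemma emeasure_var_measure: "A \<in> sets borel \<Longrightarrow> emeasure (var_measure la) A = cvar la A"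
  by (rule emeasure_measure_of[OF var_measure_def])
     (auto simp: positive_def cvar_empty countably_additive_cvar)

text \<open>Through this domination the four Jordan parts inherit integrability and inner regularity
  from the variation, the only measure for which regularity is assumed.\<close>

lemma jordan_pos_le_var_measure:
  assumes "A \<in> sets borel"
  shows "emeasure (jordan_pos (\<lambda>B. Re (la B))) A \<le> emeasure (var_measure la) A"
    "emeasure (jordan_pos (\<lambda>B. - Re (la B))) A \<le> emeasure (var_measure la) A"
    "emeasure (jordan_pos (\<lambda>B. Im (la B))) A \<le> emeasure (var_measure la) A"
    "emeasure (jordan_pos (\<lambda>B. - Im (la B))) A \<le> emeasure (var_measure la) A"
proof -
  have *: "upper_var r A \<le> cvar la A" if r: "\<And>B. r B \<le> cmod (la B)" for r
    unfolding upper_var_def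
  proof (rule SUP_least)
    fix B assume B: "B \<in> {B \<in> sets borel. B \<subseteq> A}"
    have "ennreal (r B) \<le> ennreal (cmod (la B))" by (intro ennreal_leI r)
    also have "\<dots> \<le> cvar la B" unfolding cvar_eq_partition_var using B by (intro partition_var_ge) auto
    also have "\<dots> \<le> cvar la A"
      unfolding cvar_eq_partition_var using B assms by (intro partition_var_mono) (auto simp: cac_empty)
    finally show "ennreal (r B) \<le> cvar la A" .
  qed
  show "emeasure (jordan_pos (\<lambda>B. Re (la B))) A \<le> emeasure (var_measure la) A"
    using assms by (simp add: emeasure_jordan_pos cac_Re emeasure_var_measure * complex_Re_le_cmod)
  show "emeasure (jordan_pos (\<lambda>B. - Re (la B))) A \<le> emeasure (var_measure la) A"
    using assms by (simp add: emeasure_jordan_pos cac_minus_Re emeasure_var_measure)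
      (intro *, metis abs_Re_le_cmod abs_ge_minus_self order_trans)
  show "emeasure (jordan_pos (\<lambda>B. Im (la B))) A \<le> emeasure (var_measure la) A"
    using assms by (simp add: emeasure_jordan_pos cac_Im emeasure_var_measure)
      (intro *, metis abs_Im_le_cmod abs_ge_self order_trans)
  show "emeasure (jordan_pos (\<lambda>B. - Im (la B))) A \<le> emeasure (var_measure la) A"
    using assms by (simp add: emeasure_jordan_pos cac_minus_Im emeasure_var_measure)
      (intro *, metis abs_Im_le_cmod abs_ge_minus_self order_trans)
qed

interpretation RP: finite_measure "jordan_pos (\<lambda>B. Re (la B))" by (rule finite_measure_jordan_pos[OF cac_Re])
interpretation RN: finite_measure "jordan_pos (\<lambda>B. - Re (la B))" by (rule finite_measure_jordan_pos[OF cac_minus_Re])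
interpretation IP: finite_measure "jordan_pos (\<lambda>B. Im (la B))" by (rule finite_measure_jordan_pos[OF cac_Im])
interpretation IN: finite_measure "jordan_pos (\<lambda>B. - Im (la B))" by (rule finite_measure_jordan_pos[OF cac_minus_Im])

lemma complex_jordan_decomposition:
  assumes "A \<in> sets borel"
  shows "la A = complex_of_real (measure (jordan_pos (\<lambda>B. Re (la B))) A - measure (jordan_pos (\<lambda>B. - Re (la B))) A)
     + \<i> * complex_of_real (measure (jordan_pos (\<lambda>B. Im (la B))) A - measure (jordan_pos (\<lambda>B. - Im (la B))) A)"
  using jordan_decomposition[OF cac_Re assms] jordan_decomposition[OF cac_Im assms]
  by (simp add: complex_eq_iff)

text \<open>\<open>cmod (la A)\<close> is at most the sum of four finite measures of
  \<open>A\<close>, and this sum is additive over every partition.\<close>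

lemma finite_measure_var_measure: "finite_measure (var_measure la)"
proof (rule finite_measureI)
  define S where "S A = measure (jordan_pos (\<lambda>B. Re (la B))) A + measure (jordan_pos (\<lambda>B. - Re (la B))) A
     + measure (jordan_pos (\<lambda>B. Im (la B))) A + measure (jordan_pos (\<lambda>B. - Im (la B))) A" for A
  have le: "cmod (la A) \<le> S A" if "A \<in> sets borel" for A
    using cmod_le[of "la A"] jordan_decomposition[OF cac_Re that] jordan_decomposition[OF cac_Im that]
      measure_nonneg[of "jordan_pos (\<lambda>B. Re (la B))" A] measure_nonneg[of "jordan_pos (\<lambda>B. - Re (la B))" A]
      measure_nonneg[of "jordan_pos (\<lambda>B. Im (la B))" A] measure_nonneg[of "jordan_pos (\<lambda>B. - Im (la B))" A]
    unfolding S_def by linarith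
  have "cvar la UNIV \<le> ennreal (S UNIV)"
    unfolding cvar_def
  proof (rule SUP_least)
    fix P :: "'a set set" assume "P \<in> borel_partitions UNIV"
    then have P: "finite P" "disjoint P" "\<Union>P = UNIV" "P \<subseteq> sets borel" by (auto simp: borel_partitions_def)
    have d: "disjoint_family_on (\<lambda>E. E) P" using P(2) by (auto simp: disjoint_family_on_def pairwise_def disjnt_def)
    have m: "(\<Sum>E\<in>P. measure M E) = measure M UNIV" if "finite_measure M" "sets M = sets borel" for M
      using finite_measure.finite_measure_finite_Union[OF that(1) P(1), of "\<lambda>E. E"] P d that(2) by simp
    have "(\<Sum>E\<in>P. ennreal (cmod (la E))) \<le> (\<Sum>E\<in>P. ennreal (S E))"
      using P(4) by (intro sum_mono ennreal_leI le) auto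
    also have "\<dots> = ennreal (\<Sum>E\<in>P. S E)"
      by (rule sum_ennreal) (auto simp: S_def)
    also have "(\<Sum>E\<in>P. S E) = S UNIV"
      by (simp add: S_def sum.distrib m RP.finite_measure_axioms RN.finite_measure_axioms
          IP.finite_measure_axioms IN.finite_measure_axioms)
    finally show "(\<Sum>E\<in>P. ennreal (cmod (la E))) \<le> ennreal (S UNIV)" .
  qed
  then show "emeasure (var_measure la) (space (var_measure la)) \<noteq> \<infinity>"
    by (auto simp: emeasure_var_measure top_unique)
qed

lemma measure_var_measure_ge: "A \<in> sets borel \<Longrightarrow> cmod (la A) \<le> measure (var_measure la) A"
proof -
  assume A: "A \<in> sets borel"
  interpret V: finite_measure "var_measure la" by (rule finite_measure_var_measure)
  have "ennreal (cmod (la A)) \<le> ennreal (measure (var_measure la) A)"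
    using partition_var_ge[of A "\<lambda>E. ennreal (cmod (la E))"] A
    by (simp add: V.emeasure_eq_measure[symmetric] emeasure_var_measure cvar_eq_partition_var)
  then show ?thesis by simp
qed

end

section \<open>Integration against a complex measure\<close>

definition cintegrable :: "('a::topological_space set \<Rightarrow> complex) \<Rightarrow> ('a \<Rightarrow> complex) \<Rightarrow> bool" where
  "cintegrable la f \<longleftrightarrow> integrable (jordan_pos (\<lambda>B. Re (la B))) f \<and> integrable (jordan_pos (\<lambda>B. - Re (la B))) f
     \<and> integrable (jordan_pos (\<lambda>B. Im (la B))) f \<and> integrable (jordan_pos (\<lambda>B. - Im (la B))) f"

lemma of_real_indicator: "of_real (indicator A x) = (indicator A x :: 'b::real_algebra_1)"
  by (simp add: indicator_def)

lemma cintegral_UNIV_indicator: "cintegral la f A = cintegral la (\<lambda>x. indicator A x * f x) UNIV"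
  by (simp add: cintegral_def set_lebesgue_integral_def scaleR_conv_of_real of_real_indicator)

lemma cintegral_UNIV: "cintegral la f UNIV =
    (integral\<^sup>L (jordan_pos (\<lambda>B. Re (la B))) f - integral\<^sup>L (jordan_pos (\<lambda>B. - Re (la B))) f)
    + \<i> * (integral\<^sup>L (jordan_pos (\<lambda>B. Im (la B))) f - integral\<^sup>L (jordan_pos (\<lambda>B. - Im (la B))) f)"
  by (simp add: cintegral_def set_lebesgue_integral_def)

lemma cintegral_add:
  "cintegrable la f \<Longrightarrow> cintegrable la g \<Longrightarrow>
    cintegral la (\<lambda>x. f x + g x) UNIV = cintegral la f UNIV + cintegral la g UNIV"
  by (simp add: cintegral_UNIV cintegrable_def algebra_simps)

lemma cintegral_diff:
  "cintegrable la f \<Longrightarrow> cintegrable la g \<Longrightarrow>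
    cintegral la (\<lambda>x. f x - g x) UNIV = cintegral la f UNIV - cintegral la g UNIV"
  by (simp add: cintegral_UNIV cintegrable_def algebra_simps)

lemma cintegral_cmult: "cintegral la (\<lambda>x. c * f x) UNIV = c * cintegral la f UNIV"
  by (simp add: cintegral_UNIV algebra_simps)

lemma cintegrable_add: "cintegrable la f \<Longrightarrow> cintegrable la g \<Longrightarrow> cintegrable la (\<lambda>x. f x + g x)"
  by (simp add: cintegrable_def)

lemma cintegrable_cmult: "cintegrable la f \<Longrightarrow> cintegrable la (\<lambda>x. c * f x)"
  by (simp add: cintegrable_def)

lemma cintegral_sum:
  assumes "finite I" "\<And>i. i \<in> I \<Longrightarrow> cintegrable la (f i)"
  shows "cintegral la (\<lambda>x. \<Sum>i\<in>I. f i x) UNIV = (\<Sum>i\<in>I. cintegral la (f i) UNIV)"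
    and "cintegrable la (\<lambda>x. \<Sum>i\<in>I. f i x)"
proof -
  have "cintegral la (\<lambda>x. \<Sum>i\<in>I. f i x) UNIV = (\<Sum>i\<in>I. cintegral la (f i) UNIV)
      \<and> cintegrable la (\<lambda>x. \<Sum>i\<in>I. f i x)"
    using assms
  proof (induction I)
    case empty
    then show ?case by (simp add: cintegral_UNIV cintegrable_def)
  next
    case (insert i I)
    then show ?case by (simp add: cintegral_add cintegrable_add)
  qed
  then show "cintegral la (\<lambda>x. \<Sum>i\<in>I. f i x) UNIV = (\<Sum>i\<in>I. cintegral la (f i) UNIV)"
    and "cintegrable la (\<lambda>x. \<Sum>i\<in>I. f i x)" by auto
qed

lemma integral_dominated_measure:
  fixes f :: "'a \<Rightarrow> 'b::{banach, second_countable_topology}"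
  assumes sets: "sets N = sets M" and le: "\<And>A. A \<in> sets M \<Longrightarrow> emeasure N A \<le> emeasure M A"
    and f: "integrable M f"
  shows "integrable N f" "norm (integral\<^sup>L N f) \<le> integral\<^sup>L M (\<lambda>x. norm (f x))"
proof -
  have meas: "f \<in> borel_measurable N" using f sets by (simp cong: measurable_cong_sets)
  have leM: "N \<le> M" using sets le by (simp add: le_measure)
  have "(\<integral>\<^sup>+x. ennreal (norm (f x)) \<partial>N) \<le> (\<integral>\<^sup>+x. ennreal (norm (f x)) \<partial>M)"
    using f by (intro nn_integral_mono_measure[OF sets leM])
  moreover have "(\<integral>\<^sup>+x. ennreal (norm (f x)) \<partial>M) = ennreal (integral\<^sup>L M (\<lambda>x. norm (f x)))"
    using f by (intro nn_integral_eq_integral) auto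
  ultimately have *: "(\<integral>\<^sup>+x. ennreal (norm (f x)) \<partial>N) \<le> ennreal (integral\<^sup>L M (\<lambda>x. norm (f x)))"
    by simp
  show i: "integrable N f"
    using meas * by (intro integrableI_bounded) (auto intro: le_less_trans)
  have "ennreal (norm (integral\<^sup>L N f)) \<le> (\<integral>\<^sup>+x. ennreal (norm (f x)) \<partial>N)"
    using i by (intro integral_norm_bound_ennreal) auto
  with * have "ennreal (norm (integral\<^sup>L N f)) \<le> ennreal (integral\<^sup>L M (\<lambda>x. norm (f x)))"
    by (rule order_trans[rotated])
  then show "norm (integral\<^sup>L N f) \<le> integral\<^sup>L M (\<lambda>x. norm (f x))"
    by (subst (asm) ennreal_le_iff) auto
qed

text \<open>The constant 4 counts the Jordan parts, each of which lies below \<open>M\<close>. The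
  dominating measure is a parameter because it will be the variation itself in some places and its
  sum with Haar measure in another.\<close>

lemma
  assumes la: "countably_additive_c la" and sets: "sets M = sets borel"
    and le: "\<And>A. A \<in> sets borel \<Longrightarrow> emeasure (var_measure la) A \<le> emeasure M A"
    and f: "integrable M f"
  shows cintegrable_dominated: "cintegrable la f"
    and cmod_cintegral_le: "cmod (cintegral la f UNIV) \<le> 4 * (LINT x|M. cmod (f x))"
proof -
  note le' = order_trans[OF jordan_pos_le_var_measure(1)[OF la] le]
    order_trans[OF jordan_pos_le_var_measure(2)[OF la] le]
    order_trans[OF jordan_pos_le_var_measure(3)[OF la] le]
    order_trans[OF jordan_pos_le_var_measure(4)[OF la] le]
  have s: "sets (jordan_pos r) = sets M" for r :: "'a set \<Rightarrow> real" using sets by simp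
  show "cintegrable la f"
    unfolding cintegrable_def using sets
    by (intro conjI integral_dominated_measure(1)[OF s _ f]) (auto intro!: le')
  have b: "cmod (integral\<^sup>L (jordan_pos (\<lambda>B. Re (la B))) f) \<le> (LINT x|M. cmod (f x))"
    "cmod (integral\<^sup>L (jordan_pos (\<lambda>B. - Re (la B))) f) \<le> (LINT x|M. cmod (f x))"
    "cmod (integral\<^sup>L (jordan_pos (\<lambda>B. Im (la B))) f) \<le> (LINT x|M. cmod (f x))"
    "cmod (integral\<^sup>L (jordan_pos (\<lambda>B. - Im (la B))) f) \<le> (LINT x|M. cmod (f x))"
    using sets by (intro integral_dominated_measure(2)[OF s _ f]; auto intro!: le')+
  have tri: "cmod ((a - b) + \<i> * (c - d)) \<le> cmod a + cmod b + (cmod c + cmod d)" for a b c d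
    using norm_triangle_ineq[of "a - b" "\<i> * (c - d)"] norm_triangle_ineq4[of a b] norm_triangle_ineq4[of c d]
    by (simp add: norm_mult)
  show "cmod (cintegral la f UNIV) \<le> 4 * (LINT x|M. cmod (f x))"
    unfolding cintegral_UNIV
    using tri[of "integral\<^sup>L (jordan_pos (\<lambda>B. Re (la B))) f" "integral\<^sup>L (jordan_pos (\<lambda>B. - Re (la B))) f"
      "integral\<^sup>L (jordan_pos (\<lambda>B. Im (la B))) f" "integral\<^sup>L (jordan_pos (\<lambda>B. - Im (la B))) f"] b
    by simp
qed

context
  fixes la :: "'a::topological_space set \<Rightarrow> complex"
  assumes la: "countably_additive_c la"
begin

interpretation RP: finite_measure "jordan_pos (\<lambda>B. Re (la B))" by (rule finite_measure_jordan_pos[OF cac_Re[OF la]])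
interpretation RN: finite_measure "jordan_pos (\<lambda>B. - Re (la B))" by (rule finite_measure_jordan_pos[OF cac_minus_Re[OF la]])
interpretation IP: finite_measure "jordan_pos (\<lambda>B. Im (la B))" by (rule finite_measure_jordan_pos[OF cac_Im[OF la]])
interpretation IN: finite_measure "jordan_pos (\<lambda>B. - Im (la B))" by (rule finite_measure_jordan_pos[OF cac_minus_Im[OF la]])

lemma cintegrable_bounded:
  assumes "f \<in> borel_measurable borel" "\<And>x. cmod (f x) \<le> B"
  shows "cintegrable la f"
  unfolding cintegrable_def using assms
  by (auto intro!: RP.integrable_const_bound[of _ B] RN.integrable_const_bound[of _ B]
      IP.integrable_const_bound[of _ B] IN.integrable_const_bound[of _ B] cong: measurable_cong_sets)

lemma cintegral_indicator:
  assumes "A \<in> sets borel"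
  shows "cintegral la (indicator A) UNIV = la A"
proof -
  have "integral\<^sup>L M (indicator A) = complex_of_real (measure M A)"
    if "finite_measure M" "sets M = sets borel" for M :: "'a measure"
  proof -
    have "integral\<^sup>L M (indicator A) = (LINT x|M. complex_of_real (indicator A x))"
      by (simp add: of_real_indicator)
    also have "\<dots> = complex_of_real (measure M A)"
      using that assms sets_eq_imp_space_eq[OF that(2)] by (simp add: integral_complex_of_real)
    finally show ?thesis .
  qed
  then show ?thesis
    by (simp add: cintegral_UNIV complex_jordan_decomposition[OF la assms] RP.finite_measure_axioms
       RN.finite_measure_axioms IP.finite_measure_axioms IN.finite_measure_axioms)
qed

lemma cintegral_step:
  assumes "finite P" "P \<subseteq> sets borel" "A \<in> sets borel"
  shows "cintegral la (\<lambda>s. \<Sum>E\<in>P. \<theta> E * indicator E s) A = (\<Sum>E\<in>P. \<theta> E * la (E \<inter> A))"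
proof -
  have "cintegral la (\<lambda>s. \<Sum>E\<in>P. \<theta> E * indicator E s) A
      = cintegral la (\<lambda>s. \<Sum>E\<in>P. \<theta> E * indicator (E \<inter> A) s) UNIV"
    unfolding cintegral_UNIV_indicator[of la _ A]
    by (simp add: sum_distrib_left indicator_inter_arith mult_ac)
  also have "\<dots> = (\<Sum>E\<in>P. cintegral la (\<lambda>s. \<theta> E * indicator (E \<inter> A) s) UNIV)"
    using assms by (intro cintegral_sum(1) cintegrable_cmult cintegrable_bounded[of _ 1])
      (auto simp: indicator_def)
  also have "\<dots> = (\<Sum>E\<in>P. \<theta> E * la (E \<inter> A))"
    using assms by (intro sum.cong refl) (auto simp: cintegral_cmult intro!: cintegral_indicator)
  finally show ?thesis .
qed

end

text \<open>\<open>ennreal (u x)\<close> already is the positive part of \<open>u\<close>, and the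
  supremum over subsets of \<open>A\<close> is attained at
  \<open>A \<inter> {x. 0 \<le> u x}\<close>.\<close>

lemma jordan_pos_density:
  fixes u :: "'a::topological_space \<Rightarrow> real"
  assumes sets: "sets m = sets borel" and u: "integrable m u"
    and r: "\<And>B. B \<in> sets borel \<Longrightarrow> r B = (LINT x:B|m. u x)"
  shows "jordan_pos r = density m (\<lambda>x. ennreal (u x))"
proof (rule measure_eqI)
  have sp: "space m = UNIV" using sets_eq_imp_space_eq[OF sets] by simp
  have um: "u \<in> borel_measurable borel" using u sets by (auto cong: measurable_cong_sets)
  have le: "ennreal (r B) \<le> (\<integral>\<^sup>+x\<in>B. ennreal (u x) \<partial>m)" if B: "B \<in> sets borel" for B
  proof -
    have i: "integrable m (\<lambda>x. indicator B x * max 0 (u x))"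
      using integrable_mult_indicator[of B m "\<lambda>x. max 0 (u x)"] u B sets by simp
    have "r B \<le> (LINT x|m. indicator B x * max 0 (u x))"
      unfolding r[OF B] set_lebesgue_integral_def using B sets u i
      by (intro integral_mono integrable_mult_indicator) (auto simp: indicator_def)
    also have "ennreal \<dots> = (\<integral>\<^sup>+x. ennreal (indicator B x * max 0 (u x)) \<partial>m)"
      using i by (intro nn_integral_eq_integral[symmetric]) auto
    also have "\<dots> = (\<integral>\<^sup>+x\<in>B. ennreal (u x) \<partial>m)"
      by (intro nn_integral_cong) (auto simp: indicator_def max_def ennreal_neg)
    finally show ?thesis by (simp add: ennreal_leI)
  qed
  have ca: "countably_additive_real r"
    unfolding countably_additive_real_def
  proof safe
    fix A :: "nat \<Rightarrow> 'a set" assume A: "range A \<subseteq> sets borel" "disjoint_family A"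
    have iu: "set_integrable m B u" if "B \<in> sets borel" for B
      unfolding set_integrable_def using that u sets by (intro integrable_mult_indicator) auto
    have "(\<Sum>i<n. LINT x:A i|m. u x) = (LINT x:(\<Union>i<n. A i)|m. u x)" for n
      using A sets by (intro set_integral_finite_Union[symmetric] iu)
        (auto simp: disjoint_family_on_def intro!: iu)
    moreover have "(\<lambda>n. LINT x:(\<Union>i<n. A i)|m. u x) \<longlonglongrightarrow> (LINT x:(\<Union>n. \<Union>i<n. A i)|m. u x)"
    proof (intro set_integral_cont_up iu)
      show "incseq (\<lambda>n. \<Union>i<n. A i)" by (intro monoI UN_mono) auto
    qed (use A sets in auto)
    moreover have "(\<Union>n. \<Union>i<n. A i) = (\<Union>n. A n)" by auto
    ultimately have "(\<lambda>n. LINT x:A n|m. u x) sums (LINT x:(\<Union>n. A n)|m. u x)"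
      by (simp add: sums_def)
    moreover have "(\<Union>n. A n) \<in> sets borel" "\<And>n. A n \<in> sets borel" using A by auto
    ultimately show "(\<lambda>n. r (A n)) sums r (\<Union>n. A n)" by (simp add: r)
  qed
  show "sets (jordan_pos r) = sets (density m (\<lambda>x. ennreal (u x)))" using sets by simp
  fix A assume "A \<in> sets (jordan_pos r)"
  then have A: "A \<in> sets borel" by simp
  have P: "{x. 0 \<le> u x} \<in> sets borel" using um by measurable
  have "upper_var r A = (\<integral>\<^sup>+x\<in>A. ennreal (u x) \<partial>m)"
  proof (rule antisym)
    show "upper_var r A \<le> (\<integral>\<^sup>+x\<in>A. ennreal (u x) \<partial>m)"
      unfolding upper_var_def
    proof (rule SUP_least)
      fix B assume B: "B \<in> {B \<in> sets borel. B \<subseteq> A}"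
      have "ennreal (r B) \<le> (\<integral>\<^sup>+x\<in>B. ennreal (u x) \<partial>m)" using B by (intro le) auto
      also have "\<dots> \<le> (\<integral>\<^sup>+x\<in>A. ennreal (u x) \<partial>m)"
        using B by (intro nn_integral_mono) (auto simp: indicator_def)
      finally show "ennreal (r B) \<le> (\<integral>\<^sup>+x\<in>A. ennreal (u x) \<partial>m)" .
    qed
    have AP: "A \<inter> {x. 0 \<le> u x} \<in> sets borel" using A P by auto
    have i: "integrable m (\<lambda>x. indicator (A \<inter> {x. 0 \<le> u x}) x * u x)"
      using integrable_mult_indicator[of "A \<inter> {x. 0 \<le> u x}" m u] AP sets u by simp
    have "(\<integral>\<^sup>+x\<in>A. ennreal (u x) \<partial>m) = (\<integral>\<^sup>+x. ennreal (indicator (A \<inter> {x. 0 \<le> u x}) x * u x) \<partial>m)"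
      by (intro nn_integral_cong) (auto simp: indicator_def ennreal_neg)
    also have "\<dots> = ennreal (r (A \<inter> {x. 0 \<le> u x}))"
      unfolding r[OF AP] set_lebesgue_integral_def using i
      by (subst nn_integral_eq_integral) (auto simp: indicator_def)
    also have "\<dots> \<le> upper_var r A" by (intro upper_var_ge[OF ca]) (use AP in auto)
    finally show "(\<integral>\<^sup>+x\<in>A. ennreal (u x) \<partial>m) \<le> upper_var r A" .
  qed
  then show "emeasure (jordan_pos r) A = emeasure (density m (\<lambda>x. ennreal (u x))) A"
    using A um sets by (simp add: emeasure_jordan_pos[OF ca A] emeasure_density cong: measurable_cong_sets)
qed

text \<open>Used with \<open>W\<close> replaced by the density of a scalar pairing of the vector
  measure, to turn integrals against that pairing into Haar integrals. The positive and negative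
  parts of \<open>Re W\<close> and \<open>Im W\<close> are bounded by \<open>cmod (W x)\<close>, so
  integrability of \<open>g * W\<close> settles all four integrals, even for unbounded
  \<open>g\<close>.\<close>

lemma cintegral_density:
  fixes W :: "'a::topological_space \<Rightarrow> complex"
  assumes sets: "sets m = sets borel" and W: "integrable m W"
    and la: "\<And>B. B \<in> sets borel \<Longrightarrow> la B = (LINT x:B|m. W x)"
    and g: "g \<in> borel_measurable borel" and gW: "integrable m (\<lambda>x. g x * W x)"
  shows "cintegral la g UNIV = (LINT x|m. g x * W x)"
proof -
  have gm: "g \<in> borel_measurable m" using g sets by (simp cong: measurable_cong_sets)
  have Wm: "W \<in> borel_measurable m" using W by auto
  have iW: "set_integrable m B W" if "B \<in> sets borel" for B
    unfolding set_integrable_def using that W sets by (intro integrable_mult_indicator) auto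
  have part: "integral\<^sup>L (density m (\<lambda>x. ennreal (u x))) g = (LINT x|m. complex_of_real (max 0 (u x)) * g x)"
     if "u \<in> borel_measurable m" for u
  proof -
    have "density m (\<lambda>x. ennreal (u x)) = density m (\<lambda>x. ennreal (max 0 (u x)))"
      using that by (intro density_cong) (auto simp: max_def ennreal_neg)
    then show ?thesis using that gm by (simp add: integral_density scaleR_conv_of_real)
  qed
  have int: "integrable m (\<lambda>x. complex_of_real (max 0 (u x)) * g x)"
    if "u \<in> borel_measurable m" "\<And>x. \<bar>u x\<bar> \<le> cmod (W x)" for u
  proof (rule Bochner_Integration.integrable_bound[OF gW])
    show "AE x in m. norm (complex_of_real (max 0 (u x)) * g x) \<le> norm (g x * W x)"
    proof (rule AE_I2)
      fix x
      have "max 0 (u x) \<le> cmod (W x)" using that(2)[of x] by auto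
      then show "norm (complex_of_real (max 0 (u x)) * g x) \<le> norm (g x * W x)"
        using mult_right_mono[of "max 0 (u x)" "cmod (W x)" "cmod (g x)"]
        by (simp add: norm_mult mult.commute del: max.bounded_iff)
    qed
  qed (use that gm in measurable)
  have dec: "g x * W x = (complex_of_real (max 0 (Re (W x))) * g x - complex_of_real (max 0 (- Re (W x))) * g x)
      + \<i> * (complex_of_real (max 0 (Im (W x))) * g x - complex_of_real (max 0 (- Im (W x))) * g x)" for x
  proof -
    have "W x = complex_of_real (max 0 (Re (W x))) - complex_of_real (max 0 (- Re (W x)))
      + \<i> * (complex_of_real (max 0 (Im (W x))) - complex_of_real (max 0 (- Im (W x))))"
      by (auto simp: complex_eq_iff max_def)
    then have "g x * W x = g x * (complex_of_real (max 0 (Re (W x))) - complex_of_real (max 0 (- Re (W x)))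
      + \<i> * (complex_of_real (max 0 (Im (W x))) - complex_of_real (max 0 (- Im (W x)))))" by (rule arg_cong)
    then show ?thesis by (simp only: algebra_simps)
  qed
  have "jordan_pos (\<lambda>B. Re (la B)) = density m (\<lambda>x. ennreal (Re (W x)))"
    "jordan_pos (\<lambda>B. - Re (la B)) = density m (\<lambda>x. ennreal (- Re (W x)))"
    "jordan_pos (\<lambda>B. Im (la B)) = density m (\<lambda>x. ennreal (Im (W x)))"
    "jordan_pos (\<lambda>B. - Im (la B)) = density m (\<lambda>x. ennreal (- Im (W x)))"
    using iW W by (auto intro!: jordan_pos_density[OF sets] simp: la set_lebesgue_integral_def set_integrable_def
         integral_Re[symmetric] integral_Im[symmetric] simp flip: Bochner_Integration.integral_minus)
  then have "cintegral la g UNIV = 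
     ((LINT x|m. complex_of_real (max 0 (Re (W x))) * g x) - (LINT x|m. complex_of_real (max 0 (- Re (W x))) * g x))
      + \<i> * ((LINT x|m. complex_of_real (max 0 (Im (W x))) * g x) - (LINT x|m. complex_of_real (max 0 (- Im (W x))) * g x))"
    using Wm by (simp add: cintegral_UNIV part)
  also have "\<dots> = (LINT x|m. g x * W x)"
    unfolding dec using Wm
    by (simp add: int abs_Re_le_cmod abs_Im_le_cmod)
  finally show ?thesis .
qed

section \<open>Fubini for inner regular measures\<close>

text \<open>Compact approximation is demanded for all Borel sets, with a small difference instead of
  a supremum. In this form it passes to dominated measures and to sums, and complements give
  approximation by open sets from outside.\<close>

definition inner_regular :: "'a::topological_space measure \<Rightarrow> bool" where
  "inner_regular p \<longleftrightarrow> finite_measure p \<and> sets p = sets borel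
     \<and> (\<forall>A\<in>sets borel. \<forall>e>0. \<exists>K\<subseteq>A. compact K \<and> measure p (A - K) < e)"

lemma inner_regularD:
  assumes "inner_regular p"
  shows "finite_measure p" "sets p = sets borel" "space p = UNIV"
  using assms sets_eq_imp_space_eq[of p borel] by (auto simp: inner_regular_def)

lemma inner_regular_compact:
  assumes "inner_regular p" "A \<in> sets borel" "e > 0"
  obtains K where "K \<subseteq> A" "compact K" "measure p (A - K) < e"
  using assms unfolding inner_regular_def by blast

lemma inner_regular_open:
  fixes p :: "'a::t2_space measure"
  assumes p: "inner_regular p" and A: "A \<in> sets borel" "e > 0"
  obtains U where "A \<subseteq> U" "open U" "measure p (U - A) < e"
proof -
  obtain K where "K \<subseteq> - A" "compact K" "measure p (- A - K) < e"
    using inner_regular_compact[OF p, of "-A" e] A by auto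
  moreover have "- A - K = - K - A" by auto
  moreover have "A \<subseteq> - K" using \<open>K \<subseteq> - A\<close> by blast
  ultimately show thesis using that[of "- K"] by (auto simp: compact_imp_closed open_Compl)
qed

text \<open>Outer regularity applied to \<open>- A\<close> gives an open \<open>U\<close>; in a
  compact space \<open>- U\<close> is compact, and \<open>A - (- U) = U - (- A)\<close> is
  small.\<close>

lemma radon_measure_inner_regular:
  fixes p :: "'a::t2_space measure"
  assumes c: "compact (UNIV::'a set)" and p: "radon_measure p" and fin: "finite_measure p"
  shows "inner_regular p"
  unfolding inner_regular_def
proof (intro conjI ballI allI impI)
  interpret finite_measure p by fact
  show s: "sets p = sets borel" using p by (simp add: radon_measure_def)
  fix A :: "'a set" and e :: real assume A: "A \<in> sets borel" and e: "e > 0"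
  have "emeasure p (- A) = (INF U\<in>{U. open U \<and> - A \<subseteq> U}. emeasure p U)"
    using p A unfolding radon_measure_def by (metis borel_comp)
  moreover have "emeasure p (- A) < emeasure p (- A) + ennreal e"
    using e by (auto simp: emeasure_eq_measure ennreal_plus[symmetric] ennreal_less_iff simp del: ennreal_plus)
  ultimately obtain U where U: "open U" "- A \<subseteq> U" "emeasure p U < emeasure p (- A) + ennreal e"
    by (auto simp: INF_less_iff)
  have "measure p (U - (- A)) = measure p U - measure p (- A)"
    using U A s by (intro finite_measure_Diff) auto
  moreover have "measure p U < measure p (- A) + e"
    using U(3) e by (auto simp: emeasure_eq_measure ennreal_plus[symmetric] ennreal_less_iff simp del: ennreal_plus)
  moreover have "U - (- A) = A - (- U)" by auto
  moreover have "compact (- U)" using c U(1) by (metis closed_Compl compact_Int_closed inf_top_left)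
  ultimately show "\<exists>K\<subseteq>A. compact K \<and> measure p (A - K) < e"
    using U(2) by (intro exI[of _ "- U"]) auto
qed fact

lemma inner_regular_dominated:
  fixes p q :: "'a::t2_space measure"
  assumes p: "inner_regular p" and s: "sets q = sets borel"
    and le: "\<And>A. A \<in> sets borel \<Longrightarrow> emeasure q A \<le> emeasure p A"
  shows "inner_regular q"
proof -
  interpret p: finite_measure p using p by (rule inner_regularD)
  have "emeasure q (space q) \<le> emeasure p UNIV"
    using le[of UNIV] sets_eq_imp_space_eq[OF s] by simp
  then interpret q: finite_measure q
    by (intro finite_measureI) (auto simp: top_unique p.emeasure_eq_measure)
  have "measure q A \<le> measure p A" if "A \<in> sets borel" for A
    using le[OF that] by (simp add: p.emeasure_eq_measure q.emeasure_eq_measure)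
  moreover have "A - K \<in> sets borel" if "A \<in> sets borel" "compact K" for A K :: "'a set"
    using that by (auto intro: borel_compact)
  ultimately show ?thesis
    using p s q.finite_measure_axioms unfolding inner_regular_def
    by (meson order_le_less_trans)
qed

lemma inner_regular_homeo_image:
  fixes p :: "'a::t2_space measure" and h h' :: "'a \<Rightarrow> 'a"
  assumes p: "inner_regular p" and h: "continuous_on UNIV h" "continuous_on UNIV h'"
    and inv: "\<And>x. h (h' x) = x" "\<And>x. h' (h x) = x"
  shows "inner_regular (distr p borel h)"
  unfolding inner_regular_def
proof (intro conjI ballI allI impI)
  interpret p: finite_measure p using p by (rule inner_regularD)
  have hm: "h \<in> measurable p borel"
    using borel_measurable_continuous_onI[OF h(1)] inner_regularD[OF p] by (simp cong: measurable_cong_sets)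
  show "finite_measure (distr p borel h)" by (rule p.finite_measure_distr[OF hm])
  fix A :: "'a set" and e :: real assume A: "A \<in> sets borel" and e: "e > 0"
  have hA: "h -` A \<in> sets borel" using measurable_sets[OF hm A] inner_regularD[OF p] by simp
  obtain K where K: "K \<subseteq> h -` A" "compact K" "measure p (h -` A - K) < e"
    using inner_regular_compact[OF p hA e] .
  have c: "compact (h ` K)" using K(2) h(1) by (meson compact_continuous_image continuous_on_subset subset_UNIV)
  have "h -` (A - h ` K) = h -` A - K" using inv by (auto simp: image_iff) metis
  then have "measure (distr p borel h) (A - h ` K) = measure p (h -` A - K)"
    using hm A c inner_regularD[OF p] by (subst measure_distr) (auto intro: borel_compact)
  then show "\<exists>K\<subseteq>A. compact K \<and> measure (distr p borel h) (A - K) < e"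
    using K c by (intro exI[of _ "h ` K"]) auto
qed simp

subsection \<open>Fubini for Borel functions on the product space\<close>

lemma borel_measurable_section:
  assumes "H \<in> borel_measurable (borel :: ('a::topological_space \<times> 'b::topological_space) measure)"
  shows "(\<lambda>s. H (s, t)) \<in> borel_measurable borel" "(\<lambda>t. H (s, t)) \<in> borel_measurable borel"
proof -
  have "(\<lambda>s. (s, t)) \<in> borel_measurable borel" "(\<lambda>t. (s, t)) \<in> borel_measurable borel"
    by (intro borel_measurable_continuous_onI continuous_intros)+
  from this[THEN measurable_compose, OF assms]
  show "(\<lambda>s. H (s, t)) \<in> borel_measurable borel" "(\<lambda>t. H (s, t)) \<in> borel_measurable borel"
    by auto
qed

lemma borel_section:
  assumes "W \<in> sets (borel :: ('a::topological_space \<times> 'b::topological_space) measure)"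
  shows "{s. (s, t) \<in> W} \<in> sets borel" "{t. (s, t) \<in> W} \<in> sets borel"
proof -
  have "(\<lambda>s. (s, t)) \<in> measurable borel borel" "(\<lambda>t. (s, t)) \<in> measurable borel borel"
    by (intro borel_measurable_continuous_onI continuous_intros)+
  from measurable_sets[OF this(1) assms] measurable_sets[OF this(2) assms]
  show "{s. (s, t) \<in> W} \<in> sets borel" "{t. (s, t) \<in> W} \<in> sets borel"
    by (auto simp: vimage_def)
qed

lemma open_section_tube:
  fixes W :: "('a::topological_space \<times> 'b::topological_space) set"
  assumes "open W" "compact K" "K \<times> {t} \<subseteq> W"
  obtains U V where "open U" "open V" "K \<subseteq> U" "t \<in> V" "U \<times> V \<subseteq> W"
proof -
  have "openin (prod_topology euclidean euclidean) W" using assms(1) by simp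
  then obtain U V where "openin euclidean U" "openin euclidean V" "K \<subseteq> U" "t \<in> V" "U \<times> V \<subseteq> W"
    using tube_lemma_left[of euclidean euclidean W K t] assms(2,3) by (metis UNIV_I compactin_euclidean_iff topspace_euclidean)
  then show thesis using that by simp
qed

text \<open>Inner regularity replaces the section by a compact \<open>K\<close> of measure above
  \<open>a\<close>, and the tube lemma thickens \<open>K \<times> {t}\<close> to an open rectangle.
  This is lower semicontinuity of the section measure in \<open>t\<close>, with an explicit
  witness.\<close>

lemma open_section_rectangle:
  fixes W :: "('a::t2_space \<times> 'b::topological_space) set"
  assumes p: "inner_regular p" and W: "open W" and a: "a < measure p {s. (s, t) \<in> W}"
  obtains U V where "open U" "open V" "t \<in> V" "U \<times> V \<subseteq> W" "a < measure p U"
proof -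
  interpret finite_measure p using p by (rule inner_regularD)
  let ?A = "{s. (s, t) \<in> W}"
  have A: "?A \<in> sets borel" using W by (intro borel_section) auto
  obtain K where K: "K \<subseteq> ?A" "compact K" "measure p (?A - K) < measure p ?A - a"
    using inner_regular_compact[OF p A, of "measure p ?A - a"] a by auto
  have "measure p (?A - K) = measure p ?A - measure p K"
    using A K inner_regularD[OF p] by (intro finite_measure_Diff) (auto intro: borel_compact)
  then have "a < measure p K" using K(3) by simp
  obtain U V where UV: "open U" "open V" "K \<subseteq> U" "t \<in> V" "U \<times> V \<subseteq> W"
    using open_section_tube[OF W K(2), of t] K(1) by auto
  have "measure p K \<le> measure p U"
    using UV inner_regularD[OF p] by (intro finite_measure_mono) auto
  with \<open>a < measure p K\<close> UV that show thesis by auto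
qed

lemma borel_measurable_measure_section_open:
  fixes W :: "('a::t2_space \<times> 'b::topological_space) set"
  assumes p: "inner_regular p" and W: "open W"
  shows "(\<lambda>t. emeasure p {s. (s, t) \<in> W}) \<in> borel_measurable borel"
proof -
  interpret finite_measure p using p by (rule inner_regularD)
  have "(\<lambda>t. measure p {s. (s, t) \<in> W}) \<in> borel_measurable borel"
  proof (rule borel_measurableI_greater)
    fix a
    have "open {t. a < measure p {s. (s, t) \<in> W}}"
    proof (rule topological_space_class.openI)
      fix t assume "t \<in> {t. a < measure p {s. (s, t) \<in> W}}"
      then have "a < measure p {s. (s, t) \<in> W}" by simp
      then obtain U V where UV: "open U" "open V" "t \<in> V" "U \<times> V \<subseteq> W" "a < measure p U"
        by (rule open_section_rectangle[OF p W])
      have "a < measure p {s. (s, t') \<in> W}" if "t' \<in> V" for t'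
      proof -
        have "measure p U \<le> measure p {s. (s, t') \<in> W}"
          using UV that W borel_section(1)[of W t'] inner_regularD[OF p] by (intro finite_measure_mono) auto
        with UV show ?thesis by simp
      qed
      then show "\<exists>T. open T \<and> t \<in> T \<and> T \<subseteq> {t. a < measure p {s. (s, t) \<in> W}}"
        using UV by auto
    qed
    then show "{t\<in>space borel. a < measure p {s. (s, t) \<in> W}} \<in> sets borel" by auto
  qed
  then show ?thesis by (simp add: emeasure_eq_measure)
qed

text \<open>Dynkin's argument starts from the open sets, which generate the Borel sets of the
  product space and are stable under intersection; measurable rectangles need not generate
  them.\<close>

lemma borel_measurable_emeasure_section:
  fixes W :: "('a::t2_space \<times> 'b::topological_space) set"
  assumes p: "inner_regular p" and W: "W \<in> sets borel"
  shows "(\<lambda>t. emeasure p {s. (s, t) \<in> W}) \<in> borel_measurable borel"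
proof -
  interpret finite_measure p using p by (rule inner_regularD)
  have sp: "sets p = sets borel" "space p = UNIV" using inner_regularD[OF p] by auto
  have "W \<in> sigma_sets UNIV {S. open S}" using W by (simp add: borel_def)
  have Int: "Int_stable {S :: ('a \<times> 'b) set. open S}" by (auto intro!: Int_stableI)
  have cl: "{S :: ('a \<times> 'b) set. open S} \<subseteq> Pow UNIV" by simp
  have "W \<in> sets borel \<and> (\<lambda>t. emeasure p {s. (s, t) \<in> W}) \<in> borel_measurable borel"
    using \<open>W \<in> sigma_sets UNIV {S. open S}\<close>
  proof (induction rule: sigma_sets_induct_disjoint[OF Int cl, consumes 1, case_names basic empty compl union])
    case (basic A)
    then show ?case using borel_measurable_measure_section_open[OF p] by auto
  next
    case empty
    show ?case by simp
  next
    case (compl A)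
    then have A: "A \<in> sets borel" and m: "(\<lambda>t. emeasure p {s. (s, t) \<in> A}) \<in> borel_measurable borel" by auto
    have "emeasure p {s. (s, t) \<in> UNIV - A} = emeasure p UNIV - emeasure p {s. (s, t) \<in> A}" for t
    proof -
      have "{s. (s, t) \<in> UNIV - A} = UNIV - {s. (s, t) \<in> A}" by auto
      then show ?thesis using emeasure_compl[of "{s. (s, t) \<in> A}" p] borel_section(1)[OF A, of t] sp
        by (simp add: emeasure_eq_measure)
    qed
    then show ?case using A m by auto
  next
    case (union A)
    then have A: "A n \<in> sets borel" and m: "(\<lambda>t. emeasure p {s. (s, t) \<in> A n}) \<in> borel_measurable borel" for n by auto
    have "emeasure p {s. (s, t) \<in> (\<Union>n. A n)} = (\<Sum>n. emeasure p {s. (s, t) \<in> A n})" for t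
    proof -
      have "{s. (s, t) \<in> (\<Union>n. A n)} = (\<Union>n. {s. (s, t) \<in> A n})" by auto
      moreover have "disjoint_family (\<lambda>n. {s. (s, t) \<in> A n})"
        using union(1) by (fastforce simp: disjoint_family_on_def)
      ultimately show ?thesis using borel_section(1)[OF A] sp
        by (simp add: suminf_emeasure image_subset_iff)
    qed
    then show ?case using A m by auto
  qed
  then show ?thesis by simp
qed


text \<open>The rectangles contained in the open set \<open>W\<close> have a countable union \<open>R\<close> of maximal product
  measure. By inner regularity almost every section of \<open>W\<close> agrees with that of \<open>R\<close>
  up to a null set, and \<open>R\<close> lies in the product sigma-algebra, where Fubini is available.\<close>
lemma nn_integral_section_open_le:
  fixes W :: "('a::t2_space \<times> 'b::t2_space) set"
  assumes p: "inner_regular p" and q: "inner_regular q" and W: "open W"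
  shows "(\<integral>\<^sup>+t. emeasure p {s. (s, t) \<in> W} \<partial>q) \<le> (\<integral>\<^sup>+s. emeasure q {t. (s, t) \<in> W} \<partial>p)"
proof -
  interpret p: finite_measure p using p by (rule inner_regularD)
  interpret q: finite_measure q using q by (rule inner_regularD)
  interpret pq: pair_sigma_finite p q ..
  interpret pqf: finite_measure "p \<Otimes>\<^sub>M q"
    by (rule finite_measure_pair_measure) unfold_locales
  have sp: "sets p = sets borel" "space p = UNIV" "sets q = sets borel" "space q = UNIV"
    using inner_regularD[OF p] inner_regularD[OF q] by auto
  define Rect where "Rect = {U \<times> V | U V. open U \<and> open V \<and> U \<times> V \<subseteq> W}"
  define FU where "FU = {\<Union>F | F. finite F \<and> F \<subseteq> Rect}"
  have Rect_sets: "X \<in> sets (p \<Otimes>\<^sub>M q)" if "X \<in> Rect" for X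
    using that sp by (auto simp: Rect_def)
  have FU_sets: "X \<in> sets (p \<Otimes>\<^sub>M q)" if "X \<in> FU" for X
    using that Rect_sets by (auto simp: FU_def intro!: sets.finite_Union)
  have FU_W: "X \<subseteq> W" if "X \<in> FU" for X using that by (auto simp: FU_def Rect_def)
  have FU_Un: "X \<union> Y \<in> FU" if "X \<in> FU" "Y \<in> FU" for X Y
  proof -
    obtain F G where "finite F" "F \<subseteq> Rect" "finite G" "G \<subseteq> Rect" "X = \<Union>F" "Y = \<Union>G"
      using \<open>X \<in> FU\<close> \<open>Y \<in> FU\<close> unfolding FU_def by auto
    then show ?thesis unfolding FU_def by (intro CollectI exI[of _ "F \<union> G"]) auto
  qed
  have FU_empty: "{} \<in> FU" unfolding FU_def by (intro CollectI exI[of _ "{}"]) auto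
  have Rect_FU: "X \<in> FU" if "X \<in> Rect" for X
    unfolding FU_def using that by (intro CollectI exI[of _ "{X}"]) auto
  have "\<exists>f::nat \<Rightarrow> ennreal. range f \<subseteq> emeasure (p \<Otimes>\<^sub>M q) ` FU \<and> (SUP X\<in>FU. emeasure (p \<Otimes>\<^sub>M q) X) = (SUP i. f i)"
    using ennreal_Sup_countable_SUP[of "emeasure (p \<Otimes>\<^sub>M q) ` FU"] FU_empty by auto
  then obtain f :: "nat \<Rightarrow> ennreal" where f: "range f \<subseteq> emeasure (p \<Otimes>\<^sub>M q) ` FU"
      "(SUP X\<in>FU. emeasure (p \<Otimes>\<^sub>M q) X) = (SUP i. f i)" by auto
  have "\<forall>i. \<exists>X. X \<in> FU \<and> f i = emeasure (p \<Otimes>\<^sub>M q) X" using f(1) by (auto simp: image_subset_iff image_iff)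
  then obtain R0 where R0: "\<And>i. R0 i \<in> FU" "\<And>i. f i = emeasure (p \<Otimes>\<^sub>M q) (R0 i)" by metis
  define R1 where "R1 n = (\<Union>i\<le>n. R0 i)" for n
  have R1: "R1 n \<in> FU" for n
  proof (induction n)
    case (Suc n)
    have "R1 (Suc n) = R1 n \<union> R0 (Suc n)" by (auto simp: R1_def atMost_Suc)
    then show ?case using Suc R0 FU_Un by simp
  qed (simp add: R1_def R0)
  have R1_inc: "incseq R1" by (auto simp: R1_def incseq_def) (meson atMost_iff order_trans)
  define R where "R = (\<Union>n. R1 n)"
  have R_sets: "R \<in> sets (p \<Otimes>\<^sub>M q)" unfolding R_def using R1 FU_sets by auto
  have R_W: "R \<subseteq> W" unfolding R_def using R1 FU_W by auto
  have sup_le: "(SUP X\<in>FU. emeasure (p \<Otimes>\<^sub>M q) X) \<le> emeasure (p \<Otimes>\<^sub>M q) R"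
    unfolding f(2)
  proof (rule SUP_least)
    fix i
    have "R0 i \<subseteq> R" unfolding R_def R1_def by auto
    then show "f i \<le> emeasure (p \<Otimes>\<^sub>M q) R" unfolding R0(2) by (intro emeasure_mono R_sets)
  qed
  \<comment> \<open>Each \<open>R1 n \<union> X\<close> competes in the supremum that
    \<open>R\<close> attains, so adjoining the rectangle \<open>X\<close> to \<open>R\<close> adds
    no measure.\<close>
  have null: "emeasure (p \<Otimes>\<^sub>M q) (X - R) = 0" if X: "X \<in> Rect" for X
  proof -
    have "incseq (\<lambda>n. R1 n \<union> X)" using R1_inc unfolding incseq_def by blast
    then have "emeasure (p \<Otimes>\<^sub>M q) (\<Union>n. R1 n \<union> X) = (SUP n. emeasure (p \<Otimes>\<^sub>M q) (R1 n \<union> X))"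
      using FU_sets[OF R1] Rect_sets[OF X] by (intro SUP_emeasure_incseq[symmetric]) (auto simp: image_subset_iff)
    also have "\<dots> \<le> (SUP X\<in>FU. emeasure (p \<Otimes>\<^sub>M q) X)"
      by (intro SUP_least SUP_upper FU_Un R1 Rect_FU X)
    also note sup_le
    finally have "emeasure (p \<Otimes>\<^sub>M q) (R \<union> (X - R)) \<le> emeasure (p \<Otimes>\<^sub>M q) R"
      by (simp add: R_def)
    moreover have "emeasure (p \<Otimes>\<^sub>M q) (R \<union> (X - R)) = emeasure (p \<Otimes>\<^sub>M q) R + emeasure (p \<Otimes>\<^sub>M q) (X - R)"
      using R_sets Rect_sets[OF X] by (intro plus_emeasure[symmetric]) auto
    ultimately have "measure (p \<Otimes>\<^sub>M q) R + measure (p \<Otimes>\<^sub>M q) (X - R) \<le> measure (p \<Otimes>\<^sub>M q) R"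
      by (simp add: pqf.emeasure_eq_measure ennreal_plus[symmetric] del: ennreal_plus)
    then show ?thesis by (simp add: pqf.emeasure_eq_measure measure_le_0_iff)
  qed
  have mW: "(\<lambda>t. emeasure p {s. (s, t) \<in> W}) \<in> borel_measurable q"
    using borel_measurable_emeasure_section[OF p, of W] W sp by (simp cong: measurable_cong_sets)
  have secR: "{s. (s, t) \<in> R} \<in> sets borel" "{t. (s, t) \<in> R} \<in> sets borel" for s t
    using sets_Pair1[OF R_sets] sets_Pair2[OF R_sets] sp by (auto simp: vimage_def)
  have mR: "(\<lambda>t. emeasure p {s. (s, t) \<in> R}) \<in> borel_measurable q"
    using pq.measurable_emeasure_Pair2[OF R_sets] by (simp add: vimage_def)
  \<comment> \<open>For a fixed level \<open>a\<close>, consider the points whose section of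
    \<open>R\<close> has measure at most \<open>a\<close> while that of \<open>W\<close> has more.
    If they were not null, they would contain a compact \<open>C\<close> of positive measure,
    covered by finitely many \<open>V t\<close>. Each \<open>V t \<inter> C\<close> is null, because
    \<open>U t \<times> V t - R\<close> is null although every section of it over
    \<open>V t \<inter> C\<close> has positive measure.\<close>
  have T: "AE t in q. \<not> (emeasure p {s. (s, t) \<in> R} \<le> ennreal a \<and> ennreal a < emeasure p {s. (s, t) \<in> W})" for a :: real
  proof (rule ccontr)
    let ?T = "{t. emeasure p {s. (s, t) \<in> R} \<le> ennreal a \<and> ennreal a < emeasure p {s. (s, t) \<in> W}}"
    have "{t\<in>space q. emeasure p {s. (s, t) \<in> R} \<le> ennreal a \<and> ennreal a < emeasure p {s. (s, t) \<in> W}} \<in> sets q"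
      using mW mR by measurable
    then have Tq: "?T \<in> sets q" using sp(4) by simp
    assume "\<not> (AE t in q. \<not> (emeasure p {s. (s, t) \<in> R} \<le> ennreal a \<and> ennreal a < emeasure p {s. (s, t) \<in> W}))"
    then have "measure q ?T \<noteq> 0"
      using Tq sp(4) by (subst (asm) AE_iff_measurable[of ?T]) (auto simp: q.emeasure_eq_measure)
    then have pos: "measure q ?T > 0" by (simp add: zero_less_measure_iff)
    obtain C where C: "C \<subseteq> ?T" "compact C" "measure q (?T - C) < measure q ?T"
      using inner_regular_compact[OF q _ pos, of ?T] Tq sp by auto
    have CT: "C \<in> sets q" using C(2) sp by (auto intro: borel_compact)
    have "measure q (?T - C) = measure q ?T - measure q C"
      using C Tq CT by (intro q.finite_measure_Diff) auto
    then have Cpos: "measure q C > 0" using C(3) by simp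
    have "\<exists>U V. open U \<and> open V \<and> t \<in> V \<and> U \<times> V \<subseteq> W \<and> ennreal a < emeasure p U" if "t \<in> C" for t
    proof -
      have "ennreal a < emeasure p {s. (s, t) \<in> W}" using that C(1) by auto
      then have "max 0 a < measure p {s. (s, t) \<in> W}"
        by (cases "a \<ge> 0") (auto simp: p.emeasure_eq_measure ennreal_less_iff ennreal_neg zero_less_measure_iff)
      then obtain U V where "open U" "open V" "t \<in> V" "U \<times> V \<subseteq> W" "max 0 a < measure p U"
        by (rule open_section_rectangle[OF p W])
      then show ?thesis
        by (cases "a \<ge> 0") (auto simp: p.emeasure_eq_measure ennreal_less_iff ennreal_neg intro!: exI[of _ U] exI[of _ V])
    qed
    then obtain U V where UV: "\<And>t. t \<in> C \<Longrightarrow> open (U t) \<and> open (V t) \<and> t \<in> V t \<and> U t \<times> V t \<subseteq> W \<and> ennreal a < emeasure p (U t)"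
      by metis
    have Z: "measure q (V t \<inter> C) = 0" if t: "t \<in> C" for t
    proof -
      have X: "U t \<times> V t \<in> Rect" using UV[OF t] by (auto simp: Rect_def)
      have "0 = (\<integral>\<^sup>+y. emeasure p ((\<lambda>x. (x, y)) -` (U t \<times> V t - R)) \<partial>q)"
        using pq.emeasure_pair_measure_alt2[of "U t \<times> V t - R"] null[OF X] Rect_sets[OF X] R_sets by auto
      then have "AE y in q. emeasure p ((\<lambda>x. (x, y)) -` (U t \<times> V t - R)) = 0"
        using Rect_sets[OF X] R_sets pq.measurable_emeasure_Pair2[of "U t \<times> V t - R"]
        by (subst nn_integral_0_iff_AE[symmetric]) auto
      moreover have "emeasure p ((\<lambda>x. (x, y)) -` (U t \<times> V t - R)) \<noteq> 0" if y: "y \<in> V t \<inter> C" for y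
      proof
        assume z: "emeasure p ((\<lambda>x. (x, y)) -` (U t \<times> V t - R)) = 0"
        have e: "(\<lambda>x. (x, y)) -` (U t \<times> V t - R) = U t - {s. (s, y) \<in> R}" using y by auto
        have "emeasure p (U t) \<le> emeasure p ({s. (s, y) \<in> R} \<union> (U t - {s. (s, y) \<in> R}))"
          using secR UV[OF t] sp by (intro emeasure_mono) auto
        also have "\<dots> \<le> emeasure p {s. (s, y) \<in> R} + emeasure p (U t - {s. (s, y) \<in> R})"
          using secR UV[OF t] sp by (intro emeasure_subadditive) auto
        also have "\<dots> \<le> ennreal a" using z e y C(1) by auto
        finally show False using UV[OF t] leD by blast
      qed
      ultimately have "AE y in q. y \<notin> V t \<inter> C" by (auto elim: AE_mp)
      moreover have VC: "V t \<inter> C \<in> sets q" using UV[OF t] CT sp by auto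
      ultimately have "emeasure q (V t \<inter> C) = 0"
        using AE_iff_measurable[of "V t \<inter> C" q "\<lambda>y. y \<notin> V t \<inter> C"] sp(4) by auto
      then show ?thesis by (simp add: measure_def)
    qed
    have "C \<subseteq> (\<Union>t\<in>C. V t)" "\<And>t. t \<in> C \<Longrightarrow> open (V t)" using UV by auto
    then obtain D where D: "D \<subseteq> C" "finite D" "C \<subseteq> (\<Union>t\<in>D. V t)"
      using compactE_image[OF C(2), of C V] by metis
    have "measure q C \<le> measure q (\<Union>t\<in>D. V t \<inter> C)"
    proof (rule q.finite_measure_mono)
      have "open (V t)" if "t \<in> D" for t using D(1) UV that by auto
      then have "V t \<inter> C \<in> sets q" if "t \<in> D" for t using CT sp that by auto
      then show "(\<Union>t\<in>D. V t \<inter> C) \<in> sets q" using D(2) by (intro sets.finite_UN) auto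
    qed (use D in auto)
    also have "\<dots> \<le> (\<Sum>t\<in>D. measure q (V t \<inter> C))"
      using D CT UV sp by (intro measure_subadditive_finite) (auto simp: q.emeasure_eq_measure)
    also have "\<dots> = 0" using Z D(1) by (intro sum.neutral) auto
    finally show False using Cpos by simp
  qed
  \<comment> \<open>Rational levels suffice to separate two different finite section measures, and
    countably many null sets may be united.\<close>
  have "AE t in q. \<forall>a\<in>\<rat>. \<not> (emeasure p {s. (s, t) \<in> R} \<le> ennreal a \<and> ennreal a < emeasure p {s. (s, t) \<in> W})"
    using T by (simp add: AE_ball_countable countable_rat)
  then have "AE t in q. emeasure p {s. (s, t) \<in> W} \<le> emeasure p {s. (s, t) \<in> R}"
  proof (rule AE_mp, intro AE_I2 impI)
    fix t assume a: "\<forall>a\<in>\<rat>. \<not> (emeasure p {s. (s, t) \<in> R} \<le> ennreal a \<and> ennreal a < emeasure p {s. (s, t) \<in> W})"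
    show "emeasure p {s. (s, t) \<in> W} \<le> emeasure p {s. (s, t) \<in> R}"
    proof (rule ccontr)
      assume "\<not> ?thesis"
      then have "measure p {s. (s, t) \<in> R} < measure p {s. (s, t) \<in> W}"
        by (simp add: p.emeasure_eq_measure not_le ennreal_less_iff)
      then obtain r where "r \<in> \<rat>" "measure p {s. (s, t) \<in> R} < r" "r < measure p {s. (s, t) \<in> W}"
        using Rats_dense_in_real by blast
      moreover from this have "r \<ge> 0" using measure_nonneg[of p "{s. (s, t) \<in> R}"] by linarith
      ultimately show False using a
        by (auto simp: p.emeasure_eq_measure ennreal_less_iff dest!: bspec[of _ _ r])
    qed
  qed
  then have "(\<integral>\<^sup>+t. emeasure p {s. (s, t) \<in> W} \<partial>q) \<le> (\<integral>\<^sup>+t. emeasure p {s. (s, t) \<in> R} \<partial>q)"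
    by (rule nn_integral_mono_AE)
  also have "\<dots> = emeasure (p \<Otimes>\<^sub>M q) R"
    using pq.emeasure_pair_measure_alt2[OF R_sets] by (simp add: vimage_def)
  also have "\<dots> = (\<integral>\<^sup>+s. emeasure q {t. (s, t) \<in> R} \<partial>p)"
    using q.emeasure_pair_measure_alt[OF R_sets] by (simp add: vimage_def)
  also have "\<dots> \<le> (\<integral>\<^sup>+s. emeasure q {t. (s, t) \<in> W} \<partial>p)"
    using R_W secR W sp borel_section(2)[of W]
    by (intro nn_integral_mono emeasure_mono) auto
  finally show ?thesis .
qed


lemma borel_swap:
  fixes W :: "('a::topological_space \<times> 'b::topological_space) set"
  shows "W \<in> sets borel \<Longrightarrow> {x. (snd x, fst x) \<in> W} \<in> sets borel"
    and "open W \<Longrightarrow> open {x. (snd x, fst x) \<in> W}"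
proof -
  have c: "continuous_on UNIV (\<lambda>x::'b \<times> 'a. (snd x, fst x))" by (intro continuous_intros)
  show "W \<in> sets borel \<Longrightarrow> {x. (snd x, fst x) \<in> W} \<in> sets borel"
    using measurable_sets[OF borel_measurable_continuous_onI[OF c], of W] by (simp add: vimage_def)
  show "open W \<Longrightarrow> open {x. (snd x, fst x) \<in> W}"
    using open_vimage[OF _ c, of W] by (simp add: vimage_def)
qed

lemma borel_measurable_emeasure_section':
  fixes W :: "('a::topological_space \<times> 'b::t2_space) set"
  assumes q: "inner_regular q" and W: "W \<in> sets borel"
  shows "(\<lambda>s. emeasure q {t. (s, t) \<in> W}) \<in> borel_measurable borel"
  using borel_measurable_emeasure_section[OF q borel_swap(1)[OF W]] by simp

text \<open>For open sets the one-sided estimate applied to \<open>W\<close> and to its mirror image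
  gives equality. Complements and disjoint unions carry it to all Borel sets; finiteness of both
  measures justifies the subtraction.\<close>

lemma nn_integral_section_eq:
  fixes W :: "('a::t2_space \<times> 'b::t2_space) set"
  assumes p: "inner_regular p" and q: "inner_regular q" and W: "W \<in> sets borel"
  shows "(\<integral>\<^sup>+t. emeasure p {s. (s, t) \<in> W} \<partial>q) = (\<integral>\<^sup>+s. emeasure q {t. (s, t) \<in> W} \<partial>p)"
proof -
  interpret p: finite_measure p using p by (rule inner_regularD)
  interpret q: finite_measure q using q by (rule inner_regularD)
  have sp: "sets p = sets borel" "space p = UNIV" "sets q = sets borel" "space q = UNIV"
    using inner_regularD[OF p] inner_regularD[OF q] by auto
  have mp: "(\<lambda>t. emeasure p {s. (s, t) \<in> A}) \<in> borel_measurable q"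
    and mq: "(\<lambda>s. emeasure q {t. (s, t) \<in> A}) \<in> borel_measurable p" if "A \<in> sets borel" for A
    using borel_measurable_emeasure_section[OF p that] borel_measurable_emeasure_section'[OF q that] sp
    by (auto cong: measurable_cong_sets)
  have open_eq: "(\<integral>\<^sup>+t. emeasure p {s. (s, t) \<in> A} \<partial>q) = (\<integral>\<^sup>+s. emeasure q {t. (s, t) \<in> A} \<partial>p)"
    if "open A" for A
    using nn_integral_section_open_le[OF p q that] nn_integral_section_open_le[OF q p borel_swap(2)[OF that]]
    by (intro antisym) auto
  have "W \<in> sigma_sets UNIV {S. open S}" using W by (simp add: borel_def)
  have Int: "Int_stable {S :: ('a \<times> 'b) set. open S}" by (auto intro!: Int_stableI)
  have cl: "{S :: ('a \<times> 'b) set. open S} \<subseteq> Pow UNIV" by simp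
  have "W \<in> sets borel \<and> (\<integral>\<^sup>+t. emeasure p {s. (s, t) \<in> W} \<partial>q) = (\<integral>\<^sup>+s. emeasure q {t. (s, t) \<in> W} \<partial>p)"
    using \<open>W \<in> sigma_sets UNIV {S. open S}\<close>
  proof (induction rule: sigma_sets_induct_disjoint[OF Int cl, consumes 1, case_names basic empty compl union])
    case (basic A)
    then show ?case using open_eq by auto
  next
    case empty
    show ?case by simp
  next
    case (compl A)
    then have A: "A \<in> sets borel" and eq: "(\<integral>\<^sup>+t. emeasure p {s. (s, t) \<in> A} \<partial>q) = (\<integral>\<^sup>+s. emeasure q {t. (s, t) \<in> A} \<partial>p)" by auto
    have 1: "emeasure p {s. (s, t) \<in> UNIV - A} = emeasure p UNIV - emeasure p {s. (s, t) \<in> A}" for t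
    proof -
      have "{s. (s, t) \<in> UNIV - A} = UNIV - {s. (s, t) \<in> A}" by auto
      then show ?thesis using emeasure_compl[of "{s. (s, t) \<in> A}" p] borel_section(1)[OF A, of t] sp
        by (simp add: p.emeasure_eq_measure)
    qed
    have 2: "emeasure q {t. (s, t) \<in> UNIV - A} = emeasure q UNIV - emeasure q {t. (s, t) \<in> A}" for s
    proof -
      have "{t. (s, t) \<in> UNIV - A} = UNIV - {t. (s, t) \<in> A}" by auto
      then show ?thesis using emeasure_compl[of "{t. (s, t) \<in> A}" q] borel_section(2)[OF A, of s] sp
        by (simp add: q.emeasure_eq_measure)
    qed
    have le: "emeasure p X \<le> emeasure p UNIV" "emeasure q Y \<le> emeasure q UNIV" for X Y
      using emeasure_space[of p X] emeasure_space[of q Y] sp by auto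
    have f1: "(\<integral>\<^sup>+t. emeasure p {s. (s, t) \<in> A} \<partial>q) \<noteq> \<infinity>"
    proof -
      have "(\<integral>\<^sup>+t. emeasure p {s. (s, t) \<in> A} \<partial>q) \<le> (\<integral>\<^sup>+t. emeasure p UNIV \<partial>q)"
        by (intro nn_integral_mono le)
      also have "\<dots> < \<infinity>" by (simp add: p.emeasure_eq_measure q.emeasure_eq_measure ennreal_mult_less_top)
      finally show ?thesis by simp
    qed
    have "(\<integral>\<^sup>+t. emeasure p {s. (s, t) \<in> UNIV - A} \<partial>q)
        = (\<integral>\<^sup>+t. emeasure p UNIV \<partial>q) - (\<integral>\<^sup>+t. emeasure p {s. (s, t) \<in> A} \<partial>q)"
      unfolding 1 using f1 mp[OF A] le by (intro nn_integral_diff) auto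
    also have "\<dots> = (\<integral>\<^sup>+s. emeasure q UNIV \<partial>p) - (\<integral>\<^sup>+s. emeasure q {t. (s, t) \<in> A} \<partial>p)"
      using eq sp by (simp add: mult.commute)
    also have "\<dots> = (\<integral>\<^sup>+s. emeasure q {t. (s, t) \<in> UNIV - A} \<partial>p)"
      unfolding 2 using f1 eq mq[OF A] le by (intro nn_integral_diff[symmetric]) auto
    finally show ?case using A by auto
  next
    case (union A)
    then have A: "A n \<in> sets borel"
      and eq: "(\<integral>\<^sup>+t. emeasure p {s. (s, t) \<in> A n} \<partial>q) = (\<integral>\<^sup>+s. emeasure q {t. (s, t) \<in> A n} \<partial>p)" for n by auto
    have 1: "emeasure p {s. (s, t) \<in> (\<Union>n. A n)} = (\<Sum>n. emeasure p {s. (s, t) \<in> A n})" for t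
    proof -
      have "{s. (s, t) \<in> (\<Union>n. A n)} = (\<Union>n. {s. (s, t) \<in> A n})" by auto
      moreover have "disjoint_family (\<lambda>n. {s. (s, t) \<in> A n})"
        using union(1) by (fastforce simp: disjoint_family_on_def)
      ultimately show ?thesis using borel_section(1)[OF A] sp
        by (simp add: suminf_emeasure image_subset_iff)
    qed
    have 2: "emeasure q {t. (s, t) \<in> (\<Union>n. A n)} = (\<Sum>n. emeasure q {t. (s, t) \<in> A n})" for s
    proof -
      have "{t. (s, t) \<in> (\<Union>n. A n)} = (\<Union>n. {t. (s, t) \<in> A n})" by auto
      moreover have "disjoint_family (\<lambda>n. {t. (s, t) \<in> A n})"
        using union(1) by (fastforce simp: disjoint_family_on_def)
      ultimately show ?thesis using borel_section(2)[OF A] sp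
        by (simp add: suminf_emeasure image_subset_iff)
    qed
    show ?case
      unfolding 1 2 using A mp mq eq by (simp add: nn_integral_suminf)
  qed
  then show ?thesis by simp
qed

lemma
  fixes H :: "'a::t2_space \<times> 'b::t2_space \<Rightarrow> ennreal"
  assumes p: "inner_regular p" and q: "inner_regular q" and H: "H \<in> borel_measurable borel"
  shows borel_measurable_nn_integral_section: "(\<lambda>t. \<integral>\<^sup>+s. H (s, t) \<partial>p) \<in> borel_measurable borel"
    and borel_measurable_nn_integral_section': "(\<lambda>s. \<integral>\<^sup>+t. H (s, t) \<partial>q) \<in> borel_measurable borel"
    and borel_Fubini_nn: "(\<integral>\<^sup>+t. \<integral>\<^sup>+s. H (s, t) \<partial>p \<partial>q) = (\<integral>\<^sup>+s. \<integral>\<^sup>+t. H (s, t) \<partial>q \<partial>p)"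
proof -
  have sp: "sets p = sets borel" "space p = UNIV" "sets q = sets borel" "space q = UNIV"
    using inner_regularD[OF p] inner_regularD[OF q] by auto
  have cs: "borel_measurable p = (borel_measurable borel :: ('a \<Rightarrow> ennreal) set)"
    "borel_measurable q = (borel_measurable borel :: ('b \<Rightarrow> ennreal) set)"
    using sp by (auto intro!: measurable_cong_sets)
  have "(\<lambda>t. \<integral>\<^sup>+s. H (s, t) \<partial>p) \<in> borel_measurable borel \<and> (\<lambda>s. \<integral>\<^sup>+t. H (s, t) \<partial>q) \<in> borel_measurable borel
    \<and> (\<integral>\<^sup>+t. \<integral>\<^sup>+s. H (s, t) \<partial>p \<partial>q) = (\<integral>\<^sup>+s. \<integral>\<^sup>+t. H (s, t) \<partial>q \<partial>p)"
    using H
  proof (induction rule: borel_measurable_induct)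
    case (cong f g)
    then have "f = g" by auto
    then show ?case using cong by simp
  next
    case (set A)
    have 1: "(\<integral>\<^sup>+s. indicator A (s, t) \<partial>p) = emeasure p {s. (s, t) \<in> A}" for t
      using borel_section(1)[OF set, of t] sp nn_integral_indicator[of "{s. (s, t) \<in> A}" p]
      by (simp add: indicator_def)
    have 2: "(\<integral>\<^sup>+t. indicator A (s, t) \<partial>q) = emeasure q {t. (s, t) \<in> A}" for s
      using borel_section(2)[OF set, of s] sp nn_integral_indicator[of "{t. (s, t) \<in> A}" q]
      by (simp add: indicator_def)
    show ?case unfolding 1 2
      using borel_measurable_emeasure_section[OF p set] borel_measurable_emeasure_section'[OF q set]
        nn_integral_section_eq[OF p q set] by simp
  next
    case (mult u c)
    then have "(\<lambda>t. \<integral>\<^sup>+s. u (s, t) \<partial>p) \<in> borel_measurable borel" "(\<lambda>s. \<integral>\<^sup>+t. u (s, t) \<partial>q) \<in> borel_measurable borel"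
      by auto
    then have "(\<lambda>t. c * (\<integral>\<^sup>+s. u (s, t) \<partial>p)) \<in> borel_measurable borel" "(\<lambda>s. c * (\<integral>\<^sup>+t. u (s, t) \<partial>q)) \<in> borel_measurable borel"
      by measurable
    then show ?case using mult borel_measurable_section[OF mult(2)] by (simp add: nn_integral_cmult cs)
  next
    case (add u v)
    then have "u \<in> borel_measurable borel" "v \<in> borel_measurable borel" by auto
    note borel_measurable_section[OF this(1)] borel_measurable_section[OF this(2)]
    then show ?case using add
      by (auto simp: nn_integral_add cs intro!: borel_measurable_add)
  next
    case (seq U)
    have inc: "incseq (\<lambda>i s. U i (s, t))" "incseq (\<lambda>i t. U i (s, t))" for s t
      using seq(3) by (auto simp: incseq_def le_fun_def)
    have m: "(\<lambda>s. U i (s, t)) \<in> borel_measurable p" "(\<lambda>t. U i (s, t)) \<in> borel_measurable q" for i s t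
      using borel_measurable_section[OF seq(1)] cs by auto
    have 1: "(\<integral>\<^sup>+s. Sup (range U) (s, t) \<partial>p) = (SUP i. \<integral>\<^sup>+s. U i (s, t) \<partial>p)" for t
      using nn_integral_monotone_convergence_SUP[OF inc(1) m(1)] by (simp add: image_comp)
    have 2: "(\<integral>\<^sup>+t. Sup (range U) (s, t) \<partial>q) = (SUP i. \<integral>\<^sup>+t. U i (s, t) \<partial>q)" for s
      using nn_integral_monotone_convergence_SUP[OF inc(2) m(2)] by (simp add: image_comp)
    have inc': "incseq (\<lambda>i t. \<integral>\<^sup>+s. U i (s, t) \<partial>p)" "incseq (\<lambda>i s. \<integral>\<^sup>+t. U i (s, t) \<partial>q)"
      using inc by (auto simp: incseq_def le_fun_def intro!: nn_integral_mono)
    show ?case unfolding 1 2 using seq(5) inc'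
      by (auto simp: nn_integral_monotone_convergence_SUP cs image_comp intro!: borel_measurable_SUP)
  qed
  then show "(\<lambda>t. \<integral>\<^sup>+s. H (s, t) \<partial>p) \<in> borel_measurable borel" "(\<lambda>s. \<integral>\<^sup>+t. H (s, t) \<partial>q) \<in> borel_measurable borel"
    "(\<integral>\<^sup>+t. \<integral>\<^sup>+s. H (s, t) \<partial>p \<partial>q) = (\<integral>\<^sup>+s. \<integral>\<^sup>+t. H (s, t) \<partial>q \<partial>p)" by auto
qed

lemma
  fixes H :: "'a::t2_space \<times> 'b::t2_space \<Rightarrow> real"
  assumes p: "inner_regular p" and q: "inner_regular q" and H: "H \<in> borel_measurable borel"
    and B: "\<And>x. \<bar>H x\<bar> \<le> B"
  shows borel_measurable_integral_section_real: "(\<lambda>t. LINT s|p. H (s, t)) \<in> borel_measurable borel"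
    and borel_Fubini_real: "(LINT t|q. LINT s|p. H (s, t)) = (LINT s|p. LINT t|q. H (s, t))"
proof -
  interpret p: finite_measure p using p by (rule inner_regularD)
  interpret q: finite_measure q using q by (rule inner_regularD)
  have sp: "sets p = sets borel" "space p = UNIV" "sets q = sets borel" "space q = UNIV"
    using inner_regularD[OF p] inner_regularD[OF q] by auto
  have cs: "borel_measurable p = (borel_measurable borel :: ('a \<Rightarrow> 'c::topological_space) set)"
    "borel_measurable q = (borel_measurable borel :: ('b \<Rightarrow> 'c) set)"
    using sp by (auto intro!: measurable_cong_sets)
  have m: "(\<lambda>s. H (s, t)) \<in> borel_measurable p" "(\<lambda>t. H (s, t)) \<in> borel_measurable q" for s t
    using borel_measurable_section[OF H] sp by (auto cong: measurable_cong_sets)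
  have i: "integrable p (\<lambda>s. H (s, t))" "integrable q (\<lambda>t. H (s, t))" for s t
    using m B by (auto intro!: p.integrable_const_bound[of _ B] q.integrable_const_bound[of _ B])
  \<comment> \<open>Adding the bound \<open>B\<close> makes the integrand nonnegative; all integrals
    stay finite, so the added constant can be subtracted again at the end.\<close>
  let ?H = "\<lambda>x. ennreal (H x + B)"
  have Hm: "?H \<in> borel_measurable borel" using H by measurable
  have B0: "H x + B \<ge> 0" for x using B[of x] by linarith
  have 1: "(\<integral>\<^sup>+s. ?H (s, t) \<partial>p) = ennreal ((LINT s|p. H (s, t)) + B * measure p UNIV)" for t
  proof -
    have "(\<integral>\<^sup>+s. ?H (s, t) \<partial>p) = ennreal (LINT s|p. H (s, t) + B)"
      using i B0 by (intro nn_integral_eq_integral) auto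
    then show ?thesis using i sp by (simp add: mult.commute)
  qed
  have 2: "(\<integral>\<^sup>+t. ?H (s, t) \<partial>q) = ennreal ((LINT t|q. H (s, t)) + B * measure q UNIV)" for s
  proof -
    have "(\<integral>\<^sup>+t. ?H (s, t) \<partial>q) = ennreal (LINT t|q. H (s, t) + B)"
      using i B0 by (intro nn_integral_eq_integral) auto
    then show ?thesis using i sp by (simp add: mult.commute)
  qed
  have n1: "(LINT s|p. H (s, t)) + B * measure p UNIV \<ge> 0" for t
  proof -
    have "0 \<le> (LINT s|p. H (s, t) + B)" using B0 by (intro integral_nonneg_AE) auto
    then show ?thesis using i sp by (simp add: mult.commute)
  qed
  have n2: "(LINT t|q. H (s, t)) + B * measure q UNIV \<ge> 0" for s
  proof -
    have "0 \<le> (LINT t|q. H (s, t) + B)" using B0 by (intro integral_nonneg_AE) auto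
    then show ?thesis using i sp by (simp add: mult.commute)
  qed
  have "(\<lambda>t. enn2real (\<integral>\<^sup>+s. ?H (s, t) \<partial>p) - B * measure p UNIV) \<in> borel_measurable borel"
    using borel_measurable_nn_integral_section[OF p q Hm] by simp
  then show m1: "(\<lambda>t. LINT s|p. H (s, t)) \<in> borel_measurable borel"
    using n1 by (simp add: 1)
  have "(\<lambda>s. enn2real (\<integral>\<^sup>+t. ?H (s, t) \<partial>q) - B * measure q UNIV) \<in> borel_measurable borel"
    using borel_measurable_nn_integral_section'[OF p q Hm] by simp
  then have m2: "(\<lambda>s. LINT t|q. H (s, t)) \<in> borel_measurable borel"
    using n2 by (simp add: 2)
  have b1: "\<bar>LINT s|p. H (s, t)\<bar> \<le> B * measure p UNIV" for t
  proof -
    have "\<bar>LINT s|p. H (s, t)\<bar> \<le> (LINT s|p. \<bar>H (s, t)\<bar>)" by (rule integral_abs_bound)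
    also have "\<dots> \<le> (LINT s|p. B)" using i B by (intro integral_mono) auto
    finally show ?thesis using sp by (simp add: mult.commute)
  qed
  have b2: "\<bar>LINT t|q. H (s, t)\<bar> \<le> B * measure q UNIV" for s
  proof -
    have "\<bar>LINT t|q. H (s, t)\<bar> \<le> (LINT t|q. \<bar>H (s, t)\<bar>)" by (rule integral_abs_bound)
    also have "\<dots> \<le> (LINT t|q. B)" using i B by (intro integral_mono) auto
    finally show ?thesis using sp by (simp add: mult.commute)
  qed
  have i1: "integrable q (\<lambda>t. LINT s|p. H (s, t))"
    using m1 b1 cs by (intro q.integrable_const_bound[of _ "B * measure p UNIV"]) auto
  have i2: "integrable p (\<lambda>s. LINT t|q. H (s, t))"
    using m2 b2 cs by (intro p.integrable_const_bound[of _ "B * measure q UNIV"]) auto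
  have "(\<integral>\<^sup>+t. \<integral>\<^sup>+s. ?H (s, t) \<partial>p \<partial>q) = (\<integral>\<^sup>+s. \<integral>\<^sup>+t. ?H (s, t) \<partial>q \<partial>p)"
    by (rule borel_Fubini_nn[OF p q Hm])
  then have "ennreal (LINT t|q. (LINT s|p. H (s, t)) + B * measure p UNIV)
     = ennreal (LINT s|p. (LINT t|q. H (s, t)) + B * measure q UNIV)"
    unfolding 1 2 using i1 i2 n1 n2 by (subst (asm) (1 2) nn_integral_eq_integral) auto
  then have "(LINT t|q. (LINT s|p. H (s, t)) + B * measure p UNIV)
     = (LINT s|p. (LINT t|q. H (s, t)) + B * measure q UNIV)"
    using n1 n2 by (subst (asm) ennreal_inj) (auto intro!: integral_nonneg_AE)
  then show "(LINT t|q. LINT s|p. H (s, t)) = (LINT s|p. LINT t|q. H (s, t))"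
    using i1 i2 sp by (simp add: mult_ac)
qed

lemma
  fixes H :: "'a::t2_space \<times> 'b::t2_space \<Rightarrow> complex"
  assumes p: "inner_regular p" and q: "inner_regular q" and H: "H \<in> borel_measurable borel"
    and B: "\<And>x. cmod (H x) \<le> B"
  shows borel_measurable_integral_section: "(\<lambda>t. LINT s|p. H (s, t)) \<in> borel_measurable borel"
    and borel_Fubini: "(LINT t|q. LINT s|p. H (s, t)) = (LINT s|p. LINT t|q. H (s, t))"
proof -
  have R: "(\<lambda>x. Re (H x)) \<in> borel_measurable borel" "(\<lambda>x. Im (H x)) \<in> borel_measurable borel"
    using H by auto
  have b: "\<bar>Re (H x)\<bar> \<le> B" "\<bar>Im (H x)\<bar> \<le> B" for x
    using B[of x] abs_Re_le_cmod[of "H x"] abs_Im_le_cmod[of "H x"] by linarith+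
  interpret p: finite_measure p using p by (rule inner_regularD)
  interpret q: finite_measure q using q by (rule inner_regularD)
  have sp: "sets p = sets borel" "space p = UNIV" "sets q = sets borel" "space q = UNIV"
    using inner_regularD[OF p] inner_regularD[OF q] by auto
  have i: "integrable p (\<lambda>s. H (s, t))" "integrable q (\<lambda>t. H (s, t))" for s t
    using borel_measurable_section[OF H] B sp
    by (auto intro!: p.integrable_const_bound[of _ B] q.integrable_const_bound[of _ B] cong: measurable_cong_sets)
  have Rm: "(\<lambda>t. LINT s|p. Re (H (s, t))) \<in> borel_measurable borel" "(\<lambda>t. LINT s|p. Im (H (s, t))) \<in> borel_measurable borel"
    using borel_measurable_integral_section_real[OF p q R(1) b(1)] borel_measurable_integral_section_real[OF p q R(2) b(2)] by auto
  have c: "(LINT s|p. H (s, t)) = Complex (LINT s|p. Re (H (s, t))) (LINT s|p. Im (H (s, t)))" for t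
    using i by (simp add: complex_eq_iff)
  show m: "(\<lambda>t. LINT s|p. H (s, t)) \<in> borel_measurable borel"
    unfolding c Complex_eq using Rm by measurable
  have bp: "cmod (LINT s|p. H (s, t)) \<le> B * measure p UNIV" for t
  proof -
    have "cmod (LINT s|p. H (s, t)) \<le> (LINT s|p. cmod (H (s, t)))" by (rule integral_norm_bound)
    also have "\<dots> \<le> (LINT s|p. B)" using i B by (intro integral_mono) auto
    finally show ?thesis using sp by (simp add: mult.commute)
  qed
  have bq: "cmod (LINT t|q. H (s, t)) \<le> B * measure q UNIV" for s
  proof -
    have "cmod (LINT t|q. H (s, t)) \<le> (LINT t|q. cmod (H (s, t)))" by (rule integral_norm_bound)
    also have "\<dots> \<le> (LINT t|q. B)" using i B by (intro integral_mono) auto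
    finally show ?thesis using sp by (simp add: mult.commute)
  qed
  have Hs: "(\<lambda>x. H (snd x, fst x)) \<in> borel_measurable borel"
    by (rule measurable_compose[OF borel_measurable_continuous_onI H]) (intro continuous_intros)
  have R': "(\<lambda>x. Re (H (snd x, fst x))) \<in> borel_measurable borel" "(\<lambda>x. Im (H (snd x, fst x))) \<in> borel_measurable borel"
    using Hs by auto
  have c': "(LINT t|q. H (s, t)) = Complex (LINT t|q. Re (H (s, t))) (LINT t|q. Im (H (s, t)))" for s
    using i by (simp add: complex_eq_iff)
  have "(\<lambda>s. LINT t|q. Re (H (s, t))) \<in> borel_measurable borel" "(\<lambda>s. LINT t|q. Im (H (s, t))) \<in> borel_measurable borel"
    using borel_measurable_integral_section_real[OF q p R'(1) b(1)] borel_measurable_integral_section_real[OF q p R'(2) b(2)] by auto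
  then have m': "(\<lambda>s. LINT t|q. H (s, t)) \<in> borel_measurable borel"
    unfolding c' Complex_eq by measurable
  have i1: "integrable q (\<lambda>t. LINT s|p. H (s, t))"
    using m bp sp by (intro q.integrable_const_bound[of _ "B * measure p UNIV"]) (auto cong: measurable_cong_sets)
  have i2: "integrable p (\<lambda>s. LINT t|q. H (s, t))"
    using m' bq sp by (intro p.integrable_const_bound[of _ "B * measure q UNIV"]) (auto cong: measurable_cong_sets)
  show "(LINT t|q. LINT s|p. H (s, t)) = (LINT s|p. LINT t|q. H (s, t))"
    using borel_Fubini_real[OF p q R(1) b(1)] borel_Fubini_real[OF p q R(2) b(2)] i i1 i2
    by (simp add: complex_eq_iff)
qed

section \<open>Density of continuous functions\<close>

lemma Urysohn_compact_t2:
  fixes S T :: "'a::t2_space set"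
  assumes c: "compact (UNIV :: 'a set)" and "closed S" "closed T" "S \<inter> T = {}"
  obtains f :: "'a \<Rightarrow> real" where "continuous_on UNIV f" "\<And>x. 0 \<le> f x" "\<And>x. f x \<le> 1"
    "\<And>x. x \<in> S \<Longrightarrow> f x = 0" "\<And>x. x \<in> T \<Longrightarrow> f x = 1"
proof -
  have "compact_space (euclidean :: 'a topology)" using c by (simp add: compact_space_def)
  then have "normal_space (euclidean :: 'a topology)"
    by (intro compact_Hausdorff_or_regular_imp_normal_space disjI1)
      (auto simp: Hausdorff_space_def disjnt_def, metis hausdorff)
  then obtain f where f: "continuous_map euclidean (top_of_set {0..1::real}) f" "f ` S \<subseteq> {0}" "f ` T \<subseteq> {1}"
    using Urysohn_lemma[of "euclidean :: 'a topology" S T 0 1] assms by (auto simp: disjnt_def)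
  have "continuous_on UNIV f" "range f \<subseteq> {0..1}"
    using f(1) by (auto simp: continuous_map_in_subtopology)
  then show thesis using f that[of f] by (auto simp: image_subset_iff)
qed

text \<open>The indicator of \<open>A\<close> is replaced by a Urysohn function that is 1 on a
  compact \<open>K \<subseteq> A\<close> and 0 outside an open \<open>U \<supseteq> A\<close>; the
  two differ at most on \<open>A - K\<close> and \<open>U - A\<close>. Linearity and dominated
  convergence do the rest.\<close>

lemma continuous_dense_L1:
  fixes M :: "'a::t2_space measure" and f :: "'a \<Rightarrow> complex"
  assumes c: "compact (UNIV :: 'a set)" and M: "inner_regular M" and f: "integrable M f" and e: "e > 0"
  shows "\<exists>g. continuous_on UNIV g \<and> (LINT x|M. cmod (f x - g x)) < e"
proof -
  interpret finite_measure M using M by (rule inner_regularD)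
  have sp: "sets M = sets borel" "space M = UNIV" using inner_regularD[OF M] by auto
  have ig: "integrable M g" if "continuous_on UNIV g" for g :: "'a \<Rightarrow> complex"
  proof -
    have "bounded (range g)" using compact_continuous_image[OF that c] by (rule compact_imp_bounded)
    then obtain B where "\<And>x. cmod (g x) \<le> B" by (auto simp: bounded_iff)
    moreover have "g \<in> borel_measurable M"
      using borel_measurable_continuous_onI[OF that] sp by (simp cong: measurable_cong_sets)
    ultimately show ?thesis by (intro integrable_const_bound[of _ B]) auto
  qed
  have "\<forall>e>0. \<exists>g. continuous_on UNIV g \<and> (LINT x|M. cmod (f x - g x)) < e"
    using f
  proof (induction rule: integrable_induct)
    case (base A c)
    show ?case
    proof (intro allI impI)
      fix e :: real assume e: "e > 0"
      \<comment> \<open>The error will be at most \<open>cmod c * (d + d)\<close>; adding 1 to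
        \<open>cmod c\<close> covers \<open>c = 0\<close> and makes the final inequality
        strict.\<close>
      define d where "d = e / (2 * (cmod c + 1))"
      have "cmod c + 1 > 0" using norm_ge_zero[of c] by linarith
      then have d: "d > 0" "d * cmod c < e / 2" using e
        by (simp_all add: d_def field_simps)
      have A: "A \<in> sets borel" using base sp by simp
      obtain K where K: "K \<subseteq> A" "compact K" "measure M (A - K) < d"
        using inner_regular_compact[OF M A d(1)] .
      obtain U where U: "A \<subseteq> U" "open U" "measure M (U - A) < d"
        using inner_regular_open[OF M A d(1)] .
      have "- U \<inter> K = {}" using K U by auto
      then obtain f where f: "continuous_on UNIV f" "\<And>x. 0 \<le> f x" "\<And>x. f x \<le> 1"
        "\<And>x. x \<in> - U \<Longrightarrow> f x = 0" "\<And>x. x \<in> K \<Longrightarrow> f x = (1::real)"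
        using Urysohn_compact_t2[OF c, of "- U" K] U(2) K(2) by (metis closed_Compl compact_imp_closed)
      have s: "A - K \<in> sets M" "U - A \<in> sets M" using A K U sp by (auto intro: borel_compact)
      have "cmod (indicator A x *\<^sub>R c - f x *\<^sub>R c) \<le> cmod c * (indicator (A - K) x + indicator (U - A) x)" for x
      proof -
        have "indicator A x *\<^sub>R c - f x *\<^sub>R c = (indicator A x - f x) *\<^sub>R c" by (simp add: algebra_simps)
        moreover have "\<bar>indicator A x - f x\<bar> \<le> indicator (A - K) x + indicator (U - A) x"
          using f(2,3)[of x] f(4,5)[of x] K(1) U(1) by (auto simp: indicator_def)
        ultimately show ?thesis by (simp add: mult.commute mult_left_mono)
      qed
      then have "(LINT x|M. cmod (indicator A x *\<^sub>R c - f x *\<^sub>R c))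
          \<le> (LINT x|M. cmod c * (indicator (A - K) x + indicator (U - A) x))"
        using s base f(1) by (intro integral_mono integrable_norm Bochner_Integration.integrable_diff integrable_mult_right
           Bochner_Integration.integrable_add integrable_mult_indicator ig continuous_intros) (auto simp: emeasure_eq_measure)
      also have "\<dots> = cmod c * (measure M (A - K) + measure M (U - A))"
        using s by (simp add: emeasure_eq_measure)
      also have "\<dots> \<le> cmod c * (d + d)"
        using K(3) U(3) by (intro mult_left_mono) auto
      also have "\<dots> < e" using d(2) by (simp add: algebra_simps)
      finally show "\<exists>g. continuous_on UNIV g \<and> (LINT x|M. cmod (indicator A x *\<^sub>R c - g x)) < e"
        using f(1) by (intro exI[of _ "\<lambda>x. f x *\<^sub>R c"]) (auto intro!: continuous_intros)
    qed
  next
    case (add f g)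
    show ?case
    proof (intro allI impI)
      fix e :: real assume e: "e > 0"
      obtain f' g' where fg: "continuous_on UNIV f'" "(LINT x|M. cmod (f x - f' x)) < e/2"
        "continuous_on UNIV g'" "(LINT x|M. cmod (g x - g' x)) < e/2"
        using add(3,4) e by (meson half_gt_zero)
      have i: "integrable M (\<lambda>x. cmod (f x - f' x))" "integrable M (\<lambda>x. cmod (g x - g' x))"
        using add fg ig by auto
      have "(LINT x|M. cmod (f x + g x - (f' x + g' x))) \<le> (LINT x|M. cmod (f x - f' x) + cmod (g x - g' x))"
        using add fg ig i
        by (intro integral_mono) (auto simp: norm_diff_triangle_ineq add_diff_add intro: norm_triangle_ineq)
      also have "\<dots> < e" using i fg by simp
      finally show "\<exists>h. continuous_on UNIV h \<and> (LINT x|M. cmod (f x + g x - h x)) < e"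
        using fg by (intro exI[of _ "\<lambda>x. f' x + g' x"]) (auto intro!: continuous_intros)
    qed
  next
    case (lim f s)
    show ?case
    proof (intro allI impI)
      fix e :: real assume e: "e > 0"
      have "(\<lambda>i. LINT x|M. cmod (f x - s i x)) \<longlonglongrightarrow> (LINT x|M. 0)"
      proof (rule integral_dominated_convergence[where w="\<lambda>x. 3 * cmod (f x)"])
        show "AE x in M. (\<lambda>i. cmod (f x - s i x)) \<longlonglongrightarrow> 0"
          using lim(2) by (intro AE_I2 tendsto_norm_zero) (auto intro!: tendsto_eq_intros)
        show "AE x in M. norm (cmod (f x - s i x)) \<le> 3 * cmod (f x)" for i
        proof (rule AE_I2)
          fix x assume "x \<in> space M"
          then show "norm (cmod (f x - s i x)) \<le> 3 * cmod (f x)"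
            using lim(3)[of x i] norm_triangle_ineq4[of "f x" "s i x"] by simp
        qed
      qed (use lim in auto)
      then have "\<forall>\<^sub>F i in sequentially. (LINT x|M. cmod (f x - s i x)) < e / 2"
        using e by (intro order_tendstoD(2)) auto
      then obtain i where i: "(LINT x|M. cmod (f x - s i x)) < e / 2" by (meson eventually_happens sequentially_bot)
      obtain g where g: "continuous_on UNIV g" "(LINT x|M. cmod (s i x - g x)) < e / 2"
        using lim(5)[of i] e by (meson half_gt_zero)
      have ii: "integrable M (\<lambda>x. cmod (f x - s i x))" "integrable M (\<lambda>x. cmod (s i x - g x))"
        using lim g ig by auto
      have "(LINT x|M. cmod (f x - g x)) \<le> (LINT x|M. cmod (f x - s i x) + cmod (s i x - g x))"
      proof (rule integral_mono)
        show "cmod (f x - g x) \<le> cmod (f x - s i x) + cmod (s i x - g x)" for x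
          using norm_triangle_ineq[of "f x - s i x" "s i x - g x"] by simp
      qed (use lim g ig ii in auto)
      also have "\<dots> < e" using ii i g by simp
      finally show "\<exists>g. continuous_on UNIV g \<and> (LINT x|M. cmod (f x - g x)) < e" using g by blast
    qed
  qed
  then show ?thesis using e by blast
qed

text \<open>Projecting the values of \<open>g\<close> onto the disc of radius \<open>B\<close> is
  1-Lipschitz and fixes the values of \<open>f\<close>, so the distance does not grow. The uniform
  bound is what later turns smallness in \<open>L1\<close> into smallness in Luxemburg norm.\<close>

lemma bounded_continuous_dense_L1:
  fixes M :: "'a::t2_space measure" and f :: "'a \<Rightarrow> complex"
  assumes c: "compact (UNIV :: 'a set)" and M: "inner_regular M" and f: "f \<in> borel_measurable borel"
    and B: "\<And>x. cmod (f x) \<le> B" and e: "e > 0"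
  obtains g where "continuous_on UNIV g" "\<And>x. cmod (g x) \<le> B" "(LINT x|M. cmod (f x - g x)) < e"
proof -
  interpret finite_measure M using M by (rule inner_regularD)
  have sp: "sets M = sets borel" "space M = UNIV" using inner_regularD[OF M] by auto
  have fM: "f \<in> borel_measurable M" using f sp by (simp cong: measurable_cong_sets)
  have fi: "integrable M f" using fM B by (intro integrable_const_bound[of _ B]) auto
  obtain g where g: "continuous_on UNIV g" "(LINT x|M. cmod (f x - g x)) < e"
    using continuous_dense_L1[OF c M fi e] by blast
  have gM: "g \<in> borel_measurable M"
    using borel_measurable_continuous_onI[OF g(1)] sp by (simp cong: measurable_cong_sets)
  have B0: "B \<ge> 0" using B[of undefined] norm_ge_zero[of "f undefined"] by linarith
  then have ne: "cball (0::complex) B \<noteq> {}" by auto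
  define h where "h x = closest_point (cball 0 B) (g x)" for x
  have h: "continuous_on UNIV h"
    unfolding h_def using g(1) ne
    by (intro continuous_on_compose2[OF continuous_on_closest_point[of "cball 0 B" UNIV]]) auto
  have hB: "cmod (h x) \<le> B" for x
    using closest_point_in_set[of "cball 0 B" "g x"] ne by (simp add: h_def)
  have hM: "h \<in> borel_measurable M"
    using borel_measurable_continuous_onI[OF h] sp by (simp cong: measurable_cong_sets)
  have le: "cmod (f x - h x) \<le> cmod (f x - g x)" for x
    using closest_point_lipschitz[of "cball (0::complex) B" "f x" "g x"] ne B[of x]
      closest_point_self[of "f x" "cball 0 B"] by (simp add: h_def dist_norm)
  have "bounded (range g)" using compact_continuous_image[OF g(1) c] by (rule compact_imp_bounded)
  then obtain B' where B': "\<And>x. cmod (g x) \<le> B'" by (auto simp: bounded_iff)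
  have "integrable M g" using gM B' by (intro integrable_const_bound[of _ B']) auto
  moreover have "integrable M h" using hM hB by (intro integrable_const_bound[of _ B]) auto
  ultimately have "(LINT x|M. cmod (f x - h x)) \<le> (LINT x|M. cmod (f x - g x))"
    using fi le by (intro integral_mono) auto
  then show thesis using that[OF h hB] g(2) by simp
qed

text \<open>\<open>\<sigma> v\<close> is the centre of the first set of a finite subcover that
  contains \<open>v\<close>. The order of the list makes the level sets Borel, being finite Boolean
  combinations of open sets.\<close>

lemma finite_borel_selection:
  fixes V :: "'a::topological_space \<Rightarrow> 'a set"
  assumes c: "compact (UNIV :: 'a set)" and V: "\<And>u. open (V u)" "\<And>u. u \<in> V u"
  obtains \<sigma> where "finite (range \<sigma>)" "\<And>u. \<sigma> -` {u} \<in> sets borel" "\<And>v. v \<in> V (\<sigma> v)"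
proof -
  obtain D where D: "finite D" "(UNIV :: 'a set) \<subseteq> (\<Union>u\<in>D. V u)"
  proof -
    have "(UNIV :: 'a set) \<subseteq> (\<Union>u\<in>UNIV. V u)" using V(2) by blast
    then show thesis using compactE_image[OF c, of UNIV V] V(1) that by metis
  qed
  obtain us where us: "set us = D" using D(1) finite_list by blast
  define \<sigma> where "\<sigma> v = the (find (\<lambda>u. v \<in> V u) us)" for v
  have find: "\<exists>u. find (\<lambda>u. v \<in> V u) us = Some u" for v
    using D(2) us by (metis UNIV_I UN_E find_None_iff not_Some_eq subsetD)
  have \<sigma>: "find (\<lambda>u. v \<in> V u) us = Some (\<sigma> v)" for v
    using find[of v] by (auto simp: \<sigma>_def)
  have \<sigma>V: "v \<in> V (\<sigma> v)" and \<sigma>D: "\<sigma> v \<in> D" for v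
    using \<sigma>[of v] us by (auto simp: find_Some_iff)
  have "{v. find (\<lambda>u. v \<in> V u) xs = Some u} \<in> sets borel" for u xs
  proof (induction xs)
    case (Cons x xs)
    have "{v. find (\<lambda>u. v \<in> V u) (x # xs) = Some u}
        = (if x = u then V x else {}) \<union> ({v. find (\<lambda>u. v \<in> V u) xs = Some u} - V x)"
      by auto
    then show ?case using Cons V(1) by auto
  qed simp
  moreover have "\<sigma> -` {u} = {v. find (\<lambda>u. v \<in> V u) us = Some u}" for u
    using \<sigma> by auto
  ultimately have "\<sigma> -` {u} \<in> sets borel" for u by simp
  moreover have "finite (range \<sigma>)" using \<sigma>D D(1) by (meson finite_subset image_subsetI)
  ultimately show thesis using that \<sigma>V by blast
qed

text \<open>The tube lemma over the compact first factor takes the place of uniform continuity, so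
  no uniform structure on the group has to be introduced.\<close>

lemma continuous_uniformly_in_parameter:
  fixes H :: "'a::t2_space \<times> 'b::topological_space \<Rightarrow> 'c::metric_space"
  assumes c: "compact (UNIV :: 'a set)" and H: "continuous_on UNIV H" and e: "e > 0"
  obtains V where "open V" "u \<in> V" "\<And>v t. v \<in> V \<Longrightarrow> dist (H (t, v)) (H (t, u)) < e"
proof -
  let ?W = "{x. dist (H x) (H (fst x, u)) < e}"
  have "continuous_on UNIV (\<lambda>x. dist (H x) (H (fst x, u)))"
  proof (intro continuous_on_dist H)
    show "continuous_on UNIV (\<lambda>x. H (fst x, u))"
      by (intro continuous_on_compose2[OF H] continuous_intros) auto
  qed
  then have "open ?W" by (rule open_Collect_less[OF _ continuous_on_const])
  moreover have "(UNIV :: 'a set) \<times> {u} \<subseteq> ?W" using e by auto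
  ultimately obtain U V where "open V" "UNIV \<subseteq> U" "u \<in> V" "U \<times> V \<subseteq> ?W"
    by (rule open_section_tube[OF _ c])
  moreover from this have "dist (H (t, v)) (H (t, u)) < e" if "v \<in> V" for v t
    using that by (auto dest!: subsetD[of "U \<times> V" _ "(t, v)"])
  ultimately show thesis using that[of V] by blast
qed

section \<open>Fubini for a complex and a positive measure\<close>

context
  fixes la :: "'a::t2_space set \<Rightarrow> complex" and q :: "'b::t2_space measure"
  assumes la: "countably_additive_c la" and reg: "inner_regular (var_measure la)" and q: "inner_regular q"
begin

lemma inner_regular_jordan_parts:
  "inner_regular (jordan_pos (\<lambda>B. Re (la B)))" "inner_regular (jordan_pos (\<lambda>B. - Re (la B)))"
  "inner_regular (jordan_pos (\<lambda>B. Im (la B)))" "inner_regular (jordan_pos (\<lambda>B. - Im (la B)))"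
  using jordan_pos_le_var_measure[OF la] by (auto intro!: inner_regular_dominated[OF reg])

lemma
  fixes H :: "'a \<times> 'b \<Rightarrow> complex"
  assumes H: "H \<in> borel_measurable borel" and B: "\<And>x. cmod (H x) \<le> B"
  shows borel_measurable_cintegral_section: "(\<lambda>t. cintegral la (\<lambda>s. H (s, t)) UNIV) \<in> borel_measurable borel"
    and cintegral_Fubini: "(LINT t|q. cintegral la (\<lambda>s. H (s, t)) UNIV) = cintegral la (\<lambda>s. LINT t|q. H (s, t)) UNIV"
proof -
  note m = inner_regular_jordan_parts[THEN borel_measurable_integral_section, OF q H B]
  note F = inner_regular_jordan_parts[THEN borel_Fubini, OF q H B]
  show "(\<lambda>t. cintegral la (\<lambda>s. H (s, t)) UNIV) \<in> borel_measurable borel"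
    unfolding cintegral_UNIV using m by measurable
  interpret q: finite_measure q using q by (rule inner_regularD)
  have i: "integrable q (\<lambda>t. LINT s|p. H (s, t))" if p: "inner_regular p" for p
  proof -
    interpret p: finite_measure p using p by (rule inner_regularD)
    have sp: "sets p = sets borel" "space p = UNIV" using inner_regularD[OF p] by auto
    have ip: "integrable p (\<lambda>s. H (s, t))" for t
      using borel_measurable_section[OF H] B sp
      by (auto intro!: p.integrable_const_bound[of _ B] cong: measurable_cong_sets)
    have "cmod (LINT s|p. H (s, t)) \<le> B * measure p UNIV" for t
    proof -
      have "cmod (LINT s|p. H (s, t)) \<le> (LINT s|p. cmod (H (s, t)))" by (rule integral_norm_bound)
      also have "\<dots> \<le> (LINT s|p. B)" using ip B by (intro integral_mono) auto
      finally show ?thesis using sp by (simp add: mult.commute)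
    qed
    then show ?thesis
      using borel_measurable_integral_section[OF p q H B] inner_regularD[OF q]
      by (intro q.integrable_const_bound[of _ "B * measure p UNIV"]) (auto cong: measurable_cong_sets)
  qed
  note iq = inner_regular_jordan_parts[THEN i]
  show "(LINT t|q. cintegral la (\<lambda>s. H (s, t)) UNIV) = cintegral la (\<lambda>s. LINT t|q. H (s, t)) UNIV"
    unfolding cintegral_UNIV using iq F by simp
qed

end

section \<open>Compact groups\<close>

text \<open>The class \<open>group_add\<close> is written additively but is not commutative:
  \<open>- s + t\<close> stands for the product of the inverse of \<open>s\<close> with
  \<open>t\<close>. The class has no topology, so continuity of the operations is assumed
  separately, and \<open>normalized_haar\<close> supplies left invariance only.\<close>

locale compact_group =
  fixes m :: "'g::{group_add,t2_space} measure"
  assumes compact_UNIV: "compact (UNIV :: 'g set)"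
    and continuous_add: "continuous_on UNIV (\<lambda>p::'g \<times> 'g. fst p + snd p)"
    and continuous_uminus: "continuous_on UNIV (uminus :: 'g \<Rightarrow> 'g)"
    and haar: "normalized_haar m"
begin

lemma sets_m [simp, measurable_cong]: "sets m = sets borel"
  using haar by (simp add: normalized_haar_def radon_measure_def)

lemma space_m [simp]: "space m = UNIV"
  using sets_eq_imp_space_eq[OF sets_m] by simp

lemma emeasure_UNIV: "emeasure m UNIV = 1"
  using haar by (simp add: normalized_haar_def)

lemma measure_UNIV: "measure m UNIV = 1"
  by (simp add: measure_def emeasure_UNIV)

sublocale finite_measure m
  by (rule finite_measureI) (simp add: emeasure_UNIV)

lemma inner_regular_m: "inner_regular m"
  using haar by (intro radon_measure_inner_regular[OF compact_UNIV]) (auto simp: normalized_haar_def intro: finite_measure_axioms)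

lemma borel_measurable_m: "borel_measurable m = borel_measurable borel"
  by (intro measurable_cong_sets) auto

lemma continuous_on_group_add:
  fixes f g :: "'a::topological_space \<Rightarrow> 'g"
  assumes "continuous_on S f" "continuous_on S g"
  shows "continuous_on S (\<lambda>x. f x + g x)"
  using continuous_on_compose2[OF continuous_add continuous_on_Pair[OF assms]] by simp

lemma continuous_on_group_minus:
  fixes f :: "'a::topological_space \<Rightarrow> 'g"
  assumes "continuous_on S f"
  shows "continuous_on S (\<lambda>x. - f x)"
  using continuous_on_compose2[OF continuous_uminus assms] by simp

lemma continuous_on_group_diff:
  fixes f g :: "'a::topological_space \<Rightarrow> 'g"
  assumes "continuous_on S f" "continuous_on S g"
  shows "continuous_on S (\<lambda>x. f x - g x)"
  using continuous_on_group_add[OF assms(1) continuous_on_group_minus[OF assms(2)]] by simp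

lemmas group_continuous = continuous_on_group_add continuous_on_group_minus continuous_on_group_diff
  continuous_on_fst continuous_on_snd continuous_on_const continuous_on_id

lemma measurable_translates:
  "(\<lambda>y::'g. x + y) \<in> measurable borel borel" "(\<lambda>y::'g. y + x) \<in> measurable borel borel"
  "(\<lambda>y::'g. y - x) \<in> measurable borel borel" "(\<lambda>y::'g. - y) \<in> measurable borel borel"
  "(\<lambda>y::'g. x - y) \<in> measurable borel borel"
  by (intro borel_measurable_continuous_onI group_continuous)+

lemma emeasure_left: "A \<in> sets borel \<Longrightarrow> emeasure m {y. x + y \<in> A} = emeasure m A"
proof -
  assume A: "A \<in> sets borel"
  have "{y. x + y \<in> A} = (\<lambda>y. - x + y) ` A"
    by (auto simp: image_iff) (metis add.assoc add_0 left_minus)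
  then show ?thesis using haar A by (simp add: normalized_haar_def)
qed

lemma distr_left: "distr m borel (\<lambda>y. x + y) = m"
proof (rule measure_eqI)
  fix A assume "A \<in> sets (distr m borel (\<lambda>y. x + y))"
  then show "emeasure (distr m borel (\<lambda>y. x + y)) A = emeasure m A"
    using measurable_translates(1)[of x] emeasure_left[of A x]
    by (simp add: emeasure_distr vimage_def)
qed simp

text \<open>Unimodularity: comparing \<open>m\<close> with its image \<open>n\<close> under inversion by integrating
  the indicator of \<open>t + s \<in> A\<close> in both orders.\<close>
lemma emeasure_uminus:
  assumes A: "A \<in> sets borel"
  shows "emeasure m {y. - y \<in> A} = emeasure m A"
proof -
  define n where "n = distr m borel uminus"
  have n: "inner_regular n"
    unfolding n_def by (rule inner_regular_homeo_image[OF inner_regular_m continuous_uminus continuous_uminus]) auto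
  have n_eq: "emeasure n B = emeasure m {y. - y \<in> B}" if "B \<in> sets borel" for B
    unfolding n_def using that measurable_translates(4) by (simp add: emeasure_distr vimage_def)
  have n1: "emeasure n UNIV = 1" by (simp add: n_eq emeasure_UNIV)
  let ?W = "{x::'g \<times> 'g. snd x + fst x \<in> A}"
  have W: "?W \<in> sets borel"
  proof -
    have "(\<lambda>x::'g \<times> 'g. snd x + fst x) \<in> measurable borel borel"
      by (intro borel_measurable_continuous_onI group_continuous)
    from measurable_sets[OF this A] show ?thesis by (simp add: vimage_def)
  qed
  have "(\<integral>\<^sup>+t. emeasure m {s. (s, t) \<in> ?W} \<partial>n) = (\<integral>\<^sup>+s. emeasure n {t. (s, t) \<in> ?W} \<partial>m)"
    by (rule nn_integral_section_eq[OF inner_regular_m n W])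
  moreover have "emeasure m {s. (s, t) \<in> ?W} = emeasure m A" for t
    using emeasure_left[OF A] by simp
  \<comment> \<open>Inversion turns left invariance of \<open>m\<close> into right invariance of
    \<open>n\<close>. With total masses 1, the two iterated integrals then reduce to
    \<open>emeasure m A\<close> and \<open>emeasure n A\<close>.\<close>
  moreover have "emeasure n {t. (s, t) \<in> ?W} = emeasure n A" for s
  proof -
    have B: "{t. t + s \<in> A} \<in> sets borel" "{y. - y \<in> A} \<in> sets borel"
      using measurable_sets[OF measurable_translates(2) A] measurable_sets[OF measurable_translates(4) A]
      by (auto simp: vimage_def)
    have "emeasure n {t. t + s \<in> A} = emeasure m {y. - y + s \<in> A}" using n_eq[OF B(1)] by simp
    also have "{y. - y + s \<in> A} = {y. (- s) + y \<in> {y. - y \<in> A}}" by (simp add: minus_add)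
    also have "emeasure m \<dots> = emeasure m {y. - y \<in> A}" by (rule emeasure_left[OF B(2)])
    finally show ?thesis using n_eq[OF A] by simp
  qed
  ultimately have "emeasure n A = emeasure m A"
    using inner_regularD[OF n] n1 emeasure_UNIV by simp
  then show ?thesis by (simp add: n_eq[OF A])
qed

text \<open>A right translation is a left translation conjugated by inversion, and both preserve
  \<open>m\<close>. Right invariance is needed because the pairing below translates its functions on
  the right.\<close>

lemma emeasure_right:
  assumes A: "A \<in> sets borel"
  shows "emeasure m {y. y + x \<in> A} = emeasure m A"
proof -
  have B: "{t. t + x \<in> A} \<in> sets borel" "{y. - y \<in> A} \<in> sets borel"
    using measurable_sets[OF measurable_translates(2) A] measurable_sets[OF measurable_translates(4) A]
    by (auto simp: vimage_def)
  have "emeasure m {y. y + x \<in> A} = emeasure m {y. - y \<in> {y. y + x \<in> A}}"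
    by (rule emeasure_uminus[OF B(1), symmetric])
  also have "{y. - y \<in> {y. y + x \<in> A}} = {y. (- x) + y \<in> {y. - y \<in> A}}" by (simp add: minus_add)
  also have "emeasure m \<dots> = emeasure m A"
    using emeasure_left[OF B(2)] emeasure_uminus[OF A] by simp
  finally show ?thesis .
qed

lemma distr_right: "distr m borel (\<lambda>y. y + x) = m"
proof (rule measure_eqI)
  fix A assume "A \<in> sets (distr m borel (\<lambda>y. y + x))"
  then show "emeasure (distr m borel (\<lambda>y. y + x)) A = emeasure m A"
    using measurable_translates(2)[of x] emeasure_right[of A x]
    by (simp add: emeasure_distr vimage_def)
qed simp

lemma nn_integral_right:
  assumes "h \<in> borel_measurable borel"
  shows "(\<integral>\<^sup>+t. h (t + u) \<partial>m) = (\<integral>\<^sup>+t. h t \<partial>m)"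
  using nn_integral_distr[of "\<lambda>y. y + u" m borel h] measurable_translates(2)[of u] assms
  by (simp add: distr_right)

lemma integral_right:
  fixes h :: "'g \<Rightarrow> 'b::{banach, second_countable_topology}"
  assumes "h \<in> borel_measurable borel"
  shows "(LINT t|m. h (t + u)) = (LINT t|m. h t)"
  using integral_distr[of "\<lambda>y. y + u" m borel h] measurable_translates(2)[of u] assms
  by (simp add: distr_right)

lemma integral_left:
  fixes h :: "'g \<Rightarrow> 'b::{banach, second_countable_topology}"
  assumes "h \<in> borel_measurable borel"
  shows "(LINT t|m. h (s + t)) = (LINT t|m. h t)"
  using integral_distr[of "\<lambda>y. s + y" m borel h] measurable_translates(1)[of s] assms
  by (simp add: distr_left)

end

section \<open>Orlicz spaces\<close>

locale orlicz = finite_measure m for m :: "'a measure" +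
  fixes Phi :: "real \<Rightarrow> real"
  assumes measure_space_1: "measure m (space m) = 1"
    and young: "young_function Phi"
begin

lemma Phi_0 [simp]: "Phi 0 = 0" and Phi_nonneg: "x \<ge> 0 \<Longrightarrow> Phi x \<ge> 0"
  using young by (auto simp: young_function_def)

lemma Phi_scale: "0 \<le> c \<Longrightarrow> c \<le> 1 \<Longrightarrow> 0 \<le> x \<Longrightarrow> Phi (c * x) \<le> c * Phi x"
proof -
  assume c: "0 \<le> c" "c \<le> 1" "0 \<le> x"
  have "convex_on {0..} Phi" using young by (simp add: young_function_def)
  from convex_onD[OF this c(1,2), of 0 x] c(3) show ?thesis by simp
qed

lemma Phi_mono: "0 \<le> x \<Longrightarrow> x \<le> y \<Longrightarrow> Phi x \<le> Phi y"
proof (cases "y = 0")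
  case False
  assume xy: "0 \<le> x" "x \<le> y"
  then have "Phi (x / y * y) \<le> x / y * Phi y" using False by (intro Phi_scale) auto
  also have "\<dots> \<le> 1 * Phi y" using xy False by (intro mult_right_mono Phi_nonneg) auto
  finally show ?thesis using False by simp
qed auto

lemma Phi_convex:
  "0 \<le> u \<Longrightarrow> 0 \<le> v \<Longrightarrow> u + v = 1 \<Longrightarrow> 0 \<le> x \<Longrightarrow> 0 \<le> y \<Longrightarrow> Phi (u * x + v * y) \<le> u * Phi x + v * Phi y"
proof -
  assume uv: "0 \<le> u" "0 \<le> v" "u + v = 1" "0 \<le> x" "0 \<le> y"
  then have u: "u = 1 - v" by simp
  have "convex_on {0..} Phi" using young by (simp add: young_function_def)
  from convex_onD[OF this, of v x y] uv(1,2,4,5) show ?thesis by (simp add: u)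
qed

lemma Phi_measurable:
  assumes "f \<in> borel_measurable N" and that: "k \<ge> 0"
  shows "(\<lambda>x. Phi (cmod (f x) / k)) \<in> borel_measurable N"
proof -
  have "mono (\<lambda>x. Phi (max 0 x))" by (intro monoI Phi_mono) auto
  then have "(\<lambda>x. Phi (max 0 x)) \<in> borel_measurable borel" by (rule borel_measurable_mono)
  then have "(\<lambda>x. Phi (max 0 (cmod (f x) / k))) \<in> borel_measurable N" using assms by measurable
  moreover have "max 0 (cmod (f x) / k) = cmod (f x) / k" for x using that by (simp add: max_def)
  ultimately show ?thesis by simp
qed

text \<open>Convexity and \<open>Phi 0 = 0\<close> bound the value at \<open>1 / (1 + Phi 1)\<close>
  by \<open>Phi 1 / (1 + Phi 1)\<close>. This point yields the constants that compare bounded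
  functions, Luxemburg norm and \<open>L1\<close> norm.\<close>

lemma Phi_small: obtains y where "y > 0" "Phi y \<le> 1"
proof -
  have "Phi (1 / (1 + Phi 1) * 1) \<le> 1 / (1 + Phi 1) * Phi 1"
    using Phi_nonneg[of 1] by (intro Phi_scale) auto
  also have "\<dots> \<le> 1" using Phi_nonneg[of 1] by (simp add: divide_simps)
  finally show thesis using Phi_nonneg[of 1] by (intro that[of "1 / (1 + Phi 1)"]) auto
qed

definition modular :: "('a \<Rightarrow> complex) \<Rightarrow> real \<Rightarrow> ennreal" where
  "modular f k = (\<integral>\<^sup>+x. ennreal (Phi (cmod (f x) / k)) \<partial>m)"

abbreviation L where "L \<equiv> orlicz_space Phi m"
abbreviation lux where "lux \<equiv> lux_norm Phi m"

lemma L_iff: "f \<in> L \<longleftrightarrow> f \<in> borel_measurable m \<and> (\<exists>k>0. modular f k \<le> 1)"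
  by (simp add: orlicz_space_def modular_def)

lemma L_measurable: "f \<in> L \<Longrightarrow> f \<in> borel_measurable m"
  by (simp add: L_iff)

lemma lux_eq: "lux f = Inf {k. k > 0 \<and> modular f k \<le> 1}"
  by (simp add: lux_norm_def modular_def)

lemma lux_le: "k > 0 \<Longrightarrow> modular f k \<le> 1 \<Longrightarrow> lux f \<le> k"
  unfolding lux_eq by (rule cInf_lower) (auto intro!: bdd_belowI[of _ 0])

lemma lux_nonneg: "f \<in> L \<Longrightarrow> lux f \<ge> 0"
  unfolding lux_eq L_iff by (intro cInf_greatest) auto

lemma modular_mono: "0 < k \<Longrightarrow> k \<le> l \<Longrightarrow> modular f l \<le> modular f k"
  unfolding modular_def
  by (intro nn_integral_mono ennreal_leI Phi_mono divide_left_mono divide_nonneg_nonneg mult_pos_pos) auto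

lemma lux_less: "f \<in> L \<Longrightarrow> lux f < k \<Longrightarrow> modular f k \<le> 1"
proof -
  assume f: "f \<in> L" "lux f < k"
  then obtain l where "l > 0" "modular f l \<le> 1" "l < k"
    unfolding lux_eq L_iff by (subst (asm) cInf_less_iff) (auto intro!: bdd_belowI[of _ 0])
  then show ?thesis using modular_mono[of l k f] by (meson less_imp_le order_trans)
qed

lemma lux_leI: "f \<in> L \<Longrightarrow> (\<And>k. k > c \<Longrightarrow> k > 0 \<Longrightarrow> modular f k \<le> 1) \<Longrightarrow> c \<ge> 0 \<Longrightarrow> lux f \<le> c"
proof (rule field_le_epsilon)
  fix e :: real assume *: "\<And>k. k > c \<Longrightarrow> k > 0 \<Longrightarrow> modular f k \<le> 1" "c \<ge> 0" "e > 0"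
  then show "lux f \<le> c + e" by (intro lux_le *(1)) auto
qed

text \<open>\<open>(f + g) / (k + l)\<close> is the convex combination of \<open>f / k\<close> and
  \<open>g / l\<close> with weights \<open>k / (k + l)\<close> and \<open>l / (k + l)\<close>;
  convexity of \<open>Phi\<close> then yields the triangle inequality for the norm.\<close>

lemma modular_add:
  assumes "f \<in> borel_measurable m" "g \<in> borel_measurable m" "k > 0" "l > 0" "modular f k \<le> 1" "modular g l \<le> 1"
  shows "modular (\<lambda>x. f x + g x) (k + l) \<le> 1"
proof -
  have k: "k / (k + l) + l / (k + l) = 1" "0 \<le> k / (k + l)" "0 \<le> l / (k + l)"
    using assms by (auto simp: add_divide_distrib[symmetric])
  have "Phi (cmod (f x + g x) / (k + l)) \<le> k / (k + l) * Phi (cmod (f x) / k) + l / (k + l) * Phi (cmod (g x) / l)" for x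
  proof -
    have "Phi (cmod (f x + g x) / (k + l)) \<le> Phi (k / (k + l) * (cmod (f x) / k) + l / (k + l) * (cmod (g x) / l))"
      using assms norm_triangle_ineq[of "f x" "g x"] by (intro Phi_mono) (auto simp: divide_simps)
    also have "\<dots> \<le> k / (k + l) * Phi (cmod (f x) / k) + l / (k + l) * Phi (cmod (g x) / l)"
      using k assms by (intro Phi_convex) auto
    finally show ?thesis .
  qed
  then have "modular (\<lambda>x. f x + g x) (k + l)
     \<le> (\<integral>\<^sup>+x. ennreal (k / (k + l)) * ennreal (Phi (cmod (f x) / k)) + ennreal (l / (k + l)) * ennreal (Phi (cmod (g x) / l)) \<partial>m)"
    unfolding modular_def using assms
    by (intro nn_integral_mono) (auto simp: ennreal_mult[symmetric] ennreal_plus[symmetric] Phi_nonneg simp del: ennreal_plus intro!: ennreal_leI)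
  also have "\<dots> = ennreal (k / (k + l)) * modular f k + ennreal (l / (k + l)) * modular g l"
  proof -
    have "(\<lambda>x. ennreal (Phi (cmod (f x) / k))) \<in> borel_measurable m" "(\<lambda>x. ennreal (Phi (cmod (g x) / l))) \<in> borel_measurable m"
      using Phi_measurable[of f m k] Phi_measurable[of g m l] assms by auto
    then show ?thesis unfolding modular_def by (simp add: nn_integral_add nn_integral_cmult)
  qed
  also have "\<dots> \<le> ennreal (k / (k + l)) * 1 + ennreal (l / (k + l)) * 1"
    using assms by (intro add_mono mult_left_mono) auto
  also have "\<dots> = 1" using k by (simp add: ennreal_plus[symmetric] del: ennreal_plus)
  finally show ?thesis .
qed

lemma L_add: "f \<in> L \<Longrightarrow> g \<in> L \<Longrightarrow> (\<lambda>x. f x + g x) \<in> L"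
proof -
  assume "f \<in> L" "g \<in> L"
  then obtain k l where kl: "k > 0" "modular f k \<le> 1" "l > 0" "modular g l \<le> 1"
    and meas: "f \<in> borel_measurable m" "g \<in> borel_measurable m"
    unfolding L_iff by blast
  have "modular (\<lambda>x. f x + g x) (k + l) \<le> 1" using modular_add[OF meas kl(1,3,2,4)] .
  moreover have "k + l > 0" using kl by simp
  ultimately show ?thesis unfolding L_iff using meas by auto
qed

lemma lux_add: "f \<in> L \<Longrightarrow> g \<in> L \<Longrightarrow> lux (\<lambda>x. f x + g x) \<le> lux f + lux g"
proof (rule field_le_epsilon)
  fix e :: real assume fg: "f \<in> L" "g \<in> L" and e: "e > 0"
  have "modular f (lux f + e/2) \<le> 1" "modular g (lux g + e/2) \<le> 1"
    using fg e by (auto intro!: lux_less)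
  then have "modular (\<lambda>x. f x + g x) ((lux f + e/2) + (lux g + e/2)) \<le> 1"
    using fg e lux_nonneg[OF fg(1)] lux_nonneg[OF fg(2)] by (intro modular_add) (auto simp: L_measurable)
  then have "lux (\<lambda>x. f x + g x) \<le> (lux f + e/2) + (lux g + e/2)"
    using e lux_nonneg[OF fg(1)] lux_nonneg[OF fg(2)] by (intro lux_le) auto
  then show "lux (\<lambda>x. f x + g x) \<le> lux f + lux g + e" by simp
qed

lemma modular_mono_fun:
  assumes "AE x in m. cmod (g x) \<le> cmod (f x)" "k > 0"
  shows "modular g k \<le> modular f k"
  unfolding modular_def
proof (rule nn_integral_mono_AE)
  show "AE x in m. ennreal (Phi (cmod (g x) / k)) \<le> ennreal (Phi (cmod (f x) / k))"
    using assms(1)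
  proof eventually_elim
    case (elim x)
    then show ?case using assms(2) by (intro ennreal_leI Phi_mono divide_right_mono) auto
  qed
qed

lemma
  assumes "f \<in> L" "g \<in> borel_measurable m" "AE x in m. cmod (g x) \<le> cmod (f x)"
  shows L_mono: "g \<in> L" and lux_mono: "lux g \<le> lux f"
proof -
  show g: "g \<in> L"
    using assms modular_mono_fun[OF assms(3)] unfolding L_iff by (meson order_trans)
  have "modular g k \<le> 1" if "k > lux f" "k > 0" for k
    using lux_less[OF assms(1) that(1)] modular_mono_fun[OF assms(3) that(2)] by simp
  then show "lux g \<le> lux f"
    using g lux_nonneg[OF assms(1)] by (intro lux_leI) auto
qed

lemma lux_cong_AE:
  assumes "f \<in> L" "g \<in> borel_measurable m" "AE x in m. g x = f x"
  shows "g \<in> L" "lux g = lux f"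
proof -
  have "AE x in m. cmod (g x) \<le> cmod (f x)" "AE x in m. cmod (f x) \<le> cmod (g x)" using assms(3) by auto
  then show "g \<in> L" "lux g = lux f"
    using L_mono[OF assms(1,2)] lux_mono[OF assms(1,2)] lux_mono[of g f] assms L_measurable
    by (auto intro!: antisym)
qed

lemma modular_cmult: "c \<noteq> 0 \<Longrightarrow> modular (\<lambda>x. c * f x) (cmod c * k) = modular f k"
  by (simp add: modular_def norm_mult)

lemma modular_zero: "modular (\<lambda>x. 0) k = 0"
  by (simp add: modular_def)

lemma zero_L: "(\<lambda>x. 0) \<in> L"
  by (auto simp: L_iff modular_zero intro!: exI[of _ 1])

lemma lux_zero: "lux (\<lambda>x. 0) = 0"
  using lux_leI[OF zero_L, of 0] lux_nonneg[OF zero_L] by (simp add: modular_zero)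

lemma L_cmult: "f \<in> L \<Longrightarrow> (\<lambda>x. c * f x) \<in> L"
proof (cases "c = 0")
  case False
  assume "f \<in> L"
  then obtain k where "k > 0" "modular f k \<le> 1" "f \<in> borel_measurable m" by (auto simp: L_iff)
  then show ?thesis unfolding L_iff using False modular_cmult[OF False, of f k]
    by (intro conjI exI[of _ "cmod c * k"]) auto
qed (simp add: zero_L)

lemma lux_cmult_le: "f \<in> L \<Longrightarrow> lux (\<lambda>x. c * f x) \<le> cmod c * lux f"
proof (cases "c = 0")
  case False
  assume f: "f \<in> L"
  show ?thesis
  proof (rule lux_leI[OF L_cmult[OF f]])
    fix k assume k: "k > cmod c * lux f" "k > 0"
    then have "lux f < k / cmod c" using False by (simp add: field_simps)
    then have "modular f (k / cmod c) \<le> 1" by (rule lux_less[OF f])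
    then show "modular (\<lambda>x. c * f x) k \<le> 1" using modular_cmult[OF False, of f "k / cmod c"] False by simp
  qed (use lux_nonneg[OF f] in auto)
qed (simp add: lux_zero)

lemma lux_cmult: "f \<in> L \<Longrightarrow> lux (\<lambda>x. c * f x) = cmod c * lux f"
proof (cases "c = 0")
  case False
  assume f: "f \<in> L"
  have "lux (\<lambda>x. inverse c * (c * f x)) \<le> cmod (inverse c) * lux (\<lambda>x. c * f x)"
    by (rule lux_cmult_le[OF L_cmult[OF f]])
  moreover have "(\<lambda>x. inverse c * (c * f x)) = f" using False by auto
  ultimately have "lux f \<le> inverse (cmod c) * lux (\<lambda>x. c * f x)"
    by (simp add: norm_inverse)
  moreover have "cmod c > 0" using False by simp
  ultimately have "cmod c * lux f \<le> lux (\<lambda>x. c * f x)"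
    by (simp add: field_simps)
  then show ?thesis using lux_cmult_le[OF f, of c] by simp
qed (simp add: lux_zero)

lemma L_diff: "f \<in> L \<Longrightarrow> g \<in> L \<Longrightarrow> (\<lambda>x. f x - g x) \<in> L"
  using L_add[of f "\<lambda>x. -1 * g x"] L_cmult[of g "-1"] by simp

lemma lux_minus: "g \<in> L \<Longrightarrow> lux (\<lambda>x. - g x) = lux g"
  using lux_cmult[of g "-1"] by simp

lemma lux_diff_commute: "f \<in> L \<Longrightarrow> g \<in> L \<Longrightarrow> lux (\<lambda>x. f x - g x) = lux (\<lambda>x. g x - f x)"
proof -
  assume "f \<in> L" "g \<in> L"
  then have "lux (\<lambda>x. - (g x - f x)) = lux (\<lambda>x. g x - f x)" by (intro lux_minus L_diff)
  then show ?thesis by (simp only: minus_diff_eq)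
qed

lemma lux_diff_triangle:
  assumes "f \<in> L" "g \<in> L" "h \<in> L"
  shows "lux (\<lambda>x. f x - h x) \<le> lux (\<lambda>x. f x - g x) + lux (\<lambda>x. g x - h x)"
  using lux_add[OF L_diff[OF assms(1,2)] L_diff[OF assms(2,3)]] by simp

lemma lux_triangle_sub:
  assumes "f \<in> L" "g \<in> L"
  shows "lux f \<le> lux g + lux (\<lambda>x. f x - g x)"
  using lux_add[OF assms(2) L_diff[OF assms]] by simp

lemma
  assumes "finite I" "\<And>i. i \<in> I \<Longrightarrow> f i \<in> L"
  shows L_sum: "(\<lambda>x. \<Sum>i\<in>I. c i * f i x) \<in> L"
    and lux_sum: "lux (\<lambda>x. \<Sum>i\<in>I. c i * f i x) \<le> (\<Sum>i\<in>I. cmod (c i) * lux (f i))"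
proof -
  have "(\<lambda>x. \<Sum>i\<in>I. c i * f i x) \<in> L \<and> lux (\<lambda>x. \<Sum>i\<in>I. c i * f i x) \<le> (\<Sum>i\<in>I. cmod (c i) * lux (f i))"
    using assms
  proof (induction I)
    case empty
    show ?case by (simp add: zero_L lux_zero)
  next
    case (insert i I)
    have f: "f i \<in> L" "(\<lambda>x. \<Sum>i\<in>I. c i * f i x) \<in> L"
      "lux (\<lambda>x. \<Sum>i\<in>I. c i * f i x) \<le> (\<Sum>i\<in>I. cmod (c i) * lux (f i))"
      using insert.IH insert.prems by simp_all
    have "lux (\<lambda>x. c i * f i x + (\<Sum>i\<in>I. c i * f i x)) \<le> cmod (c i) * lux (f i) + (\<Sum>i\<in>I. cmod (c i) * lux (f i))"
      using lux_add[OF L_cmult[OF f(1), of "c i"] f(2)] lux_cmult_le[OF f(1), of "c i"] f(3) by linarith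
    then show ?case using insert.hyps L_add[OF L_cmult[OF f(1), of "c i"] f(2)] by simp
  qed
  then show "(\<lambda>x. \<Sum>i\<in>I. c i * f i x) \<in> L" "lux (\<lambda>x. \<Sum>i\<in>I. c i * f i x) \<le> (\<Sum>i\<in>I. cmod (c i) * lux (f i))"
    by auto
qed

lemma modular_bounded:
  assumes "\<And>x. x \<in> space m \<Longrightarrow> cmod (f x) \<le> B" "k > 0" "Phi (B / k) \<le> 1"
  shows "modular f k \<le> 1"
proof -
  have "modular f k \<le> (\<integral>\<^sup>+x. ennreal (Phi (B / k)) \<partial>m)"
    unfolding modular_def using assms
    by (intro nn_integral_mono ennreal_leI Phi_mono divide_right_mono) auto
  also have "\<dots> = ennreal (Phi (B / k))"
    using measure_space_1 by (simp add: emeasure_eq_measure)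
  finally show ?thesis using assms(3) by (auto intro: order_trans simp: ennreal_le_1)
qed

text \<open>The constant is \<open>1 / y\<close> with \<open>Phi y \<le> 1\<close>: dividing by
  \<open>B / y\<close> brings the values below \<open>y\<close>, and the total mass is 1.\<close>

lemma bounded_L:
  obtains c where "c > 0"
    "\<forall>f B. f \<in> borel_measurable m \<longrightarrow> (\<forall>x\<in>space m. cmod (f x) \<le> B) \<longrightarrow> f \<in> L \<and> lux f \<le> c * B"
proof -
  obtain y where y: "y > 0" "Phi y \<le> 1" by (rule Phi_small)
  have "f \<in> L \<and> lux f \<le> 1 / y * B" if f: "f \<in> borel_measurable m" "\<And>x. x \<in> space m \<Longrightarrow> cmod (f x) \<le> B" for f B
  proof -
    have ne: "space m \<noteq> {}" using measure_space_1 by auto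
    then have B0: "B \<ge> 0" using f(2) norm_ge_zero order_trans by blast
    have *: "modular f k \<le> 1" if k: "k > 0" "k \<ge> B / y" for k
    proof (rule modular_bounded[OF f(2) k(1)])
      have "B / k \<le> y" using k y by (simp add: field_simps)
      then show "Phi (B / k) \<le> 1" using Phi_mono[of "B / k" y] B0 k y by auto
    qed
    have "modular f (B / y + 1) \<le> 1" using B0 y by (intro *) (auto intro: add_nonneg_pos)
    moreover have "B / y + 1 > 0" using B0 y by (intro add_nonneg_pos) auto
    ultimately have fL: "f \<in> L" using f(1) by (auto simp: L_iff)
    have "lux f \<le> B / y"
    proof (rule lux_leI[OF fL])
      show "modular f k \<le> 1" if "k > B / y" "k > 0" for k using that by (intro *) auto
    qed (use B0 y in auto)
    with fL show ?thesis by simp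
  qed
  then show thesis using that[of "1 / y"] y(1) by auto
qed

lemma bounded_in_L: "f \<in> borel_measurable m \<Longrightarrow> (\<And>x. x \<in> space m \<Longrightarrow> cmod (f x) \<le> B) \<Longrightarrow> f \<in> L"
proof -
  assume f: "f \<in> borel_measurable m" "\<And>x. x \<in> space m \<Longrightarrow> cmod (f x) \<le> B"
  then show ?thesis using bounded_L by metis
qed

text \<open>For values bounded by \<open>B\<close>, convexity along the ray from 0 gives
  \<open>Phi (t / e) \<le> t / (B + 1) * Phi ((B + 1) / e)\<close>, so the modular at scale
  \<open>e\<close> is linear in the \<open>L1\<close> norm. Writing \<open>B + 1\<close> avoids a
  division by zero.\<close>

lemma lux_small_of_L1_small:
  assumes "B \<ge> 0" "e > 0"
  obtains d where "d > 0" "\<forall>f. f \<in> borel_measurable m \<longrightarrow> (\<forall>x\<in>space m. cmod (f x) \<le> B) \<longrightarrow>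
      (LINT x|m. cmod (f x)) < d \<longrightarrow> lux f \<le> e"
proof (rule that; (intro allI impI)?)
  define P where "P = Phi ((B + 1) / e)"
  have P: "P \<ge> 0" using assms by (auto simp: P_def intro!: Phi_nonneg)
  show "(B + 1) / (P + 1) > 0" using P assms by auto
  fix f assume f: "f \<in> borel_measurable m" "\<forall>x\<in>space m. cmod (f x) \<le> B"
    "(LINT x|m. cmod (f x)) < (B + 1) / (P + 1)"
  have fi: "integrable m f" using f by (intro integrable_const_bound[of _ B]) auto
  have "modular f e \<le> (\<integral>\<^sup>+x. ennreal (P / (B + 1) * cmod (f x)) \<partial>m)"
    unfolding modular_def
  proof (intro nn_integral_mono ennreal_leI)
    fix x assume x: "x \<in> space m"
    have "Phi (cmod (f x) / (B + 1) * ((B + 1) / e)) \<le> cmod (f x) / (B + 1) * P"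
      unfolding P_def using f(2) x assms by (intro Phi_scale) auto
    moreover have "B + 1 \<noteq> 0" using assms by auto
    then have "cmod (f x) / (B + 1) * ((B + 1) / e) = cmod (f x) / e" by simp
    ultimately show "Phi (cmod (f x) / e) \<le> P / (B + 1) * cmod (f x)" by (simp add: mult.commute)
  qed
  also have "\<dots> = ennreal (P / (B + 1) * (LINT x|m. cmod (f x)))"
    using fi P assms by (subst nn_integral_eq_integral) auto
  also have "\<dots> \<le> ennreal 1"
  proof (rule ennreal_leI)
    have "P / (B + 1) * (LINT x|m. cmod (f x)) \<le> P / (B + 1) * ((B + 1) / (P + 1))"
      using f(3) P assms(1) by (intro mult_left_mono less_imp_le[OF f(3)] divide_nonneg_nonneg) auto
    also have "\<dots> = P / (P + 1)" using assms(1) by simp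
    also have "\<dots> \<le> 1" using P by simp
    finally show "P / (B + 1) * (LINT x|m. cmod (f x)) \<le> 1" .
  qed
  finally show "lux f \<le> e" using assms(2) by (intro lux_le) auto
qed

lemma lux_bounded_convergence:
  assumes f: "\<And>n. f n \<in> borel_measurable m" "\<And>n x. x \<in> space m \<Longrightarrow> cmod (f n x) \<le> B"
    and lim: "\<And>x. x \<in> space m \<Longrightarrow> (\<lambda>n. f n x) \<longlonglongrightarrow> 0"
  shows "(\<lambda>n. lux (f n)) \<longlonglongrightarrow> 0"
proof (rule LIMSEQ_I)
  fix e :: real assume e: "e > 0"
  have ne: "space m \<noteq> {}" using measure_space_1 by auto
  then have B0: "B \<ge> 0" using f(2) norm_ge_zero order_trans by blast
  obtain d where d: "d > 0" "\<forall>f. f \<in> borel_measurable m \<longrightarrow> (\<forall>x\<in>space m. cmod (f x) \<le> B) \<longrightarrow>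
      (LINT x|m. cmod (f x)) < d \<longrightarrow> lux f \<le> e / 2"
    by (rule lux_small_of_L1_small[OF B0 half_gt_zero[OF e]])
  have "(\<lambda>n. LINT x|m. cmod (f n x)) \<longlonglongrightarrow> (LINT x|m. 0)"
    using f lim by (intro integral_dominated_convergence[where w="\<lambda>_. B"]) (auto intro!: AE_I2 tendsto_norm_zero)
  then have "\<forall>\<^sub>F n in sequentially. (LINT x|m. cmod (f n x)) < d"
    using d(1) by (intro order_tendstoD(2)) auto
  then obtain N where "\<And>n. n \<ge> N \<Longrightarrow> (LINT x|m. cmod (f n x)) < d" by (auto simp: eventually_sequentially)
  then have le: "lux (f n) \<le> e / 2" if "n \<ge> N" for n using d(2) f that by auto
  have "lux (f n) \<ge> 0" for n using bounded_in_L[OF f] by (intro lux_nonneg) auto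
  then have "norm (lux (f n) - 0) < e" if "n \<ge> N" for n using le[OF that] e by simp
  then show "\<exists>N. \<forall>n\<ge>N. norm (lux (f n) - 0) < e" by blast
qed

end

text \<open>An interior point has a supporting line. If its slope is negative, evaluating at 0
  forces \<open>Phi a = 0\<close>, and slope 0 works since \<open>Phi\<close> is nonnegative; slope
  0 also serves at the boundary point \<open>a = 0\<close>.\<close>

lemma convex_subgradient_exists:
  assumes "young_function Phi" "a \<ge> 0"
  obtains b where "b \<ge> 0" "\<And>x. x \<ge> 0 \<Longrightarrow> Phi x \<ge> Phi a + b * (x - a)"
proof (cases "a = 0")
  case True
  then show thesis using assms that[of 0] by (auto simp: young_function_def)
next
  case False
  have cv: "convex_on {0..} Phi" and nn: "\<And>x. x \<ge> 0 \<Longrightarrow> Phi x \<ge> 0" and 0: "Phi 0 = 0"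
    using assms by (auto simp: young_function_def)
  have "a \<in> interior {0..}" using assms False by (simp add: interior_real_atLeast)
  then obtain b where b: "\<And>x. x \<ge> 0 \<Longrightarrow> Phi x \<ge> Phi a + b * (x - a)"
    using convex_le_Inf_differential[OF cv] by (metis atLeast_iff)
  show thesis
  proof (cases "b \<ge> 0")
    case True
    then show thesis using b that by blast
  next
    case False
    have "Phi 0 \<ge> Phi a + b * (0 - a)" using b[of 0] by simp
    moreover have "b * (0 - a) \<ge> 0" using False assms(2) by (simp add: mult_nonpos_nonneg)
    ultimately have "Phi a = 0" using nn[OF assms(2)] 0 by linarith
    then show thesis using that[of 0] nn by auto
  qed
qed

section \<open>Complementary Young functions: Hoelder's inequality and norming tests\<close>

locale orlicz_pair = orlicz m Phi for m :: "'a measure" and Phi :: "real \<Rightarrow> real" +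
  fixes Psi :: "real \<Rightarrow> real"
  assumes young_Psi: "young_function Psi" and complementary: "complementary_young Phi Psi"
begin

sublocale Psi: orlicz m Psi
  by unfold_locales (rule measure_space_1, rule young_Psi)

lemma Young_inequality: "0 \<le> x \<Longrightarrow> 0 \<le> y \<Longrightarrow> x * y \<le> Phi x + Psi y"
proof -
  assume x: "0 \<le> x" and y: "0 \<le> y"
  have "ereal (x * y - Phi x) \<le> young_conj Phi y"
    unfolding young_conj_def using x by (intro SUP_upper) auto
  then have "x * y - Phi x \<le> Psi y" using complementary y by (simp add: complementary_young_def)
  then show ?thesis by simp
qed

text \<open>Plays the role of the derivative of \<open>Phi\<close>. Any choice of subgradients is
  monotone, hence Borel measurable, so an arbitrary selection does no harm.\<close>

definition subgrad :: "real \<Rightarrow> real" where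
  "subgrad a = (SOME b. b \<ge> 0 \<and> (\<forall>x\<ge>0. Phi x \<ge> Phi a + b * (x - a)))"

lemma subgrad: assumes "a \<ge> 0"
  shows "subgrad a \<ge> 0" "x \<ge> 0 \<Longrightarrow> Phi x \<ge> Phi a + subgrad a * (x - a)"
proof -
  have "\<exists>b. b \<ge> 0 \<and> (\<forall>x\<ge>0. Phi x \<ge> Phi a + b * (x - a))"
    using convex_subgradient_exists[OF young assms] by metis
  from someI_ex[OF this] show "subgrad a \<ge> 0" "x \<ge> 0 \<Longrightarrow> Phi x \<ge> Phi a + subgrad a * (x - a)"
    unfolding subgrad_def by auto
qed

lemma subgrad_mono: "0 \<le> a \<Longrightarrow> a \<le> b \<Longrightarrow> subgrad a \<le> subgrad b"
proof (cases "a = b")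
  case False
  assume ab: "0 \<le> a" "a \<le> b"
  then have "Phi b \<ge> Phi a + subgrad a * (b - a)" "Phi a \<ge> Phi b + subgrad b * (a - b)"
    using subgrad(2)[of a b] subgrad(2)[of b a] by auto
  then have "subgrad a * (b - a) \<le> subgrad b * (b - a)" by (simp add: algebra_simps)
  then show ?thesis using False ab by simp
qed simp

text \<open>The subgradient inequality says precisely that the supremum defining the conjugate at
  \<open>subgrad a\<close> is attained at \<open>a\<close>.\<close>

lemma Young_equality: "a \<ge> 0 \<Longrightarrow> a * subgrad a = Phi a + Psi (subgrad a)"
proof (rule antisym)
  assume a: "a \<ge> 0"
  show "a * subgrad a \<le> Phi a + Psi (subgrad a)" using a subgrad by (intro Young_inequality) auto
  have "young_conj Phi (subgrad a) \<le> ereal (a * subgrad a - Phi a)"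
    unfolding young_conj_def
  proof (rule SUP_least)
    fix x :: real assume "x \<in> {0..}"
    then show "ereal (x * subgrad a - Phi x) \<le> ereal (a * subgrad a - Phi a)"
      using subgrad(2)[OF a, of x] by (simp add: algebra_simps)
  qed
  then show "Phi a + Psi (subgrad a) \<le> a * subgrad a"
    using complementary subgrad(1)[OF a] by (simp add: complementary_young_def)
qed

text \<open>Young's inequality is applied to \<open>cmod (f x) / k\<close> and
  \<open>cmod (w x)\<close> with \<open>k\<close> slightly above the norm; the factor 2 is the sum
  of two modulars that are at most 1.\<close>

lemma Hoelder:
  assumes f: "f \<in> L" and w: "w \<in> borel_measurable m" "Psi.modular w 1 \<le> 1"
  shows "integrable m (\<lambda>x. f x * w x)" "(LINT x|m. cmod (f x * w x)) \<le> 2 * lux f"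
proof -
  have fm: "f \<in> borel_measurable m" using f by (rule L_measurable)
  have *: "(\<integral>\<^sup>+x. ennreal (cmod (f x * w x)) \<partial>m) \<le> ennreal (2 * k)" if k: "k > lux f" for k
  proof -
    have k0: "k > 0" using k lux_nonneg[OF f] by simp
    have mod: "modular f k \<le> 1" using lux_less[OF f k] .
    have "(\<integral>\<^sup>+x. ennreal (cmod (f x * w x)) \<partial>m)
        \<le> (\<integral>\<^sup>+x. ennreal k * (ennreal (Phi (cmod (f x) / k)) + ennreal (Psi (cmod (w x) / 1))) \<partial>m)"
    proof (rule nn_integral_mono)
      fix x
      have "cmod (f x) / k * cmod (w x) \<le> Phi (cmod (f x) / k) + Psi (cmod (w x))"
        using k0 by (intro Young_inequality) auto
      then have "cmod (f x * w x) \<le> k * (Phi (cmod (f x) / k) + Psi (cmod (w x)))"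
        using k0 by (simp add: norm_mult field_simps)
      then show "ennreal (cmod (f x * w x)) \<le> ennreal k * (ennreal (Phi (cmod (f x) / k)) + ennreal (Psi (cmod (w x) / 1)))"
        using k0 by (simp add: ennreal_mult[symmetric] ennreal_plus[symmetric] Phi_nonneg Psi.Phi_nonneg ennreal_leI del: ennreal_plus)
    qed
    also have "\<dots> = ennreal k * (modular f k + Psi.modular w 1)"
    proof -
      have "(\<lambda>x. ennreal (Phi (cmod (f x) / k))) \<in> borel_measurable m" "(\<lambda>x. ennreal (Psi (cmod (w x) / 1))) \<in> borel_measurable m"
        using Phi_measurable[OF fm, of k] Psi.Phi_measurable[OF w(1), of 1] k0 by auto
      then show ?thesis unfolding modular_def Psi.modular_def by (simp add: nn_integral_add nn_integral_cmult)
    qed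
    also have "\<dots> \<le> ennreal k * (1 + 1)" using mod w(2) by (intro mult_left_mono add_mono) auto
    also have "\<dots> = ennreal (2 * k)" using k0
      by (metis ennreal_mult'' ennreal_numeral mult.commute one_add_one zero_le_numeral)
    finally show ?thesis .
  qed
  show i: "integrable m (\<lambda>x. f x * w x)"
  proof (rule integrableI_bounded)
    show "(\<integral>\<^sup>+x. ennreal (norm (f x * w x)) \<partial>m) < \<infinity>"
      using *[of "lux f + 1"] by (auto intro: le_less_trans)
  qed (use fm w in measurable)
  show "(LINT x|m. cmod (f x * w x)) \<le> 2 * lux f"
  proof (rule field_le_epsilon)
    fix e :: real assume e: "e > 0"
    have "ennreal (LINT x|m. cmod (f x * w x)) = (\<integral>\<^sup>+x. ennreal (cmod (f x * w x)) \<partial>m)"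
      using i by (intro nn_integral_eq_integral[symmetric]) auto
    also have "\<dots> \<le> ennreal (2 * (lux f + e / 2))" using e by (intro *) auto
    finally have "(LINT x|m. cmod (f x * w x)) \<le> 2 * (lux f + e / 2)"
      using e lux_nonneg[OF f] by (subst (asm) ennreal_le_iff) auto
    then show "(LINT x|m. cmod (f x * w x)) \<le> 2 * lux f + e" by simp
  qed
qed

lemma cmod_integral_Hoelder:
  assumes f: "f \<in> L" and w: "w \<in> borel_measurable m" "Psi.modular w 1 \<le> 1"
  shows "cmod (LINT x|m. f x * w x) \<le> 2 * lux f"
  using integral_norm_bound[of m "\<lambda>x. f x * w x"] Hoelder(2)[OF assms] by linarith

text \<open>Hoelder's inequality against a constant test \<open>y\<close> with
  \<open>Psi y \<le> 1\<close>.\<close>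

lemma L_integrable:
  obtains C where "C > 0" "\<forall>f\<in>L. integrable m f \<and> (LINT x|m. cmod (f x)) \<le> C * lux f"
proof -
  obtain y where y: "y > 0" "Psi y \<le> 1" by (rule Psi.Phi_small)
  have w: "(\<lambda>x. complex_of_real y) \<in> borel_measurable m" "Psi.modular (\<lambda>x. complex_of_real y) 1 \<le> 1"
    using y by (auto intro!: Psi.modular_bounded[where B=y])
  have "integrable m f \<and> (LINT x|m. cmod (f x)) \<le> 2 / y * lux f" if f: "f \<in> L" for f
  proof -
    have "integrable m (\<lambda>x. f x * complex_of_real y)" "(LINT x|m. cmod (f x * complex_of_real y)) \<le> 2 * lux f"
      using Hoelder[OF f w] by auto
    moreover from this(1) have "integrable m (\<lambda>x. f x * complex_of_real y * (1 / complex_of_real y))"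
      by (rule integrable_mult_left)
    ultimately show ?thesis using y by (simp add: norm_mult field_simps)
  qed
  then show thesis using that[of "2 / y"] y(1) by simp
qed

lemma integrable_L: "f \<in> L \<Longrightarrow> integrable m f"
proof -
  assume "f \<in> L"
  obtain C where "C > 0" "\<forall>f\<in>L. integrable m f \<and> (LINT x|m. cmod (f x)) \<le> C * lux f" by (rule L_integrable)
  then show ?thesis using \<open>f \<in> L\<close> by blast
qed

lemma integrable_L_mult_bounded:
  assumes f: "f \<in> L" and w: "w \<in> borel_measurable m" "\<And>x. x \<in> space m \<Longrightarrow> cmod (w x) \<le> B"
  shows "integrable m (\<lambda>x. f x * w x)"
proof (rule Bochner_Integration.integrable_bound)
  show "integrable m (\<lambda>x. B * cmod (f x))" using integrable_L[OF f] by simp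
  show "AE x in m. norm (f x * w x) \<le> norm (B * cmod (f x))"
  proof (rule AE_I2)
    fix x assume "x \<in> space m"
    then have "cmod (w x) \<le> \<bar>B\<bar>" using w(2) by fastforce
    then have "cmod (f x) * cmod (w x) \<le> cmod (f x) * \<bar>B\<bar>" by (intro mult_left_mono) auto
    then show "norm (f x * w x) \<le> norm (B * cmod (f x))" by (simp add: norm_mult mult.commute abs_mult)
  qed
qed (use f w L_measurable in auto)

text \<open>The test function is \<open>w = subgrad (|x| / k) / max 1 J\<close> with the conjugate phase of \<open>x\<close>,
  where \<open>J\<close> is its modular before normalization, so that Young's inequality is an equality.\<close>
lemma norming:
  assumes x: "integrable m x" and \<delta>: "\<delta> \<ge> 0"
    and le: "\<And>w B. w \<in> borel_measurable m \<Longrightarrow> (\<forall>t\<in>space m. cmod (w t) \<le> B) \<Longrightarrow> Psi.modular w 1 \<le> 1 \<Longrightarrow>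
      cmod (LINT t|m. x t * w t) \<le> \<delta>"
    and k: "k > \<delta>"
  shows "modular x k \<le> 1"
proof (rule ccontr)
  assume "\<not> modular x k \<le> 1"
  then have big: "1 < modular x k" by simp
  have k0: "k > 0" using k \<delta> by simp
  have xm: "x \<in> borel_measurable m" using x by auto
  \<comment> \<open>Truncation keeps the subgradients bounded, so that the function built from them
    is an admissible bounded test, and it makes the integrals \<open>I\<close> and \<open>J\<close>
    finite.\<close>
  define A where "A n = {t\<in>space m. cmod (x t) \<le> real n}" for n :: nat
  have A: "A n \<in> sets m" for n unfolding A_def using xm by measurable
  have Phim: "(\<lambda>t. ennreal (Phi (cmod (x t) / k))) \<in> borel_measurable m"
    using Phi_measurable[OF xm, of k] k0 by simp
  have "modular x k = (SUP n. \<integral>\<^sup>+t. ennreal (Phi (cmod (x t) / k)) * indicator (A n) t \<partial>m)"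
  proof (subst nn_integral_monotone_convergence_SUP[symmetric])
    show "incseq (\<lambda>n t. ennreal (Phi (cmod (x t) / k)) * indicator (A n) t)"
      by (auto simp: incseq_def le_fun_def A_def indicator_def)
    show "(\<lambda>t. ennreal (Phi (cmod (x t) / k)) * indicator (A n) t) \<in> borel_measurable m" for n
      using Phim A by measurable
    show "modular x k = (\<integral>\<^sup>+t. (SUP n. ennreal (Phi (cmod (x t) / k)) * indicator (A n) t) \<partial>m)"
      unfolding modular_def
    proof (rule nn_integral_cong)
      fix t assume t: "t \<in> space m"
      obtain n :: nat where "cmod (x t) \<le> real n" using real_arch_simple by blast
      then have n: "t \<in> A n" using t by (simp add: A_def)
      show "ennreal (Phi (cmod (x t) / k)) = (SUP n. ennreal (Phi (cmod (x t) / k)) * indicator (A n) t)"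
      proof (rule antisym)
        show "ennreal (Phi (cmod (x t) / k)) \<le> (SUP n. ennreal (Phi (cmod (x t) / k)) * indicator (A n) t)"
          using n by (intro SUP_upper2[of n]) auto
      qed (auto intro!: SUP_least simp: indicator_def)
    qed
  qed
  with big obtain n where n: "1 < (\<integral>\<^sup>+t. ennreal (Phi (cmod (x t) / k)) * indicator (A n) t \<partial>m)"
    by (auto simp: less_SUP_iff)
  define b where "b t = (if t \<in> A n then subgrad (cmod (x t) / k) else 0)" for t
  have smono: "mono (\<lambda>a. subgrad (max 0 a))" by (intro monoI subgrad_mono) auto
  have bm: "b \<in> borel_measurable m"
  proof -
    have "(\<lambda>t. subgrad (max 0 (cmod (x t) / k))) \<in> borel_measurable m"
      by (rule measurable_compose[OF _ borel_measurable_mono[OF smono]]) (use xm in simp)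
    moreover have "max 0 (cmod (x t) / k) = cmod (x t) / k" for t using k0 by (simp add: max_def)
    ultimately have "(\<lambda>t. subgrad (cmod (x t) / k)) \<in> borel_measurable m" by simp
    then show ?thesis unfolding b_def using A by (intro measurable_If_set) (auto simp: Int_absorb2 sets.sets_into_space)
  qed
  have b0: "b t \<ge> 0" for t using k0 by (auto simp: b_def intro!: subgrad)
  define B where "B = subgrad (real n / k)"
  have bB: "b t \<le> B" for t
    using k0 subgrad(1)[of "real n / k"] by (auto simp: b_def B_def A_def intro!: subgrad_mono divide_right_mono)
  have Phib: "Phi (cmod (x t) / k) \<le> Phi (real n / k)" if "t \<in> A n" for t
    using that k0 by (auto simp: A_def intro!: Phi_mono divide_right_mono)
  have eq: "cmod (x t) * b t = k * (Phi (cmod (x t) / k) * indicator (A n) t + Psi (b t))" for t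
  proof (cases "t \<in> A n")
    case True
    have "cmod (x t) / k * b t = Phi (cmod (x t) / k) + Psi (b t)"
      using True k0 Young_equality[of "cmod (x t) / k"] by (simp add: b_def)
    then show ?thesis using True k0 by (simp add: field_simps)
  qed (auto simp: b_def)
  have Phim': "(\<lambda>t. Phi (cmod (x t) / k)) \<in> borel_measurable m"
    using Phi_measurable[OF xm, of k] k0 by simp
  have Psim: "(\<lambda>t. Psi (b t)) \<in> borel_measurable m"
    using Psi.Phi_measurable[of "\<lambda>t. complex_of_real (b t)" m 1] bm b0 by simp
  have iI: "integrable m (\<lambda>t. Phi (cmod (x t) / k) * indicator (A n) t)"
  proof (rule integrable_const_bound[of _ "Phi (real n / k)"])
    show "AE t in m. norm (Phi (cmod (x t) / k) * indicator (A n) t) \<le> Phi (real n / k)"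
      using Phib k0 by (auto simp: indicator_def Phi_nonneg)
  qed (use Phim' A in measurable)
  have iJ: "integrable m (\<lambda>t. Psi (b t))"
  proof (rule integrable_const_bound[of _ "Psi B"])
    show "AE t in m. norm (Psi (b t)) \<le> Psi B"
      using Psi.Phi_mono[OF b0 bB] Psi.Phi_nonneg[OF b0] by auto
  qed (rule Psim)
  define I where "I = (LINT t|m. Phi (cmod (x t) / k) * indicator (A n) t)"
  define J where "J = (LINT t|m. Psi (b t))"
  have J0: "J \<ge> 0" unfolding J_def using b0 by (intro integral_nonneg_AE) (auto simp: Psi.Phi_nonneg)
  have I1: "I > 1"
  proof -
    have "(\<integral>\<^sup>+t. ennreal (Phi (cmod (x t) / k)) * indicator (A n) t \<partial>m)
        = (\<integral>\<^sup>+t. ennreal (Phi (cmod (x t) / k) * indicator (A n) t) \<partial>m)"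
      by (intro nn_integral_cong) (auto simp: indicator_def)
    also have "\<dots> = ennreal I" unfolding I_def using iI k0
      by (intro nn_integral_eq_integral) (auto simp: Phi_nonneg indicator_def)
    finally show ?thesis using n by (simp add: ennreal_less_iff flip: ennreal_1)
  qed
  define M where "M = max 1 J"
  have M: "M \<ge> 1" "M \<ge> J" by (auto simp: M_def)
  define w where "w t = complex_of_real (b t / M) * cnj (sgn (x t))" for t
  have wm: "w \<in> borel_measurable m"
  proof -
    have c: "cnj \<in> borel_measurable borel"
      by (intro borel_measurable_continuous_onI continuous_on_cnj continuous_on_id)
    have "(\<lambda>t. x t / complex_of_real (cmod (x t))) \<in> borel_measurable m" using xm by measurable
    from measurable_compose[OF this c] show ?thesis
      unfolding w_def sgn_eq using bm by measurable
  qed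
  have w_le: "cmod (w t) \<le> b t / M" for t
  proof -
    have "b t / M \<ge> 0" using b0[of t] M by simp
    then have "cmod (w t) = b t / M * norm (sgn (x t))"
      by (simp only: w_def norm_mult norm_of_real complex_mod_cnj abs_of_nonneg)
    also have "\<dots> \<le> b t / M * 1"
      using \<open>b t / M \<ge> 0\<close> by (intro mult_left_mono) (simp_all add: norm_sgn)
    finally show ?thesis by simp
  qed
  have wB: "\<forall>t\<in>space m. cmod (w t) \<le> B / M"
  proof
    fix t
    have "b t / M \<le> B / M" using bB[of t] M by (intro divide_right_mono) auto
    then show "cmod (w t) \<le> B / M" using w_le[of t] by linarith
  qed
  have "Psi.modular w 1 \<le> 1"
  proof -
    have "Psi.modular w 1 \<le> (\<integral>\<^sup>+t. ennreal (Psi (b t) / M) \<partial>m)"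
      unfolding Psi.modular_def
    proof (intro nn_integral_mono ennreal_leI)
      fix t
      have "Psi (cmod (w t) / 1) \<le> Psi (1 / M * b t)"
        using w_le[of t] by (intro Psi.Phi_mono) auto
      also have "\<dots> \<le> 1 / M * Psi (b t)" using M b0 by (intro Psi.Phi_scale) auto
      finally show "Psi (cmod (w t) / 1) \<le> Psi (b t) / M" by simp
    qed
    also have "\<dots> = ennreal (J / M)"
      unfolding J_def using iJ M b0 by (subst nn_integral_eq_integral) (auto simp: Psi.Phi_nonneg)
    also have "\<dots> \<le> 1" using M by (simp add: divide_le_eq_1 flip: ennreal_1)
    finally show ?thesis .
  qed
  then have small: "cmod (LINT t|m. x t * w t) \<le> \<delta>" using le[OF wm wB] by simp
  have xw: "x t * w t = complex_of_real (k / M * (Phi (cmod (x t) / k) * indicator (A n) t + Psi (b t)))" for t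
  proof -
    have "x t * cnj (sgn (x t)) = complex_of_real (cmod (x t))"
    proof (cases "x t = 0")
      case False
      then have "x t * cnj (x t) / complex_of_real (cmod (x t)) = complex_of_real (cmod (x t))"
        by (simp add: complex_norm_square[symmetric] power2_eq_square)
      then show ?thesis by (simp add: sgn_eq)
    qed simp
    then have "x t * w t = complex_of_real (cmod (x t) * b t / M)"
      by (simp add: w_def mult.left_commute)
    then show ?thesis unfolding eq by simp
  qed
  have "(LINT t|m. x t * w t) = complex_of_real (k / M * (I + J))"
    unfolding xw I_def J_def using iI iJ by (simp add: integral_complex_of_real del: of_real_mult of_real_add of_real_divide)
  then have "cmod (LINT t|m. x t * w t) = k / M * (I + J)"
    using k0 M I1 J0 by (simp del: of_real_mult of_real_add of_real_divide)
  moreover have "k / M * (I + J) \<ge> k"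
  proof -
    \<comment> \<open>\<open>I > 1\<close> covers the case \<open>M = 1\<close> and
      \<open>I \<ge> 0\<close> the case \<open>M = J\<close>. The pairing therefore reaches
      \<open>k\<close>, which exceeds \<open>\<delta>\<close>.\<close>
    have "I + J \<ge> M" using I1 J0 by (auto simp: M_def)
    then have "k * M \<le> k * (I + J)" using k0 by (intro mult_left_mono) auto
    then show ?thesis using M by (simp add: field_simps)
  qed
  ultimately show False using small k by linarith
qed

text \<open>Membership in \<open>L\<close> is concluded and only integrability is assumed. This is
  how the density of \<open>mu\<close>, known at first merely as an \<open>L1\<close> function, is
  recognized as an element of the Orlicz space.\<close>

lemma norming_lux:
  assumes x: "integrable m x" and \<delta>: "\<delta> \<ge> 0"
    and le: "\<And>w B. w \<in> borel_measurable m \<Longrightarrow> (\<forall>t\<in>space m. cmod (w t) \<le> B) \<Longrightarrow> Psi.modular w 1 \<le> 1 \<Longrightarrow>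
      cmod (LINT t|m. x t * w t) \<le> \<delta>"
  shows "x \<in> L" "lux x \<le> \<delta>"
proof -
  have *: "modular x k \<le> 1" if "k > \<delta>" for k
    by (rule norming[OF x \<delta> _ that]) (rule le)
  have "modular x (\<delta> + 1) \<le> 1" "\<delta> + 1 > 0" using * \<delta> by auto
  then show xL: "x \<in> L" using x by (auto simp: L_iff)
  show "lux x \<le> \<delta>" using * by (intro lux_leI[OF xL _ \<delta>])
qed

end

section \<open>Bounded functionals and completeness\<close>

context orlicz_pair
begin

lemma dual_add: "ph \<in> orlicz_dual Phi m \<Longrightarrow> f \<in> L \<Longrightarrow> g \<in> L \<Longrightarrow> ph (\<lambda>x. f x + g x) = ph f + ph g"
  and dual_cmult: "ph \<in> orlicz_dual Phi m \<Longrightarrow> f \<in> L \<Longrightarrow> ph (\<lambda>x. c * f x) = c * ph f"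
  by (simp_all add: orlicz_dual_def)

lemma dual_bound:
  assumes "ph \<in> orlicz_dual Phi m"
  obtains C where "C > 0" "\<forall>f\<in>L. cmod (ph f) \<le> C * lux f"
proof -
  obtain C where C: "\<forall>f\<in>L. cmod (ph f) \<le> C * lux f" using assms by (auto simp: orlicz_dual_def)
  have "cmod (ph f) \<le> (\<bar>C\<bar> + 1) * lux f" if f: "f \<in> L" for f
  proof -
    have "C * lux f \<le> (\<bar>C\<bar> + 1) * lux f" using lux_nonneg[OF f] by (intro mult_right_mono) auto
    then show ?thesis using C f by force
  qed
  then show thesis using that[of "\<bar>C\<bar> + 1"] by auto
qed

lemma dual_diff:
  assumes "ph \<in> orlicz_dual Phi m" "f \<in> L" "g \<in> L"
  shows "ph (\<lambda>x. f x - g x) = ph f - ph g"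
  using dual_add[OF assms(1,2) L_cmult[OF assms(3), of "-1"]] dual_cmult[OF assms(1,3), of "-1"] by simp

lemma dual_zero: "ph \<in> orlicz_dual Phi m \<Longrightarrow> ph (\<lambda>x. 0) = 0"
  using dual_cmult[OF _ zero_L, of ph 0] by simp

lemma dual_sum:
  assumes ph: "ph \<in> orlicz_dual Phi m" and "finite I" "\<And>i. i \<in> I \<Longrightarrow> f i \<in> L"
  shows "ph (\<lambda>x. \<Sum>i\<in>I. c i * f i x) = (\<Sum>i\<in>I. c i * ph (f i))"
  using assms(2,3)
proof (induction I)
  case empty
  show ?case using dual_zero[OF ph] by simp
next
  case (insert i I)
  have "(\<lambda>x. \<Sum>i\<in>I. c i * f i x) \<in> L" using insert by (intro L_sum) auto
  then show ?case
    using insert dual_add[OF ph L_cmult] dual_cmult[OF ph] by simp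
qed

lemma integral_functional:
  assumes w: "w \<in> borel_measurable m" "\<And>x. x \<in> space m \<Longrightarrow> cmod (w x) \<le> B"
    and C: "\<And>f. f \<in> L \<Longrightarrow> cmod (LINT x|m. f x * w x) \<le> C * lux f"
  shows "(\<lambda>h. c * (LINT x|m. h x * w x)) \<in> orlicz_dual Phi m"
  unfolding orlicz_dual_def
proof (safe, goal_cases)
  case (1 f g)
  then show ?case using integrable_L_mult_bounded[OF _ w] by (simp add: distrib_right distrib_left)
next
  case (2 d f)
  have "(LINT x|m. d * f x * w x) = d * (LINT x|m. f x * w x)"
    by (simp only: mult.assoc integral_mult_right_zero)
  then show ?case by (simp only: mult.left_commute)
next
  case 3
  have "cmod (c * (LINT x|m. f x * w x)) \<le> (cmod c * C) * lux f" if "f \<in> L" for f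
    using mult_left_mono[OF C[OF that], of "cmod c"] by (simp add: norm_mult mult.assoc)
  then show ?case by blast
qed

text \<open>The factor \<open>1/2\<close> compensates the factor 2 of Hoelder's inequality, so that
  the functional lands in the unit ball of the dual.\<close>

lemma test_functional:
  assumes w: "w \<in> borel_measurable m" "\<And>x. x \<in> space m \<Longrightarrow> cmod (w x) \<le> B" and mod: "Psi.modular w 1 \<le> 1"
  shows "(\<lambda>h. LINT x|m. h x * w x) \<in> orlicz_dual Phi m"
    "(\<lambda>h. 1/2 * (LINT x|m. h x * w x)) \<in> orlicz_dual_ball Phi m"
proof -
  note b = cmod_integral_Hoelder[OF _ w(1) mod]
  show "(\<lambda>h. LINT x|m. h x * w x) \<in> orlicz_dual Phi m"
    using integral_functional[OF w b, of 1] by simp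
  have "cmod (1/2 * (LINT x|m. f x * w x)) \<le> lux f" if "f \<in> L" for f
    using b[OF that] by (simp add: norm_mult)
  then show "(\<lambda>h. 1/2 * (LINT x|m. h x * w x)) \<in> orlicz_dual_ball Phi m"
    unfolding orlicz_dual_ball_def using integral_functional[OF w b, of "1/2"] by blast
qed

text \<open>The Haar integral is the one functional whose pairing with the convolution measure is a
  multiple of \<open>m\<close>; that allows the norm of \<open>L1_vm\<close> to be compared with the
  \<open>L1\<close> norm.\<close>

lemma integral_functional_ball:
  obtains C where "C > 0" "(\<lambda>h. LINT x|m. h x) \<in> orlicz_dual Phi m"
    "(\<lambda>h. complex_of_real (1 / C) * (LINT x|m. h x)) \<in> orlicz_dual_ball Phi m"
proof -
  obtain C where C: "C > 0" "\<forall>f\<in>L. integrable m f \<and> (LINT x|m. cmod (f x)) \<le> C * lux f"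
    by (rule L_integrable)
  have b: "cmod (LINT x|m. f x * 1) \<le> C * lux f" if "f \<in> L" for f
  proof -
    have "(LINT x|m. cmod (f x)) \<le> C * lux f" using C(2) that by blast
    then show ?thesis by (simp add: order_trans[OF integral_norm_bound])
  qed
  have d: "(\<lambda>h. c * (LINT x|m. h x * 1)) \<in> orlicz_dual Phi m" for c
    using integral_functional[of "\<lambda>_. 1" 1 C c] b by simp
  have "cmod (complex_of_real (1 / C) * (LINT x|m. f x)) \<le> lux f" if "f \<in> L" for f
    using b[OF that] C(1) by (simp add: norm_mult norm_divide field_simps)
  then show thesis using that[OF C(1)] d[of 1] d[of "complex_of_real (1 / C)"]
    unfolding orlicz_dual_ball_def by simp
qed

text \<open>Replaces an appeal to Hahn-Banach. By \<open>norming_lux\<close> some bounded test pairs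
  with \<open>x\<close> to more than \<open>lux x / 2\<close>; halving it to enter the dual ball
  leaves a quarter.\<close>

lemma norming_functional:
  assumes x: "x \<in> L"
  obtains ph where "ph \<in> orlicz_dual_ball Phi m" "lux x / 4 \<le> cmod (ph x)"
proof (cases "lux x = 0")
  case True
  obtain C where "(\<lambda>h. complex_of_real (1 / C) * (LINT x|m. h x)) \<in> orlicz_dual_ball Phi m"
    by (rule integral_functional_ball)
  then show thesis using that True by auto
next
  case False
  then have pos: "lux x > 0" using lux_nonneg[OF x] by simp
  have "\<not> (\<forall>w B. w \<in> borel_measurable m \<longrightarrow> (\<forall>t\<in>space m. cmod (w t) \<le> B) \<longrightarrow> Psi.modular w 1 \<le> 1 \<longrightarrow>
      cmod (LINT t|m. x t * w t) \<le> lux x / 2)"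
  proof
    assume "\<forall>w B. w \<in> borel_measurable m \<longrightarrow> (\<forall>t\<in>space m. cmod (w t) \<le> B) \<longrightarrow> Psi.modular w 1 \<le> 1 \<longrightarrow>
      cmod (LINT t|m. x t * w t) \<le> lux x / 2"
    then have "lux x \<le> lux x / 2"
      using pos by (intro norming_lux(2)[OF integrable_L[OF x]]) auto
    then show False using pos by simp
  qed
  then obtain w B where w: "w \<in> borel_measurable m" "\<And>t. t \<in> space m \<Longrightarrow> cmod (w t) \<le> B" "Psi.modular w 1 \<le> 1"
    "lux x / 2 < cmod (LINT t|m. x t * w t)" by (auto simp: not_le)
  show thesis
    by (rule that[OF test_functional(2)[OF w(1,2,3)]]) (use w(4) in \<open>simp_all add: norm_mult\<close>)
qed

text \<open>The Riesz-Fischer scheme: differences of a fast subsequence are summable in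
  \<open>L1\<close>, which gives an almost everywhere limit, and Fatou's lemma for the modular
  upgrades this to convergence in norm.\<close>

lemma lux_complete:
  assumes x: "\<And>n::nat. x n \<in> L" and Cauchy: "\<And>e. e > 0 \<Longrightarrow> \<exists>N. \<forall>i\<ge>N. \<forall>j\<ge>N. lux (\<lambda>t. x i t - x j t) < e"
  obtains r y where "strict_mono r" "y \<in> L" "(\<lambda>n. lux (\<lambda>t. x (r n) t - y t)) \<longlonglongrightarrow> 0"
proof -
  have "\<forall>k::nat. \<exists>N. \<forall>i\<ge>N. \<forall>j\<ge>N. lux (\<lambda>t. x i t - x j t) < (1/2)^k" using Cauchy by simp
  then obtain N where N: "\<And>k i j. i \<ge> N k \<Longrightarrow> j \<ge> N k \<Longrightarrow> lux (\<lambda>t. x i t - x j t) < (1/2)^k" by metis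
  define r where "r k = (\<Sum>i\<le>k. N i) + k" for k
  have r: "strict_mono r" unfolding r_def by (intro strict_mono_Suc_iff[THEN iffD2]) simp
  have rN: "r k \<ge> N k" for k unfolding r_def by (simp add: member_le_sum trans_le_add1)
  obtain C where C: "C > 0" "\<forall>f\<in>L. integrable m f \<and> (LINT x|m. cmod (f x)) \<le> C * lux f"
    by (rule L_integrable)
  have xm: "x n \<in> borel_measurable m" for n using L_measurable[OF x] .
  define d where "d k t = x (r (Suc k)) t - x (r k) t" for k t
  have dL: "d k \<in> L" for k unfolding d_def by (intro L_diff x)
  have dm: "d k \<in> borel_measurable m" for k by (rule L_measurable[OF dL])
  have di: "(\<integral>\<^sup>+t. ennreal (cmod (d k t)) \<partial>m) \<le> ennreal (C * (1/2)^k)" for k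
  proof -
    have "r (Suc k) \<ge> N k" using rN[of k] strict_monoD[OF r, of k "Suc k"] by simp
    then have "lux (d k) \<le> (1/2)^k" unfolding d_def using N[OF _ rN] by (intro less_imp_le) auto
    then have "(LINT t|m. cmod (d k t)) \<le> C * (1/2)^k"
      using C dL by (meson mult_left_mono less_imp_le order_trans)
    moreover have "(\<integral>\<^sup>+t. ennreal (cmod (d k t)) \<partial>m) = ennreal (LINT t|m. cmod (d k t))"
      using C dL by (intro nn_integral_eq_integral) auto
    ultimately show ?thesis by (simp add: ennreal_leI)
  qed
  have "(\<integral>\<^sup>+t. (\<Sum>k. ennreal (cmod (d k t))) \<partial>m) = (\<Sum>k. \<integral>\<^sup>+t. ennreal (cmod (d k t)) \<partial>m)"
    using dm by (intro nn_integral_suminf) auto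
  also have "\<dots> \<le> (\<Sum>k. ennreal (C * (1/2)^k))" by (intro suminf_le di) auto
  also have "\<dots> < \<infinity>"
    using C(1) by (subst suminf_ennreal2) (auto intro!: summable_mult summable_geometric)
  finally have "(\<integral>\<^sup>+t. (\<Sum>k. ennreal (cmod (d k t))) \<partial>m) \<noteq> \<infinity>" by simp
  then have "AE t in m. (\<Sum>k. ennreal (cmod (d k t))) \<noteq> \<infinity>"
    using dm by (intro nn_integral_PInf_AE) auto
  then have conv: "AE t in m. convergent (\<lambda>k. x (r k) t)"
  proof eventually_elim
    case (elim t)
    then have "summable (\<lambda>k. cmod (d k t))" by (intro summable_suminf_not_top) auto
    then have "summable (\<lambda>k. d k t)" by (rule summable_norm_cancel)
    then have "convergent (\<lambda>n. \<Sum>k<n. d k t)" by (simp add: summable_iff_convergent)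
    moreover have "(\<Sum>k<n. d k t) = x (r n) t - x (r 0) t" for n
      unfolding d_def by (rule sum_lessThan_telescope)
    ultimately have "convergent (\<lambda>n. (x (r n) t - x (r 0) t) + x (r 0) t)"
      by (intro convergent_add convergent_const) auto
    then show ?case by simp
  qed
  define y where "y t = lim (\<lambda>k. x (r k) t)" for t
  have ym: "y \<in> borel_measurable m" unfolding y_def using xm by measurable
  have lim: "AE t in m. (\<lambda>k. x (r k) t) \<longlonglongrightarrow> y t"
    using conv unfolding y_def by (simp add: convergent_LIMSEQ_iff)
  \<comment> \<open>Half of \<open>cmod (x (r i) t - y t)\<close> is eventually below
    \<open>cmod (x (r i) t - x (r j) t)\<close>. Monotonicity of \<open>Phi\<close> then replaces
    its continuity before Fatou's lemma, and the halving is the reason for the scale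
    \<open>2 * e\<close>.\<close>
  have close: "modular (\<lambda>t. x (r i) t - y t) (2 * e) \<le> 1"
    if e: "e > 0" and i: "\<And>j. j \<ge> i \<Longrightarrow> lux (\<lambda>t. x (r i) t - x (r j) t) < e" for e i
  proof -
    have m: "(\<lambda>t. ennreal (Phi (cmod (x (r i) t - x (r j) t) / e))) \<in> borel_measurable m" for j
      using Phi_measurable[of "\<lambda>t. x (r i) t - x (r j) t" m e] xm e by simp
    have "modular (\<lambda>t. x (r i) t - y t) (2 * e)
        \<le> (\<integral>\<^sup>+t. liminf (\<lambda>j. ennreal (Phi (cmod (x (r i) t - x (r j) t) / e))) \<partial>m)"
      unfolding modular_def
    proof (rule nn_integral_mono_AE)
      show "AE t in m. ennreal (Phi (cmod (x (r i) t - y t) / (2 * e))) \<le> liminf (\<lambda>j. ennreal (Phi (cmod (x (r i) t - x (r j) t) / e)))"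
        using lim
      proof eventually_elim
        case (elim t)
        have "(\<lambda>j. cmod (x (r i) t - x (r j) t)) \<longlonglongrightarrow> cmod (x (r i) t - y t)"
          by (intro tendsto_intros elim)
        have "\<forall>\<^sub>F j in sequentially. cmod (x (r i) t - y t) / 2 \<le> cmod (x (r i) t - x (r j) t)"
        proof (cases "cmod (x (r i) t - y t) = 0")
          case False
          then have "cmod (x (r i) t - y t) / 2 < cmod (x (r i) t - y t)" by simp
          from order_tendstoD(1)[OF \<open>(\<lambda>j. cmod (x (r i) t - x (r j) t)) \<longlonglongrightarrow> _\<close> this]
          show ?thesis by (rule eventually_mono) simp
        qed simp
        then have "\<forall>\<^sub>F j in sequentially. ennreal (Phi (cmod (x (r i) t - y t) / (2 * e)))
            \<le> ennreal (Phi (cmod (x (r i) t - x (r j) t) / e))"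
        proof (rule eventually_mono)
          fix j assume "cmod (x (r i) t - y t) / 2 \<le> cmod (x (r i) t - x (r j) t)"
          then have "cmod (x (r i) t - y t) / 2 / e \<le> cmod (x (r i) t - x (r j) t) / e"
            using e by (intro divide_right_mono) auto
          then show "ennreal (Phi (cmod (x (r i) t - y t) / (2 * e))) \<le> ennreal (Phi (cmod (x (r i) t - x (r j) t) / e))"
            using e by (intro ennreal_leI Phi_mono) auto
        qed
        then show ?case by (rule Liminf_bounded)
      qed
    qed
    also have "\<dots> \<le> liminf (\<lambda>j. modular (\<lambda>t. x (r i) t - x (r j) t) e)"
      unfolding modular_def using m by (rule nn_integral_liminf)
    also have "\<dots> \<le> liminf (\<lambda>j. 1)"
    proof (intro Liminf_mono)
      show "\<forall>\<^sub>F j in sequentially. modular (\<lambda>t. x (r i) t - x (r j) t) e \<le> 1"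
        using eventually_ge_at_top[of i]
      proof eventually_elim
        case (elim j)
        then show ?case using i lux_less[OF L_diff[OF x x]] by blast
      qed
    qed
    also have "\<dots> = (1::ennreal)" by (rule Liminf_const) simp
    finally show ?thesis .
  qed
  have step: "lux (\<lambda>t. x (r i) t - x (r j) t) < (1/2)^k" if "k \<le> i" "i \<le> j" for i j k
  proof -
    have "r i \<ge> r k" "r j \<ge> r k" using that strict_mono_less_eq[OF r] by auto
    then show ?thesis using rN[of k] by (intro N) auto
  qed
  have e: "modular (\<lambda>t. x (r i) t - y t) (2 * (1/2)^k) \<le> 1" if "k \<le> i" for i k
    using that by (intro close step) auto
  have dyL: "(\<lambda>t. x (r i) t - y t) \<in> L" for i
    using e[of 0 i] xm ym unfolding L_iff by (intro conjI exI[of _ "2"]) auto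
  have "(\<lambda>t. x (r 0) t - (x (r 0) t - y t)) \<in> L" by (intro L_diff x dyL)
  then have yL: "y \<in> L" by simp
  have le: "lux (\<lambda>t. x (r i) t - y t) \<le> 2 * (1/2)^i" for i using e[of i i] by (intro lux_le) auto
  have lim0: "(\<lambda>i. 2 * (1/2)^i :: real) \<longlonglongrightarrow> 0"
    by (intro tendsto_mult_right_zero LIMSEQ_realpow_zero) auto
  define a where "a i = lux (\<lambda>t. x (r i) t - y t)" for i
  have "norm (a i) \<le> 2 * (1/2)^i" for i
    using le[of i] lux_nonneg[OF dyL[of i]] by (simp only: a_def real_norm_def abs_of_nonneg)
  then have "\<forall>\<^sub>F i in sequentially. norm (a i) \<le> 2 * (1/2)^i"
    by (intro always_eventually allI)
  then have "a \<longlonglongrightarrow> 0" using lim0 by (rule Lim_null_comparison)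
  then have "(\<lambda>i. lux (\<lambda>t. x (r i) t - y t)) \<longlonglongrightarrow> 0" by (simp only: a_def[abs_def])
  then show thesis by (rule that[OF r yL])
qed

end

section \<open>Consequences of the doubling condition\<close>

locale orlicz_delta2 = orlicz_pair +
  assumes delta2: "delta2 Phi"
begin

text \<open>Starting from one admissible scale \<open>l\<close>, each halving multiplies the modular
  by at most \<open>K\<close> and adds \<open>Phi (2 * x0)\<close>, which accounts for arguments
  below the doubling threshold; on total mass 1 this stays finite.\<close>

lemma modular_finite:
  assumes f: "f \<in> L" and k: "k > 0"
  shows "modular f k < \<infinity>"
proof -
  obtain K x0 where K: "K > 0" "x0 > 0" "\<And>x. x \<ge> x0 \<Longrightarrow> Phi (2 * x) \<le> K * Phi x"
    using delta2 by (auto simp: delta2_def)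
  have double: "Phi (2 * x) \<le> K * Phi x + Phi (2 * x0)" if "x \<ge> 0" for x
  proof (cases "x \<ge> x0")
    case True
    then show ?thesis using K(3)[OF True] Phi_nonneg[of "2 * x0"] K(2) by simp
  next
    case False
    then have "Phi (2 * x) \<le> Phi (2 * x0)" using that by (intro Phi_mono) auto
    moreover have "K * Phi x \<ge> 0" using K(1) Phi_nonneg[OF that] by simp
    ultimately show ?thesis by simp
  qed
  have fm: "f \<in> borel_measurable m" using f by (rule L_measurable)
  obtain l where l: "l > 0" "modular f l \<le> 1" using f by (auto simp: L_iff)
  have "modular f (l / 2 ^ n) < \<infinity>" for n
  proof (induction n)
    case 0
    then show ?case using l(2) by (auto intro: le_less_trans)
  next
    case (Suc n)
    have "modular f (l / 2 ^ Suc n) \<le> (\<integral>\<^sup>+x. ennreal K * ennreal (Phi (cmod (f x) / (l / 2 ^ n))) + ennreal (Phi (2 * x0)) \<partial>m)"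
      unfolding modular_def
    proof (rule nn_integral_mono)
      fix x
      have "Phi (cmod (f x) / (l / 2 ^ Suc n)) = Phi (2 * (cmod (f x) / (l / 2 ^ n)))" by (simp add: field_simps)
      also have "\<dots> \<le> K * Phi (cmod (f x) / (l / 2 ^ n)) + Phi (2 * x0)" using l(1) by (intro double) auto
      finally show "ennreal (Phi (cmod (f x) / (l / 2 ^ Suc n))) \<le> ennreal K * ennreal (Phi (cmod (f x) / (l / 2 ^ n))) + ennreal (Phi (2 * x0))"
        using K l(1) by (simp add: ennreal_mult[symmetric] ennreal_plus[symmetric] Phi_nonneg ennreal_leI del: ennreal_plus)
    qed
    also have "\<dots> = ennreal K * modular f (l / 2 ^ n) + ennreal (Phi (2 * x0))"
    proof -
      have "(\<lambda>x. ennreal (Phi (cmod (f x) / (l / 2 ^ n)))) \<in> borel_measurable m"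
        using Phi_measurable[OF fm, of "l / 2^n"] l(1) by simp
      then show ?thesis unfolding modular_def using measure_space_1
        by (simp add: nn_integral_add nn_integral_cmult emeasure_eq_measure)
    qed
    also have "\<dots> < \<infinity>" using Suc by (simp add: ennreal_mult_less_top)
    finally show ?case .
  qed
  moreover obtain n where "l / 2 ^ n \<le> k"
  proof -
    obtain n where "l / k < 2 ^ n" using real_arch_pow[of 2 "l / k"] by auto
    then have "l / 2 ^ n \<le> k" using k by (simp add: field_simps)
    then show thesis by (rule that)
  qed
  ultimately show ?thesis using modular_mono[of "l / 2 ^ n" k f] l(1) by (meson divide_pos_pos le_less_trans zero_less_numeral zero_less_power)
qed

text \<open>Dominated convergence for the modular at the small scale \<open>e\<close>. The majorant
  is integrable at this scale only thanks to \<open>modular_finite\<close>, and through this lemma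
  the doubling condition makes continuous functions dense.\<close>

lemma truncation:
  assumes f: "f \<in> L" and e: "e > 0"
  obtains n :: nat where "lux (\<lambda>x. f x - (if cmod (f x) \<le> real n then f x else 0)) \<le> e"
proof -
  have fm: "f \<in> borel_measurable m" using f by (rule L_measurable)
  define g where "g n x = (if cmod (f x) \<le> real n then 0 else f x)" for n :: nat and x
  have gm: "g n \<in> borel_measurable m" for n unfolding g_def using fm by measurable
  have "(\<lambda>n. modular (g n) e) \<longlonglongrightarrow> (\<integral>\<^sup>+x. 0 \<partial>m)"
    unfolding modular_def
  proof (rule nn_integral_dominated_convergence[where w="\<lambda>x. ennreal (Phi (cmod (f x) / e))"])
    show "AE x in m. ennreal (Phi (cmod (g n x) / e)) \<le> ennreal (Phi (cmod (f x) / e))" for n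
      using e by (auto simp: g_def intro!: AE_I2)
    show "(\<integral>\<^sup>+x. ennreal (Phi (cmod (f x) / e)) \<partial>m) < \<infinity>"
      using modular_finite[OF f e] by (simp add: modular_def)
    show "AE x in m. (\<lambda>n. ennreal (Phi (cmod (g n x) / e))) \<longlonglongrightarrow> 0"
    proof (rule AE_I2)
      fix x
      obtain N :: nat where "cmod (f x) \<le> real N" using real_arch_simple by blast
      then have "ennreal (Phi (cmod (g n x) / e)) = 0" if "n \<ge> N" for n using that by (simp add: g_def)
      then have "\<forall>\<^sub>F n in sequentially. ennreal (Phi (cmod (g n x) / e)) = 0"
        unfolding eventually_sequentially by blast
      then show "(\<lambda>n. ennreal (Phi (cmod (g n x) / e))) \<longlonglongrightarrow> 0" by (rule tendsto_eventually)
    qed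
  qed (use Phi_measurable[OF gm, of e] Phi_measurable[OF fm, of e] e in auto)
  then have "\<forall>\<^sub>F n in sequentially. modular (g n) e < 1" by (intro order_tendstoD(2)) auto
  then obtain n where "modular (g n) e < 1" by (meson eventually_happens sequentially_bot)
  then have "lux (g n) \<le> e" using e by (intro lux_le) auto
  moreover have "g n = (\<lambda>x. f x - (if cmod (f x) \<le> real n then f x else 0))" by (auto simp: g_def fun_eq_iff)
  ultimately show thesis using that by simp
qed

end

section \<open>Translations in the Orlicz space\<close>

locale orlicz_group = compact_group m + orlicz_delta2 m Phi Psi
  for m :: "'g::{group_add,t2_space} measure" and Phi Psi
begin

text \<open>Right translation, fitted to the change of variable \<open>s + u\<close> in the pairing:
  when \<open>mu\<close> has density \<open>f\<close>, the vector density at \<open>u\<close> is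
  \<open>translate u f\<close>.\<close>

definition translate :: "'g \<Rightarrow> ('g \<Rightarrow> complex) \<Rightarrow> 'g \<Rightarrow> complex" where
  "translate u f t = f (t - u)"

lemma borel_measurable_L: "f \<in> L \<Longrightarrow> f \<in> borel_measurable borel"
  using L_measurable borel_measurable_m by auto

lemma modular_translate:
  assumes "f \<in> borel_measurable borel" "k \<ge> 0"
  shows "modular (translate u f) k = modular f k"
proof -
  have "(\<lambda>t. ennreal (Phi (cmod (f t) / k))) \<in> borel_measurable borel"
    using Phi_measurable[OF assms] by simp
  from nn_integral_right[OF this, of "- u"] show ?thesis by (simp add: modular_def translate_def)
qed

lemma measurable_translate: "f \<in> borel_measurable borel \<Longrightarrow> translate u f \<in> borel_measurable borel"
  unfolding translate_def[abs_def] using measurable_compose[OF measurable_translates(3)] by blast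

lemma translate_L: "f \<in> L \<Longrightarrow> translate u f \<in> L"
  and lux_translate: "f \<in> L \<Longrightarrow> lux (translate u f) = lux f"
proof -
  assume f: "f \<in> L"
  have m: "modular (translate u f) k = modular f k" if "k > 0" for k
    using that borel_measurable_L[OF f] by (intro modular_translate) auto
  show "translate u f \<in> L"
    using f m measurable_translate[OF borel_measurable_L[OF f]] by (auto simp: L_iff borel_measurable_m)
  show "lux (translate u f) = lux f"
    unfolding lux_eq using m by (intro arg_cong[of _ _ Inf]) auto
qed

lemma translate_diff: "translate u (\<lambda>t. f t - g t) = (\<lambda>t. translate u f t - translate u g t)"
  by (auto simp: translate_def)

text \<open>After truncation at level \<open>n\<close>, a continuous approximant with the same bound
  is chosen close in \<open>L1\<close>; the difference is bounded by \<open>2 * n\<close>, so it is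
  also small in norm.\<close>

lemma continuous_dense_L:
  assumes f: "f \<in> L" and e: "e > 0"
  obtains g where "continuous_on UNIV g" "g \<in> L" "lux (\<lambda>x. f x - g x) \<le> e"
proof -
  obtain n :: nat where n: "lux (\<lambda>x. f x - (if cmod (f x) \<le> real n then f x else 0)) \<le> e / 2"
    by (rule truncation[OF f half_gt_zero[OF e]])
  define h where "h x = (if cmod (f x) \<le> real n then f x else 0)" for x
  have hm: "h \<in> borel_measurable borel" unfolding h_def using borel_measurable_L[OF f] by measurable
  have hB: "cmod (h x) \<le> real n" for x by (simp add: h_def)
  have hL: "h \<in> L" using hm hB by (intro bounded_in_L) (auto simp: borel_measurable_m)
  have B: "2 * real n \<ge> 0" by simp
  obtain d where d: "d > 0" "\<forall>f. f \<in> borel_measurable m \<longrightarrow> (\<forall>x\<in>space m. cmod (f x) \<le> 2 * real n) \<longrightarrow>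
      (LINT x|m. cmod (f x)) < d \<longrightarrow> lux f \<le> e / 2"
    by (rule lux_small_of_L1_small[OF B half_gt_zero[OF e]])
  obtain g where g: "continuous_on UNIV g" "\<And>x. cmod (g x) \<le> real n" "(LINT x|m. cmod (h x - g x)) < d"
    using bounded_continuous_dense_L1[OF compact_UNIV inner_regular_m hm hB d(1)] by metis
  have gm: "g \<in> borel_measurable borel" using g(1) by (rule borel_measurable_continuous_onI)
  have gL: "g \<in> L" using gm g(2) by (intro bounded_in_L) (auto simp: borel_measurable_m)
  have "cmod (h x - g x) \<le> 2 * real n" for x
    using norm_triangle_ineq4[of "h x" "g x"] hB[of x] g(2)[of x] by linarith
  then have "lux (\<lambda>x. h x - g x) \<le> e / 2"
    using d(2) g(3) hm gm by (auto simp: borel_measurable_m)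
  then have "lux (\<lambda>x. f x - g x) \<le> e"
    using lux_diff_triangle[OF f hL gL] n by (simp add: h_def)
  then show thesis using that g(1) gL by blast
qed

text \<open>Translations are isometries, so the approximation error by a continuous \<open>g\<close>
  is the same at \<open>u\<close> and at \<open>v\<close>. For \<open>g\<close> itself closeness is
  uniform in \<open>t\<close>, and the constant \<open>c\<close> of \<open>bounded_L\<close>
  converts it to norm.\<close>

lemma continuous_translate:
  assumes f: "f \<in> L" and e: "e > 0"
  obtains V where "open V" "u \<in> V" "\<forall>v\<in>V. lux (\<lambda>t. translate v f t - translate u f t) \<le> e"
proof -
  have e3: "e / 3 > 0" using e by simp
  obtain g where g: "continuous_on UNIV g" "g \<in> L" "lux (\<lambda>x. f x - g x) \<le> e / 3"
    by (rule continuous_dense_L[OF f e3])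
  obtain c where c: "c > 0" "\<forall>f B. f \<in> borel_measurable m \<longrightarrow> (\<forall>x\<in>space m. cmod (f x) \<le> B) \<longrightarrow> f \<in> L \<and> lux f \<le> c * B"
    by (rule bounded_L)
  have H: "continuous_on UNIV (\<lambda>x::'g \<times> 'g. g (fst x - snd x))"
    by (intro continuous_on_compose2[OF g(1)] group_continuous) auto
  have ec: "e / 3 / c > 0" using e3 c by simp
  obtain V where V: "open V" "u \<in> V" "\<And>v t. v \<in> V \<Longrightarrow> dist (g (fst (t, v) - snd (t, v))) (g (fst (t, u) - snd (t, u))) < e / 3 / c"
    by (rule continuous_uniformly_in_parameter[OF compact_UNIV H ec, of u]) blast
  have "lux (\<lambda>t. translate v f t - translate u f t) \<le> e" if v: "v \<in> V" for v
  proof -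
    note T = translate_L[OF f] translate_L[OF g(2)]
    have "\<forall>t. cmod (translate v g t - translate u g t) \<le> e / 3 / c"
      using V(3)[OF v] by (auto simp: translate_def dist_norm intro: less_imp_le)
    then have "lux (\<lambda>t. translate v g t - translate u g t) \<le> c * (e / 3 / c)"
      using c(2) L_measurable[OF L_diff[OF T(2)[of v] T(2)[of u]]] by blast
    then have 1: "lux (\<lambda>t. translate v g t - translate u g t) \<le> e / 3" using c(1) by simp
    have 2: "lux (\<lambda>t. translate w f t - translate w g t) \<le> e / 3" for w
      using lux_translate[OF L_diff[OF f g(2)], of w] g(3) by (simp add: translate_diff)
    have "lux (\<lambda>t. translate v f t - translate u f t)
        \<le> lux (\<lambda>t. translate v f t - translate v g t) + lux (\<lambda>t. translate v g t - translate u f t)"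
      by (intro lux_diff_triangle T)
    also have "lux (\<lambda>t. translate v g t - translate u f t)
        \<le> lux (\<lambda>t. translate v g t - translate u g t) + lux (\<lambda>t. translate u g t - translate u f t)"
      by (intro lux_diff_triangle T)
    also have "lux (\<lambda>t. translate u g t - translate u f t) = lux (\<lambda>t. translate u f t - translate u g t)"
      by (intro lux_diff_commute T)
    finally show ?thesis using 1 2[of v] 2[of u] by linarith
  qed
  then show thesis using that V(1,2) by blast
qed

text \<open>The orbit of \<open>f\<close> is approximated uniformly by finitely many of its members
  in a Borel manner. All vector integrals with a density are reduced to finite sums over the values
  of this \<open>\<sigma>\<close>.\<close>

lemma translate_selection:
  assumes f: "f \<in> L" and e: "e > 0"
  obtains \<sigma> where "finite (range \<sigma>)" "\<And>u. \<sigma> -` {u} \<in> sets borel"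
    "\<And>v. lux (\<lambda>t. translate v f t - translate (\<sigma> v) f t) \<le> e"
proof -
  have "\<forall>u. \<exists>V. open V \<and> u \<in> V \<and> (\<forall>v\<in>V. lux (\<lambda>t. translate v f t - translate u f t) \<le> e)"
    using continuous_translate[OF f e] by metis
  then obtain V where V: "\<And>u. open (V u)" "\<And>u. u \<in> V u"
    "\<And>u v. v \<in> V u \<Longrightarrow> lux (\<lambda>t. translate v f t - translate u f t) \<le> e" by metis
  obtain \<sigma> where "finite (range \<sigma>)" "\<And>u. \<sigma> -` {u} \<in> sets borel" "\<And>v. v \<in> V (\<sigma> v)"
    using finite_borel_selection[OF compact_UNIV V(1,2)] by blast
  then show thesis using that V(3) by blast
qed

end

section \<open>The convolution vector measure\<close>

lemma integral_zero_imp_AE_zero: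
  fixes h :: "'a \<Rightarrow> complex"
  assumes h: "integrable m h" and z: "\<And>A. A \<in> sets m \<Longrightarrow> (LINT x:A|m. h x) = 0"
  shows "AE x in m. h x = 0"
proof -
  have real: "AE x in m. r x = 0" if r: "integrable m r" and z: "\<And>A. A \<in> sets m \<Longrightarrow> (LINT x:A|m. r x) = 0" for r :: "'a \<Rightarrow> real"
  proof -
    have rm: "r \<in> borel_measurable m" using r by auto
    define P where "P = {x\<in>space m. r x \<ge> 0}"
    define N where "N = {x\<in>space m. r x < 0}"
    have PN: "P \<in> sets m" "N \<in> sets m" unfolding P_def N_def using rm by measurable
    have i: "integrable m (\<lambda>x. indicator A x * r x)" if "A \<in> sets m" for A
      using integrable_mult_indicator[OF that r] by simp
    have "(LINT x|m. indicator P x * r x) = 0" "(LINT x|m. indicator N x * r x) = 0"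
      using z[OF PN(1)] z[OF PN(2)] by (simp_all add: set_lebesgue_integral_def)
    then have "(LINT x|m. indicator P x * r x - indicator N x * r x) = 0"
      using i[OF PN(1)] i[OF PN(2)] by simp
    moreover have "(LINT x|m. \<bar>r x\<bar>) = (LINT x|m. indicator P x * r x - indicator N x * r x)"
      by (intro Bochner_Integration.integral_cong) (auto simp: P_def N_def indicator_def)
    ultimately have "(LINT x|m. \<bar>r x\<bar>) = 0" by simp
    then have "AE x in m. \<bar>r x\<bar> = 0"
      using r by (subst (asm) integral_nonneg_eq_0_iff_AE) auto
    then show ?thesis by simp
  qed
  have si: "integrable m (\<lambda>x. indicator A x *\<^sub>R h x)" if "A \<in> sets m" for A
    using integrable_mult_indicator[OF that h] .
  have "AE x in m. Re (h x) = 0"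
  proof (rule real)
    fix A assume "A \<in> sets m"
    then show "(LINT x:A|m. Re (h x)) = 0"
      using integral_Re[OF si] z by (simp add: set_lebesgue_integral_def)
  qed (use h in simp)
  moreover have "AE x in m. Im (h x) = 0"
  proof (rule real)
    fix A assume "A \<in> sets m"
    then show "(LINT x:A|m. Im (h x)) = 0"
      using integral_Im[OF si] z by (simp add: set_lebesgue_integral_def)
  qed (use h in simp)
  ultimately show ?thesis by eventually_elim (simp add: complex_eq_iff)
qed

locale conv_measure = orlicz_group m Phi Psi
  for m :: "'g::{group_add,t2_space} measure" and Phi Psi +
  fixes mu :: "'g set \<Rightarrow> complex"
  assumes mu_radon: "complex_radon_measure mu" and mu_UNIV: "mu UNIV \<noteq> 0"
begin

abbreviation nu where "nu \<equiv> conv_vm mu"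

lemma mu_ca: "countably_additive_c mu"
  using mu_radon by (simp add: complex_radon_measure_def)

lemma mu_regular: "inner_regular (var_measure mu)"
  using mu_radon by (intro radon_measure_inner_regular[OF compact_UNIV] finite_measure_var_measure mu_ca)
    (simp add: complex_radon_measure_def)

definition M where "M = measure (var_measure mu) UNIV"

lemma measurable_shift: "(\<lambda>s::'g. - s + t) \<in> measurable borel borel"
  by (intro borel_measurable_continuous_onI group_continuous)

lemma shift_sets: "A \<in> sets borel \<Longrightarrow> {s::'g. - s + t \<in> A} \<in> sets borel"
  using measurable_sets[OF measurable_shift, of A t] by (simp add: vimage_def)

lemma nu_eq: "A \<in> sets borel \<Longrightarrow> nu A t = mu {s. - s + t \<in> A}"
proof -
  assume A: "A \<in> sets borel"
  have "(\<lambda>s. indicator A (- s + t) :: complex) = indicator {s. - s + t \<in> A}"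
    by (auto simp: indicator_def)
  then show ?thesis unfolding conv_vm_def using cintegral_indicator[OF mu_ca shift_sets[OF A]] by simp
qed

lemma cmod_mu_le: "A \<in> sets borel \<Longrightarrow> cmod (mu A) \<le> M"
proof -
  assume A: "A \<in> sets borel"
  interpret V: finite_measure "var_measure mu" by (rule finite_measure_var_measure[OF mu_ca])
  have "cmod (mu A) \<le> measure (var_measure mu) A" by (rule measure_var_measure_ge[OF mu_ca A])
  also have "\<dots> \<le> M" unfolding M_def using A by (intro V.finite_measure_mono) auto
  finally show ?thesis .
qed

lemma cmod_nu_le: "A \<in> sets borel \<Longrightarrow> cmod (nu A t) \<le> M"
  unfolding nu_eq by (intro cmod_mu_le shift_sets)

lemma M_nonneg: "M \<ge> 0"
  by (simp add: M_def)

lemma measurable_shift2: "(\<lambda>x::'g \<times> 'g. - fst x + snd x) \<in> measurable borel borel"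
  by (intro borel_measurable_continuous_onI group_continuous)

lemma indicator_shift_measurable:
  assumes A: "A \<in> sets borel"
  shows "(\<lambda>x::'g \<times> 'g. indicator A (- fst x + snd x) :: complex) \<in> borel_measurable borel"
  by (rule measurable_compose[OF measurable_shift2]) (use A in simp)

lemma nu_measurable: "A \<in> sets borel \<Longrightarrow> nu A \<in> borel_measurable borel"
proof -
  assume A: "A \<in> sets borel"
  have "cmod (indicator A (- fst x + snd x)) \<le> 1" for x :: "'g \<times> 'g" by (simp add: indicator_def)
  from borel_measurable_cintegral_section[OF mu_ca mu_regular inner_regular_m indicator_shift_measurable[OF A] this]
  show ?thesis by (simp add: conv_vm_def[abs_def])
qed

lemma nu_L: "A \<in> sets borel \<Longrightarrow> nu A \<in> L"
  by (rule bounded_in_L[of _ M]) (simp_all add: borel_measurable_m nu_measurable cmod_nu_le)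

lemma nu_sums:
  assumes A: "range A \<subseteq> sets borel" "disjoint_family A"
  shows "(\<lambda>n. nu (A n) t) sums nu (\<Union>n. A n) t"
proof -
  have "(\<lambda>n. mu {s. - s + t \<in> A n}) sums mu (\<Union>n. {s. - s + t \<in> A n})"
    using A by (intro cac_sums[OF mu_ca]) (auto simp: disjoint_family_on_def intro!: shift_sets)
  moreover have "(\<Union>n. {s. - s + t \<in> A n}) = {s. - s + t \<in> (\<Union>n. A n)}" by auto
  moreover have "nu (A n) t = mu {s. - s + t \<in> A n}" for n using A by (intro nu_eq) auto
  moreover have "nu (\<Union>n. A n) t = mu {s. - s + t \<in> (\<Union>n. A n)}" using A by (intro nu_eq) auto
  ultimately show ?thesis by simp
qed

lemma nu_empty: "nu {} = (\<lambda>t. 0)"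
  using cac_empty[OF mu_ca] by (auto simp: nu_eq)

lemma nu_union: "A \<in> sets borel \<Longrightarrow> B \<in> sets borel \<Longrightarrow> A \<inter> B = {} \<Longrightarrow> nu (A \<union> B) t = nu A t + nu B t"
proof -
  assume A: "A \<in> sets borel" "B \<in> sets borel" "A \<inter> B = {}"
  have "{s. - s + t \<in> A \<union> B} = {s. - s + t \<in> A} \<union> {s. - s + t \<in> B}" by auto
  moreover have "mu ({s. - s + t \<in> A} \<union> {s. - s + t \<in> B}) = mu {s. - s + t \<in> A} + mu {s. - s + t \<in> B}"
    using A by (intro cac_union[OF mu_ca] shift_sets) auto
  ultimately show ?thesis using A by (simp add: nu_eq sets.Un)
qed

text \<open>The partial sums converge pointwise because \<open>mu\<close> is countably additive and
  stay below \<open>M\<close>; bounded convergence then holds in Luxemburg norm, and a bounded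
  functional preserves it.\<close>

lemma dual_nu_countably_additive:
  assumes ph: "ph \<in> orlicz_dual Phi m"
  shows "countably_additive_c (\<lambda>E. ph (nu E))"
  unfolding countably_additive_c_def
proof safe
  fix A :: "nat \<Rightarrow> 'g set" assume A: "range A \<subseteq> sets borel" "disjoint_family A"
  have Un: "(\<Union>n. A n) \<in> sets borel" "(\<Union>i<n. A i) \<in> sets borel" for n using A by auto
  have nL: "nu (A i) \<in> L" for i using A by (intro nu_L) auto
  obtain C where C: "C > 0" "\<forall>f\<in>L. cmod (ph f) \<le> C * lux f" by (rule dual_bound[OF ph])
  define d where "d n t = (\<Sum>i<n. nu (A i) t) - nu (\<Union>n. A n) t" for n t
  have sL: "(\<lambda>t. \<Sum>i<n. nu (A i) t) \<in> L" for n
    using L_sum[of "{..<n}" "\<lambda>i. nu (A i)" "\<lambda>_. 1"] nL by simp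
  have dL: "d n \<in> L" for n unfolding d_def by (intro L_diff sL nu_L Un)
  have fin: "(\<Sum>i<n. nu (A i) t) = nu (\<Union>i<n. A i) t" for n t
  proof (induction n)
    case (Suc n)
    have "(\<Union>i<n. A i) \<inter> A n = {}"
    proof -
      have "A i \<inter> A n = {}" if "i < n" for i using disjoint_family_onD[OF A(2), of i n] that by simp
      then show ?thesis by blast
    qed
    then have "nu ((\<Union>i<n. A i) \<union> A n) t = nu (\<Union>i<n. A i) t + nu (A n) t"
      using A by (intro nu_union) auto
    moreover have "(\<Union>i<Suc n. A i) = (\<Union>i<n. A i) \<union> A n" by (simp add: lessThan_Suc Un_commute)
    ultimately show ?case using Suc by simp
  qed (simp add: nu_empty)
  have dB: "cmod (d n t) \<le> 2 * M" for n t
    unfolding d_def fin using norm_triangle_ineq4[of "nu (\<Union>i<n. A i) t" "nu (\<Union>n. A n) t"]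
      cmod_nu_le[OF Un(1), of t] cmod_nu_le[OF Un(2), of n t] by linarith
  have dlim: "(\<lambda>n. d n t) \<longlonglongrightarrow> 0" for t
    unfolding d_def using nu_sums[OF A, of t] by (simp add: sums_def LIM_zero_iff)
  have "(\<lambda>n. lux (d n)) \<longlonglongrightarrow> 0"
    using L_measurable[OF dL] dB dlim by (intro lux_bounded_convergence[where B="2 * M"])
  then have "(\<lambda>n. C * lux (d n)) \<longlonglongrightarrow> 0" by (rule tendsto_mult_right_zero)
  moreover have "\<forall>\<^sub>F n in sequentially. norm (ph (d n)) \<le> C * lux (d n)"
    using C(2) dL by (intro always_eventually allI) auto
  ultimately have "(\<lambda>n. ph (d n)) \<longlonglongrightarrow> 0" by (rule Lim_null_comparison[rotated])
  moreover have "ph (d n) = (\<Sum>i<n. ph (nu (A i))) - ph (nu (\<Union>n. A n))" for n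
    unfolding d_def using dual_diff[OF ph sL nu_L[OF Un(1)]] dual_sum[OF ph, of "{..<n}" "\<lambda>i. nu (A i)" "\<lambda>_. 1"] nL
    by simp
  ultimately show "(\<lambda>n. ph (nu (A n))) sums ph (nu (\<Union>n. A n))"
    by (simp add: sums_def LIM_zero_iff)
qed

text \<open>The density, with respect to \<open>m\<close>, of the scalar measure obtained by pairing
  the convolution measure with \<open>w\<close>. It is defined at every point \<open>u\<close>,
  which the covering argument exploits.\<close>

definition W where "W w u = cintegral mu (\<lambda>s. w (s + u)) UNIV"

lemma measurable_add2: "(\<lambda>x::'g \<times> 'g. fst x + snd x) \<in> measurable borel borel"
  by (intro borel_measurable_continuous_onI group_continuous)

lemma
  assumes w: "w \<in> borel_measurable borel" "\<And>x. cmod (w x) \<le> B"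
  shows W_measurable: "W w \<in> borel_measurable borel"
    and W_bounded: "cmod (W w u) \<le> 4 * B * M"
proof -
  show "W w \<in> borel_measurable borel"
    using borel_measurable_cintegral_section[OF mu_ca mu_regular inner_regular_m measurable_compose[OF measurable_add2 w(1)], of B] w(2)
    by (simp add: W_def[abs_def])
  interpret V: finite_measure "var_measure mu" by (rule finite_measure_var_measure[OF mu_ca])
  have "(\<lambda>s. w (s + u)) \<in> borel_measurable (var_measure mu)"
    using measurable_compose[OF measurable_translates(2) w(1)] by (simp cong: measurable_cong_sets)
  then have i: "integrable (var_measure mu) (\<lambda>s. w (s + u))"
    using w(2) by (intro V.integrable_const_bound[of _ B]) auto
  have "cmod (W w u) \<le> 4 * (LINT s|var_measure mu. cmod (w (s + u)))"
    unfolding W_def by (rule cmod_cintegral_le[OF mu_ca _ _ i]) auto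
  also have "(LINT s|var_measure mu. cmod (w (s + u))) \<le> (LINT s|var_measure mu. B)"
    using i w(2) by (intro integral_mono) auto
  also have "\<dots> = B * M" by (simp add: M_def)
  finally show "cmod (W w u) \<le> 4 * B * M" by simp
qed

lemma W_integrable:
  assumes w: "w \<in> borel_measurable borel" "\<And>x. cmod (w x) \<le> B"
  shows "integrable m (W w)"
proof (rule integrable_const_bound)
  show "AE u in m. cmod (W w u) \<le> 4 * B * M" using W_bounded[OF w] by (intro AE_I2)
qed (simp add: borel_measurable_m W_measurable[OF w])

text \<open>Fubini is used twice, with the left translation \<open>t = s + u\<close> in between; the
  indicator then depends on \<open>u\<close> alone and leaves the integral against
  \<open>mu\<close>.\<close>

lemma nu_duality:
  assumes w: "w \<in> borel_measurable borel" "\<And>x. cmod (w x) \<le> B" and A: "A \<in> sets borel"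
  shows "(LINT t|m. nu A t * w t) = (LINT u:A|m. W w u)"
proof -
  note F = cintegral_Fubini[OF mu_ca mu_regular inner_regular_m]
  have ind: "(indicator A x :: complex) = of_real (indicator A x)" for x :: 'g by (simp add: indicator_def)
  have H1: "(\<lambda>x::'g \<times> 'g. indicator A (- fst x + snd x) * w (snd x)) \<in> borel_measurable borel"
  proof -
    have "(\<lambda>x::'g \<times> 'g. w (snd x)) \<in> borel_measurable borel"
      by (rule measurable_compose[OF borel_measurable_continuous_onI w(1)]) (intro continuous_intros)
    then show ?thesis by (rule borel_measurable_times[OF indicator_shift_measurable[OF A]])
  qed
  have B1: "cmod (indicator A (- fst x + snd x) * w (snd x)) \<le> B" for x :: "'g \<times> 'g"
    using w(2)[of "snd x"] order_trans[OF norm_ge_zero w(2)] by (auto simp: indicator_def)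
  have H2: "(\<lambda>x::'g \<times> 'g. indicator A (snd x) * w (fst x + snd x)) \<in> borel_measurable borel"
  proof -
    have "(\<lambda>x::'g \<times> 'g. indicator A (snd x) :: complex) \<in> borel_measurable borel"
      by (rule measurable_compose[OF borel_measurable_continuous_onI]) (use A in \<open>auto intro!: continuous_intros\<close>)
    then show ?thesis by (rule borel_measurable_times) (rule measurable_compose[OF measurable_add2 w(1)])
  qed
  have B2: "cmod (indicator A (snd x) * w (fst x + snd x)) \<le> B" for x :: "'g \<times> 'g"
    using w(2)[of "fst x + snd x"] order_trans[OF norm_ge_zero w(2)] by (auto simp: indicator_def)
  have "(LINT t|m. nu A t * w t) = (LINT t|m. cintegral mu (\<lambda>s. indicator A (- s + t) * w t) UNIV)"
    by (simp add: conv_vm_def mult.commute[of _ "w _"] cintegral_cmult)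
  also have "\<dots> = cintegral mu (\<lambda>s. LINT t|m. indicator A (- s + t) * w t) UNIV"
    using F[OF H1 B1] by simp
  also have "(\<lambda>s. LINT t|m. indicator A (- s + t) * w t) = (\<lambda>s. LINT u|m. indicator A u * w (s + u))"
  proof
    fix s
    have "(\<lambda>t. indicator A (- s + t) * w t) \<in> borel_measurable borel"
      using borel_measurable_section(2)[OF H1, of s] by simp
    from integral_left[OF this, of s]
    show "(LINT t|m. indicator A (- s + t) * w t) = (LINT u|m. indicator A u * w (s + u))"
      by (simp add: add.assoc[symmetric])
  qed
  also have "cintegral mu (\<lambda>s. LINT u|m. indicator A u * w (s + u)) UNIV
      = (LINT u|m. cintegral mu (\<lambda>s. indicator A u * w (s + u)) UNIV)"
    using F[OF H2 B2] by simp
  also have "\<dots> = (LINT u:A|m. W w u)"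
    by (simp add: W_def cintegral_cmult set_lebesgue_integral_def scaleR_conv_of_real ind)
  finally show ?thesis .
qed

lemma nu_UNIV: "nu UNIV = (\<lambda>t. mu UNIV)"
  by (auto simp: nu_eq)

text \<open>\<open>nu UNIV\<close> is the constant function \<open>mu UNIV\<close>, so the
  hypothesis on the total mass of \<open>mu\<close> supplies a set of positive variation.\<close>

lemma lux_nu_UNIV_pos: "lux (nu UNIV) > 0"
proof -
  obtain C where C: "C > 0" "\<forall>f\<in>L. integrable m f \<and> (LINT x|m. cmod (f x)) \<le> C * lux f"
    by (rule L_integrable)
  have "(LINT x|m. cmod (nu UNIV x)) \<le> C * lux (nu UNIV)" using C nu_L[of UNIV] by auto
  then have "cmod (mu UNIV) \<le> C * lux (nu UNIV)" by (simp add: nu_UNIV measure_UNIV)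
  moreover have "cmod (mu UNIV) > 0" using mu_UNIV by simp
  ultimately show ?thesis using C(1) by (metis less_le_trans zero_less_mult_pos)
qed

text \<open>Left translates of a null set are null. By Fubini, for almost every \<open>t\<close> the
  set of \<open>s\<close> with \<open>- s + t \<in> E\<close> is null for the variation of
  \<open>mu\<close>, hence \<open>nu E\<close> vanishes almost everywhere.\<close>

lemma nu_null:
  assumes E: "E \<in> sets borel" and null: "emeasure m E = 0"
  shows "lux (nu E) = 0"
proof -
  let ?S = "{x::'g \<times> 'g. - fst x + snd x \<in> E}"
  have S: "?S \<in> sets borel" using measurable_sets[OF measurable_shift2 E] by (simp add: vimage_def)
  have "emeasure m {t. (s, t) \<in> ?S} = 0" for s
    using emeasure_left[OF E, of "- s"] null by simp
  then have "(\<integral>\<^sup>+t. emeasure (var_measure mu) {s. (s, t) \<in> ?S} \<partial>m) = 0"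
    using nn_integral_section_eq[OF mu_regular inner_regular_m S] by simp
  then have "AE t in m. emeasure (var_measure mu) {s. (s, t) \<in> ?S} = 0"
    using borel_measurable_emeasure_section[OF mu_regular S] by (subst (asm) nn_integral_0_iff_AE) (auto simp: borel_measurable_m)
  then have "AE t in m. nu E t = 0"
  proof eventually_elim
    case (elim t)
    then have "measure (var_measure mu) {s. - s + t \<in> E} = 0" by (simp add: measure_def)
    then show ?case using measure_var_measure_ge[OF mu_ca shift_sets[OF E, of t]] nu_eq[OF E, of t] by simp
  qed
  then show ?thesis
    using lux_cong_AE(2)[OF zero_L, of "nu E"] nu_measurable[OF E] by (simp add: lux_zero borel_measurable_m)
qed

lemma vvar_null:
  assumes A: "A \<in> sets borel" "emeasure m A = 0"
  shows "vvar Phi m nu A = 0"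
proof -
  have "(\<Sum>E\<in>P. ennreal (lux (nu E))) = 0" if P: "P \<in> borel_partitions A" for P
  proof (rule sum.neutral, rule ballI)
    fix E assume "E \<in> P"
    then have "E \<in> sets borel" "E \<subseteq> A" using P by (auto simp: borel_partitions_def)
    then show "ennreal (lux (nu E)) = 0" using nu_null emeasure_mono[of E A m] A by simp
  qed
  then show ?thesis unfolding vvar_def using singleton_borel_partition[OF A(1)] by (auto intro!: SUP_eq_const)
qed

text \<open>Continuity of the tests makes every \<open>W w\<close> continuous, so that the sets
  where \<open>cmod (W w u) > n\<close> form an open cover; the bound on the modular is invariant
  under right translation.\<close>

definition tests where "tests = {w. continuous_on UNIV w \<and> Psi.modular w 1 \<le> 1}"

lemma tests_bounded:
  assumes "continuous_on UNIV (w :: 'g \<Rightarrow> complex)"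
  obtains B where "w \<in> borel_measurable borel" "\<forall>x. cmod (w x) \<le> B"
proof -
  have "bounded (range w)" using compact_continuous_image[OF assms compact_UNIV] by (rule compact_imp_bounded)
  then show thesis using that borel_measurable_continuous_onI[OF assms] by (auto simp: bounded_iff)
qed

lemma W_continuous:
  assumes w: "continuous_on UNIV w"
  shows "continuous_on UNIV (W w)"
  unfolding continuous_on_def
proof (intro ballI tendstoI)
  fix u and e :: real assume e: "e > 0"
  obtain B where B: "w \<in> borel_measurable borel" "\<forall>x. cmod (w x) \<le> B" by (rule tests_bounded[OF w])
  have H: "continuous_on UNIV (\<lambda>x::'g \<times> 'g. w (fst x + snd x))"
    by (intro continuous_on_compose2[OF w] group_continuous) auto
  \<comment> \<open>The 4 is the constant of \<open>cmod_cintegral_le\<close>; \<open>M + 1\<close>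
    in the denominator keeps \<open>4 * d * M\<close> strictly below \<open>e\<close>.\<close>
  define d where "d = e / (4 * (M + 1))"
  have d: "d > 0" "4 * d * M < e" using e M_nonneg by (auto simp: d_def field_simps)
  obtain V where V: "open V" "u \<in> V" "\<And>v t. v \<in> V \<Longrightarrow> dist (w (fst (t, v) + snd (t, v))) (w (fst (t, u) + snd (t, u))) < d"
    using continuous_uniformly_in_parameter[OF compact_UNIV H d(1), of u] by metis
  interpret Vm: finite_measure "var_measure mu" by (rule finite_measure_var_measure[OF mu_ca])
  have "dist (W w v) (W w u) < e" if v: "v \<in> V" for v
  proof -
    have m: "(\<lambda>s. w (s + x)) \<in> borel_measurable borel" for x
      using measurable_compose[OF measurable_translates(2) B(1)] by simp
    have c: "cintegrable mu (\<lambda>s. w (s + x))" for x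
      using B(2) by (intro cintegrable_bounded[OF mu_ca m, of _ B]) auto
    have le: "cmod (w (s + v) - w (s + u)) \<le> d" for s
      using V(3)[OF v, of s] by (simp add: dist_norm less_imp_le)
    have "(\<lambda>s. w (s + v) - w (s + u)) \<in> borel_measurable (var_measure mu)"
      using m[of u] m[of v] by (simp cong: measurable_cong_sets)
    then have i: "integrable (var_measure mu) (\<lambda>s. w (s + v) - w (s + u))"
      using le by (intro Vm.integrable_const_bound[of _ d]) auto
    have "W w v - W w u = cintegral mu (\<lambda>s. w (s + v) - w (s + u)) UNIV"
      unfolding W_def by (rule cintegral_diff[OF c c, symmetric])
    then have "dist (W w v) (W w u) \<le> 4 * (LINT s|var_measure mu. cmod (w (s + v) - w (s + u)))"
      unfolding dist_norm using cmod_cintegral_le[OF mu_ca _ _ i] by simp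
    also have "(LINT s|var_measure mu. cmod (w (s + v) - w (s + u))) \<le> (LINT s|var_measure mu. d)"
      using i le by (intro integral_mono) auto
    also have "4 * (LINT s|var_measure mu. d) = 4 * d * M" by (simp add: M_def)
    finally show ?thesis using d(2) by simp
  qed
  then show "\<forall>\<^sub>F v in at u within UNIV. dist (W w v) (W w u) < e"
    using V(1,2) by (auto simp: eventually_at_topological)
qed

lemma tests_translate:
  assumes w: "w \<in> tests"
  shows "(\<lambda>t. w (t - u)) \<in> tests"
proof -
  have c: "continuous_on UNIV w" using w by (simp add: tests_def)
  have "continuous_on UNIV (\<lambda>t. w (t - u))"
    by (intro continuous_on_compose2[OF c] group_continuous) auto
  moreover have "Psi.modular (\<lambda>t. w (t - u)) 1 = Psi.modular w 1"
  proof -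
    have "(\<lambda>t. ennreal (Psi (cmod (w t) / 1))) \<in> borel_measurable borel"
      using Psi.Phi_measurable[OF borel_measurable_continuous_onI[OF c], of 1] by simp
    from nn_integral_right[OF this, of "- u"] show ?thesis by (simp add: Psi.modular_def)
  qed
  ultimately show ?thesis using w by (simp add: tests_def)
qed

text \<open>The translate \<open>t \<mapsto> w (t - u)\<close> is again a test, and its
  \<open>W\<close> at \<open>u\<close> is the integral of \<open>w\<close> itself. A bound at one
  point is thus a bound everywhere.\<close>

lemma W_tests_bound:
  assumes b: "\<And>w. w \<in> tests \<Longrightarrow> cmod (W w u) \<le> n" and w: "w \<in> tests"
  shows "cmod (cintegral mu w UNIV) \<le> n"
  using b[OF tests_translate[OF w, of u]] by (simp add: W_def)

text \<open>If no point evaluation of the functions \<open>W w\<close> is bounded on all test functions, compactness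
  yields, for each \<open>n\<close>, finitely many test functions one of which exceeds \<open>n\<close> at any given
  point; a bounded evaluation anywhere is moved to the neutral element by \<open>W_tests_bound\<close>.\<close>
lemma unbounded_tests:
  assumes "\<not> (\<exists>n. \<forall>w\<in>tests. cmod (cintegral mu w UNIV) \<le> n)"
  obtains D where "finite D" "D \<subseteq> tests" "\<forall>u. \<exists>w\<in>D. cmod (W w u) > n"
proof -
  have "\<exists>w\<in>tests. cmod (W w u) > n" for u
    using assms W_tests_bound[of u n] by (meson not_le)
  then have cover: "(UNIV :: 'g set) \<subseteq> (\<Union>w\<in>tests. {u. cmod (W w u) > n})" by auto
  have op: "open {u. cmod (W w u) > n}" if "w \<in> tests" for w
  proof -
    have "continuous_on UNIV (\<lambda>u. cmod (W w u))"
      using that by (intro continuous_on_norm W_continuous) (simp add: tests_def)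
    from open_Collect_less[OF continuous_on_const this] show ?thesis .
  qed
  obtain D where "D \<subseteq> tests" "finite D" "(UNIV :: 'g set) \<subseteq> (\<Union>w\<in>D. {u. cmod (W w u) > n})"
    using compactE_image[OF compact_UNIV, of tests "\<lambda>w. {u. cmod (W w u) > n}"] op cover by metis
  note D = this
  have "\<forall>u. \<exists>w\<in>D. cmod (W w u) > n"
  proof
    fix u
    have "u \<in> (\<Union>w\<in>D. {u. cmod (W w u) > n})" using D(3) by (rule subsetD) simp
    then show "\<exists>w\<in>D. cmod (W w u) > n" by simp
  qed
  then show thesis by (rule that[OF D(2,1)])
qed

lemma tests_functional:
  assumes w: "w \<in> tests"
  obtains B where "w \<in> borel_measurable borel" "\<forall>x. cmod (w x) \<le> B"
    "(\<lambda>h. LINT x|m. h x * w x) \<in> orlicz_dual Phi m"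
    "\<forall>f\<in>L. cmod (LINT x|m. f x * w x) \<le> 2 * lux f"
proof -
  have c: "continuous_on UNIV w" and mod: "Psi.modular w 1 \<le> 1" using w by (auto simp: tests_def)
  obtain B where B: "w \<in> borel_measurable borel" "\<forall>x. cmod (w x) \<le> B" by (rule tests_bounded[OF c])
  have wm: "w \<in> borel_measurable m" using B(1) by (simp add: borel_measurable_m)
  have "(\<lambda>h. LINT x|m. h x * w x) \<in> orlicz_dual Phi m" using B(2) by (intro test_functional(1)[OF wm _ mod]) auto
  moreover have "\<forall>f\<in>L. cmod (LINT x|m. f x * w x) \<le> 2 * lux f" using cmod_integral_Hoelder[OF _ wm mod] by blast
  ultimately show thesis using that B by blast
qed

text \<open>For each single test the density bounds \<open>W w\<close> by
  \<open>2 * lux (F u)\<close> almost everywhere. If the integrals of the tests were unbounded,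
  finitely many tests would force \<open>2 * lux (F u) > n\<close> almost everywhere, for every
  \<open>n\<close>, which no real number satisfies.\<close>

lemma Pettis_imp_bounded_tests:
  assumes F: "pettis_integrable_LPhi Phi m F" "\<forall>A\<in>sets borel. pettis_integral_is Phi m F A (nu A)"
  shows "\<exists>n. \<forall>w\<in>tests. cmod (cintegral mu w UNIV) \<le> n"
proof (rule ccontr)
  assume unb: "\<not> ?thesis"
  have FL: "F s \<in> L" for s using F(1) by (simp add: pettis_integrable_LPhi_def)
  have AE_le: "AE u in m. cmod (W w u) \<le> 2 * lux (F u)" if w: "w \<in> tests" for w
  proof -
    obtain B where B: "w \<in> borel_measurable borel" "\<forall>x. cmod (w x) \<le> B"
      and ph: "(\<lambda>h. LINT x|m. h x * w x) \<in> orlicz_dual Phi m"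
      and le: "\<forall>f\<in>L. cmod (LINT x|m. f x * w x) \<le> 2 * lux f" by (rule tests_functional[OF w])
    define p where "p s = (LINT x|m. F s x * w x)" for s
    have p: "integrable m p"
    proof -
      have "\<forall>ph\<in>orlicz_dual Phi m. integrable m (\<lambda>s. ph (F s))"
        using F(1) by (simp add: pettis_integrable_LPhi_def)
      from bspec[OF this ph] show ?thesis by (simp add: p_def[abs_def])
    qed
    have Wi: "integrable m (W w)" using W_integrable[OF B(1)] B(2) by blast
    \<comment> \<open>The Pettis integral and \<open>nu_duality\<close> compute the same pairing of
      \<open>nu A\<close> with \<open>w\<close>, so the two scalar densities agree almost
      everywhere.\<close>
    have "(LINT x:A|m. p x - W w x) = 0" if A: "A \<in> sets m" for A
    proof -
      have A': "A \<in> sets borel" using A by simp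
      have "(LINT s:A|m. p s) = (LINT x|m. nu A x * w x)"
      proof -
        have "\<forall>ph\<in>orlicz_dual Phi m. (LINT s:A|m. ph (F s)) = ph (nu A)"
          using F(2) A' by (simp add: pettis_integral_is_def)
        from bspec[OF this ph] show ?thesis by (simp add: p_def[abs_def])
      qed
      also have "\<dots> = (LINT u:A|m. W w u)" using B(2) by (intro nu_duality[OF B(1) _ A']) auto
      finally show ?thesis
        using A p Wi integrable_mult_indicator[OF A p] integrable_mult_indicator[OF A Wi]
        by (simp add: set_lebesgue_integral_def scaleR_diff_right)
    qed
    then have "AE x in m. p x - W w x = 0" using p Wi by (intro integral_zero_imp_AE_zero) auto
    then show ?thesis
    proof eventually_elim
      case (elim u)
      then have "W w u = p u" by simp
      then show ?case using le FL[of u] by (simp add: p_def)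
    qed
  qed
  have "AE u in m. real n < 2 * lux (F u)" for n :: nat
  proof -
    obtain D where D: "finite D" "D \<subseteq> tests" "\<forall>u. \<exists>w\<in>D. cmod (W w u) > real n"
      by (rule unbounded_tests[OF unb])
    have "AE u in m. \<forall>w\<in>D. cmod (W w u) \<le> 2 * lux (F u)"
      using D AE_le by (intro AE_finite_allI) auto
    then show ?thesis
    proof eventually_elim
      case (elim u)
      obtain w where "w \<in> D" "real n < cmod (W w u)" using D(3) by blast
      then show ?case using elim by (meson less_le_trans)
    qed
  qed
  then have "AE u in m. \<forall>n::nat. real n < 2 * lux (F u)"
    unfolding AE_all_countable by (intro allI)
  then have "AE u in m. \<not> True"
  proof eventually_elim
    case (elim u)
    obtain n :: nat where n: "2 * lux (F u) \<le> real n" using real_arch_simple by blast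
    have "real n < 2 * lux (F u)" using elim by (rule spec)
    with n show ?case by simp
  qed
  from emeasure_eq_0_AE[OF this] show False using emeasure_UNIV by simp
qed

lemma vvar_ge: "E \<in> sets borel \<Longrightarrow> ennreal (lux (nu E)) \<le> vvar Phi m nu E"
  unfolding vvar_eq_partition_var by (rule partition_var_ge)

text \<open>On a set where the real or imaginary part of \<open>W w\<close> has constant sign, its
  integral is the pairing of \<open>nu\<close> with \<open>w\<close>, at most twice the norm.
  Superadditivity of the variation rejoins the two sign sets without loss; real and imaginary parts
  together double the constant to 4.\<close>

lemma integral_W_le_vvar:
  assumes w: "w \<in> tests" and E: "E \<in> sets borel"
  shows "(\<integral>\<^sup>+u\<in>E. ennreal (cmod (W w u)) \<partial>m) \<le> 4 * vvar Phi m nu E"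
proof -
  obtain B where B: "w \<in> borel_measurable borel" "\<forall>x. cmod (w x) \<le> B"
    and le: "\<forall>f\<in>L. cmod (LINT x|m. f x * w x) \<le> 2 * lux f" by (rule tests_functional[OF w])
  have Wm: "W w \<in> borel_measurable borel" and Wi: "integrable m (W w)"
    using W_measurable[OF B(1)] W_integrable[OF B(1)] B(2) by blast+
  have bound: "ennreal (cmod (LINT u:F|m. W w u)) \<le> 2 * vvar Phi m nu F" if F: "F \<in> sets borel" for F
  proof -
    have "cmod (LINT u:F|m. W w u) \<le> 2 * lux (nu F)"
      using nu_duality[OF B(1) _ F] B(2) le nu_L[OF F] by metis
    then have "ennreal (cmod (LINT u:F|m. W w u)) \<le> 2 * ennreal (lux (nu F))"
      using lux_nonneg[OF nu_L[OF F]] by (metis ennreal_leI ennreal_mult' ennreal_numeral mult.commute zero_le_numeral ennreal_mult'')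
    also have "\<dots> \<le> 2 * vvar Phi m nu F" by (intro mult_left_mono vvar_ge F) auto
    finally show ?thesis .
  qed
  have part: "(\<integral>\<^sup>+u\<in>E. ennreal \<bar>r (W w u)\<bar> \<partial>m) \<le> 2 * vvar Phi m nu E"
    if r: "r \<in> {Re, Im}" for r :: "complex \<Rightarrow> real"
  proof -
    have rl: "bounded_linear r" using r by (auto intro: bounded_linear_Re bounded_linear_Im)
    have rm: "(\<lambda>u. r (W w u)) \<in> borel_measurable borel" using r Wm by auto
    have rle: "\<bar>r z\<bar> \<le> cmod z" for z using r by (auto simp: abs_Re_le_cmod abs_Im_le_cmod)
    define P where "P = {u. r (W w u) \<ge> 0}"
    define N where "N = {u. r (W w u) < 0}"
    have PN: "P \<in> sets borel" "N \<in> sets borel" unfolding P_def N_def using rm by measurable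
    have ri: "integrable m (\<lambda>u. r (W w u))" by (rule integrable_bounded_linear[OF rl Wi])
    have si: "integrable m (\<lambda>u. indicator F u *\<^sub>R W w u)" if "F \<in> sets borel" for F
      using integrable_mult_indicator[of F m "W w"] that Wi by simp
    have rint: "(LINT u|m. indicator F u * r (W w u)) = r (LINT u:F|m. W w u)" if "F \<in> sets borel" for F
      unfolding set_lebesgue_integral_def integral_bounded_linear[OF rl si[OF that], symmetric]
      using r by auto
    have sgn: "(\<integral>\<^sup>+u. ennreal (indicator F u * \<bar>r (W w u)\<bar>) \<partial>m) \<le> 2 * vvar Phi m nu F"
      if F: "F \<in> sets borel" and c: "(\<forall>u\<in>F. r (W w u) \<ge> 0) \<or> (\<forall>u\<in>F. r (W w u) \<le> 0)" for F
    proof -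
      have i: "integrable m (\<lambda>u. indicator F u * r (W w u))"
        using integrable_mult_indicator[of F m "\<lambda>u. r (W w u)"] F ri by simp
      have "(\<integral>\<^sup>+u. ennreal (indicator F u * \<bar>r (W w u)\<bar>) \<partial>m) = ennreal (LINT u|m. indicator F u * \<bar>r (W w u)\<bar>)"
      proof (rule nn_integral_eq_integral)
        show "integrable m (\<lambda>u. indicator F u * \<bar>r (W w u)\<bar>)"
          using integrable_abs[OF i] by (simp add: abs_mult)
      qed auto
      also have "(LINT u|m. indicator F u * \<bar>r (W w u)\<bar>) = \<bar>LINT u|m. indicator F u * r (W w u)\<bar>"
        using c
      proof
        assume c: "\<forall>u\<in>F. r (W w u) \<ge> 0"
        have "(LINT u|m. indicator F u * r (W w u)) \<ge> 0" using c by (intro integral_nonneg_AE) (auto simp: indicator_def)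
        moreover have "(LINT u|m. indicator F u * \<bar>r (W w u)\<bar>) = (LINT u|m. indicator F u * r (W w u))"
          using c by (intro Bochner_Integration.integral_cong) (auto simp: indicator_def)
        ultimately show ?thesis by simp
      next
        assume c: "\<forall>u\<in>F. r (W w u) \<le> 0"
        have "(LINT u|m. - (indicator F u * r (W w u))) \<ge> 0" using c by (intro integral_nonneg_AE) (auto simp: indicator_def)
        moreover have "(LINT u|m. indicator F u * \<bar>r (W w u)\<bar>) = (LINT u|m. - (indicator F u * r (W w u)))"
          using c by (intro Bochner_Integration.integral_cong) (auto simp: indicator_def)
        ultimately show ?thesis by simp
      qed
      also have "\<dots> \<le> cmod (LINT u:F|m. W w u)" unfolding rint[OF F] by (rule rle)
      finally show ?thesis using bound[OF F] by (meson ennreal_leI order_trans)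
    qed
    have "(\<integral>\<^sup>+u\<in>E. ennreal \<bar>r (W w u)\<bar> \<partial>m)
        = (\<integral>\<^sup>+u. ennreal (indicator (E \<inter> P) u * \<bar>r (W w u)\<bar>) + ennreal (indicator (E \<inter> N) u * \<bar>r (W w u)\<bar>) \<partial>m)"
      by (intro nn_integral_cong) (auto simp: indicator_def P_def N_def)
    also have "\<dots> = (\<integral>\<^sup>+u. ennreal (indicator (E \<inter> P) u * \<bar>r (W w u)\<bar>) \<partial>m) + (\<integral>\<^sup>+u. ennreal (indicator (E \<inter> N) u * \<bar>r (W w u)\<bar>) \<partial>m)"
      using rm E PN by (intro nn_integral_add) (auto simp: borel_measurable_m)
    also have "\<dots> \<le> 2 * vvar Phi m nu (E \<inter> P) + 2 * vvar Phi m nu (E \<inter> N)"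
      using E PN by (intro add_mono sgn) (auto simp: P_def N_def)
    also have "\<dots> = 2 * (vvar Phi m nu (E \<inter> P) + vvar Phi m nu (E \<inter> N))" by (simp add: distrib_left)
    also have "\<dots> \<le> 2 * vvar Phi m nu ((E \<inter> P) \<union> (E \<inter> N))"
      unfolding vvar_eq_partition_var using E PN
      by (intro mult_left_mono partition_var_superadditive) (auto simp: nu_empty lux_zero P_def N_def)
    also have "(E \<inter> P) \<union> (E \<inter> N) = E" by (auto simp: P_def N_def)
    finally show ?thesis .
  qed
  have "(\<integral>\<^sup>+u\<in>E. ennreal (cmod (W w u)) \<partial>m) \<le> (\<integral>\<^sup>+u. ennreal \<bar>Re (W w u)\<bar> * indicator E u + ennreal \<bar>Im (W w u)\<bar> * indicator E u \<partial>m)"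
    by (intro nn_integral_mono) (auto simp: indicator_def cmod_le ennreal_plus[symmetric] intro!: ennreal_leI simp del: ennreal_plus)
  also have "\<dots> = (\<integral>\<^sup>+u\<in>E. ennreal \<bar>Re (W w u)\<bar> \<partial>m) + (\<integral>\<^sup>+u\<in>E. ennreal \<bar>Im (W w u)\<bar> \<partial>m)"
    using Wm E by (intro nn_integral_add) (auto simp: borel_measurable_m)
  also have "\<dots> \<le> 2 * vvar Phi m nu E + 2 * vvar Phi m nu E" by (intro add_mono part) auto
  also have "\<dots> = 4 * vvar Phi m nu E" by (simp add: distrib_right[symmetric])
  finally show ?thesis .
qed

text \<open>Unbounded tests would give \<open>n * m A \<le> 4 * |nu| A\<close> for every
  \<open>n\<close>. This is absurd, since positive variation implies \<open>m A > 0\<close> by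
  \<open>vvar_null\<close>.\<close>

lemma finite_vvar_imp_bounded_tests:
  assumes A: "A \<in> sets borel" "0 < vvar Phi m nu A" "vvar Phi m nu A < \<infinity>"
  shows "\<exists>n. \<forall>w\<in>tests. cmod (cintegral mu w UNIV) \<le> n"
proof (rule ccontr)
  assume unb: "\<not> ?thesis"
  have mA: "measure m A > 0"
  proof -
    have "emeasure m A \<noteq> 0" using vvar_null[OF A(1)] A(2) by fastforce
    then have "measure m A \<noteq> 0" by (simp add: emeasure_eq_measure)
    then show ?thesis by (simp add: zero_less_measure_iff)
  qed
  have le: "ennreal (real n) * emeasure m A \<le> 4 * vvar Phi m nu A" for n :: nat
  proof -
    obtain D where D: "finite D" "D \<subseteq> tests" "\<forall>u. \<exists>w\<in>D. cmod (W w u) > real n"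
      by (rule unbounded_tests[OF unb])
    obtain k :: nat and ws where ws: "D = ws ` {i. i < k}"
      using finite_imp_nat_seg_image_inj_on[OF D(1)] by blast
    have Wm: "W (ws i) \<in> borel_measurable borel" if "i < k" for i
      using that D(2) ws by (intro borel_measurable_continuous_onI W_continuous) (auto simp: tests_def)
    \<comment> \<open>Part of \<open>A\<close> on which the \<open>i\<close>-th test exceeds
      \<open>n\<close>. These parts cover \<open>A\<close>; made disjoint, each one is estimated
      with its own test, and superadditivity collects the variations.\<close>
    define E where "E i = (if i < k then {u\<in>A. cmod (W (ws i) u) > real n} else {})" for i
    have E: "E i \<in> sets borel" for i
    proof (cases "i < k")
      case True
      have "(\<lambda>u. cmod (W (ws i) u)) \<in> borel_measurable borel" using Wm[OF True] by simp
      then have "{u\<in>space borel. real n < cmod (W (ws i) u)} \<in> sets borel" by (rule borel_measurable_less[OF borel_measurable_const])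
      then have "A \<inter> {u. cmod (W (ws i) u) > real n} \<in> sets borel" using A(1) by simp
      then show ?thesis using True by (simp add: E_def Int_def)
    qed (simp add: E_def)
    have EA: "(\<Union>i\<in>{0..<k}. disjointed E i) = A"
      unfolding finite_UN_disjointed_eq
    proof (intro equalityI subsetI)
      fix x assume x: "x \<in> A"
      obtain w where "w \<in> D" "real n < cmod (W w x)" using D(3) by blast
      then obtain i where "i < k" "real n < cmod (W (ws i) x)" unfolding ws by blast
      then show "x \<in> (\<Union>i\<in>{0..<k}. E i)" using x by (intro UN_I[of i]) (simp_all add: E_def)
    qed (auto simp: E_def)
    have dE: "disjointed E i \<in> sets borel" for i
      using E sets.range_disjointed_sets[of E borel] by auto
    have disj: "disjoint_family_on (disjointed E) {0..<k}"
      using disjoint_family_disjointed[of E] by (rule disjoint_family_on_mono[rotated]) simp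
    have "ennreal (real n) * emeasure m (disjointed E i) \<le> 4 * vvar Phi m nu (disjointed E i)" if i: "i \<in> {0..<k}" for i
    proof -
      have t: "ws i \<in> tests" using i D(2) ws by auto
      have "ennreal (real n) * emeasure m (disjointed E i) = (\<integral>\<^sup>+u. ennreal (real n) * indicator (disjointed E i) u \<partial>m)"
        using dE by (simp add: nn_integral_cmult_indicator)
      also have "\<dots> \<le> (\<integral>\<^sup>+u\<in>disjointed E i. ennreal (cmod (W (ws i) u)) \<partial>m)"
        using i disjointed_subset[of E i] by (intro nn_integral_mono) (auto simp: indicator_def E_def intro!: ennreal_leI)
      also have "\<dots> \<le> 4 * vvar Phi m nu (disjointed E i)" by (rule integral_W_le_vvar[OF t dE])
      finally show ?thesis .
    qed
    then have "(\<Sum>i\<in>{0..<k}. ennreal (real n) * emeasure m (disjointed E i)) \<le> (\<Sum>i\<in>{0..<k}. 4 * vvar Phi m nu (disjointed E i))"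
      by (rule sum_mono)
    also have "\<dots> = 4 * (\<Sum>i\<in>{0..<k}. vvar Phi m nu (disjointed E i))" by (simp add: sum_distrib_left)
    also have "\<dots> \<le> 4 * vvar Phi m nu (\<Union>i\<in>{0..<k}. disjointed E i)"
      unfolding vvar_eq_partition_var using dE disj
      by (intro mult_left_mono partition_var_sum_le) (auto simp: nu_empty lux_zero)
    finally have "ennreal (real n) * (\<Sum>i\<in>{0..<k}. emeasure m (disjointed E i)) \<le> 4 * vvar Phi m nu A"
      by (simp add: EA sum_distrib_left)
    moreover have "(\<Sum>i\<in>{0..<k}. emeasure m (disjointed E i)) = emeasure m (\<Union>i\<in>{0..<k}. disjointed E i)"
      using dE disj by (intro sum_emeasure) auto
    ultimately show ?thesis by (simp add: EA)
  qed
  obtain v where v: "v \<ge> 0" "vvar Phi m nu A = ennreal v" using A(3) by (cases "vvar Phi m nu A") auto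
  obtain n :: nat where n: "4 * v / measure m A < real n" using reals_Archimedean2 by blast
  have "ennreal (real n * measure m A) \<le> ennreal (4 * v)"
    using le[of n] v by (simp add: emeasure_eq_measure ennreal_mult)
  then have "real n * measure m A \<le> 4 * v" using v(1) by (subst (asm) ennreal_le_iff) auto
  then show False using n mA by (simp add: field_simps)
qed

end

section \<open>Densities and finite variation\<close>

text \<open>Approximating in \<open>L1\<close> of a single measure that dominates both
  \<open>m\<close> and the variation of \<open>mu\<close> yields one continuous function that is
  close for both.\<close>

definition sum_measure :: "'a::topological_space measure \<Rightarrow> 'a measure \<Rightarrow> 'a measure" where
  "sum_measure p q = measure_of UNIV (sets borel) (\<lambda>A. emeasure p A + emeasure q A)"

lemma sets_sum_measure [simp]: "sets (sum_measure p q) = sets borel"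
  by (simp add: sum_measure_def sets.sigma_sets_eq[of borel, simplified])

lemma emeasure_sum_measure:
  assumes "sets p = sets borel" "sets q = sets borel" "A \<in> sets borel"
  shows "emeasure (sum_measure p q) A = emeasure p A + emeasure q A"
proof (rule emeasure_measure_of[OF sum_measure_def])
  show "countably_additive (sets (sum_measure p q)) (\<lambda>A. emeasure p A + emeasure q A)"
  proof (rule countably_additiveI)
    fix A :: "nat \<Rightarrow> 'a set" assume A: "range A \<subseteq> sets (sum_measure p q)" "disjoint_family A"
    then have "(\<Sum>i. emeasure p (A i)) = emeasure p (\<Union>i. A i)" "(\<Sum>i. emeasure q (A i)) = emeasure q (\<Union>i. A i)"
      using assms by (auto intro!: suminf_emeasure)
    moreover have "(\<Sum>i. emeasure p (A i) + emeasure q (A i)) = (\<Sum>i. emeasure p (A i)) + (\<Sum>i. emeasure q (A i))"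
      by (intro suminf_add[symmetric] summableI)
    ultimately show "(\<Sum>i. emeasure p (A i) + emeasure q (A i)) = emeasure p (\<Union>i. A i) + emeasure q (\<Union>i. A i)"
      by simp
  qed
qed (use assms in \<open>auto simp: positive_def\<close>)

lemma inner_regular_sum_measure:
  fixes p q :: "'a::t2_space measure"
  assumes p: "inner_regular p" and q: "inner_regular q"
  shows "inner_regular (sum_measure p q)"
  unfolding inner_regular_def
proof (intro conjI ballI allI impI)
  interpret p: finite_measure p using p by (rule inner_regularD)
  interpret q: finite_measure q using q by (rule inner_regularD)
  have sp: "sets p = sets borel" "space p = UNIV" "sets q = sets borel" "space q = UNIV"
    using inner_regularD[OF p] inner_regularD[OF q] by auto
  have e: "emeasure (sum_measure p q) A = ennreal (measure p A + measure q A)" if "A \<in> sets borel" for A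
    using that sp by (simp add: emeasure_sum_measure p.emeasure_eq_measure q.emeasure_eq_measure)
  show "finite_measure (sum_measure p q)"
    using sets_eq_imp_space_eq[OF sets_sum_measure[of p q]] by (intro finite_measureI) (simp add: e)
  fix A :: "'a set" and d :: real assume A: "A \<in> sets borel" and d: "d > 0"
  obtain K where K: "K \<subseteq> A" "compact K" "measure p (A - K) < d / 2"
    using inner_regular_compact[OF p A half_gt_zero[OF d]] .
  obtain K' where K': "K' \<subseteq> A" "compact K'" "measure q (A - K') < d / 2"
    using inner_regular_compact[OF q A half_gt_zero[OF d]] .
  have s: "A - K \<in> sets borel" "A - K' \<in> sets borel" "A - (K \<union> K') \<in> sets borel"
    using A K K' by (auto intro: borel_compact)
  have "measure p (A - (K \<union> K')) \<le> measure p (A - K)" "measure q (A - (K \<union> K')) \<le> measure q (A - K')"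
    using s sp by (auto intro!: p.finite_measure_mono q.finite_measure_mono)
  moreover have "measure (sum_measure p q) (A - (K \<union> K')) = measure p (A - (K \<union> K')) + measure q (A - (K \<union> K'))"
    unfolding measure_def[of "sum_measure p q"] e[OF s(3)] by (rule enn2real_ennreal) simp
  ultimately show "\<exists>K\<subseteq>A. compact K \<and> measure (sum_measure p q) (A - K) < d"
    using K K' by (intro exI[of _ "K \<union> K'"]) auto
qed simp

lemma Radon_Nikodym_integrable:
  assumes "finite_measure m" "finite_measure p" and ac: "absolutely_continuous m p" and sets: "sets p = sets m"
  obtains f :: "'a \<Rightarrow> real" where "integrable m f" "\<forall>A\<in>sets m. measure p A = (LINT x:A|m. f x)"
proof -
  interpret m: finite_measure m by fact
  interpret p: finite_measure p by fact
  obtain f where f: "f \<in> borel_measurable m" "density m f = p"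
    using m.Radon_Nikodym[OF ac sets] by blast
  have sp: "space p = space m" using sets by (rule sets_eq_imp_space_eq)
  have pA: "emeasure p A = (\<integral>\<^sup>+x. f x * indicator A x \<partial>m)" if "A \<in> sets m" for A
    using f emeasure_density[of f m A] that by auto
  have "(\<integral>\<^sup>+x. f x \<partial>m) = emeasure p (space m)"
    using pA[of "space m"] by (simp cong: nn_integral_cong_simp)
  then have fin: "(\<integral>\<^sup>+x. f x \<partial>m) \<noteq> \<infinity>" by (simp add: p.emeasure_eq_measure)
  then have AE: "AE x in m. f x \<noteq> \<infinity>" using f(1) by (intro nn_integral_PInf_AE) auto
  define g where "g x = enn2real (f x)" for x
  have gm: "g \<in> borel_measurable m" unfolding g_def using f(1) by measurable
  have eq: "AE x in m. ennreal (g x) = f x"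
    using AE by eventually_elim (simp add: g_def less_top)
  have "(\<integral>\<^sup>+x. ennreal (norm (g x)) \<partial>m) = (\<integral>\<^sup>+x. f x \<partial>m)"
    using eq by (intro nn_integral_cong_AE) (auto simp: g_def)
  then have gi: "integrable m g" using gm fin by (intro integrableI_bounded) (auto simp: less_top)
  have "measure p A = (LINT x:A|m. g x)" if A: "A \<in> sets m" for A
  proof -
    have i: "integrable m (\<lambda>x. indicator A x * g x)" using integrable_mult_indicator[OF A gi] by simp
    have "ennreal (LINT x|m. indicator A x * g x) = (\<integral>\<^sup>+x. ennreal (indicator A x * g x) \<partial>m)"
      using i by (intro nn_integral_eq_integral[symmetric]) (auto simp: g_def)
    also have "\<dots> = emeasure p A"
      unfolding pA[OF A] using eq
    proof (intro nn_integral_cong_AE, eventually_elim)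
      case (elim x)
      then show ?case by (auto simp: indicator_def)
    qed
    finally have "ennreal (LINT x|m. indicator A x * g x) = ennreal (measure p A)"
      by (simp add: p.emeasure_eq_measure)
    moreover have "(LINT x|m. indicator A x * g x) \<ge> 0" by (intro integral_nonneg_AE) (auto simp: g_def)
    ultimately show ?thesis by (simp add: set_lebesgue_integral_def)
  qed
  then show thesis using that[OF gi] by blast
qed

section \<open>From bounded tests to a density in the Orlicz space\<close>

context conv_measure
begin

lemma cintegral_le_lux_continuous:
  assumes n: "\<forall>w\<in>tests. cmod (cintegral mu w UNIV) \<le> n" and w: "continuous_on UNIV w"
  shows "cmod (cintegral mu w UNIV) \<le> n * Psi.lux w"
proof -
  obtain B where B: "w \<in> borel_measurable borel" "\<forall>x. cmod (w x) \<le> B" by (rule tests_bounded[OF w])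
  have wL: "w \<in> Psi.L" using B by (intro Psi.bounded_in_L[of _ B]) (auto simp: borel_measurable_m)
  have "(\<lambda>_. 0) \<in> tests" by (simp add: tests_def Psi.modular_zero)
  then have "cmod (cintegral mu (\<lambda>_. 0) UNIV) \<le> n" using n by blast
  then have n0: "n \<ge> 0" using norm_ge_zero order_trans by blast
  have *: "cmod (cintegral mu w UNIV) \<le> n * k" if k: "k > Psi.lux w" for k
  proof -
    have k0: "k > 0" using k Psi.lux_nonneg[OF wL] by simp
    have "Psi.modular (\<lambda>t. complex_of_real (1 / k) * w t) 1 = Psi.modular w k"
      using k0 by (simp add: Psi.modular_def norm_mult norm_divide)
    then have "(\<lambda>t. complex_of_real (1 / k) * w t) \<in> tests"
      unfolding tests_def mem_Collect_eq using Psi.lux_less[OF wL k] w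
      by (intro conjI continuous_on_mult continuous_on_const) simp_all
    then have "cmod (cintegral mu (\<lambda>t. complex_of_real (1 / k) * w t) UNIV) \<le> n" using n by blast
    then have "1 / k * cmod (cintegral mu w UNIV) \<le> n"
      unfolding cintegral_cmult using k0 by (simp add: norm_mult norm_divide)
    then show ?thesis using k0 by (simp add: pos_divide_le_eq)
  qed
  show ?thesis
  proof (rule field_le_epsilon)
    fix e :: real assume e: "e > 0"
    have "e / (n + 1) > 0" using e n0 by simp
    then have "cmod (cintegral mu w UNIV) \<le> n * (Psi.lux w + e / (n + 1))" by (intro *) simp
    also have "\<dots> = n * Psi.lux w + n / (n + 1) * e" by (simp add: distrib_left)
    also have "\<dots> \<le> n * Psi.lux w + 1 * e" using e n0 by (intro add_left_mono mult_right_mono) simp_all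
    also have "\<dots> = n * Psi.lux w + e" by simp
    finally show "cmod (cintegral mu w UNIV) \<le> n * Psi.lux w + e" .
  qed
qed

text \<open>A continuous \<open>g\<close> with the same bound is chosen close to \<open>w\<close> in
  \<open>L1\<close> of \<open>m\<close> plus the variation of \<open>mu\<close>. Closeness for the
  variation controls the integral against \<open>mu\<close>; closeness for \<open>m\<close>,
  together with the bound \<open>2 * B\<close>, controls the \<open>Psi\<close> norm.\<close>

lemma cintegral_le_lux:
  assumes n: "\<forall>w\<in>tests. cmod (cintegral mu w UNIV) \<le> n"
    and w: "w \<in> borel_measurable borel" "\<And>x. cmod (w x) \<le> B"
  shows "cmod (cintegral mu w UNIV) \<le> n * Psi.lux w"
proof (rule field_le_epsilon)
  fix e :: real assume e: "e > 0"
  have "(\<lambda>_. 0) \<in> tests" by (simp add: tests_def Psi.modular_zero)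
  then have "cmod (cintegral mu (\<lambda>_. 0) UNIV) \<le> n" using n by blast
  then have n0: "n \<ge> 0" using norm_ge_zero order_trans by blast
  have B0: "2 * B \<ge> 0" using w(2)[of 0] norm_ge_zero[of "w 0"] by linarith
  \<comment> \<open>The integral of \<open>w - g\<close> contributes at most \<open>4 * e'\<close>,
    and the excess of the norm of \<open>g\<close> over that of \<open>w\<close> at most
    \<open>n * e'\<close>.\<close>
  define e' where "e' = e / (4 + n)"
  have "e' * (4 + n) = e" using n0 by (simp add: e'_def)
  moreover have "4 * e' + n * e' = e' * (4 + n)" by (simp only: distrib_left mult.commute)
  moreover have "e' > 0" unfolding e'_def using e n0 by simp
  ultimately have e': "e' > 0" "4 * e' + n * e' = e" by (simp_all only:)
  obtain d where d: "d > 0" "\<forall>f. f \<in> borel_measurable m \<longrightarrow> (\<forall>x\<in>space m. cmod (f x) \<le> 2 * B) \<longrightarrow>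
      (LINT x|m. cmod (f x)) < d \<longrightarrow> Psi.lux f \<le> e'"
    by (rule Psi.lux_small_of_L1_small[OF B0 e'(1)])
  define S where "S = sum_measure m (var_measure mu)"
  have S: "inner_regular S" unfolding S_def by (rule inner_regular_sum_measure[OF inner_regular_m mu_regular])
  interpret S: finite_measure S using S by (rule inner_regularD)
  have Ssets: "sets S = sets borel" by (simp add: S_def)
  have leS: "emeasure m A \<le> emeasure S A" "emeasure (var_measure mu) A \<le> emeasure S A" if "A \<in> sets borel" for A
    using that by (simp_all add: S_def emeasure_sum_measure)
  have de: "min d e' > 0" using d(1) e'(1) by simp
  obtain g where g: "continuous_on UNIV g" "\<forall>x. cmod (g x) \<le> B" "(LINT x|S. cmod (w x - g x)) < min d e'"
    using bounded_continuous_dense_L1[OF compact_UNIV S w de] by metis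
  have gm: "g \<in> borel_measurable borel" using g(1) by (rule borel_measurable_continuous_onI)
  have hB: "cmod (w x - g x) \<le> 2 * B" for x
    using norm_triangle_ineq4[of "w x" "g x"] w(2)[of x] g(2)[rule_format, of x] by linarith
  have hm: "(\<lambda>x. w x - g x) \<in> borel_measurable borel" using w(1) gm by simp
  then have "(\<lambda>x. w x - g x) \<in> borel_measurable S" using Ssets by (simp cong: measurable_cong_sets)
  then have hS: "integrable S (\<lambda>x. w x - g x)" using hB by (intro S.integrable_const_bound[of _ "2 * B"]) auto
  have wL: "w \<in> Psi.L" using w by (intro Psi.bounded_in_L[of _ B]) (auto simp: borel_measurable_m)
  have gL: "g \<in> Psi.L" using gm g(2) by (intro Psi.bounded_in_L[of _ B]) (auto simp: borel_measurable_m)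
  have "(LINT x|m. cmod (w x - g x)) \<le> (LINT x|S. cmod (w x - g x))"
  proof -
    have "sets m = sets S" by (simp add: Ssets)
    from integral_dominated_measure(2)[OF this _ integrable_norm[OF hS]] leS Ssets
    have "norm (LINT x|m. cmod (w x - g x)) \<le> (LINT x|S. norm (cmod (w x - g x)))" by simp
    then show ?thesis by simp
  qed
  then have "Psi.lux (\<lambda>x. w x - g x) \<le> e'"
    using d(2) g(3) hm hB by (simp add: borel_measurable_m)
  then have luxg: "Psi.lux g \<le> Psi.lux w + e'"
    using Psi.lux_triangle_sub[OF gL wL] Psi.lux_diff_commute[OF gL wL] by simp
  have "cintegral mu w UNIV = cintegral mu (\<lambda>x. w x - g x) UNIV + cintegral mu g UNIV"
    using cintegral_add[OF cintegrable_bounded[OF mu_ca hm hB] cintegrable_bounded[OF mu_ca gm g(2)[rule_format]]] by simp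
  then have "cmod (cintegral mu w UNIV) \<le> cmod (cintegral mu (\<lambda>x. w x - g x) UNIV) + cmod (cintegral mu g UNIV)"
    by (simp add: norm_triangle_ineq)
  also have "cmod (cintegral mu (\<lambda>x. w x - g x) UNIV) \<le> 4 * (LINT x|S. cmod (w x - g x))"
    by (rule cmod_cintegral_le[OF mu_ca Ssets leS(2) hS])
  also have "\<dots> \<le> 4 * e'" using g(3) by simp
  also have "cmod (cintegral mu g UNIV) \<le> n * Psi.lux g" by (rule cintegral_le_lux_continuous[OF n g(1)])
  also have "\<dots> \<le> n * (Psi.lux w + e')" using luxg n0 by (rule mult_left_mono)
  finally show "cmod (cintegral mu w UNIV) \<le> n * Psi.lux w + e"
    using e'(2) by (simp add: distrib_left)
qed

text \<open>The indicator of a Haar null set has \<open>Psi\<close> norm 0, so \<open>mu\<close>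
  vanishes on it; applied to all its subsets, this makes the Jordan parts absolutely continuous. The
  Radon-Nikodym density pairs with a bounded \<open>w\<close> to the integral of \<open>w\<close>
  against \<open>mu\<close>, and \<open>norming_lux\<close> places it in \<open>L\<close>.\<close>

lemma bounded_tests_imp_density:
  assumes n: "\<forall>w\<in>tests. cmod (cintegral mu w UNIV) \<le> n"
  shows "\<exists>f\<in>L. \<forall>A\<in>sets borel. mu A = (LINT x:A|m. f x)"
proof -
  have null: "mu N = 0" if N: "N \<in> sets borel" "emeasure m N = 0" for N
  proof -
    have "AE x in m. indicator N x = (0 :: complex)"
      using N by (intro AE_I[of _ _ N]) (auto simp: indicator_def)
    then have "Psi.lux (indicator N) = 0"
      using Psi.lux_cong_AE(2)[OF Psi.zero_L, of "indicator N"] N by (simp add: Psi.lux_zero)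
    moreover have "cmod (cintegral mu (indicator N) UNIV) \<le> n * Psi.lux (indicator N)"
      using N by (intro cintegral_le_lux[OF n, of _ 1]) (auto simp: indicator_def)
    ultimately show ?thesis by (simp add: cintegral_indicator[OF mu_ca N(1)])
  qed
  have ac: "absolutely_continuous m (jordan_pos r)"
    if r: "countably_additive_real r" and z: "\<And>N. N \<in> sets borel \<Longrightarrow> emeasure m N = 0 \<Longrightarrow> r N = 0" for r
    unfolding absolutely_continuous_def null_sets_def
  proof clarsimp
    fix N assume N: "N \<in> sets borel" "emeasure m N = 0"
    have "r B = 0" if "B \<in> sets borel" "B \<subseteq> N" for B
      using that N emeasure_mono[of B N m] by (intro z) auto
    then have "upper_var r N = 0" unfolding upper_var_def by (auto intro!: SUP_eq_const)
    then show "emeasure (jordan_pos r) N = 0" using emeasure_jordan_pos[OF r N(1)] by simp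
  qed
  have RN: "\<exists>f. integrable m f \<and> (\<forall>A\<in>sets borel. measure (jordan_pos r) A = (LINT x:A|m. f x))"
    if r: "countably_additive_real r" and z: "\<And>N. N \<in> sets borel \<Longrightarrow> emeasure m N = 0 \<Longrightarrow> r N = 0" for r
    using Radon_Nikodym_integrable[OF finite_measure_axioms finite_measure_jordan_pos[OF r] ac[OF r z]] by auto
  obtain f1 where f1: "integrable m f1" "\<forall>A\<in>sets borel. measure (jordan_pos (\<lambda>B. Re (mu B))) A = (LINT x:A|m. f1 x)"
    using RN[OF cac_Re[OF mu_ca]] null by auto
  obtain f2 where f2: "integrable m f2" "\<forall>A\<in>sets borel. measure (jordan_pos (\<lambda>B. - Re (mu B))) A = (LINT x:A|m. f2 x)"
    using RN[OF cac_minus_Re[OF mu_ca]] null by auto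
  obtain f3 where f3: "integrable m f3" "\<forall>A\<in>sets borel. measure (jordan_pos (\<lambda>B. Im (mu B))) A = (LINT x:A|m. f3 x)"
    using RN[OF cac_Im[OF mu_ca]] null by auto
  obtain f4 where f4: "integrable m f4" "\<forall>A\<in>sets borel. measure (jordan_pos (\<lambda>B. - Im (mu B))) A = (LINT x:A|m. f4 x)"
    using RN[OF cac_minus_Im[OF mu_ca]] null by auto
  define f where "f x = Complex (f1 x - f2 x) (f3 x - f4 x)" for x
  have fi: "integrable m f" unfolding f_def[abs_def] Complex_eq using f1 f2 f3 f4 by simp
  have mu_f: "mu A = (LINT x:A|m. f x)" if A: "A \<in> sets borel" for A
  proof -
    have i: "integrable m (\<lambda>x. indicator A x * g x)" if "integrable m g" for g :: "'g \<Rightarrow> real"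
      using integrable_mult_indicator[of A m g] that A by simp
    have iF: "integrable m (\<lambda>x. indicator A x *\<^sub>R f x)"
      using integrable_mult_indicator[of A m f] fi A by simp
    have "Re (LINT x:A|m. f x) = (LINT x|m. indicator A x * f1 x - indicator A x * f2 x)"
      unfolding set_lebesgue_integral_def integral_Re[OF iF, symmetric] by (simp add: f_def right_diff_distrib)
    moreover have "Im (LINT x:A|m. f x) = (LINT x|m. indicator A x * f3 x - indicator A x * f4 x)"
      unfolding set_lebesgue_integral_def integral_Im[OF iF, symmetric] by (simp add: f_def right_diff_distrib)
    ultimately have "Re (LINT x:A|m. f x) = Re (mu A)" "Im (LINT x:A|m. f x) = Im (mu A)"
      using i[OF f1(1)] i[OF f2(1)] i[OF f3(1)] i[OF f4(1)] f1(2) f2(2) f3(2) f4(2) A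
        complex_jordan_decomposition[OF mu_ca A]
      by (simp_all add: set_lebesgue_integral_def)
    then show ?thesis by (simp add: complex_eq_iff)
  qed
  have "f \<in> L"
  proof (rule norming_lux(1)[OF fi])
    show "max n 0 \<ge> 0" by simp
    fix w B assume w: "w \<in> borel_measurable m" "\<forall>t\<in>space m. cmod (w t) \<le> B" "Psi.modular w 1 \<le> 1"
    have wb: "w \<in> borel_measurable borel" "\<And>x. cmod (w x) \<le> B" using w by (auto simp: borel_measurable_m)
    have fw: "integrable m (\<lambda>x. w x * f x)"
    proof (rule Bochner_Integration.integrable_bound)
      show "integrable m (\<lambda>x. B * cmod (f x))" using fi by simp
      show "AE x in m. norm (w x * f x) \<le> norm (B * cmod (f x))"
      proof (rule AE_I2)
        fix x
        have "cmod (w x) \<le> \<bar>B\<bar>" using wb(2)[of x] by linarith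
        then show "norm (w x * f x) \<le> norm (B * cmod (f x))" by (simp add: norm_mult abs_mult mult_right_mono)
      qed
    qed (use w(1) fi in auto)
    have "(LINT t|m. f t * w t) = cintegral mu w UNIV"
      using cintegral_density[OF sets_m fi mu_f wb(1) fw] by (simp add: mult.commute)
    also have "cmod \<dots> \<le> n * Psi.lux w" by (rule cintegral_le_lux[OF n wb])
    also have "\<dots> \<le> max n 0 * 1"
    proof (rule mult_mono)
      show "Psi.lux w \<le> 1" using w(3) by (intro Psi.lux_le) auto
      show "Psi.lux w \<ge> 0" using wb by (intro Psi.lux_nonneg Psi.bounded_in_L[of _ B]) (auto simp: borel_measurable_m)
    qed auto
    finally show "cmod (LINT t|m. f t * w t) \<le> max n 0" by simp
  qed
  then show ?thesis using mu_f by blast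
qed

section \<open>From a compact integration operator to finite variation\<close>

lemma compact_imp_finite_net:
  assumes comp: "integration_op_compact Phi m nu" and e: "e > 0"
    and K_def: "K = {z. \<exists>f\<in>L1_vm Phi m nu. L1_vm_norm Phi m nu f \<le> 1 \<and> vm_integral_is Phi m nu f UNIV z}"
  obtains Y where "finite Y" "Y \<subseteq> K" "\<forall>z\<in>K. \<exists>y\<in>Y. lux (\<lambda>t. z t - y t) < e"
proof (rule ccontr)
  assume nt: "\<not> thesis"
  note result = that
  have no: "\<exists>z\<in>K. \<forall>y\<in>Y. e \<le> lux (\<lambda>t. z t - y t)" if Y: "finite Y" "Y \<subseteq> K" for Y
  proof (rule ccontr)
    assume "\<not> ?thesis"
    then have "\<forall>z\<in>K. \<exists>y\<in>Y. lux (\<lambda>t. z t - y t) < e" by (simp add: not_le)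
    from result[OF Y this] nt show False by contradiction
  qed
  have KL: "z \<in> L" if "z \<in> K" for z using that by (auto simp: K_def vm_integral_is_def)
  \<comment> \<open>Without a finite net one can choose inside \<open>K\<close> a sequence with
    mutual distances at least \<open>e\<close>; two late members of a convergent subsequence would
    be closer than that.\<close>
  have "\<exists>x::nat \<Rightarrow> 'g \<Rightarrow> complex. \<forall>n. x n \<in> K \<and> (\<forall>i<n. e \<le> lux (\<lambda>t. x n t - x i t))"
  proof (rule dependent_wellorder_choice)
    fix n and f :: "nat \<Rightarrow> 'g \<Rightarrow> complex"
    assume f: "\<And>k. k < n \<Longrightarrow> f k \<in> K \<and> (\<forall>i<k. e \<le> lux (\<lambda>t. f k t - f i t))"
    have "finite (f ` {..<n})" "f ` {..<n} \<subseteq> K" using f by auto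
    from no[OF this] obtain z where "z \<in> K" "\<forall>y\<in>f ` {..<n}. e \<le> lux (\<lambda>t. z t - y t)" ..
    then show "\<exists>r. r \<in> K \<and> (\<forall>i<n. e \<le> lux (\<lambda>t. r t - f i t))" by (intro exI[of _ z]) simp
  qed simp
  then obtain x :: "nat \<Rightarrow> 'g \<Rightarrow> complex" where x: "\<And>n. x n \<in> K" "\<And>n i. i < n \<Longrightarrow> e \<le> lux (\<lambda>t. x n t - x i t)" by blast
  obtain r y where r: "strict_mono r" "y \<in> L" "(\<lambda>n. lux (\<lambda>t. x (r n) t - y t)) \<longlonglongrightarrow> 0"
  proof -
    have "\<forall>n. \<exists>f\<in>L1_vm Phi m nu. L1_vm_norm Phi m nu f \<le> 1 \<and> vm_integral_is Phi m nu f UNIV (x n)"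
      using x(1) by (simp add: K_def)
    with comp have "\<exists>r y. strict_mono r \<and> y \<in> L \<and> (\<lambda>n. lux (\<lambda>t. x (r n) t - y t)) \<longlonglongrightarrow> 0"
      unfolding integration_op_compact_def by simp
    then show thesis using that by blast
  qed
  have "\<forall>\<^sub>F n in sequentially. lux (\<lambda>t. x (r n) t - y t) < e / 2"
    using r(3) e by (intro order_tendstoD(2)) auto
  then obtain N where N: "\<And>n. n \<ge> N \<Longrightarrow> lux (\<lambda>t. x (r n) t - y t) < e / 2" by (auto simp: eventually_sequentially)
  have "e \<le> lux (\<lambda>t. x (r (Suc N)) t - x (r N) t)" using x(2) strict_monoD[OF r(1), of N "Suc N"] by simp
  also have "\<dots> \<le> lux (\<lambda>t. x (r (Suc N)) t - y t) + lux (\<lambda>t. y t - x (r N) t)"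
    by (intro lux_diff_triangle KL x(1) r(2))
  also have "lux (\<lambda>t. y t - x (r N) t) = lux (\<lambda>t. x (r N) t - y t)" by (intro lux_diff_commute KL x(1) r(2))
  finally show False using N[of N] N[of "Suc N"] by simp
qed

text \<open>The integral with respect to \<open>nu\<close> of the simple function with value
  \<open>\<theta> E\<close> on the cell \<open>E\<close> of \<open>P\<close>.\<close>

definition step where "step P \<theta> t = (\<Sum>E\<in>P. \<theta> E * nu E t)"

lemma step_L: "P \<in> borel_partitions A \<Longrightarrow> step P \<theta> \<in> L"
  unfolding step_def[abs_def] borel_partitions_def by (intro L_sum nu_L) auto

lemma cmod_step_le:
  assumes P: "P \<in> borel_partitions A" and \<theta>: "\<forall>E. cmod (\<theta> E) \<le> 1"
  shows "cmod (step P \<theta> t) \<le> M"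
proof -
  interpret V: finite_measure "var_measure mu" by (rule finite_measure_var_measure[OF mu_ca])
  have P': "finite P" "disjoint P" "P \<subseteq> sets borel" using P by (auto simp: borel_partitions_def)
  have "cmod (step P \<theta> t) \<le> (\<Sum>E\<in>P. cmod (\<theta> E) * cmod (nu E t))"
    unfolding step_def by (rule order_trans[OF norm_sum]) (simp add: norm_mult)
  also have "\<dots> \<le> (\<Sum>E\<in>P. measure (var_measure mu) {s. - s + t \<in> E})"
  proof (rule sum_mono)
    fix E assume "E \<in> P"
    then have E: "E \<in> sets borel" using P' by auto
    have "cmod (nu E t) \<le> measure (var_measure mu) {s. - s + t \<in> E}"
      unfolding nu_eq[OF E] by (rule measure_var_measure_ge[OF mu_ca shift_sets[OF E]])
    moreover have "cmod (\<theta> E) * cmod (nu E t) \<le> 1 * cmod (nu E t)" using \<theta> by (intro mult_right_mono) auto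
    ultimately show "cmod (\<theta> E) * cmod (nu E t) \<le> measure (var_measure mu) {s. - s + t \<in> E}" by simp
  qed
  also have "\<dots> = measure (var_measure mu) (\<Union>E\<in>P. {s. - s + t \<in> E})"
  proof (rule V.finite_measure_finite_Union[symmetric, OF P'(1)])
    show "(\<lambda>E. {s. - s + t \<in> E}) ` P \<subseteq> sets (var_measure mu)" using P'(3) shift_sets by auto
    show "disjoint_family_on (\<lambda>E. {s. - s + t \<in> E}) P"
      using P'(2) by (fastforce simp: disjoint_family_on_def pairwise_def disjnt_def)
  qed
  also have "\<dots> \<le> M" unfolding M_def by (rule V.bounded_measure[unfolded space_var_measure])
  finally show ?thesis .
qed

text \<open>The semivariation of \<open>nu\<close> on \<open>A\<close>, expressed by simple
  functions bounded by 1. It is finite because \<open>cmod_step_le\<close> bounds all these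
  integrals uniformly by the total variation of \<open>mu\<close>.\<close>

definition semivar where
  "semivar A = Sup {lux (step P \<theta>) | P \<theta>. P \<in> borel_partitions A \<and> (\<forall>E. cmod (\<theta> E) \<le> 1)}"

lemma semivar_bdd: "bdd_above {lux (step P \<theta>) | P \<theta>. P \<in> borel_partitions A \<and> (\<forall>E. cmod (\<theta> E) \<le> 1)}"
proof -
  obtain c where c: "c > 0" "\<forall>f B. f \<in> borel_measurable m \<longrightarrow> (\<forall>x\<in>space m. cmod (f x) \<le> B) \<longrightarrow> f \<in> L \<and> lux f \<le> c * B"
    by (rule bounded_L)
  have "lux (step P \<theta>) \<le> c * M" if "P \<in> borel_partitions A" "\<forall>E. cmod (\<theta> E) \<le> 1" for P \<theta>
    using c(2) L_measurable[OF step_L[OF that(1)]] cmod_step_le[OF that] by blast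
  then show ?thesis by (auto intro!: bdd_aboveI[of _ "c * M"])
qed

lemma lux_step_le_semivar:
  "P \<in> borel_partitions A \<Longrightarrow> \<forall>E. cmod (\<theta> E) \<le> 1 \<Longrightarrow> lux (step P \<theta>) \<le> semivar A"
  unfolding semivar_def by (rule cSup_upper[OF _ semivar_bdd]) blast

lemma lux_nu_le_semivar: "A \<in> sets borel \<Longrightarrow> lux (nu A) \<le> semivar A"
  using lux_step_le_semivar[OF singleton_borel_partition, of A "\<lambda>_. 1"] by (simp add: step_def[abs_def])

text \<open>Taking for \<open>\<theta> E\<close> the conjugate phase of \<open>ph (nu E)\<close>
  turns the sum of absolute values into the value of \<open>ph\<close> at one step vector.\<close>

lemma cvar_dual_le_semivar:
  assumes A: "A \<in> sets borel" and ph: "ph \<in> orlicz_dual_ball Phi m"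
  shows "cvar (\<lambda>E. ph (nu E)) A \<le> ennreal (semivar A)"
  unfolding cvar_def
proof (rule SUP_least)
  fix P assume P: "P \<in> borel_partitions A"
  have phd: "ph \<in> orlicz_dual Phi m" and le: "\<And>f. f \<in> L \<Longrightarrow> cmod (ph f) \<le> lux f"
    using ph by (auto simp: orlicz_dual_ball_def)
  have P': "finite P" "P \<subseteq> sets borel" using P by (auto simp: borel_partitions_def)
  define \<theta> where "\<theta> E = cnj (sgn (ph (nu E)))" for E
  have \<theta>: "\<forall>E. cmod (\<theta> E) \<le> 1" by (simp add: \<theta>_def norm_sgn)
  have \<theta>ph: "\<theta> E * ph (nu E) = complex_of_real (cmod (ph (nu E)))" for E
  proof (cases "ph (nu E) = 0")
    case False
    then have "ph (nu E) * cnj (ph (nu E)) / complex_of_real (cmod (ph (nu E))) = complex_of_real (cmod (ph (nu E)))"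
      by (simp add: complex_norm_square[symmetric] power2_eq_square)
    then show ?thesis by (simp add: \<theta>_def sgn_eq mult.commute)
  qed simp
  have "ph (step P \<theta>) = (\<Sum>E\<in>P. \<theta> E * ph (nu E))"
    unfolding step_def[abs_def] using P' by (intro dual_sum[OF phd] nu_L) auto
  also have "\<dots> = complex_of_real (\<Sum>E\<in>P. cmod (ph (nu E)))" by (simp add: \<theta>ph)
  finally have "(\<Sum>E\<in>P. cmod (ph (nu E))) = cmod (ph (step P \<theta>))"
    by (simp only: norm_of_real abs_of_nonneg[OF sum_nonneg[OF norm_ge_zero]])
  also have "\<dots> \<le> semivar A" using le[OF step_L[OF P]] lux_step_le_semivar[OF P \<theta>] by (rule order_trans)
  finally show "(\<Sum>E\<in>P. ennreal (cmod (ph (nu E)))) \<le> ennreal (semivar A)"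
    by (simp add: sum_ennreal ennreal_leI)
qed

text \<open>The simple function behind the step vector, divided by the semivariation, is bounded by
  \<open>1 / semivar A\<close> and vanishes outside \<open>A\<close>. Functionals of the dual ball
  have variation at most \<open>semivar A\<close> on \<open>A\<close>, hence its norm is at most
  1.\<close>

lemma step_in_image_ball:
  assumes A: "A \<in> sets borel" and P: "P \<in> borel_partitions A" and \<theta>: "\<forall>E. cmod (\<theta> E) \<le> 1" and T: "semivar A > 0"
  shows "\<exists>f\<in>L1_vm Phi m nu. L1_vm_norm Phi m nu f \<le> 1
    \<and> vm_integral_is Phi m nu f UNIV (\<lambda>t. complex_of_real (1 / semivar A) * step P \<theta> t)"
proof -
  have P': "finite P" "disjoint P" "P \<subseteq> sets borel" "\<Union>P = A" using P by (auto simp: borel_partitions_def)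
  define c where "c E = complex_of_real (1 / semivar A) * \<theta> E" for E
  define f where "f s = (\<Sum>E\<in>P. c E * indicator E s)" for s
  have fm: "f \<in> borel_measurable borel"
    unfolding f_def[abs_def] using P' by (intro borel_measurable_sum borel_measurable_times) auto
  have cle: "cmod (c E) \<le> 1 / semivar A" for E
    using \<theta> T by (simp add: c_def norm_mult norm_divide divide_right_mono)
  have fle: "cmod (f s) \<le> 1 / semivar A * indicator A s" for s
  proof -
    have d: "disjoint_family_on (\<lambda>E. E) P" using P'(2) by (auto simp: disjoint_family_on_def pairwise_def disjnt_def)
    have "cmod (f s) \<le> (\<Sum>E\<in>P. cmod (c E) * indicator E s)"
      unfolding f_def by (rule order_trans[OF norm_sum]) (auto simp: norm_mult indicator_def intro!: sum_mono)
    also have "\<dots> \<le> (\<Sum>E\<in>P. 1 / semivar A * indicator E s)"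
      by (intro sum_mono mult_right_mono cle) auto
    also have "\<dots> = 1 / semivar A * (\<Sum>E\<in>P. indicator E s)" by (simp only: sum_distrib_left)
    also have "(\<Sum>E\<in>P. indicator E s :: real) = indicator A s"
    proof -
      have "(indicator (\<Union>E\<in>P. E) s :: real) = (\<Sum>E\<in>P. indicator E s)"
        by (rule indicator_UN_disjoint[OF P'(1) d])
      then show ?thesis using P'(4) by simp
    qed
    finally show ?thesis .
  qed
  have fB: "cmod (f s) \<le> 1 / semivar A" for s
  proof -
    have "1 / semivar A * indicator A s \<le> 1 / semivar A * 1" using T by (intro mult_left_mono) (auto simp: indicator_def)
    with fle[of s] show ?thesis by linarith
  qed
  have int: "vm_integral_is Phi m nu f B (\<lambda>t. \<Sum>E\<in>P. c E * nu (E \<inter> B) t)" if B: "B \<in> sets borel" for B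
    unfolding vm_integral_is_def
  proof (intro conjI ballI)
    show "(\<lambda>t. \<Sum>E\<in>P. c E * nu (E \<inter> B) t) \<in> L" using P' B by (intro L_sum nu_L) auto
    fix ph assume ph: "ph \<in> orlicz_dual Phi m"
    have "cintegral (\<lambda>E. ph (nu E)) f B = (\<Sum>E\<in>P. c E * ph (nu (E \<inter> B)))"
      unfolding f_def[abs_def] by (rule cintegral_step[OF dual_nu_countably_additive[OF ph] P'(1,3) B])
    also have "\<dots> = ph (\<lambda>t. \<Sum>E\<in>P. c E * nu (E \<inter> B) t)"
      using P' B by (intro dual_sum[OF ph, symmetric] nu_L) auto
    finally show "cintegral (\<lambda>E. ph (nu E)) f B = ph (\<lambda>t. \<Sum>E\<in>P. c E * nu (E \<inter> B) t)" .
  qed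
  have "f \<in> L1_vm Phi m nu"
    unfolding L1_vm_def
  proof (intro CollectI conjI ballI)
    fix ph assume ph: "ph \<in> orlicz_dual Phi m"
    interpret V: finite_measure "var_measure (\<lambda>E. ph (nu E))"
      by (rule finite_measure_var_measure[OF dual_nu_countably_additive[OF ph]])
    have "f \<in> borel_measurable (var_measure (\<lambda>E. ph (nu E)))" using fm by (simp cong: measurable_cong_sets)
    then show "integrable (var_measure (\<lambda>E. ph (nu E))) f"
      using fB by (intro V.integrable_const_bound[of _ "1 / semivar A"]) auto
  qed (use fm int in blast)+
  moreover have "L1_vm_norm Phi m nu f \<le> 1"
    unfolding L1_vm_norm_def
  proof (rule SUP_least)
    fix ph assume ph: "ph \<in> orlicz_dual_ball Phi m"
    then have phd: "ph \<in> orlicz_dual Phi m" by (simp add: orlicz_dual_ball_def)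
    let ?V = "var_measure (\<lambda>E. ph (nu E))"
    have "(\<integral>\<^sup>+s. ennreal (cmod (f s)) \<partial>?V) \<le> (\<integral>\<^sup>+s. ennreal (1 / semivar A) * indicator A s \<partial>?V)"
    proof (rule nn_integral_mono)
      fix s
      show "ennreal (cmod (f s)) \<le> ennreal (1 / semivar A) * indicator A s"
        using fle[of s] by (auto simp: indicator_def ennreal_leI split: if_splits)
    qed
    also have "\<dots> = ennreal (1 / semivar A) * cvar (\<lambda>E. ph (nu E)) A"
      using A by (simp add: nn_integral_cmult_indicator emeasure_var_measure[OF dual_nu_countably_additive[OF phd]])
    also have "\<dots> \<le> ennreal (1 / semivar A) * ennreal (semivar A)"
      by (intro mult_left_mono cvar_dual_le_semivar A ph) auto
    also have "\<dots> = 1" using T by (simp add: ennreal_mult[symmetric])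
    finally show "(\<integral>\<^sup>+s. ennreal (cmod (f s)) \<partial>?V) \<le> 1" .
  qed
  moreover have "(\<lambda>t. \<Sum>E\<in>P. c E * nu (E \<inter> UNIV) t) = (\<lambda>t. complex_of_real (1 / semivar A) * step P \<theta> t)"
    by (simp add: c_def step_def sum_distrib_left mult.assoc)
  ultimately show ?thesis using int[of UNIV] by auto
qed

text \<open>A finite net of the image of the unit ball, normed by finitely many functionals, bounds the
  semivariation by the sum of finitely many finite scalar variations.\<close>
lemma compact_imp_finite_vvar:
  assumes comp: "integration_op_compact Phi m nu"
  shows "vvar Phi m nu UNIV < \<infinity>"
proof -
  define K where "K = {z. \<exists>f\<in>L1_vm Phi m nu. L1_vm_norm Phi m nu f \<le> 1 \<and> vm_integral_is Phi m nu f UNIV z}"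
  have KL: "z \<in> L" if "z \<in> K" for z using that by (auto simp: K_def vm_integral_is_def)
  \<comment> \<open>The radius is chosen for the following chain. A normalized step vector
    \<open>z\<close> has norm above \<open>9/10\<close>, so its net point has norm at least
    \<open>17/20\<close> and is normed to at least \<open>17/80\<close>; hence the functional is at
    least \<open>17/80 - 1/20 = 13/80\<close> on \<open>z\<close>, above \<open>1/8\<close>.\<close>
  obtain Y where Y: "finite Y" "Y \<subseteq> K" "\<forall>z\<in>K. \<exists>y\<in>Y. lux (\<lambda>t. z t - y t) < 1/20"
    by (rule compact_imp_finite_net[OF comp _ K_def, of "1/20"]) auto
  have "\<forall>y\<in>Y. \<exists>ph. ph \<in> orlicz_dual_ball Phi m \<and> lux y / 4 \<le> cmod (ph y)"
  proof
    fix y assume "y \<in> Y"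
    then have "y \<in> L" using Y(2) KL by auto
    then obtain ph where "ph \<in> orlicz_dual_ball Phi m" "lux y / 4 \<le> cmod (ph y)" by (rule norming_functional)
    then show "\<exists>ph. ph \<in> orlicz_dual_ball Phi m \<and> lux y / 4 \<le> cmod (ph y)" by blast
  qed
  then obtain ph where ph: "\<And>y. y \<in> Y \<Longrightarrow> ph y \<in> orlicz_dual_ball Phi m" "\<And>y. y \<in> Y \<Longrightarrow> lux y / 4 \<le> cmod (ph y y)"
    by metis
  define V where "V y = cvar (\<lambda>E. ph y (nu E))" for y
  have phd: "ph y \<in> orlicz_dual Phi m" if "y \<in> Y" for y using ph(1)[OF that] by (simp add: orlicz_dual_ball_def)
  \<comment> \<open>The net point that suits \<open>A\<close> varies with \<open>A\<close>; summing
    the scalar variations over the whole finite net gives a bound valid for all sets, which can be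
    added over a partition.\<close>
  have key: "ennreal (lux (nu A)) \<le> 8 * (\<Sum>y\<in>Y. V y A)" if A: "A \<in> sets borel" for A
  proof (cases "semivar A > 0")
    case False
    then have "lux (nu A) \<le> 0" using lux_nu_le_semivar[OF A] by simp
    then show ?thesis by (simp add: ennreal_neg)
  next
    case True
    let ?T = "semivar A"
    have "9 / 10 * ?T < ?T" using True by simp
    then obtain P \<theta> where P: "P \<in> borel_partitions A" "\<forall>E. cmod (\<theta> E) \<le> 1" "9 / 10 * ?T < lux (step P \<theta>)"
    proof -
      let ?X = "{lux (step P \<theta>) | P \<theta>. P \<in> borel_partitions A \<and> (\<forall>E. cmod (\<theta> E) \<le> 1)}"
      have "lux (step {A} (\<lambda>_. 1)) \<in> ?X" using singleton_borel_partition[OF A] by force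
      then have ne: "?X \<noteq> {}" by blast
      have "9 / 10 * ?T < Sup ?X" using \<open>9 / 10 * ?T < ?T\<close> by (simp only: semivar_def)
      then obtain v where "v \<in> ?X" "9 / 10 * ?T < v" by (rule less_cSupE[OF _ ne])
      then show thesis using that by blast
    qed
    have P': "finite P" "P \<subseteq> sets borel" using P by (auto simp: borel_partitions_def)
    define z where "z t = complex_of_real (1 / ?T) * step P \<theta> t" for t
    have zK: "z \<in> K" unfolding K_def z_def[abs_def] using step_in_image_ball[OF A P(1,2) True] by blast
    have zL: "z \<in> L" by (rule KL[OF zK])
    have "lux z = 1 / ?T * lux (step P \<theta>)"
      unfolding z_def[abs_def] lux_cmult[OF step_L[OF P(1)]] using True by (simp add: norm_divide)
    then have "lux z * ?T = lux (step P \<theta>)" using True by simp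
    with P(3) have "9 / 10 * ?T < lux z * ?T" by simp
    then have luxz: "lux z > 9 / 10" using True by (simp only: mult_less_cancel_right_pos)
    obtain y where y: "y \<in> Y" "lux (\<lambda>t. z t - y t) < 1/20" using Y(3) zK by blast
    have yL: "y \<in> L" using y(1) Y(2) KL by auto
    have "lux y \<ge> 17 / 20" using lux_triangle_sub[OF zL yL] luxz y(2) by simp
    then have phy: "cmod (ph y y) \<ge> 17 / 80" using ph(2)[OF y(1)] by simp
    have "cmod (ph y (\<lambda>t. z t - y t)) \<le> lux (\<lambda>t. z t - y t)"
      using ph(1)[OF y(1)] L_diff[OF zL yL] by (simp add: orlicz_dual_ball_def)
    moreover have "ph y (\<lambda>t. z t - y t) = ph y z - ph y y" by (rule dual_diff[OF phd[OF y(1)] zL yL])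
    ultimately have "cmod (ph y z - ph y y) < 1 / 20" using y(2) by simp
    moreover have "cmod (ph y y) \<le> cmod (ph y z) + cmod (ph y z - ph y y)"
      using norm_triangle_sub[of "ph y y" "ph y z"] by (simp add: norm_minus_commute)
    ultimately have "cmod (ph y z) \<ge> 1 / 8" using phy by simp
    moreover have "ph y z = complex_of_real (1 / ?T) * ph y (step P \<theta>)"
      unfolding z_def[abs_def] by (rule dual_cmult[OF phd[OF y(1)] step_L[OF P(1)]])
    ultimately have "?T \<le> 8 * cmod (ph y (step P \<theta>))" using True by (simp add: norm_mult norm_divide field_simps)
    also have "ph y (step P \<theta>) = (\<Sum>E\<in>P. \<theta> E * ph y (nu E))"
      unfolding step_def[abs_def] using P' by (intro dual_sum[OF phd[OF y(1)]] nu_L) auto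
    also have "cmod \<dots> \<le> (\<Sum>E\<in>P. cmod (ph y (nu E)))"
    proof (rule order_trans[OF norm_sum], rule sum_mono)
      fix E
      show "cmod (\<theta> E * ph y (nu E)) \<le> cmod (ph y (nu E))"
        using P(2) mult_right_mono[of "cmod (\<theta> E)" 1 "cmod (ph y (nu E))"] by (simp add: norm_mult)
    qed
    finally have "?T \<le> 8 * (\<Sum>E\<in>P. cmod (ph y (nu E)))" by simp
    then have "lux (nu A) \<le> 8 * (\<Sum>E\<in>P. cmod (ph y (nu E)))" using lux_nu_le_semivar[OF A] by simp
    then have "ennreal (lux (nu A)) \<le> ennreal (8 * (\<Sum>E\<in>P. cmod (ph y (nu E))))" by (rule ennreal_leI)
    also have "\<dots> = 8 * (\<Sum>E\<in>P. ennreal (cmod (ph y (nu E))))"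
      by (simp add: ennreal_mult sum_nonneg sum_ennreal)
    also have "\<dots> \<le> 8 * V y A"
      unfolding V_def cvar_def using P(1) by (intro mult_left_mono SUP_upper) auto
    also have "\<dots> \<le> 8 * (\<Sum>y\<in>Y. V y A)"
      using y(1) Y(1) by (intro mult_left_mono member_le_sum) auto
    finally show ?thesis .
  qed
  have "vvar Phi m nu UNIV \<le> 8 * (\<Sum>y\<in>Y. V y UNIV)"
    unfolding vvar_def
  proof (rule SUP_least)
    fix P :: "'g set set" assume P: "P \<in> borel_partitions UNIV"
    have P': "finite P" "disjoint P" "P \<subseteq> sets borel" "\<Union>P = UNIV" using P by (auto simp: borel_partitions_def)
    have d: "disjoint_family_on (\<lambda>E. E) P" using P'(2) by (auto simp: disjoint_family_on_def pairwise_def disjnt_def)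
    have "(\<Sum>E\<in>P. ennreal (lux (nu E))) \<le> (\<Sum>E\<in>P. 8 * (\<Sum>y\<in>Y. V y E))" using P' by (intro sum_mono key) auto
    also have "\<dots> = 8 * (\<Sum>y\<in>Y. \<Sum>E\<in>P. V y E)" by (simp add: sum_distrib_left[symmetric] sum.swap[of _ Y P])
    also have "\<dots> \<le> 8 * (\<Sum>y\<in>Y. V y UNIV)"
    proof (intro mult_left_mono sum_mono)
      fix y assume y: "y \<in> Y"
      have "(\<Sum>E\<in>P. V y E) \<le> V y (\<Union>E\<in>P. E)"
        unfolding V_def cvar_eq_partition_var using P' d cac_empty[OF dual_nu_countably_additive[OF phd[OF y]]]
        by (intro partition_var_sum_le) auto
      then show "(\<Sum>E\<in>P. V y E) \<le> V y UNIV" using P'(4) by simp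
    qed auto
    finally show "(\<Sum>E\<in>P. ennreal (lux (nu E))) \<le> 8 * (\<Sum>y\<in>Y. V y UNIV)" .
  qed
  also have "\<dots> < \<infinity>"
  proof -
    have "V y UNIV \<le> ennreal (semivar UNIV)" if "y \<in> Y" for y
      unfolding V_def by (rule cvar_dual_le_semivar[OF _ ph(1)[OF that]]) simp
    then have "(\<Sum>y\<in>Y. V y UNIV) \<le> (\<Sum>y\<in>Y. ennreal (semivar UNIV))" by (rule sum_mono)
    also have "\<dots> < top" by (simp add: ennreal_mult_less_top of_nat_less_top)
    finally have "(\<Sum>y\<in>Y. V y UNIV) < top" .
    then show ?thesis by (simp add: ennreal_mult_less_top)
  qed
  finally show ?thesis .
qed

end

text \<open>Functions with values in the Orlicz space are not given a measurable structure on their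
  target; scalar quantities formed from finitely valued ones are handled by this lemma.\<close>

lemma finite_range_measurable:
  assumes H: "finite (range H)" "\<And>v. H -` {v} \<in> sets borel"
  shows "(\<lambda>s. q (H s)) \<in> measurable borel N \<longleftrightarrow> range (q \<circ> H) \<subseteq> space N"
proof
  assume sp: "range (q \<circ> H) \<subseteq> space N"
  show "(\<lambda>s. q (H s)) \<in> measurable borel N"
  proof (rule measurableI)
    show "q (H x) \<in> space N" for x using sp by auto
    fix B
    have "(\<lambda>s. q (H s)) -` B = (\<Union>v\<in>{v\<in>range H. q v \<in> B}. H -` {v})" by auto
    also have "\<dots> \<in> sets borel" using H by (intro sets.finite_UN) auto
    finally show "(\<lambda>s. q (H s)) -` B \<inter> space borel \<in> sets borel" by simp
  qed
qed (auto dest: measurable_space)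

section \<open>Bochner densities and finite variation\<close>

context conv_measure
begin

lemma simple_integral:
  fixes g :: "'g \<Rightarrow> complex"
  assumes H: "finite (range H)" "\<And>v. H -` {v} \<in> sets borel" and g: "integrable m g"
  shows "(LINT u|m. g u * \<phi> (H u)) = (\<Sum>v\<in>range H. (LINT u|m. g u * indicator (H -` {v}) u) * \<phi> v)"
    and "integrable m (\<lambda>u. g u * \<phi> (H u))"
proof -
  have eq: "g u * \<phi> (H u) = (\<Sum>v\<in>range H. g u * indicator (H -` {v}) u * \<phi> v)" for u
  proof -
    have "(\<Sum>v\<in>range H. g u * indicator (H -` {v}) u * \<phi> v) = (\<Sum>v\<in>range H. if v = H u then g u * \<phi> v else 0)"
      by (intro sum.cong) (auto simp: indicator_def)
    then show ?thesis using H(1) by simp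
  qed
  have i: "integrable m (\<lambda>u. g u * indicator (H -` {v}) u)" for v
    using integrable_mult_indicator[of "H -` {v}" m g] g H(2)
    by (simp add: scaleR_conv_of_real of_real_indicator mult.commute)
  show "integrable m (\<lambda>u. g u * \<phi> (H u))" unfolding eq using i by simp
  show "(LINT u|m. g u * \<phi> (H u)) = (\<Sum>v\<in>range H. (LINT u|m. g u * indicator (H -` {v}) u) * \<phi> v)"
    unfolding eq using i by simp
qed

lemma simple_lux_measurable:
  assumes "simple_LPhi Phi m H" "simple_LPhi Phi m H'"
  shows "(\<lambda>s. ennreal (lux (\<lambda>t. H s t - H' s t))) \<in> borel_measurable m"
proof -
  let ?P = "\<lambda>s. (H s, H' s)"
  have "range ?P \<subseteq> range H \<times> range H'" by auto
  then have fin: "finite (range ?P)" using assms by (meson finite_SigmaI finite_subset simple_LPhi_def)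
  have "?P -` {v} \<in> sets borel" for v
  proof (cases "v \<in> range H \<times> range H'")
    case True
    have "?P -` {v} = H -` {fst v} \<inter> H' -` {snd v}" by auto
    also have "\<dots> \<in> sets borel" using True assms by (intro sets.Int) (auto simp: simple_LPhi_def)
    finally show ?thesis .
  next
    case False
    then have "?P -` {v} = {}" by auto
    then show ?thesis by simp
  qed
  from finite_range_measurable[OF fin this, of "\<lambda>p. ennreal (lux (\<lambda>t. fst p t - snd p t))" borel]
  show ?thesis by (simp add: borel_measurable_m)
qed

lemma simple_LPhi_zero: "simple_LPhi Phi m (\<lambda>_ _. 0)"
  by (auto simp: simple_LPhi_def zero_L vimage_def)

lemma lux_simple_int_le:
  assumes H: "simple_LPhi Phi m H" and E: "E \<in> sets borel"
  shows "simple_int m H E \<in> L" "ennreal (lux (simple_int m H E)) \<le> (\<integral>\<^sup>+s\<in>E. ennreal (lux (H s)) \<partial>m)"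
proof -
  have H': "finite (range H)" "\<And>v. v \<in> range H \<Longrightarrow> H -` {v} \<in> sets borel" "\<And>v. v \<in> range H \<Longrightarrow> v \<in> L"
    using H by (auto simp: simple_LPhi_def)
  show "simple_int m H E \<in> L" unfolding simple_int_def using H' by (intro L_sum)
  have "lux (simple_int m H E) \<le> (\<Sum>v\<in>range H. measure m (E \<inter> H -` {v}) * lux v)"
    unfolding simple_int_def
    using lux_sum[OF H'(1,3), of "\<lambda>v. v" "\<lambda>v. complex_of_real (measure m (E \<inter> H -` {v}))"] by simp
  then have "ennreal (lux (simple_int m H E)) \<le> ennreal (\<Sum>v\<in>range H. measure m (E \<inter> H -` {v}) * lux v)"
    by (rule ennreal_leI)
  also have "\<dots> = (\<Sum>v\<in>range H. ennreal (lux v) * emeasure m (E \<inter> H -` {v}))"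
    using H'(3) by (subst sum_ennreal[symmetric]) (auto simp: emeasure_eq_measure ennreal_mult lux_nonneg mult.commute)
  also have "\<dots> = (\<Sum>v\<in>range H. \<integral>\<^sup>+s. ennreal (lux v) * indicator (E \<inter> H -` {v}) s \<partial>m)"
    using H'(2) E by (intro sum.cong) (auto simp: nn_integral_cmult_indicator)
  also have "\<dots> = (\<integral>\<^sup>+s. (\<Sum>v\<in>range H. ennreal (lux v) * indicator (E \<inter> H -` {v}) s) \<partial>m)"
    using H'(2) E by (intro nn_integral_sum[symmetric]) (auto simp: borel_measurable_m)
  also have "\<dots> = (\<integral>\<^sup>+s\<in>E. ennreal (lux (H s)) \<partial>m)"
  proof (intro nn_integral_cong)
    fix s
    have "(\<Sum>v\<in>range H. ennreal (lux v) * indicator (E \<inter> H -` {v}) s)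
        = (\<Sum>v\<in>range H. if v = H s then ennreal (lux v) * indicator E s else 0)"
      by (intro sum.cong) (auto simp: indicator_def)
    then show "(\<Sum>v\<in>range H. ennreal (lux v) * indicator (E \<inter> H -` {v}) s) = ennreal (lux (H s)) * indicator E s"
      using H'(1) by simp
  qed
  finally show "ennreal (lux (simple_int m H E)) \<le> (\<integral>\<^sup>+s\<in>E. ennreal (lux (H s)) \<partial>m)" .
qed

text \<open>The norm of \<open>G n s - F s\<close> is not measurable by definition, but almost
  everywhere it is the limit of the norms of \<open>G n s - G k s\<close>, which are measurable.
  Such a version is needed to split the integrals below.\<close>

lemma bochner_approx_measurable_version:
  assumes G: "bochner_approx Phi m F G" and F: "\<And>s. F s \<in> L"
  obtains h where "h \<in> borel_measurable m" "AE s in m. ennreal (lux (\<lambda>t. G n s t - F s t)) = h s"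
proof -
  have simp: "simple_LPhi Phi m (G k)" for k using G by (simp add: bochner_approx_def)
  have GL: "G k s \<in> L" for k s using simp[of k] by (auto simp: simple_LPhi_def)
  define h where "h s = liminf (\<lambda>k. ennreal (lux (\<lambda>t. G n s t - G k s t)))" for s
  have hm: "h \<in> borel_measurable m"
    unfolding h_def[abs_def] by (intro borel_measurable_liminf simple_lux_measurable simp)
  have "AE s in m. (\<lambda>k. lux (\<lambda>t. G k s t - F s t)) \<longlonglongrightarrow> 0" using G by (simp add: bochner_approx_def)
  then have "AE s in m. ennreal (lux (\<lambda>t. G n s t - F s t)) = h s"
  proof eventually_elim
    case (elim s)
    have "\<bar>lux (\<lambda>t. G n s t - G k s t) - lux (\<lambda>t. G n s t - F s t)\<bar> \<le> lux (\<lambda>t. G k s t - F s t)" for k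
      using lux_diff_triangle[OF GL[of n s] F[of s] GL[of k s]] lux_diff_triangle[OF GL[of n s] GL[of k s] F[of s]]
        lux_diff_commute[OF GL[of k s] F[of s]] by linarith
    then have "(\<lambda>k. lux (\<lambda>t. G n s t - G k s t) - lux (\<lambda>t. G n s t - F s t)) \<longlonglongrightarrow> 0"
      by (intro Lim_null_comparison[OF always_eventually[OF allI] elim]) simp
    then have "(\<lambda>k. lux (\<lambda>t. G n s t - G k s t)) \<longlonglongrightarrow> lux (\<lambda>t. G n s t - F s t)" by (simp add: LIM_zero_iff)
    then have "(\<lambda>k. ennreal (lux (\<lambda>t. G n s t - G k s t))) \<longlonglongrightarrow> ennreal (lux (\<lambda>t. G n s t - F s t))"
      by (rule tendsto_ennrealI)
    then show ?case unfolding h_def by (rule lim_imp_Liminf[OF sequentially_bot, symmetric])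
  qed
  then show thesis using that hm by blast
qed

text \<open>One simple approximant \<open>G n0\<close> yields an integrable \<open>\<rho>\<close>
  that dominates the norm of \<open>F\<close> almost everywhere. Each \<open>nu E\<close> may come
  from its own sequence \<open>H\<close>, but in the limit every \<open>H\<close> gives the same
  bound, the integral of \<open>\<rho>\<close> over \<open>E\<close>, which is additive in
  \<open>E\<close>.\<close>

lemma Bochner_imp_finite_vvar:
  assumes F: "bochner_integrable_LPhi Phi m F" and nu: "\<forall>A\<in>sets borel. has_bochner_integral_LPhi Phi m F A (nu A)"
  shows "vvar Phi m nu UNIV < \<infinity>"
proof -
  have FL: "F s \<in> L" for s using F by (simp add: bochner_integrable_LPhi_def)
  obtain G where G: "bochner_approx Phi m F G" using F by (auto simp: bochner_integrable_LPhi_def)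
  have "(\<lambda>n. \<integral>\<^sup>+s. ennreal (lux (\<lambda>t. G n s t - F s t)) \<partial>m) \<longlonglongrightarrow> 0" using G by (simp add: bochner_approx_def)
  then have "\<forall>\<^sub>F n in sequentially. (\<integral>\<^sup>+s. ennreal (lux (\<lambda>t. G n s t - F s t)) \<partial>m) < 1"
    by (intro order_tendstoD(2)) auto
  then obtain n0 where n0: "(\<integral>\<^sup>+s. ennreal (lux (\<lambda>t. G n0 s t - F s t)) \<partial>m) < 1"
    by (meson eventually_happens sequentially_bot)
  obtain h where h: "h \<in> borel_measurable m" "AE s in m. ennreal (lux (\<lambda>t. G n0 s t - F s t)) = h s"
    by (rule bochner_approx_measurable_version[OF G FL])
  have simpG: "simple_LPhi Phi m (G n0)" using G by (simp add: bochner_approx_def)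
  have GL: "G n0 s \<in> L" for s using simpG by (auto simp: simple_LPhi_def)
  have gm: "(\<lambda>s. ennreal (lux (G n0 s))) \<in> borel_measurable m"
    using simple_lux_measurable[OF simpG simple_LPhi_zero] by simp
  define \<rho> where "\<rho> s = h s + ennreal (lux (G n0 s))" for s
  have \<rho>m: "\<rho> \<in> borel_measurable m" unfolding \<rho>_def using h(1) gm by simp
  have key: "ennreal (lux (nu E)) \<le> (\<integral>\<^sup>+s\<in>E. \<rho> s \<partial>m)" if E: "E \<in> sets borel" for E
  proof -
    obtain H where H: "bochner_approx Phi m F H" "(\<lambda>n. lux (\<lambda>t. simple_int m (H n) E t - nu E t)) \<longlonglongrightarrow> 0"
      using nu E unfolding has_bochner_integral_LPhi_def by blast
    have simpH: "simple_LPhi Phi m (H n)" for n using H(1) by (simp add: bochner_approx_def)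
    have HL: "H n s \<in> L" for n s using simpH[of n] by (auto simp: simple_LPhi_def)
    let ?d = "\<lambda>n. ennreal (lux (\<lambda>t. simple_int m (H n) E t - nu E t))"
    let ?I = "\<lambda>n. \<integral>\<^sup>+s. ennreal (lux (\<lambda>t. H n s t - F s t)) \<partial>m"
    have le: "ennreal (lux (nu E)) \<le> ?d n + ((\<integral>\<^sup>+s\<in>E. \<rho> s \<partial>m) + ?I n)" for n
    proof -
      obtain k where k: "k \<in> borel_measurable m" "AE s in m. ennreal (lux (\<lambda>t. H n s t - F s t)) = k s"
        by (rule bochner_approx_measurable_version[OF H(1) FL])
      have S: "simple_int m (H n) E \<in> L" "ennreal (lux (simple_int m (H n) E)) \<le> (\<integral>\<^sup>+s\<in>E. ennreal (lux (H n s)) \<partial>m)"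
        using lux_simple_int_le[OF simpH E] by auto
      have "(\<integral>\<^sup>+s\<in>E. ennreal (lux (H n s)) \<partial>m) \<le> (\<integral>\<^sup>+s. \<rho> s * indicator E s + k s \<partial>m)"
      proof (rule nn_integral_mono_AE)
        show "AE s in m. ennreal (lux (H n s)) * indicator E s \<le> \<rho> s * indicator E s + k s"
          using h(2) k(2)
        proof eventually_elim
          case (elim s)
          have "lux (H n s) \<le> lux (\<lambda>t. H n s t - F s t) + lux (\<lambda>t. G n0 s t - F s t) + lux (G n0 s)"
            using lux_triangle_sub[OF HL[of n s] FL[of s]] lux_triangle_sub[OF FL[of s] GL[of s]]
              lux_diff_commute[OF FL[of s] GL[of s]] by linarith
          then have "ennreal (lux (H n s)) \<le> ennreal (lux (\<lambda>t. H n s t - F s t)) + ennreal (lux (\<lambda>t. G n0 s t - F s t)) + ennreal (lux (G n0 s))"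
            using lux_nonneg[OF L_diff[OF HL[of n s] FL[of s]]] lux_nonneg[OF L_diff[OF GL[of s] FL[of s]]] lux_nonneg[OF GL[of s]]
            by (simp add: ennreal_plus[symmetric] ennreal_leI del: ennreal_plus)
          then have "ennreal (lux (H n s)) \<le> \<rho> s + k s" unfolding \<rho>_def elim by (simp add: ac_simps)
          then show ?case by (simp add: indicator_def)
        qed
      qed
      also have "\<dots> = (\<integral>\<^sup>+s\<in>E. \<rho> s \<partial>m) + (\<integral>\<^sup>+s. k s \<partial>m)"
        using \<rho>m k(1) E by (intro nn_integral_add) auto
      also have "(\<integral>\<^sup>+s. k s \<partial>m) = ?I n" using k(2) by (intro nn_integral_cong_AE) (auto elim: AE_mp)
      finally have "ennreal (lux (simple_int m (H n) E)) \<le> (\<integral>\<^sup>+s\<in>E. \<rho> s \<partial>m) + ?I n" using S(2) by (rule order_trans[rotated])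
      moreover have "lux (nu E) \<le> lux (\<lambda>t. simple_int m (H n) E t - nu E t) + lux (simple_int m (H n) E)"
        using lux_triangle_sub[OF nu_L[OF E] S(1)] lux_diff_commute[OF nu_L[OF E] S(1)] by simp
      then have "ennreal (lux (nu E)) \<le> ?d n + ennreal (lux (simple_int m (H n) E))"
        using lux_nonneg[OF L_diff[OF S(1) nu_L[OF E]]] lux_nonneg[OF S(1)]
        by (simp add: ennreal_plus[symmetric] ennreal_leI del: ennreal_plus)
      ultimately show ?thesis by (meson add_left_mono order_trans)
    qed
    have "(\<lambda>n. ?d n + ((\<integral>\<^sup>+s\<in>E. \<rho> s \<partial>m) + ?I n)) \<longlonglongrightarrow> ennreal 0 + ((\<integral>\<^sup>+s\<in>E. \<rho> s \<partial>m) + 0)"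
      using H unfolding bochner_approx_def by (intro tendsto_add tendsto_ennrealI tendsto_const) auto
    then have "ennreal (lux (nu E)) \<le> ennreal 0 + ((\<integral>\<^sup>+s\<in>E. \<rho> s \<partial>m) + 0)"
      by (rule LIMSEQ_le_const) (use le in blast)
    then show ?thesis by simp
  qed
  have fin: "(\<integral>\<^sup>+s. \<rho> s \<partial>m) < \<infinity>"
  proof -
    have "(\<integral>\<^sup>+s. \<rho> s \<partial>m) = (\<integral>\<^sup>+s. h s \<partial>m) + (\<integral>\<^sup>+s. ennreal (lux (G n0 s)) \<partial>m)"
      unfolding \<rho>_def using h(1) gm by (rule nn_integral_add)
    moreover have "(\<integral>\<^sup>+s. h s \<partial>m) = (\<integral>\<^sup>+s. ennreal (lux (\<lambda>t. G n0 s t - F s t)) \<partial>m)"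
      using h(2) by (intro nn_integral_cong_AE) (auto elim: AE_mp)
    moreover have "(\<integral>\<^sup>+s. ennreal (lux (G n0 s)) \<partial>m) < \<infinity>"
    proof -
      have "finite (lux ` range (G n0))" using simpG by (simp add: simple_LPhi_def)
      then obtain D where D: "\<forall>x\<in>lux ` range (G n0). x \<le> D" by (meson finite_has_maximal bdd_above_finite bdd_above_def)
      have "(\<integral>\<^sup>+s. ennreal (lux (G n0 s)) \<partial>m) \<le> (\<integral>\<^sup>+s. ennreal D \<partial>m)"
        using D by (intro nn_integral_mono ennreal_leI) auto
      also have "\<dots> < \<infinity>" by (simp add: emeasure_UNIV)
      finally show ?thesis .
    qed
    ultimately show ?thesis using n0 by (auto simp: less_top[symmetric] dest: less_trans)
  qed
  have "vvar Phi m nu UNIV \<le> (\<integral>\<^sup>+s. \<rho> s \<partial>m)"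
    unfolding vvar_def
  proof (rule SUP_least)
    fix P :: "'g set set" assume "P \<in> borel_partitions UNIV"
    then have P: "finite P" "disjoint P" "P \<subseteq> sets borel" "\<Union>P = UNIV" by (auto simp: borel_partitions_def)
    have d: "disjoint_family_on (\<lambda>E. E) P" using P(2) by (auto simp: disjoint_family_on_def pairwise_def disjnt_def)
    have "(\<Sum>E\<in>P. ennreal (lux (nu E))) \<le> (\<Sum>E\<in>P. \<integral>\<^sup>+s\<in>E. \<rho> s \<partial>m)" using P by (intro sum_mono key) auto
    also have "\<dots> = (\<Sum>E\<in>P. emeasure (density m \<rho>) E)"
      using P \<rho>m by (intro sum.cong) (auto simp: emeasure_density)
    also have "\<dots> = emeasure (density m \<rho>) (\<Union>E\<in>P. E)"
      using P d by (intro sum_emeasure) auto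
    also have "\<dots> = (\<integral>\<^sup>+s. \<rho> s \<partial>m)" using P(4) \<rho>m by (simp add: emeasure_density)
    finally show "(\<Sum>E\<in>P. ennreal (lux (nu E))) \<le> (\<integral>\<^sup>+s. \<rho> s \<partial>m)" .
  qed
  then show ?thesis using fin by (rule le_less_trans)
qed

end

section \<open>Consequences of a density\<close>

lemma compact_PiE_UNIV:
  fixes S :: "'i \<Rightarrow> 'a::topological_space set"
  assumes "\<And>i. compact (S i)"
  shows "compact (PiE UNIV S)"
proof -
  have "compactin (product_topology (\<lambda>i. euclidean) UNIV) (PiE UNIV S)"
    unfolding compactin_PiE using assms by simp
  then show ?thesis by (simp add: euclidean_product_topology)
qed

text \<open>A product of discs over a countable index type is sequentially compact, which packages
  the diagonal argument; convergence in the product is convergence of every coordinate.\<close>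

lemma bounded_coefficients_subseq:
  fixes c :: "nat \<Rightarrow> 'i::countable \<Rightarrow> complex"
  assumes "\<And>n i. cmod (c n i) \<le> R"
  obtains r l where "strict_mono (r :: nat \<Rightarrow> nat)" "\<forall>i. (\<lambda>n. c (r n) i) \<longlonglongrightarrow> l i"
proof -
  have "seq_compact (PiE UNIV (\<lambda>_::'i. cball (0::complex) R))"
    by (intro compact_imp_seq_compact compact_PiE_UNIV compact_cball)
  moreover have "\<forall>n. c n \<in> PiE UNIV (\<lambda>_. cball 0 R)" using assms by auto
  ultimately obtain l r where r: "strict_mono (r :: nat \<Rightarrow> nat)" "(c \<circ> r) \<longlonglongrightarrow> l"
    unfolding seq_compact_def by blast
  have "(\<lambda>n. c (r n) i) \<longlonglongrightarrow> l i" for i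
  proof -
    have "continuous_on UNIV (\<lambda>x::'i \<Rightarrow> complex. x i)" by (rule continuous_on_product_coordinates)
    then have "(\<lambda>n. (c \<circ> r) n i) \<longlonglongrightarrow> l i"
      by (rule continuous_on_tendsto_compose[OF _ r(2)]) simp_all
    then show ?thesis by simp
  qed
  then have "\<forall>i. (\<lambda>n. c (r n) i) \<longlonglongrightarrow> l i" by (rule allI)
  then show thesis by (rule that[OF r(1)])
qed

section \<open>The vector density formed by the translates of \<open>f\<close>\<close>

context conv_measure
begin

context
  fixes f :: "'g \<Rightarrow> complex"
  assumes f: "f \<in> L" and mu_f: "\<forall>A\<in>sets borel. mu A = (LINT x:A|m. f x)"
begin

text \<open>Right invariance moves \<open>u\<close> from \<open>w\<close> to \<open>f\<close>. Thus
  \<open>nu A\<close> is, tested against bounded functions, the integral over \<open>A\<close> of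
  the translates of \<open>f\<close>.\<close>

lemma W_density:
  assumes w: "w \<in> borel_measurable borel" "\<And>x. cmod (w x) \<le> B"
  shows "W w u = (LINT t|m. translate u f t * w t)"
proof -
  have ws: "(\<lambda>s. w (s + u)) \<in> borel_measurable borel"
    using measurable_compose[OF measurable_translates(2) w(1)] .
  have wsm: "(\<lambda>s. w (s + u)) \<in> borel_measurable m" using ws by (simp add: borel_measurable_m)
  have "integrable m (\<lambda>x. f x * w (x + u))" by (rule integrable_L_mult_bounded[OF f wsm w(2)])
  then have i: "integrable m (\<lambda>x. w (x + u) * f x)" by (simp add: mult.commute)
  have "W w u = (LINT s|m. w (s + u) * f s)"
    unfolding W_def using mu_f by (intro cintegral_density[OF sets_m integrable_L[OF f] _ ws i]) auto
  also have "\<dots> = (LINT s|m. translate u f (s + u) * w (s + u))"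
    by (simp add: translate_def mult.commute)
  also have "\<dots> = (LINT t|m. translate u f t * w t)"
    using measurable_translate[OF borel_measurable_L[OF f], of u] w(1)
    by (intro integral_right[of "\<lambda>t. translate u f t * w t"]) simp
  finally show ?thesis .
qed

lemma W_le: 
  assumes w: "w \<in> borel_measurable borel" "\<And>x. cmod (w x) \<le> B" and mod: "Psi.modular w 1 \<le> 1"
  shows "cmod (W w u) \<le> 2 * lux f"
proof -
  have "w \<in> borel_measurable m" using w(1) by (simp add: borel_measurable_m)
  from cmod_integral_Hoelder[OF translate_L[OF f, of u] this mod]
  show ?thesis using W_density[OF w, of u] lux_translate[OF f, of u] by simp
qed

lemma W_diff_le:
  assumes w: "w \<in> borel_measurable borel" "\<And>x. cmod (w x) \<le> B" and mod: "Psi.modular w 1 \<le> 1"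
  shows "cmod (W w u - W w v) \<le> 2 * lux (\<lambda>t. translate u f t - translate v f t)"
proof -
  have wm: "w \<in> borel_measurable m" using w(1) by (simp add: borel_measurable_m)
  have "W w u - W w v = (LINT t|m. (translate u f t - translate v f t) * w t)"
    using integrable_L_mult_bounded[OF translate_L[OF f] wm w(2)]
    by (simp add: W_density[OF w] left_diff_distrib)
  then show ?thesis
    using cmod_integral_Hoelder[OF L_diff[OF translate_L[OF f] translate_L[OF f]] wm mod] by simp
qed

text \<open>\<open>x\<close> is known only weakly, as the integral of \<open>g u\<close> times
  \<open>translate u f\<close>. Replacing \<open>u\<close> by \<open>\<sigma> u\<close> changes each
  pairing by at most \<open>2 * e\<close> times the \<open>L1\<close> norm of \<open>g\<close>, and
  \<open>norming_lux\<close> turns this into a norm estimate. It serves the values of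
  \<open>nu\<close> as well as the image of the unit ball.\<close>

lemma translate_sum_approx:
  assumes g: "integrable m g" and x: "integrable m x"
    and xg: "\<And>w B. w \<in> borel_measurable borel \<Longrightarrow> (\<And>t. cmod (w t) \<le> B) \<Longrightarrow> Psi.modular w 1 \<le> 1 \<Longrightarrow>
      (LINT t|m. x t * w t) = (LINT u|m. g u * W w u)"
    and \<sigma>: "finite (range \<sigma>)" "\<And>u. \<sigma> -` {u} \<in> sets borel"
      "\<And>v. lux (\<lambda>t. translate v f t - translate (\<sigma> v) f t) \<le> e" and e: "e \<ge> 0"
  defines "y \<equiv> \<lambda>t. \<Sum>v\<in>range \<sigma>. (LINT u|m. g u * indicator (\<sigma> -` {v}) u) * translate v f t"
  shows "y \<in> L" "x \<in> L" "lux (\<lambda>t. x t - y t) \<le> 2 * e * (LINT u|m. cmod (g u))"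
proof -
  show yL: "y \<in> L" unfolding y_def by (intro L_sum \<sigma>(1) translate_L f)
  have R0: "(LINT u|m. cmod (g u)) \<ge> 0" by simp
  have d: "integrable m (\<lambda>t. x t - y t)" using x integrable_L[OF yL] by simp
  have bound: "cmod (LINT t|m. (x t - y t) * w t) \<le> 2 * e * (LINT u|m. cmod (g u))"
    if w: "w \<in> borel_measurable m" "\<forall>t\<in>space m. cmod (w t) \<le> B" "Psi.modular w 1 \<le> 1" for w B
  proof -
    have wb: "w \<in> borel_measurable borel" "\<And>t. cmod (w t) \<le> B" using w by (auto simp: borel_measurable_m)
    have xw: "integrable m (\<lambda>t. x t * w t)"
    proof (rule Bochner_Integration.integrable_bound)
      show "integrable m (\<lambda>t. B * cmod (x t))" using x by simp
      show "AE t in m. norm (x t * w t) \<le> norm (B * cmod (x t))"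
      proof (rule AE_I2)
        fix t
        have "cmod (w t) \<le> \<bar>B\<bar>" using wb(2)[of t] by linarith
        then have "cmod (x t) * cmod (w t) \<le> cmod (x t) * \<bar>B\<bar>" by (intro mult_left_mono) auto
        then show "norm (x t * w t) \<le> norm (B * cmod (x t))" by (simp add: norm_mult abs_mult mult.commute)
      qed
    qed (use w(1) x in auto)
    have fw: "integrable m (\<lambda>t. translate v f t * w t)" for v
      by (rule integrable_L_mult_bounded[OF translate_L[OF f] w(1)]) (rule wb(2))
    have yw: "integrable m (\<lambda>t. y t * w t)"
      by (rule integrable_L_mult_bounded[OF yL w(1)]) (rule wb(2))
    have "(LINT t|m. y t * w t) = (\<Sum>v\<in>range \<sigma>. (LINT u|m. g u * indicator (\<sigma> -` {v}) u) * W w v)"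
      unfolding y_def W_density[OF wb] using fw
      by (simp add: sum_distrib_right mult.assoc)
    also have "\<dots> = (LINT u|m. g u * W w (\<sigma> u))" by (rule simple_integral(1)[OF \<sigma>(1,2) g, symmetric])
    finally have yW: "(LINT t|m. y t * w t) = (LINT u|m. g u * W w (\<sigma> u))" .
    have gW: "integrable m (\<lambda>u. g u * W w u)"
    proof (rule Bochner_Integration.integrable_bound)
      show "integrable m (\<lambda>u. 2 * lux f * cmod (g u))" using g by simp
      show "AE u in m. norm (g u * W w u) \<le> norm (2 * lux f * cmod (g u))"
      proof (rule AE_I2)
        fix u
        have "cmod (g u) * cmod (W w u) \<le> cmod (g u) * (2 * lux f)"
          using W_le[OF wb w(3)] by (intro mult_left_mono) auto
        then show "norm (g u * W w u) \<le> norm (2 * lux f * cmod (g u))"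
          using lux_nonneg[OF f] by (simp add: norm_mult abs_mult mult_ac)
      qed
      show "(\<lambda>u. g u * W w u) \<in> borel_measurable m"
        using g W_measurable[OF wb] by (auto simp: borel_measurable_m)
    qed
    have gS: "integrable m (\<lambda>u. g u * W w (\<sigma> u))" by (rule simple_integral(2)[OF \<sigma>(1,2) g])
    have "(LINT t|m. (x t - y t) * w t) = (LINT t|m. x t * w t) - (LINT t|m. y t * w t)"
      using xw yw by (simp add: left_diff_distrib)
    also have "\<dots> = (LINT u|m. g u * W w u) - (LINT u|m. g u * W w (\<sigma> u))"
      using xg[OF wb w(3)] yW by simp
    also have "\<dots> = (LINT u|m. g u * (W w u - W w (\<sigma> u)))"
      using gW gS by (simp add: right_diff_distrib)
    also have "cmod \<dots> \<le> (LINT u|m. cmod (g u * (W w u - W w (\<sigma> u))))" by (rule integral_norm_bound)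
    also have "\<dots> \<le> (LINT u|m. 2 * e * cmod (g u))"
    proof (rule integral_mono)
      show "integrable m (\<lambda>u. cmod (g u * (W w u - W w (\<sigma> u))))"
        using gW gS by (simp add: right_diff_distrib)
      fix u
      have "cmod (W w u - W w (\<sigma> u)) \<le> 2 * e" using W_diff_le[OF wb w(3), of u "\<sigma> u"] \<sigma>(3)[of u] by linarith
      then show "cmod (g u * (W w u - W w (\<sigma> u))) \<le> 2 * e * cmod (g u)"
        by (simp add: norm_mult mult.commute[of "cmod (g u)"] mult_right_mono)
    qed (use g in simp)
    finally show ?thesis by simp
  qed
  have b0: "2 * e * (LINT u|m. cmod (g u)) \<ge> 0" using e R0 by simp
  have dL: "(\<lambda>t. x t - y t) \<in> L" by (rule norming_lux(1)[OF d b0 bound])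
  show "lux (\<lambda>t. x t - y t) \<le> 2 * e * (LINT u|m. cmod (g u))" by (rule norming_lux(2)[OF d b0 bound])
  show "x \<in> L" using L_add[OF dL yL] by simp
qed

lemma nu_pairing:
  assumes A: "A \<in> sets borel" and w: "w \<in> borel_measurable borel" "\<And>t. cmod (w t) \<le> B"
  shows "(LINT t|m. nu A t * w t) = (LINT u|m. indicator A u * W w u)"
  using nu_duality[OF w A] by (simp add: set_lebesgue_integral_def scaleR_conv_of_real of_real_indicator)

lemma integrable_cindicator: "A \<in> sets borel \<Longrightarrow> integrable m (indicator A :: 'g \<Rightarrow> complex)"
  by (intro integrable_const_bound[of _ 1]) (auto simp: indicator_def)

lemma integral_cindicator: "A \<in> sets borel \<Longrightarrow> (LINT u|m. indicator A u) = complex_of_real (measure m A)"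
  using integral_complex_of_real[of m "indicator A"] by (simp add: of_real_indicator)

lemma nu_approx:
  assumes A: "A \<in> sets borel"
    and \<sigma>: "finite (range \<sigma>)" "\<And>u. \<sigma> -` {u} \<in> sets borel"
      "\<And>v. lux (\<lambda>t. translate v f t - translate (\<sigma> v) f t) \<le> e" and e: "e \<ge> 0"
  shows "lux (\<lambda>t. nu A t - (\<Sum>v\<in>range \<sigma>. (LINT u|m. indicator A u * indicator (\<sigma> -` {v}) u) * translate v f t)) \<le> 2 * e"
proof -
  have "lux (\<lambda>t. nu A t - (\<Sum>v\<in>range \<sigma>. (LINT u|m. indicator A u * indicator (\<sigma> -` {v}) u) * translate v f t))
      \<le> 2 * e * (LINT u|m. cmod (indicator A u))"
    by (rule translate_sum_approx(3)[OF integrable_cindicator[OF A] integrable_L[OF nu_L[OF A]] _ \<sigma> e])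
      (rule nu_pairing[OF A])
  also have "(LINT u|m. cmod (indicator A u)) = measure m A"
  proof -
    have "(\<lambda>u. cmod (indicator A u)) = indicator A" by (auto simp: indicator_def)
    then show ?thesis using A by simp
  qed
  also have "2 * e * measure m A \<le> 2 * e * 1"
    using finite_measure_mono[of A UNIV] measure_UNIV e by (intro mult_left_mono) auto
  finally show ?thesis by simp
qed

text \<open>Each translate pairs with a test to at most \<open>2 * lux f\<close>, so
  \<open>nu E\<close> has norm at most \<open>2 * lux f * measure m E\<close>, a bound that is
  additive in \<open>E\<close>.\<close>

lemma density_imp_finite_vvar: "vvar Phi m nu UNIV < \<infinity>"
proof -
  have key: "lux (nu E) \<le> 2 * lux f * measure m E" if E: "E \<in> sets borel" for E
  proof (rule norming_lux(2)[OF integrable_L[OF nu_L[OF E]]])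
    show "0 \<le> 2 * lux f * measure m E" using lux_nonneg[OF f] by simp
    fix w B assume w: "w \<in> borel_measurable m" "\<forall>t\<in>space m. cmod (w t) \<le> B" "Psi.modular w 1 \<le> 1"
    have wb: "w \<in> borel_measurable borel" "\<And>t. cmod (w t) \<le> B" using w by (auto simp: borel_measurable_m)
    have i: "integrable m (\<lambda>u. indicator E u * W w u)"
      using integrable_mult_indicator[of E m "W w"] E W_integrable[OF wb]
      by (simp add: scaleR_conv_of_real of_real_indicator)
    have "cmod (LINT t|m. nu E t * w t) \<le> (LINT u|m. cmod (indicator E u * W w u))"
      unfolding nu_pairing[OF E wb] by (rule integral_norm_bound)
    also have "\<dots> \<le> (LINT u|m. 2 * lux f * indicator E u)"
    proof (rule integral_mono)
      show "integrable m (\<lambda>u. 2 * lux f * indicator E u)"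
        using E by (intro integrable_mult_right integrable_real_indicator) (simp_all add: emeasure_eq_measure)
      show "cmod (indicator E u * W w u) \<le> 2 * lux f * indicator E u" for u
        using W_le[OF wb w(3), of u] by (simp add: indicator_def)
    qed (use i in simp)
    also have "\<dots> = 2 * lux f * measure m E" using E by simp
    finally show "cmod (LINT t|m. nu E t * w t) \<le> 2 * lux f * measure m E" .
  qed
  have "vvar Phi m nu UNIV \<le> ennreal (2 * lux f)"
    unfolding vvar_def
  proof (rule SUP_least)
    fix P :: "'g set set" assume "P \<in> borel_partitions UNIV"
    then have P: "finite P" "disjoint P" "P \<subseteq> sets borel" "\<Union>P = UNIV" by (auto simp: borel_partitions_def)
    have d: "disjoint_family_on (\<lambda>E. E) P" using P(2) by (auto simp: disjoint_family_on_def pairwise_def disjnt_def)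
    have "(\<Sum>E\<in>P. ennreal (lux (nu E))) \<le> (\<Sum>E\<in>P. ennreal (2 * lux f * measure m E))"
      using P by (intro sum_mono ennreal_leI key) auto
    also have "\<dots> = ennreal (\<Sum>E\<in>P. 2 * lux f * measure m E)"
      using lux_nonneg[OF f] by (intro sum_ennreal) simp
    also have "(\<Sum>E\<in>P. 2 * lux f * measure m E) = 2 * lux f * (\<Sum>E\<in>P. measure m E)" by (simp only: sum_distrib_left)
    also have "(\<Sum>E\<in>P. measure m E) = measure m (\<Union>E\<in>P. E)"
      using P d by (intro finite_measure_finite_Union[symmetric]) auto
    also have "\<dots> = 1" using P(4) measure_UNIV by simp
    finally show "(\<Sum>E\<in>P. ennreal (lux (nu E))) \<le> ennreal (2 * lux f)" by simp
  qed
  then show ?thesis by (rule le_less_trans) simp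
qed

text \<open>The finitely valued selections of translates approximate the orbit map uniformly, so one
  sequence is a Bochner approximation and computes the integral over all Borel sets.\<close>

lemma density_imp_Bochner:
  "bochner_integrable_LPhi Phi m (\<lambda>u. translate u f)
    \<and> (\<forall>A\<in>sets borel. has_bochner_integral_LPhi Phi m (\<lambda>u. translate u f) A (nu A))"
proof -
  have "\<forall>n::nat. \<exists>\<sigma>. finite (range \<sigma>) \<and> (\<forall>u. \<sigma> -` {u} \<in> sets borel)
      \<and> (\<forall>v. lux (\<lambda>t. translate v f t - translate (\<sigma> v) f t) \<le> 1 / real (Suc n))"
  proof
    fix n :: nat
    have "1 / real (Suc n) > 0" by simp
    from translate_selection[OF f this]
    show "\<exists>\<sigma>. finite (range \<sigma>) \<and> (\<forall>u. \<sigma> -` {u} \<in> sets borel)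
      \<and> (\<forall>v. lux (\<lambda>t. translate v f t - translate (\<sigma> v) f t) \<le> 1 / real (Suc n))" by metis
  qed
  then obtain \<sigma> :: "nat \<Rightarrow> 'g \<Rightarrow> 'g" where \<sigma>: "\<And>n. finite (range (\<sigma> n))" "\<And>n u. \<sigma> n -` {u} \<in> sets borel"
    "\<And>n v. lux (\<lambda>t. translate v f t - translate (\<sigma> n v) f t) \<le> 1 / real (Suc n)" by metis
  define F where "F n v = translate (\<sigma> n v) f" for n v
  have lim: "(\<lambda>n. 1 / real (Suc n)) \<longlonglongrightarrow> 0" using LIMSEQ_inverse_real_of_nat by (simp add: inverse_eq_divide)
  have le: "lux (\<lambda>t. F n v t - translate v f t) \<le> 1 / real (Suc n)" for n v
    using \<sigma>(3)[of v n] lux_diff_commute[OF translate_L[OF f] translate_L[OF f]] by (simp add: F_def)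
  have nonneg: "lux (\<lambda>t. F n v t - translate v f t) \<ge> 0" for n v
    unfolding F_def by (intro lux_nonneg L_diff translate_L f)
  \<comment> \<open>Different values of \<open>\<sigma> n\<close> may give the same translate, so a
    level set of \<open>F n\<close> is a finite union of level sets of
    \<open>\<sigma> n\<close>.\<close>
  have Fset: "F n -` {x} \<in> sets borel" for n x
  proof -
    have "F n -` {x} = (\<Union>u\<in>{u\<in>range (\<sigma> n). translate u f = x}. \<sigma> n -` {u})" by (auto simp: F_def)
    also have "\<dots> \<in> sets borel" using \<sigma>(1,2) by (intro sets.finite_UN) auto
    finally show ?thesis .
  qed
  have Ffin: "finite (range (F n))" for n
  proof -
    have "range (F n) = (\<lambda>u. translate u f) ` range (\<sigma> n)" by (auto simp: F_def)
    then show ?thesis using \<sigma>(1) by simp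
  qed
  have simpF: "simple_LPhi Phi m (F n)" for n
    unfolding simple_LPhi_def using Ffin Fset translate_L[OF f] by (auto simp: F_def)
  have approx: "bochner_approx Phi m (\<lambda>u. translate u f) F"
    unfolding bochner_approx_def
  proof (intro conjI allI simpF AE_I2)
    fix s
    show "(\<lambda>n. lux (\<lambda>t. F n s t - translate s f t)) \<longlonglongrightarrow> 0"
    proof (rule Lim_null_comparison[OF _ lim])
      show "\<forall>\<^sub>F n in sequentially. norm (lux (\<lambda>t. F n s t - translate s f t)) \<le> 1 / real (Suc n)"
        using le nonneg by (intro always_eventually allI) (simp only: real_norm_def abs_of_nonneg)
    qed
  next
    have up: "(\<integral>\<^sup>+s. ennreal (lux (\<lambda>t. F n s t - translate s f t)) \<partial>m) \<le> ennreal (1 / real (Suc n))" for n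
    proof -
      have "(\<integral>\<^sup>+s. ennreal (lux (\<lambda>t. F n s t - translate s f t)) \<partial>m) \<le> (\<integral>\<^sup>+s. ennreal (1 / real (Suc n)) \<partial>m)"
        by (intro nn_integral_mono ennreal_leI le)
      then show ?thesis by (simp add: emeasure_UNIV)
    qed
    have lim': "(\<lambda>n. ennreal (1 / real (Suc n))) \<longlonglongrightarrow> 0"
      using tendsto_ennrealI[OF lim] by (simp only: ennreal_0)
    define I where "I n = (\<integral>\<^sup>+s. ennreal (lux (\<lambda>t. F n s t - translate s f t)) \<partial>m)" for n
    have "I \<longlonglongrightarrow> 0"
    proof (rule tendsto_sandwich[OF _ _ tendsto_const lim'])
      show "\<forall>\<^sub>F n in sequentially. 0 \<le> I n" by (intro always_eventually allI zero_le)
      show "\<forall>\<^sub>F n in sequentially. I n \<le> ennreal (1 / real (Suc n))"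
        unfolding I_def by (intro always_eventually allI up)
    qed
    then show "(\<lambda>n. \<integral>\<^sup>+s. ennreal (lux (\<lambda>t. F n s t - translate s f t)) \<partial>m) \<longlonglongrightarrow> 0"
      by (simp only: I_def[abs_def])
  qed
  have int: "has_bochner_integral_LPhi Phi m (\<lambda>u. translate u f) A (nu A)" if A: "A \<in> sets borel" for A
    unfolding has_bochner_integral_LPhi_def
  proof (intro exI conjI)
    show "bochner_approx Phi m (\<lambda>u. translate u f) F" by (rule approx)
    \<comment> \<open>The sum over values of \<open>F n\<close> and the sum over values of
      \<open>\<sigma> n\<close> are groupings of the same integral; the second form is the one
      estimated in \<open>nu_approx\<close>.\<close>
    have eq: "simple_int m (F n) A t
        = (\<Sum>v\<in>range (\<sigma> n). (LINT u|m. indicator A u * indicator (\<sigma> n -` {v}) u) * translate v f t)" for n t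
    proof -
      have "simple_int m (F n) A t = (\<Sum>x\<in>range (F n). (LINT u|m. indicator A u * indicator (F n -` {x}) u) * x t)"
        unfolding simple_int_def
      proof (intro sum.cong refl)
        fix x
        have "(LINT u|m. indicator A u * indicator (F n -` {x}) u) = complex_of_real (measure m (A \<inter> F n -` {x}))"
          using integral_cindicator[of "A \<inter> F n -` {x}"] A Fset by (simp add: indicator_inter_arith sets.Int)
        then show "complex_of_real (measure m (A \<inter> F n -` {x})) * x t = (LINT u|m. indicator A u * indicator (F n -` {x}) u) * x t"
          by simp
      qed
      also have "\<dots> = (LINT u|m. indicator A u * F n u t)"
        by (rule simple_integral(1)[OF Ffin Fset integrable_cindicator[OF A], symmetric])
      also have "\<dots> = (LINT u|m. indicator A u * translate (\<sigma> n u) f t)" by (simp add: F_def)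
      also have "\<dots> = (\<Sum>v\<in>range (\<sigma> n). (LINT u|m. indicator A u * indicator (\<sigma> n -` {v}) u) * translate v f t)"
        by (rule simple_integral(1)[OF \<sigma>(1,2) integrable_cindicator[OF A]])
      finally show ?thesis .
    qed
    have SL: "simple_int m (F n) A \<in> L" for n by (rule lux_simple_int_le(1)[OF simpF A])
    have b: "lux (\<lambda>t. simple_int m (F n) A t - nu A t) \<le> 2 * (1 / real (Suc n))" for n
    proof -
      have "lux (\<lambda>t. nu A t - simple_int m (F n) A t) \<le> 2 * (1 / real (Suc n))"
        unfolding eq by (rule nu_approx[OF A \<sigma>]) simp
      then show ?thesis using lux_diff_commute[OF SL nu_L[OF A]] by simp
    qed
    have b0: "lux (\<lambda>t. simple_int m (F n) A t - nu A t) \<ge> 0" for n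
      by (intro lux_nonneg L_diff SL nu_L A)
    show "(\<lambda>n. lux (\<lambda>t. simple_int m (F n) A t - nu A t)) \<longlonglongrightarrow> 0"
    proof (rule Lim_null_comparison[OF _ tendsto_mult_right_zero[OF lim]])
      show "\<forall>\<^sub>F n in sequentially. norm (lux (\<lambda>t. simple_int m (F n) A t - nu A t)) \<le> 2 * (1 / real (Suc n))"
        using b b0 by (intro always_eventually allI) (simp only: real_norm_def abs_of_nonneg)
    qed
  qed
  show ?thesis
    unfolding bochner_integrable_LPhi_def using approx int translate_L[OF f] by blast
qed

text \<open>The functional is arbitrary and need not come from a function. Measurability of
  \<open>u \<mapsto> ph (translate u f)\<close> is drawn from continuity of translation, and the
  integral identity from finite sums of translates, where linearity of \<open>ph\<close> is
  enough.\<close>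

lemma density_imp_Pettis:
  "pettis_integrable_LPhi Phi m (\<lambda>u. translate u f)
    \<and> (\<forall>A\<in>sets borel. pettis_integral_is Phi m (\<lambda>u. translate u f) A (nu A))"
proof -
  note TL = translate_L[OF f]
  have phi: "integrable m (\<lambda>u. ph (translate u f))" if ph: "ph \<in> orlicz_dual Phi m" for ph
  proof -
    obtain C where C: "C > 0" "\<forall>f\<in>L. cmod (ph f) \<le> C * lux f" by (rule dual_bound[OF ph])
    have "continuous_on UNIV (\<lambda>u. ph (translate u f))"
      unfolding continuous_on_def
    proof (intro ballI tendstoI)
      fix u and e :: real assume e: "e > 0"
      have "e / (2 * C) > 0" using e C by simp
      then obtain V where V: "open V" "u \<in> V" "\<forall>v\<in>V. lux (\<lambda>t. translate v f t - translate u f t) \<le> e / (2 * C)"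
        by (rule continuous_translate[OF f])
      have "dist (ph (translate v f)) (ph (translate u f)) < e" if v: "v \<in> V" for v
      proof -
        have "cmod (ph (\<lambda>t. translate v f t - translate u f t)) \<le> C * lux (\<lambda>t. translate v f t - translate u f t)"
          using C(2) L_diff[OF TL TL] by blast
        also have "\<dots> \<le> C * (e / (2 * C))" using V(3) v C(1) by (intro mult_left_mono) auto
        also have "\<dots> < e" using C(1) e by simp
        finally show ?thesis using dual_diff[OF ph TL TL] by (simp add: dist_norm)
      qed
      then show "\<forall>\<^sub>F v in at u within UNIV. dist (ph (translate v f)) (ph (translate u f)) < e"
        using V(1,2) by (auto simp: eventually_at_topological)
    qed
    then have meas: "(\<lambda>u. ph (translate u f)) \<in> borel_measurable borel" by (rule borel_measurable_continuous_onI)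
    have "cmod (ph (translate u f)) \<le> C * lux f" for u
      using C(2) TL[of u] lux_translate[OF f, of u] by force
    then show ?thesis using meas by (intro integrable_const_bound[of _ "C * lux f"]) (auto simp: borel_measurable_m)
  qed
  have int: "pettis_integral_is Phi m (\<lambda>u. translate u f) A (nu A)" if A: "A \<in> sets borel" for A
    unfolding pettis_integral_is_def
  proof (intro conjI ballI nu_L[OF A])
    fix ph assume ph: "ph \<in> orlicz_dual Phi m"
    obtain C where C: "C > 0" "\<forall>f\<in>L. cmod (ph f) \<le> C * lux f" by (rule dual_bound[OF ph])
    have I: "(LINT u:A|m. ph (translate u f)) = (LINT u|m. indicator A u * ph (translate u f))"
      by (simp add: set_lebesgue_integral_def scaleR_conv_of_real of_real_indicator)
    have "cmod ((LINT u|m. indicator A u * ph (translate u f)) - ph (nu A)) \<le> e" if e: "e > 0" for e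
    proof -
      \<comment> \<open>The estimate of \<open>nu_approx\<close> contributes
        \<open>2 * C * d\<close>, the replacement of \<open>u\<close> by \<open>\<sigma> u\<close>
        inside the integral another \<open>C * d\<close>.\<close>
      define d where "d = e / (3 * C)"
      have d: "d > 0" "3 * C * d = e" using e C by (auto simp: d_def)
      obtain \<sigma> where \<sigma>: "finite (range \<sigma>)" "\<And>u. \<sigma> -` {u} \<in> sets borel"
        "\<And>v. lux (\<lambda>t. translate v f t - translate (\<sigma> v) f t) \<le> d"
        using translate_selection[OF f d(1)] by metis
      define c where "c v = (LINT u|m. indicator A u * indicator (\<sigma> -` {v}) u :: complex)" for v :: 'g
      define S where "S t = (\<Sum>v\<in>range \<sigma>. c v * translate v f t)" for t
      have SL: "S \<in> L" unfolding S_def[abs_def] by (intro L_sum \<sigma>(1) TL)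
      have "lux (\<lambda>t. nu A t - S t) \<le> 2 * d"
        unfolding S_def c_def using d(1) by (intro nu_approx[OF A \<sigma>]) simp
      then have "cmod (ph (\<lambda>t. nu A t - S t)) \<le> C * (2 * d)"
        using C L_diff[OF nu_L[OF A] SL] by (meson mult_left_mono less_imp_le order_trans)
      then have 1: "cmod (ph (nu A) - ph S) \<le> 2 * C * d" using dual_diff[OF ph nu_L[OF A] SL] by simp
      have phS: "ph S = (LINT u|m. indicator A u * ph (translate (\<sigma> u) f))"
        unfolding S_def[abs_def] dual_sum[OF ph \<sigma>(1) TL] c_def
        by (rule simple_integral(1)[OF \<sigma>(1,2) integrable_cindicator[OF A], symmetric])
      have i1: "integrable m (\<lambda>u. indicator A u * ph (translate u f))"
        using integrable_mult_indicator[of A m "\<lambda>u. ph (translate u f)"] A phi[OF ph]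
        by (simp add: scaleR_conv_of_real of_real_indicator)
      have i2: "integrable m (\<lambda>u. indicator A u * ph (translate (\<sigma> u) f))"
        by (rule simple_integral(2)[OF \<sigma>(1,2) integrable_cindicator[OF A]])
      have "cmod ((LINT u|m. indicator A u * ph (translate u f)) - ph S)
          = cmod (LINT u|m. indicator A u * ph (translate u f) - indicator A u * ph (translate (\<sigma> u) f))"
        using i1 i2 by (simp add: phS)
      also have "\<dots> \<le> (LINT u|m. cmod (indicator A u * ph (translate u f) - indicator A u * ph (translate (\<sigma> u) f)))"
        by (rule integral_norm_bound)
      also have "\<dots> \<le> (LINT u|m. C * d)"
      proof (rule integral_mono)
        fix u
        have "cmod (ph (\<lambda>t. translate u f t - translate (\<sigma> u) f t)) \<le> C * lux (\<lambda>t. translate u f t - translate (\<sigma> u) f t)"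
          using C(2) L_diff[OF TL TL] by blast
        also have "\<dots> \<le> C * d" using \<sigma>(3) C(1) by (intro mult_left_mono) auto
        finally have "cmod (ph (translate u f) - ph (translate (\<sigma> u) f)) \<le> C * d" using dual_diff[OF ph TL TL] by simp
        then show "cmod (indicator A u * ph (translate u f) - indicator A u * ph (translate (\<sigma> u) f)) \<le> C * d"
          using C(1) d(1) by (simp add: indicator_def)
      qed (use i1 i2 in simp_all)
      also have "\<dots> = C * d" by (simp add: measure_UNIV)
      finally have 2: "cmod ((LINT u|m. indicator A u * ph (translate u f)) - ph S) \<le> C * d" .
      have "cmod ((LINT u|m. indicator A u * ph (translate u f)) - ph (nu A))
          \<le> cmod ((LINT u|m. indicator A u * ph (translate u f)) - ph S) + cmod (ph (nu A) - ph S)"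
        using norm_triangle_ineq4[of "(LINT u|m. indicator A u * ph (translate u f)) - ph S" "ph (nu A) - ph S"] by simp
      then show ?thesis using 1 2 d(2) by simp
    qed
    then have "cmod ((LINT u|m. indicator A u * ph (translate u f)) - ph (nu A)) \<le> 0"
      by (rule field_le_epsilon) simp
    then show "(LINT u:A|m. ph (translate u f)) = ph (nu A)" unfolding I by simp
  qed
  show ?thesis unfolding pettis_integrable_LPhi_def using phi int TL by blast
qed

text \<open>Under the functional given by the Haar integral divided by \<open>C\<close>,
  \<open>nu E\<close> becomes \<open>mu UNIV * measure m E / C\<close>. Its variation therefore
  dominates \<open>k * m\<close> with \<open>k = cmod (mu UNIV) / C > 0\<close>, and elements of the
  unit ball have \<open>L1\<close> norm at most \<open>1 / k\<close>.\<close>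

lemma image_ball_pairing:
  obtains R where "R > 0" "\<forall>g x. g \<in> L1_vm Phi m nu \<longrightarrow> L1_vm_norm Phi m nu g \<le> 1 \<longrightarrow> vm_integral_is Phi m nu g UNIV x \<longrightarrow>
    x \<in> L \<and> integrable m g \<and> (LINT u|m. cmod (g u)) \<le> R
    \<and> (\<forall>w B. w \<in> borel_measurable borel \<longrightarrow> (\<forall>t. cmod (w t) \<le> B) \<longrightarrow> Psi.modular w 1 \<le> 1 \<longrightarrow>
      (LINT t|m. x t * w t) = (LINT u|m. g u * W w u))"
proof -
  obtain C where C: "C > 0" "(\<lambda>h. complex_of_real (1 / C) * (LINT x|m. h x)) \<in> orlicz_dual_ball Phi m"
    by (rule integral_functional_ball)
  define k where "k = cmod (mu UNIV) / C"
  have k: "k > 0" using mu_UNIV C(1) by (simp add: k_def)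
  define ph where "ph = (\<lambda>h::'g \<Rightarrow> complex. complex_of_real (1 / C) * (LINT x|m. h x))"
  have phb: "ph \<in> orlicz_dual_ball Phi m" unfolding ph_def by (rule C(2))
  then have phd: "ph \<in> orlicz_dual Phi m" by (simp add: orlicz_dual_ball_def)
  have ph_nu: "cmod (ph (nu E)) = k * measure m E" if E: "E \<in> sets borel" for E
  proof -
    have "W (\<lambda>_. 1) u = mu UNIV" for u
    proof -
      have "(\<lambda>s::'g. 1 :: complex) = indicator UNIV" by auto
      then show ?thesis unfolding W_def using cintegral_indicator[OF mu_ca, of UNIV] by simp
    qed
    moreover have "(LINT t|m. nu E t) = (LINT u|m. indicator E u * W (\<lambda>_. 1) u)"
      using nu_pairing[OF E, of "\<lambda>_. 1" 1] by simp
    ultimately have "(LINT t|m. nu E t) = complex_of_real (measure m E) * mu UNIV"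
      using integral_cindicator[OF E] by simp
    then show ?thesis using C(1) by (simp add: ph_def k_def norm_mult norm_divide)
  qed
  have "g \<in> L1_vm Phi m nu \<longrightarrow> L1_vm_norm Phi m nu g \<le> 1 \<longrightarrow> vm_integral_is Phi m nu g UNIV x \<longrightarrow>
    x \<in> L \<and> integrable m g \<and> (LINT u|m. cmod (g u)) \<le> 1 / k
    \<and> (\<forall>w B. w \<in> borel_measurable borel \<longrightarrow> (\<forall>t. cmod (w t) \<le> B) \<longrightarrow> Psi.modular w 1 \<le> 1 \<longrightarrow>
      (LINT t|m. x t * w t) = (LINT u|m. g u * W w u))" for g x
  proof (intro impI)
    assume g: "g \<in> L1_vm Phi m nu" and gn: "L1_vm_norm Phi m nu g \<le> 1" and x: "vm_integral_is Phi m nu g UNIV x"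
    have gm: "g \<in> borel_measurable borel" using g by (simp add: L1_vm_def)
    have gmm: "g \<in> borel_measurable m" using gm by (simp add: borel_measurable_m)
    have xL: "x \<in> L" using x by (simp add: vm_integral_is_def)
    let ?V = "var_measure (\<lambda>E. ph (nu E))"
    have ca: "countably_additive_c (\<lambda>E. ph (nu E))" by (rule dual_nu_countably_additive[OF phd])
    let ?N = "density m (\<lambda>_. ennreal k)"
    have NV: "emeasure ?N E \<le> emeasure ?V E" if E: "E \<in> sets borel" for E
    proof -
      have "emeasure ?N E = ennreal k * emeasure m E" using E by (simp add: emeasure_density nn_integral_cmult_indicator)
      also have "\<dots> = ennreal (cmod (ph (nu E)))"
        unfolding ph_nu[OF E] using k by (simp add: emeasure_eq_measure ennreal_mult)
      also have "\<dots> \<le> emeasure ?V E"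
        unfolding emeasure_var_measure[OF ca E] cvar_eq_partition_var by (rule partition_var_ge[OF E])
      finally show ?thesis .
    qed
    have "ennreal k * (\<integral>\<^sup>+s. ennreal (cmod (g s)) \<partial>m) = (\<integral>\<^sup>+s. ennreal (cmod (g s)) \<partial>?N)"
      using gmm by (simp add: nn_integral_density nn_integral_cmult)
    also have "\<dots> \<le> (\<integral>\<^sup>+s. ennreal (cmod (g s)) \<partial>?V)"
    proof (rule nn_integral_mono_measure)
      show s: "sets ?N = sets ?V" by simp
      show "?N \<le> ?V" unfolding le_measure[OF s] using NV by simp
    qed
    also have "\<dots> \<le> L1_vm_norm Phi m nu g"
      unfolding L1_vm_norm_def by (rule SUP_upper[OF phb])
    also note gn
    finally have kg: "ennreal k * (\<integral>\<^sup>+s. ennreal (cmod (g s)) \<partial>m) \<le> 1" .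
    have "(\<integral>\<^sup>+s. ennreal (cmod (g s)) \<partial>m) = ennreal (1 / k) * (ennreal k * (\<integral>\<^sup>+s. ennreal (cmod (g s)) \<partial>m))"
      using k by (simp add: mult.assoc[symmetric] ennreal_mult[symmetric])
    also have "\<dots> \<le> ennreal (1 / k) * 1" by (intro mult_left_mono kg) simp
    finally have nn: "(\<integral>\<^sup>+s. ennreal (cmod (g s)) \<partial>m) \<le> ennreal (1 / k)" by simp
    then have "(\<integral>\<^sup>+s. ennreal (norm (g s)) \<partial>m) < \<infinity>" by (rule le_less_trans) simp
    with gmm have gi: "integrable m g" by (rule integrableI_bounded)
    have "ennreal (LINT u|m. cmod (g u)) \<le> ennreal (1 / k)"
      using nn gi by (subst nn_integral_eq_integral[symmetric]) auto
    then have gk: "(LINT u|m. cmod (g u)) \<le> 1 / k" using k by (subst (asm) ennreal_le_iff) auto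
    have pair: "(LINT t|m. x t * w t) = (LINT u|m. g u * W w u)"
      if w: "w \<in> borel_measurable borel" "\<forall>t. cmod (w t) \<le> B" "Psi.modular w 1 \<le> 1" for w B
    proof -
      have wB: "cmod (w t) \<le> B" for t using w(2) by blast
      have wm: "w \<in> borel_measurable m" using w(1) by (simp add: borel_measurable_m)
      have phw: "(\<lambda>h. LINT x|m. h x * w x) \<in> orlicz_dual Phi m"
        by (rule test_functional(1)[OF wm wB w(3)])
      have la: "(LINT x|m. nu E x * w x) = (LINT u:E|m. W w u)" if "E \<in> sets borel" for E
        by (rule nu_duality[OF w(1) wB that])
      have gW: "integrable m (\<lambda>u. g u * W w u)"
      proof (rule Bochner_Integration.integrable_bound)
        show "integrable m (\<lambda>u. 2 * lux f * cmod (g u))" using gi by simp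
        show "AE u in m. norm (g u * W w u) \<le> norm (2 * lux f * cmod (g u))"
        proof (rule AE_I2)
          fix u
          have "cmod (g u) * cmod (W w u) \<le> cmod (g u) * (2 * lux f)"
            using W_le[OF w(1) wB w(3)] by (intro mult_left_mono) auto
          then show "norm (g u * W w u) \<le> norm (2 * lux f * cmod (g u))"
            using lux_nonneg[OF f] by (simp add: norm_mult abs_mult mult_ac)
        qed
        show "(\<lambda>u. g u * W w u) \<in> borel_measurable m"
          using gmm W_measurable[OF w(1) wB] by (auto simp: borel_measurable_m)
      qed
      have "\<forall>ph\<in>orlicz_dual Phi m. cintegral (\<lambda>E. ph (nu E)) g UNIV = ph x"
        using x by (simp add: vm_integral_is_def)
      from bspec[OF this phw] have "(LINT t|m. x t * w t) = cintegral (\<lambda>E. LINT x|m. nu E x * w x) g UNIV" by simp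
      also have "\<dots> = (LINT u|m. g u * W w u)"
        by (rule cintegral_density[OF sets_m W_integrable[OF w(1) wB] la gm gW])
      finally show ?thesis .
    qed
    show "x \<in> L \<and> integrable m g \<and> (LINT u|m. cmod (g u)) \<le> 1 / k
      \<and> (\<forall>w B. w \<in> borel_measurable borel \<longrightarrow> (\<forall>t. cmod (w t) \<le> B) \<longrightarrow> Psi.modular w 1 \<le> 1 \<longrightarrow>
        (LINT t|m. x t * w t) = (LINT u|m. g u * W w u))"
      using xL gi gk pair by (intro conjI allI impI)
  qed
  then show thesis using that[of "1 / k"] k by simp
qed

text \<open>The elements of the image of the unit ball are, up to a uniformly small error, combinations
  of finitely many translates of \<open>f\<close> with bounded coefficients.\<close>
lemma density_imp_compact: "integration_op_compact Phi m nu"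
  unfolding integration_op_compact_def
proof (intro allI impI)
  fix x :: "nat \<Rightarrow> 'g \<Rightarrow> complex"
  assume x: "\<forall>n. \<exists>f\<in>L1_vm Phi m nu. L1_vm_norm Phi m nu f \<le> 1 \<and> vm_integral_is Phi m nu f UNIV (x n)"
  obtain R where R: "R > 0" "\<forall>g x. g \<in> L1_vm Phi m nu \<longrightarrow> L1_vm_norm Phi m nu g \<le> 1 \<longrightarrow> vm_integral_is Phi m nu g UNIV x \<longrightarrow>
    x \<in> L \<and> integrable m g \<and> (LINT u|m. cmod (g u)) \<le> R
    \<and> (\<forall>w B. w \<in> borel_measurable borel \<longrightarrow> (\<forall>t. cmod (w t) \<le> B) \<longrightarrow> Psi.modular w 1 \<le> 1 \<longrightarrow>
      (LINT t|m. x t * w t) = (LINT u|m. g u * W w u))"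
    by (rule image_ball_pairing)
  obtain g where g: "\<And>n. g n \<in> L1_vm Phi m nu" "\<And>n. L1_vm_norm Phi m nu (g n) \<le> 1" "\<And>n. vm_integral_is Phi m nu (g n) UNIV (x n)"
    using x by metis
  have P: "x n \<in> L \<and> integrable m (g n) \<and> (LINT u|m. cmod (g n u)) \<le> R
    \<and> (\<forall>w B. w \<in> borel_measurable borel \<longrightarrow> (\<forall>t. cmod (w t) \<le> B) \<longrightarrow> Psi.modular w 1 \<le> 1 \<longrightarrow>
      (LINT t|m. x n t * w t) = (LINT u|m. g n u * W w u))" for n
    using R(2)[rule_format, OF g] by blast
  have xL: "x n \<in> L" and gi: "integrable m (g n)" and gR: "(LINT u|m. cmod (g n u)) \<le> R" for n
    using P by blast+
  have pair: "(LINT t|m. x n t * w t) = (LINT u|m. g n u * W w u)"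
    if "w \<in> borel_measurable borel" "\<And>t. cmod (w t) \<le> B" "Psi.modular w 1 \<le> 1" for n w B
    using P[of n] that by blast
  have "\<forall>k::nat. \<exists>\<sigma>. finite (range \<sigma>) \<and> (\<forall>u. \<sigma> -` {u} \<in> sets borel)
      \<and> (\<forall>v. lux (\<lambda>t. translate v f t - translate (\<sigma> v) f t) \<le> 1 / real (Suc k))"
  proof
    fix k :: nat
    have "1 / real (Suc k) > 0" by simp
    from translate_selection[OF f this]
    show "\<exists>\<sigma>. finite (range \<sigma>) \<and> (\<forall>u. \<sigma> -` {u} \<in> sets borel)
      \<and> (\<forall>v. lux (\<lambda>t. translate v f t - translate (\<sigma> v) f t) \<le> 1 / real (Suc k))" by metis
  qed
  then obtain \<sigma> :: "nat \<Rightarrow> 'g \<Rightarrow> 'g" where \<sigma>: "\<And>n. finite (range (\<sigma> n))" "\<And>n u. \<sigma> n -` {u} \<in> sets borel"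
    "\<And>n v. lux (\<lambda>t. translate v f t - translate (\<sigma> n v) f t) \<le> 1 / real (Suc n)" by metis
  define c where "c n k v = (LINT u|m. g n u * indicator (\<sigma> k -` {v}) u)" for n k v
  have c_le: "cmod (c n k v) \<le> R" for n k v
  proof -
    have "integrable m (\<lambda>u. g n u * indicator (\<sigma> k -` {v}) u)"
      using integrable_mult_indicator[of "\<sigma> k -` {v}" m "g n"] gi \<sigma>(2)
      by (simp add: scaleR_conv_of_real of_real_indicator mult.commute)
    then have "(LINT u|m. cmod (g n u * indicator (\<sigma> k -` {v}) u)) \<le> (LINT u|m. cmod (g n u))"
      using gi by (intro integral_mono) (auto simp: indicator_def)
    then show ?thesis unfolding c_def using integral_norm_bound[of m "\<lambda>u. g n u * indicator (\<sigma> k -` {v}) u"] gR[of n] by linarith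
  qed
  define y where "y n k t = (\<Sum>v\<in>range (\<sigma> k). c n k v * translate v f t)" for n k t
  have yL: "y n k \<in> L" for n k unfolding y_def[abs_def] by (intro L_sum \<sigma>(1) translate_L f)
  have xy: "lux (\<lambda>t. x n t - y n k t) \<le> 2 * (1 / real (Suc k)) * R" for n k
  proof -
    have "lux (\<lambda>t. x n t - y n k t) \<le> 2 * (1 / real (Suc k)) * (LINT u|m. cmod (g n u))"
      unfolding y_def c_def by (rule translate_sum_approx(3)[OF gi integrable_L[OF xL] pair \<sigma>]) simp_all
    also have "\<dots> \<le> 2 * (1 / real (Suc k)) * R" using gR by (intro mult_left_mono) auto
    finally show ?thesis .
  qed
  \<comment> \<open>The values of all \<open>\<sigma> k\<close> form a countable set; enumerating it
    by natural numbers indexes all coefficients by a countable type, so one subsequence makes all of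
    them converge.\<close>
  define D where "D = (\<Union>k. range (\<sigma> k))"
  have D: "countable D" unfolding D_def using \<sigma>(1) by (intro countable_UN) (auto intro: countable_finite)
  obtain r l where r: "strict_mono (r :: nat \<Rightarrow> nat)" "\<forall>i. (\<lambda>n. (\<lambda>(k, j). c (r n) k (from_nat_into D j)) i) \<longlonglongrightarrow> l i"
    using bounded_coefficients_subseq[of "\<lambda>n (k, j). c n k (from_nat_into D j)" R] c_le by (auto simp: split_beta)
  have conv: "\<exists>l. (\<lambda>n. c (r n) k v) \<longlonglongrightarrow> l" if "v \<in> range (\<sigma> k)" for k v
  proof -
    have "v \<in> D" using that by (auto simp: D_def)
    then have "from_nat_into D (to_nat_on D v) = v" using D by simp
    then show ?thesis using r(2)[rule_format, of "(k, to_nat_on D v)"] by auto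
  qed
  have Cauchy: "\<exists>N. \<forall>i\<ge>N. \<forall>j\<ge>N. lux (\<lambda>t. x (r i) t - x (r j) t) < e" if e: "e > 0" for e
  proof -
    \<comment> \<open>Distances in \<open>x\<close> are compared through the finite sums
      \<open>y\<close> of level \<open>k\<close>. The two approximation errors and the distance of
      the sums are each below \<open>e / 4\<close>; the index shift \<open>Suc k\<close> only
      improves the choice.\<close>
    obtain k where k: "2 * R / (e / 4) < real k" using reals_Archimedean2 by blast
    have small: "2 * (1 / real (Suc k)) * R < e / 4"
    proof -
      have "2 * R < real k * (e / 4)" using k e by (simp add: pos_divide_less_eq)
      also have "\<dots> \<le> real (Suc k) * (e / 4)" using e by (intro mult_right_mono) auto
      finally show ?thesis by (simp add: pos_divide_less_eq mult.commute)
    qed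
    define d where "d i j = (\<Sum>v\<in>range (\<sigma> k). cmod (c (r i) k v - c (r j) k v) * lux f)" for i j
    have "\<exists>N. \<forall>i\<ge>N. \<forall>j\<ge>N. d i j < e / 4"
    proof -
      have "\<forall>v\<in>range (\<sigma> k). \<exists>l. (\<lambda>n. c (r n) k v) \<longlonglongrightarrow> l" using conv by blast
      then obtain l where l: "\<And>v. v \<in> range (\<sigma> k) \<Longrightarrow> (\<lambda>n. c (r n) k v) \<longlonglongrightarrow> l v" by metis
      define h where "h i = (\<Sum>v\<in>range (\<sigma> k). cmod (c (r i) k v - l v) * lux f)" for i
      have "h \<longlonglongrightarrow> (\<Sum>v\<in>range (\<sigma> k). cmod (l v - l v) * lux f)"
        unfolding h_def[abs_def] by (intro tendsto_intros l)
      then have "h \<longlonglongrightarrow> 0" by simp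
      then have "\<forall>\<^sub>F i in sequentially. h i < e / 8" using e by (intro order_tendstoD(2)) auto
      then obtain N where N: "\<And>i. i \<ge> N \<Longrightarrow> h i < e / 8" by (auto simp: eventually_sequentially)
      have dh: "d i j \<le> h i + h j" for i j
        unfolding d_def h_def sum.distrib[symmetric] distrib_right[symmetric]
      proof (intro sum_mono mult_right_mono lux_nonneg f)
        fix v
        show "cmod (c (r i) k v - c (r j) k v) \<le> cmod (c (r i) k v - l v) + cmod (c (r j) k v - l v)"
          using norm_triangle_ineq4[of "c (r i) k v - l v" "c (r j) k v - l v"] by simp
      qed
      have "d i j < e / 4" if "i \<ge> N" "j \<ge> N" for i j
        using N[OF that(1)] N[OF that(2)] dh[of i j] by simp
      then show ?thesis by blast
    qed
    then obtain N where N: "\<And>i j. i \<ge> N \<Longrightarrow> j \<ge> N \<Longrightarrow> d i j < e / 4" by blast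
    have yd: "lux (\<lambda>t. y (r i) k t - y (r j) k t) \<le> d i j" for i j
    proof -
      have "(\<lambda>t. y (r i) k t - y (r j) k t) = (\<lambda>t. \<Sum>v\<in>range (\<sigma> k). (c (r i) k v - c (r j) k v) * translate v f t)"
        by (simp add: y_def sum_subtractf left_diff_distrib)
      then show ?thesis
        using lux_sum[OF \<sigma>(1)[of k], of "\<lambda>v. translate v f" "\<lambda>v. c (r i) k v - c (r j) k v"] translate_L[OF f]
        by (simp add: d_def lux_translate[OF f])
    qed
    have "lux (\<lambda>t. x (r i) t - x (r j) t) < e" if "i \<ge> N" "j \<ge> N" for i j
    proof -
      have "lux (\<lambda>t. x (r i) t - x (r j) t) \<le> lux (\<lambda>t. x (r i) t - y (r i) k t) + lux (\<lambda>t. y (r i) k t - x (r j) t)"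
        by (intro lux_diff_triangle xL yL)
      moreover have "lux (\<lambda>t. y (r i) k t - x (r j) t) \<le> lux (\<lambda>t. y (r i) k t - y (r j) k t) + lux (\<lambda>t. y (r j) k t - x (r j) t)"
        by (intro lux_diff_triangle xL yL)
      moreover have "lux (\<lambda>t. y (r j) k t - x (r j) t) = lux (\<lambda>t. x (r j) t - y (r j) k t)"
        by (intro lux_diff_commute xL yL)
      moreover have "lux (\<lambda>t. x n t - y n k t) < e / 4" for n using xy[of n k] small by (rule le_less_trans)
      note this[of "r i"] this[of "r j"]
      ultimately show ?thesis using yd[of i j] N[OF that] e by linarith
    qed
    then show ?thesis by blast
  qed
  obtain r' z where "strict_mono r'" "z \<in> L" "(\<lambda>n. lux (\<lambda>t. x (r (r' n)) t - z t)) \<longlonglongrightarrow> 0"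
    using lux_complete[of "\<lambda>n. x (r n)"] xL Cauchy by blast
  then show "\<exists>r y. strict_mono r \<and> y \<in> L \<and> (\<lambda>n. lux (\<lambda>t. x (r n) t - y t)) \<longlonglongrightarrow> 0"
    using strict_mono_o[OF r(1)] by (intro exI[of _ "r \<circ> r'"] exI[of _ z]) auto
qed

end

end

context conv_measure
begin

lemma finite_vvar_imp_set:
  assumes "vvar Phi m nu UNIV < \<infinity>"
  shows "\<exists>A\<in>sets borel. 0 < vvar Phi m nu A \<and> vvar Phi m nu A < \<infinity>"
proof -
  have "0 < ennreal (lux (nu UNIV))" using lux_nu_UNIV_pos by simp
  also have "\<dots> \<le> vvar Phi m nu UNIV" by (rule vvar_ge) simp
  finally show ?thesis using assms by (intro bexI[of _ UNIV]) auto
qed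

end


theorem theorem4p14:
  fixes m :: "'g::{group_add,t2_space} measure"
    and Phi Psi :: "real \<Rightarrow> real"
    and mu :: "'g set \<Rightarrow> complex"
  assumes "compact (UNIV :: 'g set)"
    and "continuous_on UNIV (\<lambda>p::'g \<times> 'g. fst p + snd p)"
    and "continuous_on UNIV (uminus :: 'g \<Rightarrow> 'g)"
    and "normalized_haar m"
    and "young_function Phi" and "young_function Psi" and "complementary_young Phi Psi"
    and "delta2 Phi" and "delta2 Psi"
    and "complex_radon_measure mu" and "mu UNIV \<noteq> 0"
  defines "nu \<equiv> conv_vm mu"
  shows "(integration_op_compact Phi m nu \<longleftrightarrow> vvar Phi m nu UNIV < \<infinity>)
    \<and> (vvar Phi m nu UNIV < \<infinity> \<longleftrightarrow>
         (\<exists>F1. bochner_integrable_LPhi Phi m F1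
               \<and> (\<forall>A\<in>sets borel. has_bochner_integral_LPhi Phi m F1 A (nu A))))
    \<and> ((\<exists>F1. bochner_integrable_LPhi Phi m F1
               \<and> (\<forall>A\<in>sets borel. has_bochner_integral_LPhi Phi m F1 A (nu A))) \<longleftrightarrow>
       (\<exists>F2. pettis_integrable_LPhi Phi m F2
               \<and> (\<forall>A\<in>sets borel. pettis_integral_is Phi m F2 A (nu A))))
    \<and> ((\<exists>F2. pettis_integrable_LPhi Phi m F2
               \<and> (\<forall>A\<in>sets borel. pettis_integral_is Phi m F2 A (nu A))) \<longleftrightarrow>
       (\<exists>A\<in>sets borel. 0 < vvar Phi m nu A \<and> vvar Phi m nu A < \<infinity>))
    \<and> ((\<exists>A\<in>sets borel. 0 < vvar Phi m nu A \<and> vvar Phi m nu A < \<infinity>) \<longleftrightarrow>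
       (\<exists>f\<in>orlicz_space Phi m. \<forall>A\<in>sets borel. mu A = (LINT x:A|m. f x)))"
proof -
  interpret compact_group m by unfold_locales fact+
  interpret conv_measure m Phi Psi mu
    by unfold_locales (use assms measure_UNIV in simp_all)
  let ?i = "integration_op_compact Phi m nu"
  let ?ii = "vvar Phi m nu UNIV < \<infinity>"
  let ?iii = "\<exists>F1. bochner_integrable_LPhi Phi m F1 \<and> (\<forall>A\<in>sets borel. has_bochner_integral_LPhi Phi m F1 A (nu A))"
  let ?iv = "\<exists>F2. pettis_integrable_LPhi Phi m F2 \<and> (\<forall>A\<in>sets borel. pettis_integral_is Phi m F2 A (nu A))"
  let ?v = "\<exists>A\<in>sets borel. 0 < vvar Phi m nu A \<and> vvar Phi m nu A < \<infinity>"
  let ?vi = "\<exists>f\<in>orlicz_space Phi m. \<forall>A\<in>sets borel. mu A = (LINT x:A|m. f x)"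
  \<comment> \<open>Condition (vi) is the hub. Compactness and a Bochner density reach it through
    (ii) and (v), a Pettis density reaches it directly, and it gives back (i) to (iv), with the
    translates of \<open>f\<close> as the density in both (iii) and (iv).\<close>
  have "?i \<Longrightarrow> ?ii" unfolding nu_def by (rule compact_imp_finite_vvar)
  moreover have "?iii \<Longrightarrow> ?ii" unfolding nu_def using Bochner_imp_finite_vvar by blast
  moreover have "?ii \<Longrightarrow> ?v" unfolding nu_def by (rule finite_vvar_imp_set)
  moreover have "?v \<Longrightarrow> ?vi" unfolding nu_def using finite_vvar_imp_bounded_tests bounded_tests_imp_density by blast
  moreover have "?iv \<Longrightarrow> ?vi" unfolding nu_def using Pettis_imp_bounded_tests bounded_tests_imp_density by blast
  moreover have "?vi \<Longrightarrow> ?i \<and> ?ii \<and> ?iii \<and> ?iv"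
    unfolding nu_def using density_imp_compact density_imp_finite_vvar density_imp_Bochner density_imp_Pettis by blast
  ultimately show ?thesis by argo
qed

end
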